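(* For all non-negative integers $i,j,k,l$, the Barrett–Crane 4-vertices satisfy (associators and unit isomorphisms suppressed): (1) $v^{i,j}_{k,l}\circ\sigma_{(j,j),(i,i)}=v^{j,i}_{k,l}$; (2) $\sigma_{(k,k),(l,l)}\circ v^{i,j}_{k,l}=v^{i,j}_{l,k}$; (3) $\bigl(\mathrm{id}_{V_{(j,j)}\otimes V_{(i,i)}}\otimes\eta_{(k,k)\otimes(l,l)}\bigr)\circ\bigl(\mathrm{id}_{V_{(j,j)}\otimes V_{(i,i)}}\otimes v^{i,j}_{k,l}\otimes\mathrm{id}_{V_{(l,l)}\otimes V_{(k,k)}}\bigr)\circ\bigl(\epsilon_{(i,i)\otimes(j,j)}\otimes\mathrm{id}_{V_{(l,l)}\otimes V_{(k,k)}}\bigr)=v^{l,k}_{j,i}$, where $\epsilon_{(i,i)\otimes(j,j)}:\mathbf 1\to V_{(j,j)}\otimes V_{(i,i)}\otimes V_{(i,i)}\otimes V_{(j,j)}$ and $\eta_{(k,k)\otimes(l,l)}:V_{(k,k)}\otimes V_{(l,l)}\otimes V_{(l,l)}\otimes V_{(k,k)}\to\mathbf 1$ are given by nested arcs; (4) $\bigl(\eta_{(k,k)\otimes(l,l)}\otimes\mathrm{id}_{V_{(j,j)}\otimes V_{(i,i)}}\bigr)\circ\bigl(\mathrm{id}_{V_{(l,l)}\otimes V_{(k,k)}}\otimes v^{i,j}_{k,l}\otimes\mathrm{id}_{V_{(j,j)}\otimes V_{(i,i)}}\bigr)\circ\bigl(\mathrm{id}_{V_{(l,l)}\otimes V_{(k,k)}}\otimes\epsilon_{(i,i)\otimes(j,j)}\bigr)=v^{l,k}_{j,i}$,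 where now $\epsilon_{(i,i)\otimes(j,j)}:\mathbf 1\to V_{(i,i)}\otimes V_{(j,j)}\otimes V_{(j,j)}\otimes V_{(i,i)}$ and $\eta_{(k,k)\otimes(l,l)}:V_{(l,l)}\otimes V_{(k,k)}\otimes V_{(k,k)}\otimes V_{(l,l)}\to\mathbf 1$ are given by nested arcs.
   Context: Temperley–Lieb recoupling. Fix $A\in\mathbb{C}\setminus\{0\}$ such that $\Delta_n:=(-1)^n\sum_{s=0}^n A^{2n-4s}\neq 0$ for all integers $n\ge 0$; the deformation parameter is $q=A^4$, and replacing $q$ by $q^{-1}$ means replacing $A$ by $A^{-1}$. The Temperley–Lieb category $TL_A$ has objects the non-negative integers and morphisms $m\to n$ the $\mathbb{C}$-linear combinations of crossingless planar tangle diagrams with $m$ top and $n$ bottom endpoints (read from top to bottom), modulo isotopy rel endpoints and deletion of a closed loop at the cost of a factor $-A^2-A^{-2}$; tensor product is juxtaposition. Crossings are expanded by the Kauffman bracket rule: a crossing equals $A$ times its $A$-smoothing (joining the regions swept out by rotating the over-strand counterclockwise) plus $A^{-1}$ times the other smoothing. An edge labelled $n$ means $n$ parallel strands with the Jones–Wenzl idempotent $f_n$ (the unique non-zero idempotent of $\mathrm{End}(n)$ killed by composition with every turn-back) inserted; $V_n$ denotes the corresponding object of the idempotent completion $\mathcal{C}_A$ of $TL_A$ (the irreducible representation of $U_q(\mathfrak{sl}_2)$ of dimension $n+1$). A triple $(a,b,c)$ is admissible if $a+b+c$ is even and each of $a,b,c$ is at most the sum of the other two. The Kauffman–Lins 3-vertex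 with legs labelled $a,b,c$ is obtained by planarly joining the legs pairwise by $\frac{a+b-c}{2},\frac{b+c-a}{2},\frac{a+c-b}{2}$ strands, with idempotents on the legs; it is $0$ if $(a,b,c)$ is not admissible. $\Delta_n$ is the value of a closed loop labelled $n$, and $\theta(a,b,c)$ is the value of the planar theta graph with edges labelled $a,b,c$ (non-zero for admissible triples). $\Delta_n$ and $\theta$ are unchanged under $A\mapsto A^{-1}$. Balanced theory. We work in $\mathrm{Rep}(U_q^{\rm bal}(\mathfrak{so}_4))=\mathcal{C}_A\boxtimes\mathcal{C}_{A^{-1}}$, where $U_q^{\rm bal}(\mathfrak{so}_4)=U_q(\mathfrak{sl}_2)\otimes U_{q^{-1}}(\mathfrak{sl}_2)$. Its irreducibles are $V_{(i,j)}=V_i\otimes W_j$, with $V_i$ from $\mathcal{C}_A$ and $W_j$ from $\mathcal{C}_{A^{-1}}$. A diagram with edges labelled by pairs denotes the tensor product of the diagram with the first labels, evaluated with parameter $A$, and the diagram with the second labels (same crossings), evaluated with parameter $A^{-1}$. Irreducibles $V_{(j,j)}$ are called balanced. The braiding $\sigma_{(a,a),(b,b)}:V_{(a,a)}\otimes V_{(b,b)}\to V_{(b,b)}\otimes V_{(a,a)}$ is the map given by a single crossing (of a fixed sign) of strands labelled $(a,a)$ and $(b,b)$. The duality maps $\epsilon$ (from $\mathbf 1$) and $\eta$ (to $\mathbf 1$) are given by arcs with both ends at the bottom, respectively top; for tensor products of two objects they are given by two nested arcs. Barrett–Crane 4-vertex. $v^{i,j}_{k,l}:V_{(i,i)}\otimes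 V_{(j,j)}\to V_{(k,k)}\otimes V_{(l,l)}$ is $$v^{i,j}_{k,l}=\sum_n \frac{\Delta_n}{\theta(i,j,n)\,\theta(k,l,n)}\,D_n,$$ where the sum is over all $n\ge0$ with $(i,j,n)$ and $(k,l,n)$ admissible (a finite sum), and $D_n$ is the pair-labelled planar diagram in which two top legs labelled $(i,i)$ and $(j,j)$ (left to right) meet at a 3-vertex joined by a vertical edge labelled $(n,n)$ to a 3-vertex with bottom legs $(k,k)$ and $(l,l)$ (left to right). *)

theory Defs
  imports Complex_Main "HOL-Library.Poly_Mapping" "HOL-Library.Disjoint_Sets"
begin

section \<open>Finite linear combinations\<close>

definition scale :: "complex \<Rightarrow> ('a \<Rightarrow>\<^sub>0 complex) \<Rightarrow> ('a \<Rightarrow>\<^sub>0 complex)" where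
  "scale c x = Poly_Mapping.map ((*) c) x"

definition bilin ::
  "('a \<Rightarrow> 'b \<Rightarrow> ('c \<Rightarrow>\<^sub>0 complex)) \<Rightarrow> ('a \<Rightarrow>\<^sub>0 complex) \<Rightarrow> ('b \<Rightarrow>\<^sub>0 complex) \<Rightarrow> ('c \<Rightarrow>\<^sub>0 complex)" where
  "bilin b x y = (\<Sum>d\<in>Poly_Mapping.keys x. \<Sum>e\<in>Poly_Mapping.keys y.
     scale (Poly_Mapping.lookup x d * Poly_Mapping.lookup y e) (b d e))"

section \<open>Crossingless planar tangle diagrams\<close>

text \<open>
  Up to isotopy rel endpoints, a crossingless diagram without closed loops is determined by which
  endpoints are joined, i.e. by a non-crossing perfect matching of its endpoints.  The point
  \<open>(r, i)\<close> is the \<open>i\<close>-th endpoint from the left in row \<open>r\<close>; row \<open>0\<close> is the top row and row \<open>1\<close>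
  the bottom row.
\<close>

type_synonym point = "nat \<times> nat"

datatype diagram = Diagram (src: nat) (tgt: nat) (arcs: "point set set")

definition row :: "nat \<Rightarrow> nat \<Rightarrow> point set" where
  "row r n = {r} \<times> {..<n}"

text \<open>
  Position of an endpoint on the boundary of the rectangle, running clockwise and starting at the
  middle of the right-hand side.
\<close>

definition boundary_pos :: "point \<Rightarrow> int" where
  "boundary_pos p = (if fst p = 0 then int (snd p) else - int (snd p) - 1)"

definition noncrossing :: "point set set \<Rightarrow> bool" where
  "noncrossing M \<longleftrightarrow> \<not> (\<exists>a\<in>M. \<exists>b\<in>M. \<exists>p\<in>a. \<exists>q\<in>a. \<exists>r\<in>b. \<exists>s\<in>b.
     boundary_pos p < boundary_pos r \<and> boundary_pos r < boundary_pos q \<and>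
     boundary_pos q < boundary_pos s)"

definition diagrams :: "nat \<Rightarrow> nat \<Rightarrow> diagram set" where
  "diagrams m n = {Diagram m n M | M.
     partition_on (row 0 m \<union> row 1 n) M \<and> (\<forall>a\<in>M. card a = 2) \<and> noncrossing M}"

definition id_diagram :: "nat \<Rightarrow> diagram" where
  "id_diagram n = Diagram n n {{(0, i), (1, i)} | i. i < n}"

definition cap_diagram :: "nat \<Rightarrow> diagram" where
  "cap_diagram n = Diagram (n + n) 0 {{(0, i), (0, n + n - 1 - i)} | i. i < n}"

definition cup_diagram :: "nat \<Rightarrow> diagram" where
  "cup_diagram n = Diagram 0 (n + n) {{(1, i), (1, n + n - 1 - i)} | i. i < n}"

definition juxtapose :: "diagram \<Rightarrow> diagram \<Rightarrow> diagram" where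
  "juxtapose D E = Diagram (src D + src E) (tgt D + tgt E)
     (arcs D \<union> image (\<lambda>(r, i). (r, (if r = 0 then src D else tgt D) + i)) ` arcs E)"

text \<open>
  Stacking \<open>D\<close> above \<open>E\<close> (for \<open>tgt D = src E\<close>) gives a graph on rows \<open>0\<close>, \<open>1\<close> and \<open>2\<close>.  Its
  connected components that miss the outer rows are the closed loops, the other ones are the
  strands of the composite.
\<close>

definition stack_arcs :: "diagram \<Rightarrow> diagram \<Rightarrow> point set set" where
  "stack_arcs D E = arcs D \<union> image (\<lambda>(r, i). (r + 1, i)) ` arcs E"

definition stack_components :: "diagram \<Rightarrow> diagram \<Rightarrow> point set set" where
  "stack_components D E = (row 0 (src D) \<union> row 1 (tgt D) \<union> row 2 (tgt E)) //
     ({(p, q). \<exists>a\<in>stack_arcs D E. p \<in> a \<and> q \<in> a}\<^sup>*)"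

definition stack_loops :: "diagram \<Rightarrow> diagram \<Rightarrow> nat" where
  "stack_loops D E = card {c \<in> stack_components D E. c \<subseteq> row 1 (tgt D)}"

definition stack :: "diagram \<Rightarrow> diagram \<Rightarrow> diagram" where
  "stack D E = Diagram (src D) (tgt E)
     {(\<lambda>(r, i). (r div 2, i)) ` (c - row 1 (tgt D)) | c.
        c \<in> stack_components D E \<and> \<not> c \<subseteq> row 1 (tgt D)}"

section \<open>The Temperley--Lieb category\<close>

type_synonym tl_mor = "diagram \<Rightarrow>\<^sub>0 complex"

definition tl_hom :: "nat \<Rightarrow> nat \<Rightarrow> tl_mor set" where
  "tl_hom m n = {x. Poly_Mapping.keys x \<subseteq> diagrams m n}"

definition loop_value :: "complex \<Rightarrow> complex" where
  "loop_value A = - (A ^ 2) - inverse A ^ 2"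

text \<open>
  Every diagram carries its source and target, so that composition and tensor product need no
  object arguments; the composite of non-composable diagrams is \<open>0\<close>.
\<close>

definition diagram_comp :: "complex \<Rightarrow> diagram \<Rightarrow> diagram \<Rightarrow> tl_mor" where
  "diagram_comp A E D = (if tgt D = src E
     then Poly_Mapping.single (stack D E) (loop_value A ^ stack_loops D E) else 0)"

definition tl_comp :: "tl_mor \<Rightarrow> complex \<Rightarrow> tl_mor \<Rightarrow> tl_mor"
    ("(_ \<circ>\<^bsub>_\<^esub>/ _)" [70, 0, 71] 70) where
  "g \<circ>\<^bsub>A\<^esub> f = bilin (diagram_comp A) g f"

definition tl_tensor :: "tl_mor \<Rightarrow> tl_mor \<Rightarrow> tl_mor" (infixl "\<otimes>" 75) where
  "f \<otimes> g = bilin (\<lambda>D E. Poly_Mapping.single (juxtapose D E) 1) f g"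

definition tl_id :: "nat \<Rightarrow> tl_mor" where
  "tl_id n = Poly_Mapping.single (id_diagram n) 1"

definition tl_cap :: "nat \<Rightarrow> tl_mor" where
  "tl_cap n = Poly_Mapping.single (cap_diagram n) 1"

definition tl_cup :: "nat \<Rightarrow> tl_mor" where
  "tl_cup n = Poly_Mapping.single (cup_diagram n) 1"

text \<open>The scalar represented by an endomorphism of the object \<open>0\<close>.\<close>

definition closed_value :: "tl_mor \<Rightarrow> complex" where
  "closed_value x = Poly_Mapping.lookup x (id_diagram 0)"

section \<open>Crossings\<close>

text \<open>The over-strand of a crossing starts at the top left or at the top right.\<close>

datatype over_strand = TopLeft | TopRight

text \<open>
  If the over-strand runs from top right to bottom left, rotating it counterclockwise sweeps out
  the upper and the lower region, so that the \<open>A\<close>-smoothing consists of two vertical strands;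
  otherwise it sweeps out the left and the right region.
\<close>

fun crossing :: "complex \<Rightarrow> over_strand \<Rightarrow> tl_mor" where
  "crossing A TopRight = scale A (tl_id 2) + scale (inverse A) (tl_cup 1 \<circ>\<^bsub>A\<^esub> tl_cap 1)"
| "crossing A TopLeft = scale A (tl_cup 1 \<circ>\<^bsub>A\<^esub> tl_cap 1) + scale (inverse A) (tl_id 2)"

text \<open>
  One strand, respectively \<open>a\<close> parallel strands, running from the top left across \<open>b\<close> parallel
  strands to the bottom right.
\<close>

fun strand_crossing :: "complex \<Rightarrow> over_strand \<Rightarrow> nat \<Rightarrow> tl_mor" where
  "strand_crossing A s 0 = tl_id 1"
| "strand_crossing A s (Suc b) =
     (tl_id b \<otimes> crossing A s) \<circ>\<^bsub>A\<^esub> (strand_crossing A s b \<otimes> tl_id 1)"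

fun cable_crossing :: "complex \<Rightarrow> over_strand \<Rightarrow> nat \<Rightarrow> nat \<Rightarrow> tl_mor" where
  "cable_crossing A s 0 b = tl_id b"
| "cable_crossing A s (Suc a) b =
     (cable_crossing A s a b \<otimes> tl_id 1) \<circ>\<^bsub>A\<^esub> (tl_id a \<otimes> strand_crossing A s b)"

section \<open>Jones--Wenzl idempotents and labelled diagrams\<close>

definition Delta :: "complex \<Rightarrow> nat \<Rightarrow> complex" where
  "Delta A n = (-1) ^ n * (\<Sum>s=0..n. A powi (2 * int n - 4 * int s))"

definition is_jones_wenzl :: "complex \<Rightarrow> nat \<Rightarrow> tl_mor \<Rightarrow> bool" where
  "is_jones_wenzl A n f \<longleftrightarrow> f \<in> tl_hom n n \<and> f \<noteq> 0 \<and> f \<circ>\<^bsub>A\<^esub> f = f \<and>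
     (\<forall>i. i + 2 \<le> n \<longrightarrow>
        (tl_id i \<otimes> tl_cap 1 \<otimes> tl_id (n - 2 - i)) \<circ>\<^bsub>A\<^esub> f = 0 \<and>
        f \<circ>\<^bsub>A\<^esub> (tl_id i \<otimes> tl_cup 1 \<otimes> tl_id (n - 2 - i)) = 0)"

definition jones_wenzl :: "complex \<Rightarrow> nat \<Rightarrow> tl_mor" where
  "jones_wenzl A n = (THE f. is_jones_wenzl A n f)"

definition admissible :: "nat \<Rightarrow> nat \<Rightarrow> nat \<Rightarrow> bool" where
  "admissible a b c \<longleftrightarrow> even (a + b + c) \<and> a \<le> b + c \<and> b \<le> a + c \<and> c \<le> a + b"

text \<open>
  The 3-vertex, drawn with two legs \<open>a\<close>, \<open>b\<close> at the top and one leg \<open>c\<close> at the bottom, and drawn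
  with one leg \<open>c\<close> at the top and two legs \<open>a\<close>, \<open>b\<close> at the bottom.
\<close>

definition vertex_merge :: "complex \<Rightarrow> nat \<Rightarrow> nat \<Rightarrow> nat \<Rightarrow> tl_mor" where
  "vertex_merge A a b c = (if admissible a b c then
     jones_wenzl A c \<circ>\<^bsub>A\<^esub>
       (tl_id ((a + c - b) div 2) \<otimes> tl_cap ((a + b - c) div 2) \<otimes> tl_id ((b + c - a) div 2)) \<circ>\<^bsub>A\<^esub>
       (jones_wenzl A a \<otimes> jones_wenzl A b)
   else 0)"

definition vertex_split :: "complex \<Rightarrow> nat \<Rightarrow> nat \<Rightarrow> nat \<Rightarrow> tl_mor" where
  "vertex_split A c a b = (if admissible a b c then
     (jones_wenzl A a \<otimes> jones_wenzl A b) \<circ>\<^bsub>A\<^esub>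
       (tl_id ((a + c - b) div 2) \<otimes> tl_cup ((a + b - c) div 2) \<otimes> tl_id ((b + c - a) div 2)) \<circ>\<^bsub>A\<^esub>
       jones_wenzl A c
   else 0)"

definition theta :: "complex \<Rightarrow> nat \<Rightarrow> nat \<Rightarrow> nat \<Rightarrow> complex" where
  "theta A a b c = closed_value
     (tl_cap c \<circ>\<^bsub>A\<^esub> ((vertex_merge A a b c \<circ>\<^bsub>A\<^esub> vertex_split A c a b) \<otimes> tl_id c) \<circ>\<^bsub>A\<^esub> tl_cup c)"

definition labelled_crossing :: "complex \<Rightarrow> over_strand \<Rightarrow> nat \<Rightarrow> nat \<Rightarrow> tl_mor" where
  "labelled_crossing A s a b =
     (jones_wenzl A b \<otimes> jones_wenzl A a) \<circ>\<^bsub>A\<^esub> cable_crossing A s a b \<circ>\<^bsub>A\<^esub>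
     (jones_wenzl A a \<otimes> jones_wenzl A b)"

definition labelled_cap :: "complex \<Rightarrow> nat \<Rightarrow> tl_mor" where
  "labelled_cap A a = tl_cap a \<circ>\<^bsub>A\<^esub> (jones_wenzl A a \<otimes> jones_wenzl A a)"

definition labelled_cup :: "complex \<Rightarrow> nat \<Rightarrow> tl_mor" where
  "labelled_cup A a = (jones_wenzl A a \<otimes> jones_wenzl A a) \<circ>\<^bsub>A\<^esub> tl_cup a"

text \<open>Two nested arcs, the outer one labelled \<open>a\<close> and the inner one labelled \<open>b\<close>.\<close>

definition nested_caps :: "complex \<Rightarrow> nat \<Rightarrow> nat \<Rightarrow> tl_mor" where
  "nested_caps A a b =
     labelled_cap A a \<circ>\<^bsub>A\<^esub> (jones_wenzl A a \<otimes> labelled_cap A b \<otimes> jones_wenzl A a)"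

definition nested_cups :: "complex \<Rightarrow> nat \<Rightarrow> nat \<Rightarrow> tl_mor" where
  "nested_cups A a b =
     (jones_wenzl A a \<otimes> labelled_cup A b \<otimes> jones_wenzl A a) \<circ>\<^bsub>A\<^esub> labelled_cup A a"

section \<open>The balanced theory\<close>

text \<open>
  Hom spaces of a product of two linear categories are tensor products of hom spaces; pairs of
  diagrams form a basis of them.  The first component lives at parameter \<open>A\<close>, the second one at
  \<open>inverse A\<close>.
\<close>

type_synonym bal_mor = "diagram \<times> diagram \<Rightarrow>\<^sub>0 complex"

definition ext_tensor :: "tl_mor \<Rightarrow> tl_mor \<Rightarrow> bal_mor" (infix "\<boxtimes>" 73) where
  "x \<boxtimes> y = bilin (\<lambda>D E. Poly_Mapping.single (D, E) 1) x y"

definition bal_comp :: "bal_mor \<Rightarrow> complex \<Rightarrow> bal_mor \<Rightarrow> bal_mor"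
    ("(_ \<odot>\<^bsub>_\<^esub>/ _)" [65, 0, 66] 65) where
  "g \<odot>\<^bsub>A\<^esub> f =
     bilin (\<lambda>(E, E') (D, D'). diagram_comp A E D \<boxtimes> diagram_comp (inverse A) E' D') g f"

definition bal_tensor :: "bal_mor \<Rightarrow> bal_mor \<Rightarrow> bal_mor" (infixl "\<otimes>\<^sub>b" 70) where
  "f \<otimes>\<^sub>b g =
     bilin (\<lambda>(D, D') (E, E'). Poly_Mapping.single (juxtapose D E, juxtapose D' E') 1) f g"

text \<open>
  The diagram \<open>X\<close>, a function of the parameter, with every label \<open>a\<close> replaced by the pair \<open>(a, a)\<close>.
\<close>

definition balanced :: "complex \<Rightarrow> (complex \<Rightarrow> tl_mor) \<Rightarrow> bal_mor" where
  "balanced A X = X A \<boxtimes> X (inverse A)"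

text \<open>
  An object of the idempotent completion is an idempotent, and this idempotent is at the same time
  its identity morphism; the tensor product of objects is the tensor product of idempotents.
  So \<open>bal_obj A a\<close> is the identity of the irreducible labelled \<open>(a, a)\<close>.
\<close>

definition bal_obj :: "complex \<Rightarrow> nat \<Rightarrow> bal_mor" where
  "bal_obj A a = balanced A (\<lambda>B. jones_wenzl B a)"

definition bal_braiding :: "complex \<Rightarrow> over_strand \<Rightarrow> nat \<Rightarrow> nat \<Rightarrow> bal_mor" where
  "bal_braiding A s a b = balanced A (\<lambda>B. labelled_crossing B s a b)"

text \<open>
  The source of \<open>bal_eta A a b\<close> and the target of \<open>bal_eps A a b\<close> are the tensor product of the
  balanced irreducibles with labels \<open>a\<close>, \<open>b\<close>, \<open>b\<close>, \<open>a\<close>, in this order.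
\<close>

definition bal_eta :: "complex \<Rightarrow> nat \<Rightarrow> nat \<Rightarrow> bal_mor" where
  "bal_eta A a b = balanced A (\<lambda>B. nested_caps B a b)"

definition bal_eps :: "complex \<Rightarrow> nat \<Rightarrow> nat \<Rightarrow> bal_mor" where
  "bal_eps A a b = balanced A (\<lambda>B. nested_cups B a b)"

definition barrett_crane :: "complex \<Rightarrow> nat \<Rightarrow> nat \<Rightarrow> nat \<Rightarrow> nat \<Rightarrow> bal_mor" where
  "barrett_crane A i j k l =
     (\<Sum>n\<in>{n. admissible i j n \<and> admissible k l n}.
        scale (Delta A n / (theta A i j n * theta A k l n))
          (balanced A (\<lambda>B. vertex_split B n k l \<circ>\<^bsub>B\<^esub> vertex_merge B i j n)))"

end

(*
  Give a matching weight 1 at those two-colourings of its endpoints in which every arc is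
  monochromatic, and weight 0 at the others.  The weights determine the matching, stacking becomes
  matrix multiplication, and a closed loop contributes a factor 2; so identities between composites
  of diagrams, closed loops included, follow from identities between finite sums.  Crossinglessness
  is preserved because it can be expressed by parities that add up along connected components.

  Jones-Wenzl idempotents come from Wenzl's recursion, and a diagram argument shows that only one
  diagram survives between the idempotents at a 3-vertex.  Hence a crossing at a vertex acts by a
  scalar; the opposite crossing acts by the inverse scalar.  Passing from A to its inverse exchanges
  the two crossings and changes nothing else, so the scalars of the two factors of the balanced
  category cancel.  This gives (1) and (2).  For (3) and (4), bending the legs rotates each
  summand by a half turn, and theta is symmetric because the bubble it computes can be rotated.
*)
theory Submission
  imports Defs
begin

section \<open>Linear extension\<close>

text \<open>Stacking is defined by connected components of a three-row graph, so even associativity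
  is a statement about transitive closures. Counting colourings replaces all tracing of paths; what
  has to be known about the graph is that a component reaching the outer rows has exactly two points
  there, and this follows by playing an edge count off against parities. Although two colours fix
  the loop value at 2, the number of loops can be read off from the weights, and so it may be
  reinserted as an exponent of the actual loop value.

  \<open>jones_wenzl\<close> is a definite description. Existence has to be constructed, but every
  later symmetry of the idempotents follows from uniqueness.

  The scalars of opposite crossings are inverse for the following reason. Undoing a crossing starts
  from the vertex with its legs exchanged, so a priori it involves the scalar for the exchanged
  legs. A reflection and a half turn lead from these two merging vertices to one and the same
  splitting vertex, and comparing them shows that the scalar is symmetric in the legs.\<close>

lemma lookup_scale [simp]: "Poly_Mapping.lookup (scale c x) k = c * Poly_Mapping.lookup x k"
  by (simp add: scale_def Poly_Mapping.map.rep_eq when_def)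

lemma scale_add_right: "scale c (x + y) = scale c x + scale c y"
  by (rule poly_mapping_eqI) (simp add: lookup_add algebra_simps)

lemma scale_add_left: "scale (c + d) x = scale c x + scale d x"
  by (rule poly_mapping_eqI) (simp add: lookup_add algebra_simps)

lemma scale_scale [simp]: "scale c (scale d x) = scale (c * d) x"
  by (rule poly_mapping_eqI) (simp add: algebra_simps)

lemma scale_one [simp]: "scale 1 x = x"
  by (rule poly_mapping_eqI) simp

lemma scale_zero_left [simp]: "scale 0 x = 0"
  by (rule poly_mapping_eqI) simp

lemma scale_zero_right [simp]: "scale c 0 = 0"
  by (rule poly_mapping_eqI) simp

lemma scale_sum: "scale c (sum f K) = (\<Sum>k\<in>K. scale c (f k))"
  by (induction K rule: infinite_finite_induct) (simp_all add: scale_add_right)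

lemma scale_single: "Poly_Mapping.single d c = scale c (Poly_Mapping.single d 1)"
  by (rule poly_mapping_eqI) (simp add: lookup_single when_def)

text \<open>Linearity as a predicate on maps, so that an identity between multilinear expressions
  can be reduced to diagrams one argument at a time.\<close>

definition lin :: "(('a \<Rightarrow>\<^sub>0 complex) \<Rightarrow> ('b \<Rightarrow>\<^sub>0 complex)) \<Rightarrow> bool" where
  "lin F \<longleftrightarrow> (\<forall>x y. F (x + y) = F x + F y) \<and> (\<forall>c x. F (scale c x) = scale c (F x))"

lemma lin_add: "lin F \<Longrightarrow> F (x + y) = F x + F y"
  and lin_scale: "lin F \<Longrightarrow> F (scale c x) = scale c (F x)"
  by (auto simp: lin_def)

lemma lin_zero: "lin F \<Longrightarrow> F 0 = 0"
  by (metis lin_scale scale_zero_left)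

lemma lin_sum: "lin F \<Longrightarrow> F (sum f K) = (\<Sum>k\<in>K. F (f k))"
  by (induction K rule: infinite_finite_induct) (simp_all add: lin_add lin_zero)

lemma lin_id: "lin (\<lambda>x. x)"
  by (simp add: lin_def)

lemma expand_singles:
  "x = (\<Sum>d\<in>Poly_Mapping.keys x. scale (Poly_Mapping.lookup x d) (Poly_Mapping.single d 1))"
proof (rule poly_mapping_eqI)
  fix k
  have "Poly_Mapping.lookup (\<Sum>d\<in>Poly_Mapping.keys x. scale (Poly_Mapping.lookup x d)
          (Poly_Mapping.single d 1)) k =
        (\<Sum>d\<in>Poly_Mapping.keys x. if d = k then Poly_Mapping.lookup x d else 0)"
    by (simp add: lookup_sum lookup_single when_def if_distrib cong: if_cong)
  then show "Poly_Mapping.lookup x k = Poly_Mapping.lookup (\<Sum>d\<in>Poly_Mapping.keys x.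
      scale (Poly_Mapping.lookup x d) (Poly_Mapping.single d 1)) k"
    by (simp add: in_keys_iff)
qed

text \<open>Both maps are sums over the support of \<open>x\<close>. The set \<open>S\<close>
  carries the typing: with \<open>S = diagrams m n\<close> only diagrams of that shape have to be
  checked.\<close>

lemma lin_eqI:
  fixes F G :: "('a \<Rightarrow>\<^sub>0 complex) \<Rightarrow> ('b \<Rightarrow>\<^sub>0 complex)"
  assumes "lin F" "lin G" "Poly_Mapping.keys x \<subseteq> S"
    and "\<And>d. d \<in> S \<Longrightarrow> F (Poly_Mapping.single d 1) = G (Poly_Mapping.single d 1)"
  shows "F x = G x"
proof -
  have *: "H x = (\<Sum>d\<in>Poly_Mapping.keys x. scale (Poly_Mapping.lookup x d) (H (Poly_Mapping.single d 1)))"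
    if "lin H" for H :: "('a \<Rightarrow>\<^sub>0 complex) \<Rightarrow> ('b \<Rightarrow>\<^sub>0 complex)"
  proof -
    have "H x = H (\<Sum>d\<in>Poly_Mapping.keys x. scale (Poly_Mapping.lookup x d) (Poly_Mapping.single d 1))"
      by (rule arg_cong[OF expand_singles])
    then show ?thesis
      by (simp only: lin_sum[OF that] lin_scale[OF that])
  qed
  show ?thesis
    unfolding *[OF assms(1)] *[OF assms(2)] using assms(3,4) by (intro sum.cong) auto
qed

text \<open>The support of a sum can be smaller than the union of the supports, because coefficients
  cancel. Summing over fixed larger sets makes additivity of \<open>bilin\<close> visible.\<close>

lemma bilin_superset:
  assumes "finite K" "finite L" "Poly_Mapping.keys x \<subseteq> K" "Poly_Mapping.keys y \<subseteq> L"
  shows "bilin b x y = (\<Sum>d\<in>K. \<Sum>e\<in>L. scale (Poly_Mapping.lookup x d * Poly_Mapping.lookup y e) (b d e))"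
proof -
  have "bilin b x y = (\<Sum>d\<in>Poly_Mapping.keys x. \<Sum>e\<in>L.
      scale (Poly_Mapping.lookup x d * Poly_Mapping.lookup y e) (b d e))"
    unfolding bilin_def using assms
    by (intro sum.cong refl sum.mono_neutral_left) (auto simp: in_keys_iff)
  also have "\<dots> = (\<Sum>d\<in>K. \<Sum>e\<in>L. scale (Poly_Mapping.lookup x d * Poly_Mapping.lookup y e) (b d e))"
    using assms by (intro sum.mono_neutral_left) (auto simp: in_keys_iff)
  finally show ?thesis .
qed

lemma lin_bilin_left':
  fixes b :: "'a \<Rightarrow> 'b \<Rightarrow> ('c \<Rightarrow>\<^sub>0 complex)"
  shows "lin (\<lambda>x. bilin b x y)"
  unfolding lin_def
proof safe
  fix x x' :: "'a \<Rightarrow>\<^sub>0 complex"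
  let ?K = "Poly_Mapping.keys x \<union> Poly_Mapping.keys x'" and ?L = "Poly_Mapping.keys y"
  have "bilin b (x + x') y = (\<Sum>d\<in>?K. \<Sum>e\<in>?L. scale (Poly_Mapping.lookup (x + x') d * Poly_Mapping.lookup y e) (b d e))"
    by (rule bilin_superset) (use keys_add[of x x'] in auto)
  also have "\<dots> = (\<Sum>d\<in>?K. \<Sum>e\<in>?L. scale (Poly_Mapping.lookup x d * Poly_Mapping.lookup y e) (b d e))
     + (\<Sum>d\<in>?K. \<Sum>e\<in>?L. scale (Poly_Mapping.lookup x' d * Poly_Mapping.lookup y e) (b d e))"
    by (simp add: lookup_add algebra_simps scale_add_left sum.distrib)
  also have "\<dots> = bilin b x y + bilin b x' y"
    by (subst (1 2) bilin_superset[where K = ?K and L = ?L]) auto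
  finally show "bilin b (x + x') y = bilin b x y + bilin b x' y" .
next
  fix c and x :: "'a \<Rightarrow>\<^sub>0 complex"
  have "bilin b (scale c x) y = (\<Sum>d\<in>Poly_Mapping.keys x. \<Sum>e\<in>Poly_Mapping.keys y.
     scale (Poly_Mapping.lookup (scale c x) d * Poly_Mapping.lookup y e) (b d e))"
    by (rule bilin_superset) (auto simp: in_keys_iff)
  then show "bilin b (scale c x) y = scale c (bilin b x y)"
    by (simp add: bilin_def scale_sum mult.assoc)
qed

lemma bilin_swap: "bilin b x y = bilin (\<lambda>e d. b d e) y x"
  unfolding bilin_def by (subst sum.swap) (simp add: mult.commute)

lemma lin_bilin_left: "lin F \<Longrightarrow> lin (\<lambda>x. bilin b (F x) y)"
  using lin_bilin_left'[of b y] by (simp add: lin_def)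

lemma lin_bilin_right: "lin F \<Longrightarrow> lin (\<lambda>x. bilin b y (F x))"
  by (subst bilin_swap) (rule lin_bilin_left)

lemma bilin_single [simp]: "bilin b (Poly_Mapping.single d 1) (Poly_Mapping.single e 1) = b d e"
  by (simp add: bilin_def)

text \<open>Linear extension of a map of basis elements. It is written through \<open>bilin\<close>
  with a one-point dummy argument so that linearity and the support bound are inherited.\<close>

definition extend :: "('a \<Rightarrow> 'b) \<Rightarrow> ('a \<Rightarrow>\<^sub>0 complex) \<Rightarrow> ('b \<Rightarrow>\<^sub>0 complex)" where
  "extend g x = bilin (\<lambda>_ d. Poly_Mapping.single (g d) 1) (Poly_Mapping.single () 1) x"

lemma extend_single [simp]: "extend g (Poly_Mapping.single d 1) = Poly_Mapping.single (g d) 1"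
  by (simp add: extend_def)

lemma lin_extend: "lin F \<Longrightarrow> lin (\<lambda>x. extend g (F x))"
  unfolding extend_def by (rule lin_bilin_right)

lemma keys_scale: "Poly_Mapping.keys (scale c x) \<subseteq> Poly_Mapping.keys x"
  by (auto simp: in_keys_iff)

lemma keys_add_subset:
  "Poly_Mapping.keys x \<subseteq> S \<Longrightarrow> Poly_Mapping.keys y \<subseteq> S \<Longrightarrow> Poly_Mapping.keys (x + y) \<subseteq> S"
  using keys_add[of x y] by blast

lemma keys_sum_subset:
  "(\<And>k. k \<in> K \<Longrightarrow> Poly_Mapping.keys (f k) \<subseteq> S) \<Longrightarrow> Poly_Mapping.keys (sum f K) \<subseteq> S"
proof (induction K rule: infinite_finite_induct)
  case (insert k K)
  then show ?case by (simp add: keys_add_subset)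
qed simp_all

lemma keys_bilin:
  assumes "\<And>d e. d \<in> Poly_Mapping.keys x \<Longrightarrow> e \<in> Poly_Mapping.keys y \<Longrightarrow> Poly_Mapping.keys (b d e) \<subseteq> S"
  shows "Poly_Mapping.keys (bilin b x y) \<subseteq> S"
  unfolding bilin_def
  by (intro keys_sum_subset order_trans[OF keys_scale] assms)

lemma keys_extend:
  assumes "\<And>d. d \<in> Poly_Mapping.keys x \<Longrightarrow> g d \<in> S"
  shows "Poly_Mapping.keys (extend g x) \<subseteq> S"
  unfolding extend_def by (rule keys_bilin) (use assms in \<open>auto split: if_splits\<close>)

section \<open>Connected components\<close>

definition conn :: "'a set set \<Rightarrow> 'a rel" where
  "conn S = {(p, q). \<exists>a\<in>S. p \<in> a \<and> q \<in> a}\<^sup>*"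

lemma sym_conn: "sym (conn S)"
  unfolding conn_def by (intro sym_rtrancl) (auto simp: sym_def)

lemma trans_conn: "(p, q) \<in> conn S \<Longrightarrow> (q, r) \<in> conn S \<Longrightarrow> (p, r) \<in> conn S"
  unfolding conn_def by (rule rtrancl_trans)

lemma conn_arc: "a \<in> S \<Longrightarrow> p \<in> a \<Longrightarrow> q \<in> a \<Longrightarrow> (p, q) \<in> conn S"
  unfolding conn_def by auto

lemma conn_closed:
  assumes "(p, q) \<in> conn S" "p \<in> s" "\<And>a. a \<in> S \<Longrightarrow> a \<inter> s \<noteq> {} \<Longrightarrow> a \<subseteq> s"
  shows "q \<in> s"
  using assms(1) unfolding conn_def
  by (induction rule: rtrancl_induct) (use assms(2,3) in auto)

lemma conn_const:
  assumes "(p, q) \<in> conn S" "\<And>a p q. a \<in> S \<Longrightarrow> p \<in> a \<Longrightarrow> q \<in> a \<Longrightarrow> f p = f q"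
  shows "f p = f q"
  using assms(1) unfolding conn_def
  by (induction rule: rtrancl_induct) (use assms(2) in auto)

text \<open>\<open>conn S\<close> is reflexive on the whole type, whereas the quotient is taken over
  \<open>V\<close>. All arcs lie in \<open>V\<close>, so no class leaves \<open>V\<close> and the
  relation may be restricted to \<open>V \<times> V\<close> without changing the quotient.\<close>

lemma partition_components:
  assumes "\<Union>S \<subseteq> V"
  shows "partition_on V (V // conn S)"
proof -
  have closed: "q \<in> V" if "(p, q) \<in> conn S" "p \<in> V" for p q
    using that by (rule conn_closed) (use assms in auto)
  have "equiv V (conn S \<inter> V \<times> V)"
    unfolding conn_def
    by (rule equivI)
      (use sym_conn[of S] in \<open>auto simp: refl_on_def sym_def trans_def conn_def intro: rtrancl_trans\<close>)
  moreover have "V // conn S = V // (conn S \<inter> V \<times> V)"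
    unfolding quotient_def using closed by (intro arg_cong[where f = \<Union>] image_cong) auto
  ultimately show ?thesis
    by (metis partition_on_quotient)
qed

lemma component_arc:
  assumes "\<Union>S \<subseteq> V" "c \<in> V // conn S" "a \<in> S" "a \<inter> c \<noteq> {}"
  shows "a \<subseteq> c"
proof
  fix q assume q: "q \<in> a"
  obtain v where v: "c = conn S `` {v}"
    using assms(2) by (auto simp: quotient_def)
  obtain p where "p \<in> a" "(v, p) \<in> conn S"
    using assms(4) v by auto
  then show "q \<in> c"
    using conn_arc[OF assms(3) _ q] v trans_conn[of v p S q] by auto
qed

text \<open>A function constant on arcs is constant along paths, and every arc lies inside a
  component. With \<open>f\<close> a colouring, this turns a condition on arcs into a condition on
  components.\<close>

lemma component_const_iff:
  assumes "\<Union>S \<subseteq> V" "\<And>a. a \<in> S \<Longrightarrow> a \<noteq> {}"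
  shows "(\<forall>a\<in>S. \<forall>p\<in>a. \<forall>q\<in>a. f p = f q) \<longleftrightarrow> (\<forall>c\<in>V // conn S. \<forall>p\<in>c. \<forall>q\<in>c. f p = f q)"
proof safe
  fix c p q assume *: "\<forall>a\<in>S. \<forall>p\<in>a. \<forall>q\<in>a. f p = f q" "c \<in> V // conn S" "p \<in> c" "q \<in> c"
  then obtain v where "(v, p) \<in> conn S" "(v, q) \<in> conn S" by (auto simp: quotient_def)
  then show "f p = f q" using conn_const[of v _ S f] *(1) by metis
next
  fix a p q assume *: "\<forall>c\<in>V // conn S. \<forall>p\<in>c. \<forall>q\<in>c. f p = f q" "a \<in> S" "p \<in> a" "q \<in> a"
  then obtain c where c: "c \<in> V // conn S" "p \<in> c"
    using partition_onD1[OF partition_components[OF assms(1)]] assms(1) by blast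
  then have "a \<subseteq> c" using component_arc[OF assms(1) c(1) *(2)] *(3) by auto
  then show "f p = f q" using * c by blast
qed

text \<open>Each edge cuts the number of subsets that are unions of components by at most one half.\<close>

lemma closed_sets_bound:
  assumes "finite V" "finite es" "\<And>a. a \<in> es \<Longrightarrow> card a = 2"
  shows "2 ^ card V \<le> card {s. s \<subseteq> V \<and> (\<forall>a\<in>es. a \<subseteq> s \<or> a \<inter> s = {})} * 2 ^ card es"
  using assms(2,3)
proof (induction es rule: finite_induct)
  case empty
  have "{s. s \<subseteq> V \<and> (\<forall>a\<in>{}. a \<subseteq> s \<or> a \<inter> s = {})} = Pow V" by auto
  then show ?case using assms(1) by (simp add: card_Pow)
next
  case (insert a es)
  define K where "K = {s. s \<subseteq> V \<and> (\<forall>a\<in>es. a \<subseteq> s \<or> a \<inter> s = {})}"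
  define L where "L = {s \<in> K. a \<subseteq> s \<or> a \<inter> s = {}}"
  have fin: "finite K" using assms(1) by (simp add: K_def)
  have LK: "L \<subseteq> K" by (auto simp: L_def)
  obtain u v where a: "a = {u, v}" "u \<noteq> v" using insert.prems[of a] by (auto simp: card_2_iff)
  have "card (K - L) \<le> card L"
  proof (cases "K - L = {}")
    case True
    then show ?thesis by (simp only: card.empty)
  next
    case False
    then obtain t where t: "t \<in> K - L" by blast
    \<comment> \<open>Both \<open>s\<close> and the fixed set \<open>t\<close> contain exactly one
      end of \<open>a\<close>, so their symmetric difference contains both ends or none. This
      injects the sets that split \<open>a\<close> into those that do not.\<close>
    have "inj_on (\<lambda>s. sym_diff s t) (K - L)"
      by (rule inj_onI) blast
    moreover have "(\<lambda>s. sym_diff s t) ` (K - L) \<subseteq> L"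
    proof
      fix r assume "r \<in> (\<lambda>s. sym_diff s t) ` (K - L)"
      then obtain s where s: "s \<in> K - L" and r: "r = sym_diff s t" by blast
      have "b \<subseteq> r \<or> b \<inter> r = {}" if b: "b \<in> es" for b
      proof -
        have "b \<subseteq> s \<or> b \<inter> s = {}" "b \<subseteq> t \<or> b \<inter> t = {}" using s t b by (auto simp: K_def)
        then show ?thesis unfolding r by blast
      qed
      moreover have "a \<subseteq> r \<or> a \<inter> r = {}" using s t a unfolding r by (auto simp: L_def)
      moreover have "r \<subseteq> V" using s t unfolding r by (auto simp: K_def)
      ultimately show "r \<in> L" by (simp add: K_def L_def)
    qed
    ultimately show ?thesis
      using fin LK by (meson card_inj_on_le finite_subset)
  qed
  moreover have "card K = card (K - L) + card L"
    using card_Diff_subset[of L K] card_mono[OF fin LK] finite_subset[OF LK fin] LK by simp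
  ultimately have "card K \<le> 2 * card L" by linarith
  then have "card K * 2 ^ card es \<le> 2 * card L * 2 ^ card es"
    by (rule mult_le_mono1)
  moreover have "2 ^ card V \<le> card K * 2 ^ card es"
    using insert.IH insert.prems by (simp add: K_def)
  ultimately have "2 ^ card V \<le> 2 * card L * 2 ^ card es" by (rule order_trans[rotated])
  then have "2 ^ card V \<le> card L * 2 ^ card (insert a es)"
    using insert.hyps by (simp add: mult.assoc mult.left_commute mult.commute[of 2])
  moreover have "L = {s. s \<subseteq> V \<and> (\<forall>a\<in>insert a es. a \<subseteq> s \<or> a \<inter> s = {})}"
    by (auto simp: K_def L_def)
  ultimately show ?case by simp
qed

text \<open>A connected graph on v vertices has at least v - 1 edges. The only subsets of a
  component closed under its edges are the empty set and the component itself, so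
  \<open>closed_sets_bound\<close> yields 2 ^ v \<le> 2 * 2 ^ e.\<close>

lemma component_edges:
  assumes "finite V" "\<Union>S \<subseteq> V" "\<And>a. a \<in> S \<Longrightarrow> card a = 2" "c \<in> V // conn S"
  shows "card c \<le> Suc (card {a \<in> S. a \<subseteq> c})"
proof -
  have part: "partition_on V (V // conn S)" by (rule partition_components[OF assms(2)])
  have "c \<subseteq> V" using part assms(4) by (auto simp: partition_on_def)
  then have fin: "finite c" using assms(1) finite_subset by blast
  let ?es = "{a \<in> S. a \<subseteq> c}"
  have fes: "finite ?es" by (rule finite_subset[of _ "Pow c"]) (use fin in auto)
  have "{s. s \<subseteq> c \<and> (\<forall>a\<in>?es. a \<subseteq> s \<or> a \<inter> s = {})} \<subseteq> {{}, c}"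
  proof
    fix s assume s: "s \<in> {s. s \<subseteq> c \<and> (\<forall>a\<in>?es. a \<subseteq> s \<or> a \<inter> s = {})}"
    have closed: "a \<subseteq> s" if "a \<in> S" "a \<inter> s \<noteq> {}" for a
    proof -
      have "a \<subseteq> c" using component_arc[OF assms(2,4) that(1)] that(2) s by blast
      then show ?thesis using that s by blast
    qed
    have "c \<subseteq> s" if p: "p \<in> s" for p
    proof
      fix q assume "q \<in> c"
      moreover have "p \<in> c" using s p by auto
      ultimately obtain v where "(v, p) \<in> conn S" "(v, q) \<in> conn S"
        using assms(4) by (auto simp: quotient_def)
      then have "(p, q) \<in> conn S" by (rule trans_conn[OF symD[OF sym_conn]])
      then show "q \<in> s"
        by (rule conn_closed[OF _ p])
          (rule closed)
    qed
    then show "s \<in> {{}, c}" using s by auto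
  qed
  then have "card {s. s \<subseteq> c \<and> (\<forall>a\<in>?es. a \<subseteq> s \<or> a \<inter> s = {})} \<le> card {{}, c}"
    by (intro card_mono) auto
  also have "\<dots> \<le> 2" by (cases "c = {}") simp_all
  finally have "card {s. s \<subseteq> c \<and> (\<forall>a\<in>?es. a \<subseteq> s \<or> a \<inter> s = {})} * 2 ^ card ?es \<le> 2 * 2 ^ card ?es"
    by (rule mult_le_mono1)
  moreover have "2 ^ card c \<le> card {s. s \<subseteq> c \<and> (\<forall>a\<in>?es. a \<subseteq> s \<or> a \<inter> s = {})} * 2 ^ card ?es"
    using assms(3) by (intro closed_sets_bound[OF fin fes]) simp
  ultimately have "2 ^ card c \<le> (2::nat) ^ Suc (card ?es)"
    unfolding power_Suc by (rule order_trans[rotated])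
  then show ?thesis by (rule power_le_imp_le_exp[rotated]) simp
qed

text \<open>If no arc leaves \<open>c\<close>, then \<open>c\<close> meets the matched points in a
  disjoint union of pairs. This is the source of all parity statements about components.\<close>

lemma card_union_arcs:
  assumes "partition_on W M" "\<And>a. a \<in> M \<Longrightarrow> card a = 2" "finite W"
    and "\<And>a. a \<in> M \<Longrightarrow> a \<inter> c \<noteq> {} \<Longrightarrow> a \<subseteq> c"
  shows "card (c \<inter> W) = 2 * card {a \<in> M. a \<subseteq> c}"
proof -
  have "c \<inter> W = \<Union>{a \<in> M. a \<subseteq> c}"
    using assms(1,4) unfolding partition_on_def by blast
  moreover have "card (\<Union>{a \<in> M. a \<subseteq> c}) = (\<Sum>a\<in>{a \<in> M. a \<subseteq> c}. card a)"
  proof (rule card_Union_disjoint)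
    show "pairwise disjnt {a \<in> M. a \<subseteq> c}"
      using partition_onD2[OF assms(1)] by (auto simp: disjoint_def pairwise_def disjnt_def)
    show "finite a" if "a \<in> {a \<in> M. a \<subseteq> c}" for a
      using assms(2)[of a] that by (intro card_ge_0_finite) simp
  qed
  ultimately show ?thesis using assms(2) by simp
qed

section \<open>Colourings of matchings\<close>

text \<open>Diagrams without the planarity condition. Weights do not see crossings of arcs, so the
  laws of stacking are proved for all perfect matchings and planarity is treated separately.\<close>

definition matchings :: "nat \<Rightarrow> nat \<Rightarrow> diagram set" where
  "matchings m n = {Diagram m n M | M. partition_on (row 0 m \<union> row 1 n) M \<and> (\<forall>a\<in>M. card a = 2)}"

lemma diagrams_eq: "diagrams m n = {D \<in> matchings m n. noncrossing (arcs D)}"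
  by (auto simp: diagrams_def matchings_def)

lemma matchingsD:
  assumes "D \<in> matchings m n"
  shows "src D = m" "tgt D = n" "partition_on (row 0 m \<union> row 1 n) (arcs D)"
    "\<And>a. a \<in> arcs D \<Longrightarrow> card a = 2" "\<Union>(arcs D) = row 0 m \<union> row 1 n"
  using assms by (auto simp: matchings_def partition_on_def)

lemma matchingsI:
  assumes "src D = m" "tgt D = n" "partition_on (row 0 m \<union> row 1 n) (arcs D)"
    "\<And>a. a \<in> arcs D \<Longrightarrow> card a = 2"
  shows "D \<in> matchings m n"
  using assms by (cases D) (auto simp: matchings_def)

lemma finite_row [simp]: "finite (row r n)" and card_row [simp]: "card (row r n) = n"
  by (simp_all add: row_def card_cartesian_product_singleton)

lemma mem_row [simp]: "(s, i) \<in> row r n \<longleftrightarrow> s = r \<and> i < n"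
  by (auto simp: row_def)

definition colour :: "(nat \<Rightarrow> bool) \<Rightarrow> (nat \<Rightarrow> bool) \<Rightarrow> point \<Rightarrow> bool" where
  "colour x y p = (if fst p = 0 then x (snd p) else y (snd p))"

definition monochrome :: "diagram \<Rightarrow> (nat \<Rightarrow> bool) \<Rightarrow> (nat \<Rightarrow> bool) \<Rightarrow> bool" where
  "monochrome D x y \<longleftrightarrow> (\<forall>a\<in>arcs D. \<forall>p\<in>a. \<forall>q\<in>a. colour x y p = colour x y q)"

text \<open>Total functions that are \<open>False\<close> from \<open>n\<close> on: this makes the
  set finite and lets each colouring of \<open>n\<close> points occur exactly once in a sum.\<close>

definition colourings :: "nat \<Rightarrow> (nat \<Rightarrow> bool) set" where
  "colourings n = {y. \<forall>i\<ge>n. \<not> y i}"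

lemma finite_colourings [simp]: "finite (colourings n)"
proof -
  have "colourings n \<subseteq> (\<lambda>S i. i \<in> S) ` Pow {..<n}"
  proof
    fix y assume "y \<in> colourings n"
    then have "{i. y i} \<in> Pow {..<n}" by (auto simp: colourings_def not_le)
    then show "y \<in> (\<lambda>S i. i \<in> S) ` Pow {..<n}" by (intro image_eqI[of _ _ "{i. y i}"]) auto
  qed
  then show ?thesis by (rule finite_subset) simp
qed

lemma monochrome_cong:
  assumes "D \<in> matchings m n" "\<And>i. i < m \<Longrightarrow> x i = x' i" "\<And>i. i < n \<Longrightarrow> y i = y' i"
  shows "monochrome D x y = monochrome D x' y'"
proof -
  have "colour x y p = colour x' y' p" if "p \<in> a" "a \<in> arcs D" for a p
  proof -
    have "p \<in> row 0 m \<union> row 1 n" using that matchingsD(5)[OF assms(1)] by blast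
    then show ?thesis using assms(2,3) by (auto simp: colour_def row_def)
  qed
  then show ?thesis unfolding monochrome_def by simp
qed

text \<open>Colour the two ends of an arc \<open>a\<close> of \<open>D\<close> with
  \<open>True\<close> and everything else with \<open>False\<close>. This is monochrome for
  \<open>D\<close>, hence for \<open>E\<close>, so the arc of \<open>E\<close> at an end of
  \<open>a\<close> stays inside \<open>a\<close> and must equal it.\<close>

lemma monochrome_determines:
  assumes D: "D \<in> matchings m n" and E: "E \<in> matchings m n" and "\<And>x y. monochrome D x y = monochrome E x y"
  shows "D = E"
proof -
  have sub: "arcs D \<subseteq> arcs E"
    if D: "D \<in> matchings m n" and E: "E \<in> matchings m n" and eq: "\<And>x y. monochrome D x y = monochrome E x y" for D E
  proof
    fix a assume a: "a \<in> arcs D"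
    have ca: "card a = 2" using matchingsD(4)[OF D a] .
    define x y where "x i = ((0, i) \<in> a)" and "y i = ((1, i) \<in> a)" for i :: nat
    have col: "colour x y p = (p \<in> a)" if "p \<in> row 0 m \<union> row 1 n" for p
      using that by (auto simp: colour_def x_def y_def row_def)
    have "monochrome D x y"
      unfolding monochrome_def
    proof (intro ballI)
      fix b p q assume b: "b \<in> arcs D" "p \<in> b" "q \<in> b"
      then have "p \<in> row 0 m \<union> row 1 n" "q \<in> row 0 m \<union> row 1 n" using matchingsD(5)[OF D] by blast+
      moreover have "p \<in> a \<longleftrightarrow> q \<in> a"
        using a b partition_onD2[OF matchingsD(3)[OF D]] by (auto simp: disjoint_def)
      ultimately show "colour x y p = colour x y q" by (simp add: col)
    qed
    then have cE: "monochrome E x y" using eq by simp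
    obtain p where p: "p \<in> a" using ca by (metis card.empty ex_in_conv zero_neq_numeral)
    then have "p \<in> row 0 m \<union> row 1 n" using matchingsD(5)[OF D] a by blast
    then obtain b where b: "b \<in> arcs E" "p \<in> b" using matchingsD(5)[OF E] by blast
    have "b \<subseteq> a"
    proof
      fix q assume q: "q \<in> b"
      then have "q \<in> row 0 m \<union> row 1 n" using matchingsD(5)[OF E] b by blast
      moreover have "colour x y p = colour x y q" using cE b q unfolding monochrome_def by blast
      ultimately show "q \<in> a" using p col \<open>p \<in> row 0 m \<union> row 1 n\<close> by auto
    qed
    then have "b = a" using ca matchingsD(4)[OF E b(1)]
      by (metis card.infinite card_subset_eq zero_neq_numeral)
    then show "a \<in> arcs E" using b by simp
  qed
  have "arcs D = arcs E" using sub[OF D E] sub[OF E D] assms(3) by blast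
  then show ?thesis using matchingsD(1,2)[OF D] matchingsD(1,2)[OF E] by (cases D; cases E) auto
qed

definition weight :: "diagram \<Rightarrow> (nat \<Rightarrow> bool) \<Rightarrow> (nat \<Rightarrow> bool) \<Rightarrow> nat" where
  "weight D x y = of_bool (monochrome D x y)"

text \<open>Every diagram has weight 1 at the all-\<open>True\<close> colouring, which separates the
  powers of 2 from the diagrams. Hence a single family of numerical identities yields both the
  diagram and the loop count.\<close>

lemma weight_determines:
  assumes D: "D \<in> matchings m n" and E: "E \<in> matchings m n"
    and "\<And>x y. 2 ^ k * weight D x y = 2 ^ l * weight E x y"
  shows "D = E" "k = l"
proof -
  have 1: "monochrome D (\<lambda>_. True) (\<lambda>_. True)" for D by (simp add: monochrome_def colour_def)
  show "k = l" using assms(3)[of "\<lambda>_. True" "\<lambda>_. True"] by (simp add: weight_def 1)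
  show "D = E"
  proof (rule monochrome_determines[OF D E])
    fix x y
    show "monochrome D x y = monochrome E x y"
      using assms(3)[of x y] by (cases "monochrome D x y"; cases "monochrome E x y") (simp_all add: weight_def)
  qed
qed

section \<open>Stacking\<close>

lemma partition_on_image:
  assumes "partition_on W M" "inj_on f W"
  shows "partition_on (f ` W) ((`) f ` M)"
proof -
  have "(`) f ` M - {{}} = (`) f ` M" using partition_onD3[OF assms(1)] by auto
  then show ?thesis using partition_on_inj_image[OF assms] by simp
qed

lemma card_inj_image_arcs:
  assumes "partition_on W M" "inj_on f W" "\<And>a. a \<in> M \<Longrightarrow> card a = 2" "b \<in> (`) f ` M"
  shows "card b = 2"
proof -
  obtain a where a: "a \<in> M" "b = f ` a" using assms(4) by auto
  then have "inj_on f a" using assms(2) partition_onD1[OF assms(1)] inj_on_subset by blast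
  then show ?thesis using a assms(3) by (simp add: card_image)
qed

text \<open>\<open>lower\<close> and \<open>halve\<close> name the anonymous maps in
  \<open>stack_arcs\<close> and \<open>stack\<close>: the first moves the second diagram to rows 1
  and 2, the other renumbers the outer rows 0 and 2 as 0 and 1.\<close>

definition lower :: "point \<Rightarrow> point" where "lower = (\<lambda>(r, i). (r + 1, i))"
definition halve :: "point \<Rightarrow> point" where "halve = (\<lambda>(r, i). (r div 2, i))"

definition colour3 :: "(nat \<Rightarrow> bool) \<Rightarrow> (nat \<Rightarrow> bool) \<Rightarrow> (nat \<Rightarrow> bool) \<Rightarrow> point \<Rightarrow> bool" where
  "colour3 x y z p = (if fst p = 0 then x (snd p) else if fst p = 1 then y (snd p) else z (snd p))"

locale stacking =
  fixes D E :: diagram and m n p :: nat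
  assumes D: "D \<in> matchings m n" and E: "E \<in> matchings n p"
begin

definition V :: "point set" where "V = row 0 m \<union> row 1 n \<union> row 2 p"
definition S :: "point set set" where "S = arcs D \<union> (`) lower ` arcs E"

abbreviation "comps \<equiv> V // conn S"

definition outer :: "point set set" where "outer = {c \<in> comps. \<not> c \<subseteq> row 1 n}"
definition loops :: "point set set" where "loops = {c \<in> comps. c \<subseteq> row 1 n}"

lemma finite_V: "finite V"
  by (simp add: V_def)

lemma inj_lower: "inj_on lower W"
  by (auto simp: inj_on_def lower_def)

lemma lower_rows: "lower ` (row 0 n \<union> row 1 p) = row 1 n \<union> row 2 p"
  unfolding image_Un by (intro arg_cong2[where f = "(\<union>)"]) (auto simp: lower_def row_def image_iff)

lemma partE: "partition_on (row 1 n \<union> row 2 p) ((`) lower ` arcs E)"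
  using partition_on_image[OF matchingsD(3)[OF E] inj_lower] unfolding lower_rows .

lemma S_sub: "\<Union>S \<subseteq> V"
  using matchingsD(5)[OF D] partition_onD1[OF partE] unfolding S_def V_def by blast

lemma S_card: "a \<in> S \<Longrightarrow> card a = 2"
  unfolding S_def using matchingsD(4)[OF D] card_inj_image_arcs[OF matchingsD(3)[OF E] inj_lower matchingsD(4)[OF E]]
  by blast

lemma components: "stack_components D E = comps"
  unfolding stack_components_def conn_def stack_arcs_def V_def S_def lower_def
  using matchingsD(1,2)[OF D] matchingsD(2)[OF E] by simp

lemma part: "partition_on V comps"
  by (rule partition_components[OF S_sub])

lemma comp_sub: "c \<in> comps \<Longrightarrow> c \<subseteq> V"
  using part by (auto simp: partition_on_def)

text \<open>No arc leaves a component. The two even counts overlap in the middle row, which is how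
  parity is passed from the top row to the bottom row.\<close>

lemma comp_even:
  assumes "c \<in> comps"
  shows "card (c \<inter> (row 0 m \<union> row 1 n)) = 2 * card {a \<in> arcs D. a \<subseteq> c}"
    and "card (c \<inter> (row 1 n \<union> row 2 p)) = 2 * card {a \<in> (`) lower ` arcs E. a \<subseteq> c}"
proof -
  have arc: "a \<subseteq> c" if "a \<in> S" "a \<inter> c \<noteq> {}" for a
    using component_arc[OF S_sub assms that] .
  show "card (c \<inter> (row 0 m \<union> row 1 n)) = 2 * card {a \<in> arcs D. a \<subseteq> c}"
    by (rule card_union_arcs[OF matchingsD(3)[OF D]]) (use S_card arc in \<open>simp_all add: S_def\<close>)
  show "card (c \<inter> (row 1 n \<union> row 2 p)) = 2 * card {a \<in> (`) lower ` arcs E. a \<subseteq> c}"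
    by (rule card_union_arcs[OF partE]) (use S_card arc in \<open>simp_all add: S_def\<close>)
qed

lemma comp_split:
  assumes "c \<in> comps"
  shows "card c = card (c \<inter> row 0 m) + card (c \<inter> row 1 n) + card (c \<inter> row 2 p)"
    "card (c \<inter> (row 0 m \<union> row 1 n)) = card (c \<inter> row 0 m) + card (c \<inter> row 1 n)"
    "card (c \<inter> (row 1 n \<union> row 2 p)) = card (c \<inter> row 1 n) + card (c \<inter> row 2 p)"
    "card (c - row 1 n) = card (c \<inter> row 0 m) + card (c \<inter> row 2 p)"
proof -
  have fin: "finite c" using comp_sub[OF assms] finite_V finite_subset by blast
  have c: "c = (c \<inter> row 0 m) \<union> (c \<inter> row 1 n) \<union> (c \<inter> row 2 p)"
    using comp_sub[OF assms] unfolding V_def by blast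
  have disj: "row 0 m \<inter> row 1 n = {}" "row 0 m \<inter> row 2 p = {}" "row 1 n \<inter> row 2 p = {}"
    by (auto simp: row_def)
  have "card c = card ((c \<inter> row 0 m) \<union> (c \<inter> row 1 n) \<union> (c \<inter> row 2 p))"
    by (rule arg_cong[OF c])
  also have "\<dots> = card ((c \<inter> row 0 m) \<union> (c \<inter> row 1 n)) + card (c \<inter> row 2 p)"
    by (rule card_Un_disjoint) (use fin disj in auto)
  also have "card ((c \<inter> row 0 m) \<union> (c \<inter> row 1 n)) = card (c \<inter> row 0 m) + card (c \<inter> row 1 n)"
    by (rule card_Un_disjoint) (use fin disj in auto)
  finally show "card c = card (c \<inter> row 0 m) + card (c \<inter> row 1 n) + card (c \<inter> row 2 p)" .
  show "card (c \<inter> (row 0 m \<union> row 1 n)) = card (c \<inter> row 0 m) + card (c \<inter> row 1 n)"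
    unfolding Int_Un_distrib by (rule card_Un_disjoint) (use fin disj in auto)
  show "card (c \<inter> (row 1 n \<union> row 2 p)) = card (c \<inter> row 1 n) + card (c \<inter> row 2 p)"
    unfolding Int_Un_distrib by (rule card_Un_disjoint) (use fin disj in auto)
  have "c - row 1 n = (c \<inter> row 0 m) \<union> (c \<inter> row 2 p)" using c disj by blast
  then show "card (c - row 1 n) = card (c \<inter> row 0 m) + card (c \<inter> row 2 p)"
    by (simp only:) (rule card_Un_disjoint, use fin disj in auto)
qed

text \<open>Let i, j, k count the points of the component in the three rows, and d, e its arcs from
  the two diagrams. Then i + j = 2 d, j + k = 2 e, and connectedness gives i + j + k \<le> d + e +
  1. Hence i + k is even and at most 2, and it is not 0 because the component leaves the middle
  row.\<close>

lemma outer_card: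
  assumes "c \<in> outer"
  shows "card (c - row 1 n) = 2"
proof -
  have c: "c \<in> comps" "\<not> c \<subseteq> row 1 n" using assms by (auto simp: outer_def)
  have fin: "finite c" using comp_sub[OF c(1)] finite_V finite_subset by blast
  let ?D = "{a \<in> arcs D. a \<subseteq> c}" and ?E = "{a \<in> (`) lower ` arcs E. a \<subseteq> c}"
  have "card c \<le> Suc (card {a \<in> S. a \<subseteq> c})"
    by (rule component_edges[OF finite_V S_sub S_card c(1)])
  also have "{a \<in> S. a \<subseteq> c} = ?D \<union> ?E" by (auto simp: S_def)
  finally have "card c \<le> Suc (card ?D + card ?E)"
    using card_Un_le[of ?D ?E] by simp
  moreover have "card (c - row 1 n) \<noteq> 0" using c(2) fin by auto
  moreover have "i + k = 2" if "i + j + k \<le> Suc (d + e)" "i + j = 2 * d" "j + k = 2 * e" "i + k \<noteq> 0"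
    for i j k d e :: nat
  proof -
    have "i + k \<le> 2" "(i + k) + 2 * j = 2 * (d + e)" using that(1-3) by auto
    moreover have "even (2 * (d + e))" by simp
    ultimately have "even (i + k)" by (metis dvd_add_times_triv_right_iff even_add even_mult_iff)
    then show ?thesis using \<open>i + k \<le> 2\<close> that(4) by (cases "i + k = 1") auto
  qed
  ultimately show ?thesis
    using comp_even[OF c(1)] unfolding comp_split[OF c(1)] by blast
qed

text \<open>The middle row has to be removed: division by 2 would identify row 1 with row 0.\<close>

lemma inj_halve: "inj_on halve (V - row 1 n)"
  by (auto simp: inj_on_def halve_def V_def row_def)

lemma halve_rows: "halve ` (V - row 1 n) = row 0 m \<union> row 1 p"
proof -
  have "V - row 1 n = row 0 m \<union> row 2 p" by (auto simp: V_def row_def)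
  moreover have "halve ` row 0 m = row 0 m" "halve ` row 2 p = row 1 p"
    by (auto simp: halve_def row_def image_iff)
  ultimately show ?thesis by (simp add: image_Un)
qed

lemma stack_eq: "stack D E = Diagram m p ((`) halve ` (\<lambda>c. c - row 1 n) ` outer)"
  unfolding stack_def components using matchingsD(1,2)[OF D] matchingsD(2)[OF E]
  by (auto simp: outer_def halve_def)

lemma part_outer: "partition_on (V - row 1 n) ((\<lambda>c. c - row 1 n) ` outer)"
proof (rule partition_onI)
  show "\<Union>((\<lambda>c. c - row 1 n) ` outer) = V - row 1 n"
  proof -
    have "\<Union>((\<lambda>c. c - row 1 n) ` outer) = \<Union>comps - row 1 n" unfolding outer_def by blast
    also have "\<Union>comps = V" by (rule partition_onD1[OF part, symmetric])
    finally show ?thesis .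
  qed
  show "{} \<notin> (\<lambda>c. c - row 1 n) ` outer"
    by (auto simp: outer_def)
  show "disjnt a b" if "a \<in> (\<lambda>c. c - row 1 n) ` outer" "b \<in> (\<lambda>c. c - row 1 n) ` outer" "a \<noteq> b" for a b
    using that partition_onD2[OF part] by (auto simp: outer_def disjoint_def disjnt_def)
qed

lemma stack_in: "stack D E \<in> matchings m p"
proof (rule matchingsI)
  show "src (stack D E) = m" "tgt (stack D E) = p" by (simp_all add: stack_eq)
  show "partition_on (row 0 m \<union> row 1 p) (arcs (stack D E))"
    using partition_on_image[OF part_outer inj_halve] unfolding stack_eq halve_rows diagram.sel .
  show "card a = 2" if "a \<in> arcs (stack D E)" for a
  proof (rule card_inj_image_arcs[OF part_outer inj_halve])
    show "a \<in> (`) halve ` (\<lambda>c. c - row 1 n) ` outer" using that unfolding stack_eq diagram.sel .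
  qed (use outer_card in blast)
qed

lemma stack_loops_eq: "stack_loops D E = card loops"
  unfolding stack_loops_def components loops_def using matchingsD(2)[OF D] by simp

lemma monochrome_both:
  "monochrome D x y \<and> monochrome E y z \<longleftrightarrow> (\<forall>c\<in>comps. \<forall>u\<in>c. \<forall>v\<in>c. colour3 x y z u = colour3 x y z v)"
proof -
  have "monochrome D x y \<longleftrightarrow> (\<forall>a\<in>arcs D. \<forall>u\<in>a. \<forall>v\<in>a. colour3 x y z u = colour3 x y z v)"
  proof -
    have "colour x y u = colour3 x y z u" if "a \<in> arcs D" "u \<in> a" for a u
    proof -
      have "u \<in> row 0 m \<union> row 1 n" using that matchingsD(5)[OF D] by blast
      then show ?thesis by (auto simp: colour_def colour3_def row_def)
    qed
    then show ?thesis by (simp add: monochrome_def)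
  qed
  moreover have "monochrome E y z \<longleftrightarrow> (\<forall>a\<in>(`) lower ` arcs E. \<forall>u\<in>a. \<forall>v\<in>a. colour3 x y z u = colour3 x y z v)"
  proof -
    have "colour y z u = colour3 x y z (lower u)" if "a \<in> arcs E" "u \<in> a" for a u
    proof -
      have "u \<in> row 0 n \<union> row 1 p" using that matchingsD(5)[OF E] by blast
      then show ?thesis by (auto simp: colour_def colour3_def row_def lower_def)
    qed
    then show ?thesis by (simp add: monochrome_def)
  qed
  moreover have "a \<noteq> {}" if "a \<in> S" for a using S_card[OF that] by auto
  note component_const_iff[OF S_sub this, of "colour3 x y z"]
  ultimately show ?thesis by (simp only: S_def ball_Un)
qed

lemma monochrome_stack:
  "monochrome (stack D E) x z \<longleftrightarrow>
    (\<forall>c\<in>outer. \<forall>u\<in>c - row 1 n. \<forall>v\<in>c - row 1 n. colour3 x y z u = colour3 x y z v)"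
proof -
  have "colour x z (halve u) = colour3 x y z u" if "c \<in> outer" "u \<in> c - row 1 n" for c u
  proof -
    have "u \<in> V - row 1 n" using that comp_sub by (auto simp: outer_def)
    then show ?thesis by (auto simp: colour_def colour3_def row_def halve_def V_def)
  qed
  then show ?thesis by (simp add: monochrome_def stack_eq)
qed

text \<open>On a component reaching an outer row the colours of the middle points are forced by the
  outer ones, while each closed loop is free to take either colour. The admissible middle colourings
  therefore correspond to sets of loops.\<close>

lemma count_colourings:
  "card {y \<in> colourings n. monochrome D x y \<and> monochrome E y z} =
    (if monochrome (stack D E) x z then 2 ^ stack_loops D E else 0)"
proof (cases "monochrome (stack D E) x z")
  case False
  have "\<not> (monochrome D x y \<and> monochrome E y z)" for y
    using False unfolding monochrome_both monochrome_stack[where y = y] outer_def by blast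
  then show ?thesis using False by simp
next
  case True
  define Y where "Y = {y \<in> colourings n. monochrome D x y \<and> monochrome E y z}"
  \<comment> \<open>A middle point is coloured \<open>True\<close> if its component is a selected
    loop or has an outer point coloured \<open>True\<close>. The all-\<open>True\<close> middle
    colouring inside \<open>colour3\<close> is a filler, since \<open>v\<close> lies outside the
    middle row.\<close>
  define g where "g U i \<longleftrightarrow> (\<exists>c\<in>comps. (1, i) \<in> c \<and> (c \<in> U \<or> (\<exists>v\<in>c - row 1 n. colour3 x (\<lambda>_. True) z v)))"
    for U and i :: nat
  have uniq: "c = d" if "c \<in> comps" "d \<in> comps" "u \<in> c" "u \<in> d" for c d u
    using that partition_onD2[OF part] by (auto simp: disjoint_def)
  have c3: "colour3 x y z v = colour3 x y' z v" if "c \<in> comps" "v \<in> c - row 1 n" for c v y y'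
    using that comp_sub by (fastforce simp: colour3_def V_def row_def)
  have fin: "finite loops"
    using finite_subset[of loops "Pow V"] comp_sub finite_V by (auto simp: loops_def)
  have "bij_betw g (Pow loops) Y"
  proof (rule bij_betw_byWitness[where f' = "\<lambda>y. {c \<in> loops. \<exists>i. (1, i) \<in> c \<and> y i}"])
    show "\<forall>U\<in>Pow loops. {c \<in> loops. \<exists>i. (1, i) \<in> c \<and> g U i} = U"
    proof safe
      fix U c i assume "U \<subseteq> loops" "c \<in> loops" "(1, i) \<in> c" "g U i"
      then show "c \<in> U" using uniq unfolding g_def loops_def by blast
    next
      fix U c assume U: "U \<subseteq> loops" "c \<in> U"
      then show c: "c \<in> loops" by auto
      have "c \<noteq> {}" using c partition_onD3[OF part] by (auto simp: loops_def)
      then obtain i where "(1, i) \<in> c" using c by (auto simp: loops_def row_def)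
      then show "\<exists>i. (1, i) \<in> c \<and> g U i" using U c unfolding g_def loops_def by blast
    qed
    show "\<forall>y\<in>Y. g {c \<in> loops. \<exists>i. (1, i) \<in> c \<and> y i} = y"
    proof (intro ballI ext)
      fix y i assume y: "y \<in> Y"
      have const: "colour3 x y z u = colour3 x y z v" if "c \<in> comps" "u \<in> c" "v \<in> c" for c u v
        using y that unfolding Y_def monochrome_both by blast
      show "g {c \<in> loops. \<exists>i. (1, i) \<in> c \<and> y i} i = y i"
      proof (cases "i < n")
        case False
        then have "\<not> y i" using y by (auto simp: Y_def colourings_def)
        moreover have "(1, i) \<notin> c" if "c \<in> comps" for c
          using comp_sub[OF that] False by (auto simp: V_def)
        ultimately show ?thesis by (auto simp: g_def)
      next
        case i: True
        then have "(1, i) \<in> V" by (auto simp: V_def)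
        then obtain c where c: "c \<in> comps" "(1, i) \<in> c" using partition_onD1[OF part] by blast
        \<comment> \<open>The existential over components in \<open>g\<close> collapses, because
          \<open>c\<close> is the only component containing the point.\<close>
        have eq: "g U i \<longleftrightarrow> c \<in> U \<or> (\<exists>v\<in>c - row 1 n. colour3 x (\<lambda>_. True) z v)" if "U \<subseteq> comps" for U
          using c uniq that unfolding g_def by blast
        have val: "colour3 x y z (1, j) = y j" for j by (simp add: colour3_def)
        show ?thesis
        proof (cases "c \<subseteq> row 1 n")
          case True
          have "y j = y i" if "(1, j) \<in> c" for j
            using const[OF c(1) that c(2)] unfolding val .
          then have "c \<in> {c \<in> loops. \<exists>i. (1, i) \<in> c \<and> y i} \<longleftrightarrow> y i"
            using c True unfolding loops_def by blast
          moreover have "c - row 1 n = {}" using True by blast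
          moreover have "{c \<in> loops. \<exists>i. (1, i) \<in> c \<and> y i} \<subseteq> comps" unfolding loops_def by blast
          ultimately show ?thesis by (simp only: eq) blast
        next
          case False
          then obtain v where v: "v \<in> c - row 1 n" by auto
          have "colour3 x (\<lambda>_. True) z w = y i" if w: "w \<in> c - row 1 n" for w
          proof -
            have "colour3 x (\<lambda>_. True) z w = colour3 x y z w" by (rule c3[OF c(1) w])
            also have "\<dots> = colour3 x y z (1, i)" by (rule const[OF c(1) _ c(2)]) (use w in simp)
            finally show ?thesis unfolding val .
          qed
          then have "(\<exists>v\<in>c - row 1 n. colour3 x (\<lambda>_. True) z v) \<longleftrightarrow> y i" using v by blast
          moreover have "{c \<in> loops. \<exists>i. (1, i) \<in> c \<and> y i} \<subseteq> comps" unfolding loops_def by blast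
          moreover have "c \<notin> loops" using False unfolding loops_def by blast
          ultimately show ?thesis by (simp only: eq) blast
        qed
      qed
    qed
    show "g ` Pow loops \<subseteq> Y"
    proof safe
      fix U assume U: "U \<subseteq> loops"
      have const: "colour3 x (g U) z u = (c \<in> U \<or> (\<exists>v\<in>c - row 1 n. colour3 x (\<lambda>_. True) z v))"
        if c: "c \<in> comps" "u \<in> c" for c u
      proof (cases "u \<in> row 1 n")
        case True
        then obtain i where u: "u = (1, i)" by (auto simp: row_def)
        have "colour3 x (g U) z u = g U i" by (simp add: colour3_def u)
        also have "\<dots> = (c \<in> U \<or> (\<exists>v\<in>c - row 1 n. colour3 x (\<lambda>_. True) z v))"
          using c uniq unfolding g_def u by blast
        finally show ?thesis .
      next
        case False
        then have co: "c \<in> outer" using c by (auto simp: outer_def)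
        then have "c \<notin> U" using U by (auto simp: outer_def loops_def)
        moreover have "colour3 x (g U) z u = colour3 x (\<lambda>_. True) z u"
          using c False by (intro c3) auto
        moreover have "colour3 x (\<lambda>_. True) z u = (\<exists>v\<in>c - row 1 n. colour3 x (\<lambda>_. True) z v)"
          using \<open>monochrome (stack D E) x z\<close>[unfolded monochrome_stack[where y = "\<lambda>_. True"]] co c(2) False by blast
        ultimately show ?thesis by simp
      qed
      moreover have "g U \<in> colourings n"
        using comp_sub by (fastforce simp: g_def colourings_def V_def)
      ultimately show "g U \<in> Y" unfolding Y_def monochrome_both by simp
    qed
    show "(\<lambda>y. {c \<in> loops. \<exists>i. (1, i) \<in> c \<and> y i}) ` Y \<subseteq> Pow loops" by auto
  qed
  then have "card Y = card (Pow loops)" by (simp add: bij_betw_same_card)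
  then show ?thesis using True fin by (simp add: card_Pow stack_loops_eq Y_def)
qed

lemma stack_weight:
  "(\<Sum>y\<in>colourings n. weight D x y * weight E y z) = 2 ^ stack_loops D E * weight (stack D E) x z"
proof -
  have "(\<Sum>y\<in>colourings n. weight D x y * weight E y z) =
      (\<Sum>y\<in>colourings n. of_bool (monochrome D x y \<and> monochrome E y z))"
    by (simp add: weight_def of_bool_conj)
  also have "\<dots> = card {y \<in> colourings n. monochrome D x y \<and> monochrome E y z}"
    by (simp add: Int_def)
  finally show ?thesis by (simp add: count_colourings weight_def)
qed

end

lemmas stack_in_matchings = stacking.stack_in[OF stacking.intro]
lemmas stack_weight = stacking.stack_weight[OF stacking.intro]

text \<open>The form in which composites are computed: guess the resulting matching and the number
  of loops, then evaluate the finite sum.\<close>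

lemma stack_eqI:
  assumes "D \<in> matchings m n" "E \<in> matchings n p" "F \<in> matchings m p"
    and "\<And>x z. (\<Sum>y\<in>colourings n. weight D x y * weight E y z) = 2 ^ k * weight F x z"
  shows "stack D E = F" "stack_loops D E = k"
  using weight_determines[OF stack_in_matchings[OF assms(1,2)] assms(3), of "stack_loops D E" k]
    assms(4) by (simp_all add: stack_weight[OF assms(1,2)])

section \<open>Weights of elementary diagrams\<close>

text \<open>Reflection in a horizontal line. Truncated \<open>1 - r\<close> exchanges the two rows,
  as only rows 0 and 1 occur.\<close>

definition flip_diagram :: "diagram \<Rightarrow> diagram" where
  "flip_diagram D = Diagram (tgt D) (src D) (image (\<lambda>(r, i). (1 - r, i)) ` arcs D)"

text \<open>Half turn of the rectangle: the rows are exchanged and each of them is read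
  backwards.\<close>

definition rotate_diagram :: "diagram \<Rightarrow> diagram" where
  "rotate_diagram D = Diagram (tgt D) (src D)
     (image (\<lambda>(r, i). (1 - r, (if r = 0 then src D else tgt D) - 1 - i)) ` arcs D)"

definition reversed :: "nat \<Rightarrow> (nat \<Rightarrow> bool) \<Rightarrow> nat \<Rightarrow> bool" where
  "reversed n x i \<longleftrightarrow> i < n \<and> x (n - 1 - i)"

definition join :: "nat \<Rightarrow> (nat \<Rightarrow> bool) \<Rightarrow> (nat \<Rightarrow> bool) \<Rightarrow> nat \<Rightarrow> bool" where
  "join n x y i = (if i < n then x i else y (i - n))"

definition suffix :: "nat \<Rightarrow> (nat \<Rightarrow> bool) \<Rightarrow> nat \<Rightarrow> bool" where
  "suffix n x i = x (n + i)"

lemma row_image: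
  assumes "\<And>i. i < m \<Longrightarrow> f (r, i) \<in> row r' m'" "\<And>j. j < m' \<Longrightarrow> \<exists>i<m. f (r, i) = (r', j)"
  shows "f ` row r m = row r' m'"
proof (intro equalityI subsetI)
  fix u assume "u \<in> row r' m'"
  then obtain j where "j < m'" "u = (r', j)" by (auto simp: row_def)
  then obtain i where "i < m" "u = f (r, i)" using assms(2)[of j] by auto
  then show "u \<in> f ` row r m" by auto
next
  fix u assume "u \<in> f ` row r m"
  then obtain i where "i < m" "u = f (r, i)" by (auto simp: row_def)
  then show "u \<in> row r' m'" using assms(1)[of i] by simp
qed

lemma row_shift:
  assumes "\<And>i. i < k \<Longrightarrow> f (r, i) = (r, m + i)"
  shows "f ` row r k = row r (m + k) - row r m"
proof (intro equalityI subsetI)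
  fix u assume "u \<in> row r (m + k) - row r m"
  then obtain j where "u = (r, j)" "m \<le> j" "j < m + k" by (cases u) (auto simp: not_less)
  then show "u \<in> f ` row r k" using assms[of "j - m"] by (intro image_eqI[of _ _ "(r, j - m)"]) auto
next
  fix u assume "u \<in> f ` row r k"
  then obtain i where "i < k" "u = f (r, i)" by (auto simp: row_def)
  then show "u \<in> row r (m + k) - row r m" using assms[of i] by simp
qed

text \<open>Common source of the facts about reflection and half turn: a bijection of endpoints
  transports the matching, and it transports the weights once the colours correspond.\<close>

lemma relabel:
  assumes D: "D \<in> matchings m n" and inj: "inj_on f (row 0 m \<union> row 1 n)"
    and img: "f ` (row 0 m \<union> row 1 n) = row 0 m' \<union> row 1 n'"
  shows "Diagram m' n' ((`) f ` arcs D) \<in> matchings m' n'"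
    "(\<And>u. u \<in> row 0 m \<union> row 1 n \<Longrightarrow> colour x y (f u) = colour x' y' u) \<Longrightarrow>
      weight (Diagram m' n' ((`) f ` arcs D)) x y = weight D x' y'"
proof -
  show "Diagram m' n' ((`) f ` arcs D) \<in> matchings m' n'"
  proof (rule matchingsI)
    show "partition_on (row 0 m' \<union> row 1 n') (arcs (Diagram m' n' ((`) f ` arcs D)))"
      using partition_on_image[OF matchingsD(3)[OF D] inj] unfolding img by simp
    show "card a = 2" if "a \<in> arcs (Diagram m' n' ((`) f ` arcs D))" for a
      using that card_inj_image_arcs[OF matchingsD(3)[OF D] inj matchingsD(4)[OF D]] by simp
  qed simp_all
  assume col: "\<And>u. u \<in> row 0 m \<union> row 1 n \<Longrightarrow> colour x y (f u) = colour x' y' u"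
  have "colour x y (f u) = colour x' y' u" if "a \<in> arcs D" "u \<in> a" for a u
    using col[of u] that matchingsD(5)[OF D] by blast
  then show "weight (Diagram m' n' ((`) f ` arcs D)) x y = weight D x' y'"
    by (simp add: weight_def monochrome_def)
qed

lemma flip_in_matchings: "D \<in> matchings m n \<Longrightarrow> flip_diagram D \<in> matchings n m"
  and weight_flip: "D \<in> matchings m n \<Longrightarrow> weight (flip_diagram D) x y = weight D y x"
proof -
  assume D: "D \<in> matchings m n"
  let ?f = "\<lambda>(r, i). (1 - r, i) :: point"
  have inj: "inj_on ?f (row 0 m \<union> row 1 n)" by (auto simp: inj_on_def row_def)
  have img: "?f ` (row 0 m \<union> row 1 n) = row 0 n \<union> row 1 m"
    unfolding image_Un by (subst Un_commute, intro arg_cong2[where f = "(\<union>)"] row_image) auto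
  have eq: "flip_diagram D = Diagram n m ((`) ?f ` arcs D)"
    using matchingsD(1,2)[OF D] by (simp add: flip_diagram_def)
  show "flip_diagram D \<in> matchings n m" unfolding eq by (rule relabel(1)[OF D inj img])
  show "weight (flip_diagram D) x y = weight D y x" unfolding eq
    by (rule relabel(2)[OF D inj img]) (auto simp: colour_def row_def)
qed

lemma rotate_in_matchings: "D \<in> matchings m n \<Longrightarrow> rotate_diagram D \<in> matchings n m"
  and weight_rotate: "D \<in> matchings m n \<Longrightarrow>
    weight (rotate_diagram D) x y = weight D (reversed m y) (reversed n x)"
proof -
  assume D: "D \<in> matchings m n"
  let ?f = "\<lambda>(r, i). (1 - r, (if r = 0 then m else n) - 1 - i) :: point"
  have inj: "inj_on ?f (row 0 m \<union> row 1 n)" by (auto simp: inj_on_def row_def)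
  have img: "?f ` (row 0 m \<union> row 1 n) = row 0 n \<union> row 1 m"
  proof -
    have "?f ` row 0 m = row 1 m"
    proof (rule row_image)
      show "\<exists>i<m. ?f (0, i) = (1, j)" if "j < m" for j
        using that by (intro exI[of _ "m - 1 - j"]) auto
    qed auto
    moreover have "?f ` row 1 n = row 0 n"
    proof (rule row_image)
      show "\<exists>i<n. ?f (1, i) = (0, j)" if "j < n" for j
        using that by (intro exI[of _ "n - 1 - j"]) auto
    qed auto
    ultimately show ?thesis by (simp only: image_Un Un_commute)
  qed
  have eq: "rotate_diagram D = Diagram n m ((`) ?f ` arcs D)"
    unfolding rotate_diagram_def matchingsD(1,2)[OF D] ..
  show "rotate_diagram D \<in> matchings n m" unfolding eq by (rule relabel(1)[OF D inj img])
  show "weight (rotate_diagram D) x y = weight D (reversed m y) (reversed n x)" unfolding eq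
    by (rule relabel(2)[OF D inj img]) (auto simp: colour_def row_def reversed_def)
qed

lemma partition_on_Un:
  assumes M: "partition_on W M" and N: "partition_on X N" and disj: "W \<inter> X = {}"
  shows "partition_on (W \<union> X) (M \<union> N)"
proof (rule partition_onI)
  have sub: "\<And>a. a \<in> M \<Longrightarrow> a \<subseteq> W" "\<And>a. a \<in> N \<Longrightarrow> a \<subseteq> X"
    using partition_onD1[OF M] partition_onD1[OF N] by auto
  show "\<Union>(M \<union> N) = W \<union> X"
    unfolding Union_Un_distrib partition_onD1[OF M, symmetric] partition_onD1[OF N, symmetric] ..
  show "{} \<notin> M \<union> N"
    using partition_onD3[OF M] partition_onD3[OF N] by simp
  show "disjnt a b" if ab: "a \<in> M \<union> N" "b \<in> M \<union> N" "a \<noteq> b" for a b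
  proof (cases "(a \<in> M \<and> b \<in> M) \<or> (a \<in> N \<and> b \<in> N)")
    case True
    then show ?thesis
      using disjointD[OF partition_onD2[OF M] _ _ ab(3)] disjointD[OF partition_onD2[OF N] _ _ ab(3)]
      by (auto simp: disjnt_def)
  next
    case False
    then have "(a \<subseteq> W \<and> b \<subseteq> X) \<or> (a \<subseteq> X \<and> b \<subseteq> W)" using ab sub by auto
    then show ?thesis using disj unfolding disjnt_def by blast
  qed
qed

lemma juxtapose_in_matchings: "D \<in> matchings m n \<Longrightarrow> E \<in> matchings m' n' \<Longrightarrow>
    juxtapose D E \<in> matchings (m + m') (n + n')"
  and weight_juxtapose: "D \<in> matchings m n \<Longrightarrow> E \<in> matchings m' n' \<Longrightarrow>
    weight (juxtapose D E) x y = weight D x y * weight E (suffix m x) (suffix n y)"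
proof -
  assume D: "D \<in> matchings m n" and E: "E \<in> matchings m' n'"
  let ?f = "\<lambda>(r, i). (r, (if r = 0 then m else n) + i) :: point"
  have inj: "inj_on ?f (row 0 m' \<union> row 1 n')" by (auto simp: inj_on_def row_def)
  have "?f ` row 0 m' = row 0 (m + m') - row 0 m" "?f ` row 1 n' = row 1 (n + n') - row 1 n"
    by (rule row_shift; simp)+
  then have "?f ` (row 0 m' \<union> row 1 n') = (row 0 (m + m') - row 0 m) \<union> (row 1 (n + n') - row 1 n)"
    by (simp add: image_Un)
  moreover have "row 0 m \<inter> row 1 n' = {}" "row 0 m \<inter> row 1 (n + n') = {}" "row 1 n \<inter> row 0 (m + m') = {}"
    by (auto simp: row_def)
  moreover have "row 0 m \<subseteq> row 0 (m + m')" "row 1 n \<subseteq> row 1 (n + n')" by (auto simp: row_def)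
  ultimately have img: "?f ` (row 0 m' \<union> row 1 n') \<union> (row 0 m \<union> row 1 n) = row 0 (m + m') \<union> row 1 (n + n')"
    "?f ` (row 0 m' \<union> row 1 n') \<inter> (row 0 m \<union> row 1 n) = {}" by blast+
  have eq: "juxtapose D E = Diagram (m + m') (n + n') (arcs D \<union> (`) ?f ` arcs E)"
    unfolding juxtapose_def matchingsD(1,2)[OF D] matchingsD(1,2)[OF E] ..
  note PE = partition_on_image[OF matchingsD(3)[OF E] inj] and PD = matchingsD(3)[OF D]
  show "juxtapose D E \<in> matchings (m + m') (n + n')"
  proof (rule matchingsI)
    show "partition_on (row 0 (m + m') \<union> row 1 (n + n')) (arcs (juxtapose D E))"
      using partition_on_Un[OF PE PD img(2)] unfolding eq diagram.sel img(1) by (simp only: Un_commute)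
    show "card a = 2" if "a \<in> arcs (juxtapose D E)" for a
      using that matchingsD(4)[OF D] card_inj_image_arcs[OF matchingsD(3)[OF E] inj matchingsD(4)[OF E]]
      unfolding eq by auto
  qed (simp_all add: eq)
  define g where "g = ?f"
  have "colour x y (g u) = colour (suffix m x) (suffix n y) u" for u
    by (auto simp: g_def colour_def suffix_def split: prod.splits)
  then have "monochrome (juxtapose D E) x y = (monochrome D x y \<and> monochrome E (suffix m x) (suffix n y))"
    unfolding eq monochrome_def diagram.sel ball_Un g_def[symmetric] by simp
  then show "weight (juxtapose D E) x y = weight D x y * weight E (suffix m x) (suffix n y)"
    by (simp add: weight_def)
qed

lemma monochrome_pairs:
  "monochrome (Diagram m n {{f i, g i} | i. i < k}) x y \<longleftrightarrow> (\<forall>i<k. colour x y (f i) = colour x y (g i))"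
proof
  assume *: "monochrome (Diagram m n {{f i, g i} | i. i < k}) x y"
  show "\<forall>i<k. colour x y (f i) = colour x y (g i)"
  proof (intro allI impI)
    fix i assume "i < k"
    then have "{f i, g i} \<in> arcs (Diagram m n {{f i, g i} | i. i < k})" by auto
    then show "colour x y (f i) = colour x y (g i)"
      by (rule *[unfolded monochrome_def, rule_format]) auto
  qed
qed (auto simp: monochrome_def)

lemma id_in_matchings: "id_diagram n \<in> matchings n n"
  and weight_id: "weight (id_diagram n) x y = of_bool (\<forall>i<n. x i = y i)"
proof -
  show "id_diagram n \<in> matchings n n"
  proof (rule matchingsI)
    show "partition_on (row 0 n \<union> row 1 n) (arcs (id_diagram n))"
      by (rule partition_onI) (auto simp: id_diagram_def row_def disjnt_def)
  qed (auto simp: id_diagram_def)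
  show "weight (id_diagram n) x y = of_bool (\<forall>i<n. x i = y i)"
    by (simp add: weight_def id_diagram_def monochrome_pairs colour_def)
qed

lemma cap_in_matchings: "cap_diagram n \<in> matchings (n + n) 0"
  and weight_cap: "weight (cap_diagram n) x y = of_bool (\<forall>i<n. x i = x (n + n - 1 - i))"
proof -
  show "cap_diagram n \<in> matchings (n + n) 0"
  proof (rule matchingsI)
    show "partition_on (row 0 (n + n) \<union> row 1 0) (arcs (cap_diagram n))"
    proof (rule partition_onI)
      show "\<Union>(arcs (cap_diagram n)) = row 0 (n + n) \<union> row 1 0"
      proof (intro equalityI subsetI)
        fix u assume "u \<in> row 0 (n + n) \<union> row 1 0"
        then obtain j where j: "u = (0, j)" "j < n + n" by (auto simp: row_def)
        let ?i = "if j < n then j else n + n - 1 - j"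
        have "?i < n" "u \<in> {(0, ?i), (0, n + n - 1 - ?i)}" using j by auto
        then show "u \<in> \<Union>(arcs (cap_diagram n))" unfolding cap_diagram_def diagram.sel by blast
      qed (auto simp: cap_diagram_def row_def)
    qed (auto simp: cap_diagram_def disjnt_def)
    show "card a = 2" if a: "a \<in> arcs (cap_diagram n)" for a
    proof -
      obtain i where "i < n" "a = {(0, i), (0, n + n - 1 - i)}" using a by (auto simp: cap_diagram_def)
      moreover from this have "i \<noteq> n + n - 1 - i" by linarith
      ultimately show ?thesis by (simp del: diff_Suc_eq_diff_pred diff_diff_left)
    qed
  qed (auto simp: cap_diagram_def)
  show "weight (cap_diagram n) x y = of_bool (\<forall>i<n. x i = x (n + n - 1 - i))"
    by (simp add: weight_def cap_diagram_def monochrome_pairs colour_def)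
qed

lemma flip_cap: "flip_diagram (cap_diagram n) = cup_diagram n"
  by (simp add: flip_diagram_def cap_diagram_def cup_diagram_def setcompr_eq_image image_image)

lemma cup_in_matchings: "cup_diagram n \<in> matchings 0 (n + n)"
  and weight_cup: "weight (cup_diagram n) x y = of_bool (\<forall>i<n. y i = y (n + n - 1 - i))"
  using flip_in_matchings[OF cap_in_matchings[of n]] weight_flip[OF cap_in_matchings[of n]]
  by (simp_all add: flip_cap weight_cap)

lemma weight_cong:
  assumes "D \<in> matchings m n" "\<And>i. i < m \<Longrightarrow> x i = x' i" "\<And>i. i < n \<Longrightarrow> y i = y' i"
  shows "weight D x y = weight D x' y'"
  using monochrome_cong[OF assms] by (simp add: weight_def)

section \<open>Sums over colourings\<close>

lemma join_in_colourings: "x \<in> colourings m \<Longrightarrow> y \<in> colourings n \<Longrightarrow> join m x y \<in> colourings (m + n)"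
  by (auto simp: colourings_def join_def)

lemma suffix_join [simp]: "suffix m (join m x y) = y"
  by (auto simp: suffix_def join_def)

lemma join_suffix: "join m (\<lambda>i. i < m \<and> x i) (suffix m x) = x"
  by (auto simp: join_def suffix_def fun_eq_iff)

lemma prefix_join: "x \<in> colourings m \<Longrightarrow> (\<lambda>i. i < m \<and> join m x y i) = x"
  by (auto simp: colourings_def join_def fun_eq_iff not_le[symmetric])

lemma sum_colourings_add:
  "(\<Sum>y\<in>colourings (m + n). f y) = (\<Sum>y\<in>colourings m. \<Sum>z\<in>colourings n. f (join m y z))"
proof -
  have "(\<Sum>y\<in>colourings (m + n). f y) = (\<Sum>(y, z)\<in>colourings m \<times> colourings n. f (join m y z))"
    by (rule sum.reindex_bij_witness[where i = "\<lambda>(y, z). join m y z"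
          and j = "\<lambda>y. (\<lambda>i. i < m \<and> y i, suffix m y)"])
      (auto simp: join_suffix prefix_join join_in_colourings, auto simp: colourings_def suffix_def)
  then show ?thesis by (simp add: sum.cartesian_product)
qed

lemma reversed_in_colourings [simp]: "reversed n x \<in> colourings n"
  by (auto simp: colourings_def reversed_def)

lemma reversed_reversed: "x \<in> colourings n \<Longrightarrow> reversed n (reversed n x) = x"
proof
  fix i assume x: "x \<in> colourings n"
  show "reversed n (reversed n x) i = x i"
  proof (cases "i < n")
    case True
    then have "n - 1 - i < n" "n - 1 - (n - 1 - i) = i" by auto
    then show ?thesis using True by (simp add: reversed_def del: diff_diff_left)
  qed (use x in \<open>auto simp: colourings_def reversed_def\<close>)
qed

lemma sum_colourings_reversed: "(\<Sum>y\<in>colourings n. f (reversed n y)) = (\<Sum>y\<in>colourings n. f y)"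
  by (rule sum.reindex_bij_witness[where i = "reversed n" and j = "reversed n"])
    (auto simp: reversed_reversed)

lemma sum_colourings_delta:
  assumes "\<And>y. y \<in> colourings n \<Longrightarrow> P y \<longleftrightarrow> y = a" "a \<in> colourings n"
  shows "(\<Sum>y\<in>colourings n. of_bool (P y) * f y) = (f a :: nat)"
proof -
  have "(\<Sum>y\<in>colourings n. of_bool (P y) * f y) = (\<Sum>y\<in>colourings n. if y = a then f y else 0)"
    by (rule sum.cong) (auto simp: assms(1))
  then show ?thesis using assms(2) by simp
qed

text \<open>The identity is the unit matrix. The colouring \<open>x\<close> may be arbitrary from
  \<open>n\<close> on; the sum meets its truncation, and the premise says that \<open>f\<close>
  cannot tell the difference.\<close>

lemma sum_weight_id:
  assumes "\<And>y. f y = f (\<lambda>i. i < n \<and> y i)"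
  shows "(\<Sum>y\<in>colourings n. weight (id_diagram n) x y * f y) = f x"
proof -
  have "(\<Sum>y\<in>colourings n. weight (id_diagram n) x y * f y) = f (\<lambda>i. i < n \<and> x i)"
    unfolding weight_id by (rule sum_colourings_delta) (auto simp: colourings_def fun_eq_iff not_le[symmetric])
  then show ?thesis using assms[of x] by simp
qed

lemma cap_join_iff:
  assumes "z \<in> colourings n"
  shows "(\<forall>i<n. join n y z i = join n y z (n + n - 1 - i)) \<longleftrightarrow> z = reversed n y"
proof
  assume *: "\<forall>i<n. join n y z i = join n y z (n + n - 1 - i)"
  show "z = reversed n y"
  proof
    fix i
    show "z i = reversed n y i"
    proof (cases "i < n")
      case True
      then have "n - 1 - i < n" "\<not> n + n - 1 - (n - 1 - i) < n" "n + n - 1 - (n - 1 - i) - n = i" by auto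
      then show ?thesis using *[rule_format, of "n - 1 - i"] True by (simp add: join_def reversed_def)
    qed (use assms in \<open>auto simp: colourings_def reversed_def\<close>)
  qed
qed (auto simp: join_def reversed_def)

text \<open>Split the 2 n colours into halves. By \<open>cap_join_iff\<close> the cap forces the
  right half to be the reversal of the left one, so a single sum over the left half is left.\<close>

lemma sum_weight_cap:
  "(\<Sum>y\<in>colourings (n + n). f y * weight (cap_diagram n) y z) = (\<Sum>y\<in>colourings n. f (join n y (reversed n y)))"
proof -
  have "(\<Sum>w\<in>colourings n. of_bool (\<forall>i<n. join n y w i = join n y w (n + n - 1 - i)) * f (join n y w)) =
      f (join n y (reversed n y))" for y
    by (rule sum_colourings_delta[OF cap_join_iff]) auto
  then show ?thesis
    unfolding sum_colourings_add weight_cap by (simp add: mult.commute)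
qed

lemma sum_weight_cup:
  "(\<Sum>y\<in>colourings (n + n). weight (cup_diagram n) z y * f y) = (\<Sum>y\<in>colourings n. f (join n y (reversed n y)))"
  using sum_weight_cap[where n = n and f = f and z = z] by (simp add: weight_cap weight_cup mult.commute)

section \<open>Identities between diagrams\<close>

lemma weight_trunc:
  assumes "D \<in> matchings m n"
  shows "weight D y z = weight D (\<lambda>i. i < m \<and> y i) z"
  by (rule weight_cong[OF assms]) auto

lemma weight_join_right:
  assumes "D \<in> matchings m n"
  shows "weight D x (join n y z) = weight D x y"
  by (rule weight_cong[OF assms]) (auto simp: join_def)

lemma weight_join_left:
  assumes "D \<in> matchings m n"
  shows "weight D (join m y z) x = weight D y x"
  by (rule weight_cong[OF assms]) (auto simp: join_def)

lemma weight_id_sym: "weight (id_diagram n) x y = weight (id_diagram n) y x"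
  by (simp add: weight_id eq_commute)

section \<open>Stacking as matrix multiplication: units, associativity, interchange,
  reversal\<close>

lemma stack_id_left:
  assumes D: "D \<in> matchings m n"
  shows "stack (id_diagram m) D = D" "stack_loops (id_diagram m) D = 0"
proof -
  have "(\<Sum>y\<in>colourings m. weight (id_diagram m) x y * weight D y z) = 2 ^ 0 * weight D x z" for x z
    using sum_weight_id[where f = "\<lambda>y. weight D y z", OF weight_trunc[OF D]] by simp
  from stack_eqI[OF id_in_matchings D D this]
  show "stack (id_diagram m) D = D" "stack_loops (id_diagram m) D = 0" .
qed

lemma stack_id_right:
  assumes D: "D \<in> matchings m n"
  shows "stack D (id_diagram n) = D" "stack_loops D (id_diagram n) = 0"
proof -
  have t: "weight D x y = weight D x (\<lambda>i. i < n \<and> y i)" for x y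
    by (rule weight_cong[OF D]) auto
  have "(\<Sum>y\<in>colourings n. weight D x y * weight (id_diagram n) y z) = 2 ^ 0 * weight D x z" for x z
    using sum_weight_id[where f = "\<lambda>y. weight D x y" and x = z, OF t]
    by (simp add: mult.commute weight_id_sym[of n z])
  from stack_eqI[OF D id_in_matchings D this]
  show "stack D (id_diagram n) = D" "stack_loops D (id_diagram n) = 0" .
qed

text \<open>Both sides evaluate the same double sum in a different order. Comparing the powers of 2
  gives the identity between loop counts at no extra cost.\<close>

lemma stack_assoc:
  assumes D: "D \<in> matchings m n" and E: "E \<in> matchings n p" and F: "F \<in> matchings p q"
  shows "stack (stack D E) F = stack D (stack E F)"
    and "stack_loops D E + stack_loops (stack D E) F = stack_loops E F + stack_loops D (stack E F)"
proof -
  note DE = stack_in_matchings[OF D E] and EF = stack_in_matchings[OF E F]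
  have "2 ^ (stack_loops D E + stack_loops (stack D E) F) * weight (stack (stack D E) F) x w =
      2 ^ (stack_loops E F + stack_loops D (stack E F)) * weight (stack D (stack E F)) x w" for x w
  proof -
    have "2 ^ (stack_loops D E + stack_loops (stack D E) F) * weight (stack (stack D E) F) x w =
        (\<Sum>z\<in>colourings p. (2 ^ stack_loops D E * weight (stack D E) x z) * weight F z w)"
      by (simp add: power_add stack_weight[OF DE F, symmetric] sum_distrib_left mult.assoc)
    also have "\<dots> = (\<Sum>z\<in>colourings p. \<Sum>y\<in>colourings n. weight D x y * weight E y z * weight F z w)"
      by (simp add: stack_weight[OF D E, symmetric] sum_distrib_right)
    also have "\<dots> = (\<Sum>y\<in>colourings n. \<Sum>z\<in>colourings p. weight D x y * weight E y z * weight F z w)"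
      by (rule sum.swap)
    also have "\<dots> = (\<Sum>y\<in>colourings n. weight D x y * (2 ^ stack_loops E F * weight (stack E F) y w))"
      by (simp add: stack_weight[OF E F, symmetric] sum_distrib_left mult.assoc)
    also have "\<dots> = 2 ^ stack_loops E F * (\<Sum>y\<in>colourings n. weight D x y * weight (stack E F) y w)"
      by (simp add: sum_distrib_left mult.left_commute)
    finally show ?thesis by (simp add: power_add stack_weight[OF D EF])
  qed
  from weight_determines[OF stack_in_matchings[OF DE F] stack_in_matchings[OF D EF] this]
  show "stack (stack D E) F = stack D (stack E F)"
    "stack_loops D E + stack_loops (stack D E) F = stack_loops E F + stack_loops D (stack E F)" .
qed

text \<open>The middle row is a join of two blocks, and each diagram sees one block only, so the sum
  over its colourings is a product of two sums.\<close>

lemma stack_juxtapose: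
  assumes D: "D \<in> matchings m n" and E: "E \<in> matchings m' n'"
    and D': "D' \<in> matchings n p" and E': "E' \<in> matchings n' p'"
  shows "stack (juxtapose D E) (juxtapose D' E') = juxtapose (stack D D') (stack E E')"
    and "stack_loops (juxtapose D E) (juxtapose D' E') = stack_loops D D' + stack_loops E E'"
proof -
  note DD = stack_in_matchings[OF D D'] and EE = stack_in_matchings[OF E E']
  have "(\<Sum>y\<in>colourings (n + n'). weight (juxtapose D E) x y * weight (juxtapose D' E') y z) =
      2 ^ (stack_loops D D' + stack_loops E E') * weight (juxtapose (stack D D') (stack E E')) x z" for x z
  proof -
    have "(\<Sum>y\<in>colourings (n + n'). weight (juxtapose D E) x y * weight (juxtapose D' E') y z) =
      (\<Sum>y\<in>colourings n. \<Sum>y'\<in>colourings n'. (weight D x y * weight D' y z) *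
        (weight E (suffix m x) y' * weight E' y' (suffix p z)))"
      unfolding sum_colourings_add weight_juxtapose[OF D E] weight_juxtapose[OF D' E'] suffix_join
        weight_join_right[OF D] weight_join_left[OF D'] by (simp add: mult_ac)
    also have "\<dots> = (\<Sum>y\<in>colourings n. weight D x y * weight D' y z) *
        (\<Sum>y'\<in>colourings n'. weight E (suffix m x) y' * weight E' y' (suffix p z))"
      by (simp add: sum_product)
    finally show ?thesis
      by (simp add: stack_weight[OF D D'] stack_weight[OF E E'] weight_juxtapose[OF DD EE] power_add)
  qed
  from stack_eqI[OF juxtapose_in_matchings[OF D E] juxtapose_in_matchings[OF D' E'] juxtapose_in_matchings[OF DD EE] this]
  show "stack (juxtapose D E) (juxtapose D' E') = juxtapose (stack D D') (stack E E')"
    "stack_loops (juxtapose D E) (juxtapose D' E') = stack_loops D D' + stack_loops E E'" .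
qed

text \<open>Transposing both matrices reverses the product, and reading the middle row backwards
  only permutes the summation index.\<close>

lemma stack_rotate:
  assumes D: "D \<in> matchings m n" and E: "E \<in> matchings n p"
  shows "stack (rotate_diagram E) (rotate_diagram D) = rotate_diagram (stack D E)"
    and "stack_loops (rotate_diagram E) (rotate_diagram D) = stack_loops D E"
proof -
  note DE = stack_in_matchings[OF D E]
  have "(\<Sum>y\<in>colourings n. weight (rotate_diagram E) x y * weight (rotate_diagram D) y z) =
      2 ^ stack_loops D E * weight (rotate_diagram (stack D E)) x z" for x z
    unfolding weight_rotate[OF D] weight_rotate[OF E] weight_rotate[OF DE] stack_weight[OF D E, symmetric]
    by (subst sum_colourings_reversed[where f = "\<lambda>y. weight E y (reversed p x) * weight D (reversed m z) y"])
      (simp add: mult.commute)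
  from stack_eqI[OF rotate_in_matchings[OF E] rotate_in_matchings[OF D] rotate_in_matchings[OF DE] this]
  show "stack (rotate_diagram E) (rotate_diagram D) = rotate_diagram (stack D E)"
    "stack_loops (rotate_diagram E) (rotate_diagram D) = stack_loops D E" .
qed

lemma stack_flip:
  assumes D: "D \<in> matchings m n" and E: "E \<in> matchings n p"
  shows "stack (flip_diagram E) (flip_diagram D) = flip_diagram (stack D E)"
    and "stack_loops (flip_diagram E) (flip_diagram D) = stack_loops D E"
proof -
  note DE = stack_in_matchings[OF D E]
  have "(\<Sum>y\<in>colourings n. weight (flip_diagram E) x y * weight (flip_diagram D) y z) =
      2 ^ stack_loops D E * weight (flip_diagram (stack D E)) x z" for x z
    unfolding weight_flip[OF D] weight_flip[OF E] weight_flip[OF DE] stack_weight[OF D E, symmetric]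
    by (simp add: mult.commute)
  from stack_eqI[OF flip_in_matchings[OF E] flip_in_matchings[OF D] flip_in_matchings[OF DE] this]
  show "stack (flip_diagram E) (flip_diagram D) = flip_diagram (stack D E)"
    "stack_loops (flip_diagram E) (flip_diagram D) = stack_loops D E" .
qed

section \<open>Juxtaposition and its behaviour under reflection and half turn\<close>

lemma diagram_eqI:
  assumes "D \<in> matchings m n" "E \<in> matchings m n" "\<And>x y. weight D x y = weight E x y"
  shows "D = E"
  using weight_determines(1)[OF assms(1,2), of 0 0] assms(3) by simp

lemma juxtapose_assoc:
  assumes "D \<in> matchings m n" "E \<in> matchings m' n'" "F \<in> matchings m'' n''"
  shows "juxtapose (juxtapose D E) F = juxtapose D (juxtapose E F)"
proof (rule diagram_eqI)
  show "juxtapose (juxtapose D E) F \<in> matchings (m + m' + m'') (n + n' + n'')"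
    by (intro juxtapose_in_matchings assms)
  show "juxtapose D (juxtapose E F) \<in> matchings (m + m' + m'') (n + n' + n'')"
    unfolding add.assoc by (intro juxtapose_in_matchings assms)
  have "suffix (a + b) x = suffix b (suffix a x)" for a b x
    by (auto simp: suffix_def add.assoc)
  then show "weight (juxtapose (juxtapose D E) F) x y = weight (juxtapose D (juxtapose E F)) x y" for x y
    by (simp add: weight_juxtapose[OF juxtapose_in_matchings[OF assms(1,2)] assms(3)]
        weight_juxtapose[OF assms(1,2)] weight_juxtapose[OF assms(2,3)]
        weight_juxtapose[OF assms(1) juxtapose_in_matchings[OF assms(2,3)]])
qed

lemma suffix_0 [simp]: "suffix 0 x = x"
  by (simp add: suffix_def fun_eq_iff)

lemma juxtapose_id_0:
  assumes D: "D \<in> matchings m n"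
  shows "juxtapose (id_diagram 0) D = D" "juxtapose D (id_diagram 0) = D"
proof -
  show "juxtapose (id_diagram 0) D = D"
    by (rule diagram_eqI[OF juxtapose_in_matchings[OF id_in_matchings D]])
      (use D in \<open>simp_all add: weight_juxtapose[OF id_in_matchings D] weight_id\<close>)
  have "juxtapose D (id_diagram 0) \<in> matchings (m + 0) (n + 0)"
    by (rule juxtapose_in_matchings[OF D id_in_matchings])
  then show "juxtapose D (id_diagram 0) = D"
    by (intro diagram_eqI[of _ m n])
      (use D in \<open>simp_all add: weight_juxtapose[OF D id_in_matchings] weight_id\<close>)
qed

lemma all_less_add: "(\<forall>i<m + n. P i) \<longleftrightarrow> (\<forall>i<m. P i) \<and> (\<forall>i<n. P (m + i))" for m n :: nat
proof safe
  fix i assume "\<forall>i<m. P i" "\<forall>i<n. P (m + i)" "i < m + n"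
  then show "P i" by (cases "i < m") (auto dest: spec[of _ "i - m"])
qed auto

lemma all_less_rev: "(\<forall>i<m. P i) \<longleftrightarrow> (\<forall>i<m. P (m - 1 - i))" for m :: nat
proof safe
  fix i assume *: "\<forall>i<m. P (m - 1 - i)" "i < m"
  then have "m - 1 - (m - 1 - i) = i" "m - 1 - i < m" by auto
  then show "P i" using * by metis
qed auto

lemma juxtapose_id_id: "juxtapose (id_diagram m) (id_diagram n) = id_diagram (m + n)"
  by (rule diagram_eqI[OF juxtapose_in_matchings[OF id_in_matchings id_in_matchings] id_in_matchings])
    (simp add: weight_juxtapose[OF id_in_matchings id_in_matchings] weight_id suffix_def all_less_add)

lemma reversed_suffix:
  assumes "i < n"
  shows "reversed (m + n) x i = reversed n (suffix m x) i"
  using assms by (simp add: reversed_def suffix_def)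

lemma rotate_juxtapose:
  assumes D: "D \<in> matchings m n" and E: "E \<in> matchings m' n'"
  shows "rotate_diagram (juxtapose D E) = juxtapose (rotate_diagram E) (rotate_diagram D)"
proof (rule diagram_eqI)
  note J = juxtapose_in_matchings[OF D E] and RD = rotate_in_matchings[OF D] and RE = rotate_in_matchings[OF E]
  show "rotate_diagram (juxtapose D E) \<in> matchings (n + n') (m + m')" by (rule rotate_in_matchings[OF J])
  show "juxtapose (rotate_diagram E) (rotate_diagram D) \<in> matchings (n + n') (m + m')"
    using juxtapose_in_matchings[OF RE RD] by (simp only: add.commute)
  fix x y
  have 1: "weight D (reversed (m + m') y) (reversed (n + n') x) =
      weight D (reversed m (suffix m' y)) (reversed n (suffix n' x))"
    by (rule weight_cong[OF D]) (simp_all add: reversed_suffix[symmetric] add.commute)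
  have 2: "weight E (suffix m (reversed (m + m') y)) (suffix n (reversed (n + n') x)) =
      weight E (reversed m' y) (reversed n' x)"
    by (rule weight_cong[OF E]) (auto simp: reversed_def suffix_def)
  show "weight (rotate_diagram (juxtapose D E)) x y = weight (juxtapose (rotate_diagram E) (rotate_diagram D)) x y"
    unfolding weight_rotate[OF J] weight_juxtapose[OF D E] weight_juxtapose[OF RE RD] weight_rotate[OF D]
      weight_rotate[OF E] 1 2 by (rule mult.commute)
qed

lemma flip_juxtapose:
  assumes D: "D \<in> matchings m n" and E: "E \<in> matchings m' n'"
  shows "flip_diagram (juxtapose D E) = juxtapose (flip_diagram D) (flip_diagram E)"
  by (rule diagram_eqI[OF flip_in_matchings[OF juxtapose_in_matchings[OF D E]]
        juxtapose_in_matchings[OF flip_in_matchings[OF D] flip_in_matchings[OF E]]])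
    (simp add: weight_flip[OF juxtapose_in_matchings[OF D E]] weight_flip[OF D] weight_flip[OF E]
      weight_juxtapose[OF D E] weight_juxtapose[OF flip_in_matchings[OF D] flip_in_matchings[OF E]])

lemma flip_id: "flip_diagram (id_diagram n) = id_diagram n"
  by (rule diagram_eqI[OF flip_in_matchings[OF id_in_matchings] id_in_matchings])
    (simp add: weight_flip[OF id_in_matchings] weight_id_sym)

lemma rotate_id: "rotate_diagram (id_diagram n) = id_diagram n"
proof (rule diagram_eqI[OF rotate_in_matchings[OF id_in_matchings] id_in_matchings])
  fix x y
  have "(\<forall>i<n. reversed n y i = reversed n x i) \<longleftrightarrow> (\<forall>i<n. y (n - 1 - i) = x (n - 1 - i))"
    by (auto simp: reversed_def)
  also have "\<dots> \<longleftrightarrow> (\<forall>i<n. y i = x i)" by (rule all_less_rev[symmetric])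
  finally show "weight (rotate_diagram (id_diagram n)) x y = weight (id_diagram n) x y"
    by (simp add: weight_rotate[OF id_in_matchings] weight_id eq_commute)
qed

lemma flip_flip:
  assumes D: "D \<in> matchings m n"
  shows "flip_diagram (flip_diagram D) = D"
  by (rule diagram_eqI[OF flip_in_matchings[OF flip_in_matchings[OF D]] D])
    (simp add: weight_flip[OF flip_in_matchings[OF D]] weight_flip[OF D])

lemma rotate_rotate:
  assumes D: "D \<in> matchings m n"
  shows "rotate_diagram (rotate_diagram D) = D"
proof (rule diagram_eqI[OF rotate_in_matchings[OF rotate_in_matchings[OF D]] D])
  have rr: "reversed k (reversed k x) i = x i" if "i < k" for k x i
  proof -
    have "k - 1 - i < k" "k - 1 - (k - 1 - i) = i" using that by auto
    then show ?thesis using that by (simp add: reversed_def del: diff_diff_left)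
  qed
  show "weight (rotate_diagram (rotate_diagram D)) x y = weight D x y" for x y
    unfolding weight_rotate[OF rotate_in_matchings[OF D]] weight_rotate[OF D]
    by (rule weight_cong[OF D]) (simp_all add: rr)
qed

lemma flip_cup: "flip_diagram (cup_diagram n) = cap_diagram n"
  using flip_flip[OF cap_in_matchings[of n]] by (simp add: flip_cap)

lemma rotate_cap: "rotate_diagram (cap_diagram n) = cup_diagram n"
proof (rule diagram_eqI[OF rotate_in_matchings[OF cap_in_matchings] cup_in_matchings])
  fix x y
  have "reversed (n + n) y i = y (n + n - 1 - i)" "reversed (n + n) y (n + n - 1 - i) = y i" if "i < n" for i
  proof -
    have "n + n - 1 - (n + n - 1 - i) = i" "n + n - 1 - i < n + n" using that by auto
    then show "reversed (n + n) y (n + n - 1 - i) = y i" by (simp add: reversed_def del: diff_diff_left)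
    show "reversed (n + n) y i = y (n + n - 1 - i)" using that by (simp add: reversed_def)
  qed
  then show "weight (rotate_diagram (cap_diagram n)) x y = weight (cup_diagram n) x y"
    by (auto simp: weight_rotate[OF cap_in_matchings] weight_cap weight_cup)
qed

lemma rotate_cup: "rotate_diagram (cup_diagram n) = cap_diagram n"
  using rotate_rotate[OF cap_in_matchings[of n]] by (simp add: rotate_cap)

section \<open>Duality: sliding through caps, snakes, nested arcs\<close>

lemma weight_id_reversed:
  assumes "y \<in> colourings n"
  shows "weight (id_diagram n) u (reversed n y) = of_bool (y = reversed n u)"
proof -
  have "(\<forall>i<n. u i = reversed n y i) \<longleftrightarrow> y = reversed n u"
  proof
    assume *: "\<forall>i<n. u i = reversed n y i"
    have "reversed n u = reversed n (reversed n y)"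
      using * by (auto simp: reversed_def fun_eq_iff)
    then show "y = reversed n u" using reversed_reversed[OF assms] by simp
  next
    assume y: "y = reversed n u"
    have "reversed n (reversed n u) i = u i" if "i < n" for i
    proof -
      have "n - 1 - i < n" "n - 1 - (n - 1 - i) = i" using that by auto
      then show ?thesis using that by (simp add: reversed_def del: diff_diff_left)
    qed
    then show "\<forall>i<n. u i = reversed n y i" by (simp add: y)
  qed
  then show ?thesis by (simp add: weight_id)
qed

text \<open>On both sides the cap feeds the reversed right half of the top colours into
  \<open>D\<close> as its bottom colours: the common entry is
  \<open>weight D x (reversed n (suffix m x))\<close>.\<close>

lemma cap_slide:
  assumes D: "D \<in> matchings m n"
  shows "stack (juxtapose D (id_diagram n)) (cap_diagram n) =
      stack (juxtapose (id_diagram m) (rotate_diagram D)) (cap_diagram m)"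
    and "stack_loops (juxtapose D (id_diagram n)) (cap_diagram n) =
      stack_loops (juxtapose (id_diagram m) (rotate_diagram D)) (cap_diagram m)"
proof -
  note DI = juxtapose_in_matchings[OF D id_in_matchings[of n]]
    and RD = rotate_in_matchings[OF D]
  note IR = juxtapose_in_matchings[OF id_in_matchings[of m] RD]
  have "(\<Sum>y\<in>colourings (n + n). weight (juxtapose D (id_diagram n)) x y * weight (cap_diagram n) y z) =
      weight D x (reversed n (suffix m x))" for x z
  proof -
    have "(\<Sum>y\<in>colourings (n + n). weight (juxtapose D (id_diagram n)) x y * weight (cap_diagram n) y z) =
        (\<Sum>y\<in>colourings n. weight D x y * weight (id_diagram n) (suffix m x) (reversed n y))"
      unfolding sum_weight_cap weight_juxtapose[OF D id_in_matchings] suffix_join weight_join_right[OF D] ..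
    also have "\<dots> = (\<Sum>y\<in>colourings n. of_bool (y = reversed n (suffix m x)) * weight D x y)"
      by (rule sum.cong) (simp_all add: weight_id_reversed)
    also have "\<dots> = weight D x (reversed n (suffix m x))"
      by (rule sum_colourings_delta) auto
    finally show ?thesis .
  qed
  moreover have "(\<Sum>y\<in>colourings (m + m). weight (juxtapose (id_diagram m) (rotate_diagram D)) x y *
      weight (cap_diagram m) y z) = weight D x (reversed n (suffix m x))" for x z
  proof -
    have "(\<Sum>y\<in>colourings (m + m). weight (juxtapose (id_diagram m) (rotate_diagram D)) x y *
      weight (cap_diagram m) y z) = (\<Sum>y\<in>colourings m. weight (id_diagram m) x y *
        weight D (reversed m (reversed m y)) (reversed n (suffix m x)))"
      unfolding sum_weight_cap weight_juxtapose[OF id_in_matchings RD] suffix_join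
        weight_join_right[OF id_in_matchings] weight_rotate[OF D] ..
    also have "\<dots> = (\<Sum>y\<in>colourings m. weight (id_diagram m) x y * weight D y (reversed n (suffix m x)))"
      by (rule sum.cong) (simp_all add: reversed_reversed)
    also have "\<dots> = weight D x (reversed n (suffix m x))"
      by (rule sum_weight_id) (rule weight_trunc[OF D])
    finally show ?thesis .
  qed
  ultimately have "2 ^ stack_loops (juxtapose D (id_diagram n)) (cap_diagram n) *
      weight (stack (juxtapose D (id_diagram n)) (cap_diagram n)) x z =
    2 ^ stack_loops (juxtapose (id_diagram m) (rotate_diagram D)) (cap_diagram m) *
      weight (stack (juxtapose (id_diagram m) (rotate_diagram D)) (cap_diagram m)) x z" for x z
    unfolding stack_weight[OF DI cap_in_matchings, symmetric] stack_weight[OF IR cap_in_matchings, symmetric]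
    by simp
  from weight_determines[OF stack_in_matchings[OF DI cap_in_matchings] stack_in_matchings[OF IR cap_in_matchings] this]
  show "stack (juxtapose D (id_diagram n)) (cap_diagram n) =
      stack (juxtapose (id_diagram m) (rotate_diagram D)) (cap_diagram m)"
    "stack_loops (juxtapose D (id_diagram n)) (cap_diagram n) =
      stack_loops (juxtapose (id_diagram m) (rotate_diagram D)) (cap_diagram m)" .
qed

text \<open>The snake identity. Contracting the right-hand strands and then the cup leaves one block
  \<open>w\<close> of colours; the cap, applied to the reversal of \<open>w\<close>, compares
  \<open>w\<close> with the incoming colours like an identity diagram.\<close>

lemma stack_zigzag:
  shows "stack (juxtapose (cup_diagram m) (id_diagram m)) (juxtapose (id_diagram m) (cap_diagram m)) = id_diagram m"
    and "stack_loops (juxtapose (cup_diagram m) (id_diagram m)) (juxtapose (id_diagram m) (cap_diagram m)) = 0"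
proof -
  note CI = juxtapose_in_matchings[OF cup_in_matchings[of m] id_in_matchings[of m]]
    and IC = juxtapose_in_matchings[OF id_in_matchings[of m] cap_in_matchings[of m]]
  have IC': "juxtapose (id_diagram m) (cap_diagram m) \<in> matchings (m + m + m) m"
    using IC by (simp add: add.assoc)
  have CI': "juxtapose (cup_diagram m) (id_diagram m) \<in> matchings m (m + m + m)"
    using CI by simp
  have "(\<Sum>y\<in>colourings (m + m + m). weight (juxtapose (cup_diagram m) (id_diagram m)) x y *
      weight (juxtapose (id_diagram m) (cap_diagram m)) y z) = 2 ^ 0 * weight (id_diagram m) x z" for x z
  proof -
    let ?g = "\<lambda>y. weight (juxtapose (id_diagram m) (cap_diagram m)) y z"
    have trunc: "?g (join (m + m) u v) = ?g (join (m + m) u (\<lambda>i. i < m \<and> v i))" for u v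
      by (rule weight_cong[OF IC']) (auto simp: join_def)
    have "(\<Sum>y\<in>colourings (m + m + m). weight (juxtapose (cup_diagram m) (id_diagram m)) x y * ?g y) =
      (\<Sum>u\<in>colourings (m + m). weight (cup_diagram m) x u *
        (\<Sum>v\<in>colourings m. weight (id_diagram m) x v * ?g (join (m + m) u v)))"
      unfolding sum_colourings_add[of _ "m + m" m] weight_juxtapose[OF cup_in_matchings id_in_matchings] suffix_join
        weight_join_right[OF cup_in_matchings] suffix_0 by (simp add: sum_distrib_left mult.assoc)
    also have "\<dots> = (\<Sum>u\<in>colourings (m + m). weight (cup_diagram m) x u * ?g (join (m + m) u x))"
      using sum_weight_id[where f = "\<lambda>v. ?g (join (m + m) u v)" for u, OF trunc] by simp
    also have "\<dots> = (\<Sum>w\<in>colourings m. ?g (join (m + m) (join m w (reversed m w)) x))"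
      by (rule sum_weight_cup)
    also have "\<dots> = (\<Sum>w\<in>colourings m. weight (id_diagram m) x w * weight (id_diagram m) w z)"
    proof (rule sum.cong[OF refl])
      fix w assume w: "w \<in> colourings m"
      have s: "suffix m (join (m + m) (join m w (reversed m w)) x) = join m (reversed m w) x"
        by (auto simp: suffix_def join_def fun_eq_iff)
      have "weight (cap_diagram m) (join m (reversed m w) x) (suffix m z) = weight (id_diagram m) x w"
      proof -
        \<comment> \<open>\<open>cap_join_iff\<close> speaks of colourings of exactly
          \<open>m\<close> points, hence the truncation.\<close>
        let ?x = "\<lambda>i. i < m \<and> x i"
        have "weight (cap_diagram m) (join m (reversed m w) x) (suffix m z) =
          weight (cap_diagram m) (join m (reversed m w) ?x) (suffix m z)"
          by (rule weight_cong[OF cap_in_matchings]) (auto simp: join_def)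
        also have "\<dots> = of_bool (?x = reversed m (reversed m w))"
          unfolding weight_cap by (subst cap_join_iff) (auto simp: colourings_def)
        also have "\<dots> = weight (id_diagram m) x w"
          unfolding reversed_reversed[OF w] weight_id using w
          by (intro arg_cong[where f = of_bool]) (auto simp: colourings_def fun_eq_iff not_le[symmetric])
        finally show ?thesis .
      qed
      moreover have "weight (id_diagram m) (join (m + m) (join m w (reversed m w)) x) z = weight (id_diagram m) w z"
        by (rule weight_cong[OF id_in_matchings]) (auto simp: join_def)
      ultimately show "?g (join (m + m) (join m w (reversed m w)) x) =
          weight (id_diagram m) x w * weight (id_diagram m) w z"
        unfolding weight_juxtapose[OF id_in_matchings cap_in_matchings] s by simp
    qed
    also have "\<dots> = weight (id_diagram m) x z"
      by (rule sum_weight_id) (rule weight_trunc[OF id_in_matchings])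
    finally show ?thesis by simp
  qed
  from stack_eqI[OF CI' IC' id_in_matchings this]
  show "stack (juxtapose (cup_diagram m) (id_diagram m)) (juxtapose (id_diagram m) (cap_diagram m)) = id_diagram m"
    "stack_loops (juxtapose (cup_diagram m) (id_diagram m)) (juxtapose (id_diagram m) (cap_diagram m)) = 0" .
qed

text \<open>The outer \<open>k\<close> arcs are glued from two bundles of straight strands, the
  inner \<open>l\<close> arcs are already there. This is what later merges two labelled nested arcs
  into one bundle.\<close>

lemma stack_nested_caps:
  defines "N \<equiv> \<lambda>k l. juxtapose (id_diagram k) (juxtapose (cap_diagram l) (id_diagram k))"
  shows "stack (N k l) (cap_diagram k) = cap_diagram (k + l)" and "stack_loops (N k l) (cap_diagram k) = 0"
proof -
  note CI = juxtapose_in_matchings[OF cap_in_matchings[of l] id_in_matchings[of k]]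
  have N: "N k l \<in> matchings ((k + l) + (k + l)) (k + k)"
    using juxtapose_in_matchings[OF id_in_matchings[of k] CI] by (simp add: N_def add_ac)
  have "(\<Sum>y\<in>colourings (k + k). weight (N k l) x y * weight (cap_diagram k) y z) =
      2 ^ 0 * weight (cap_diagram (k + l)) x z" for x z
  proof -
    let ?h = "\<lambda>w. weight (cap_diagram l) (suffix k x) (reversed k w) *
      weight (id_diagram k) (suffix (l + l) (suffix k x)) (reversed k w)"
    have "(\<Sum>y\<in>colourings (k + k). weight (N k l) x y * weight (cap_diagram k) y z) =
      (\<Sum>w\<in>colourings k. weight (id_diagram k) x w * ?h w)"
      unfolding sum_weight_cap N_def weight_juxtapose[OF id_in_matchings CI] suffix_join
        weight_juxtapose[OF cap_in_matchings id_in_matchings] weight_join_right[OF id_in_matchings] suffix_0 ..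
    also have "\<dots> = ?h x"
    proof (rule sum_weight_id)
      fix w
      have "reversed k w = reversed k (\<lambda>i. i < k \<and> w i)" by (auto simp: reversed_def fun_eq_iff)
      then show "?h w = ?h (\<lambda>i. i < k \<and> w i)" by simp
    qed
    also have "\<dots> = weight (cap_diagram (k + l)) x z"
    proof -
      have "(\<forall>i<k. x i = x ((k + l) + (k + l) - 1 - i)) \<longleftrightarrow> (\<forall>i<k. suffix (l + l) (suffix k x) i = reversed k x i)"
      proof -
        have "(\<forall>i<k. x i = x ((k + l) + (k + l) - 1 - i)) \<longleftrightarrow>
            (\<forall>i<k. x (k - 1 - i) = x ((k + l) + (k + l) - 1 - (k - 1 - i)))"
          by (rule all_less_rev)
        moreover have "(k + l) + (k + l) - 1 - (k - 1 - i) = k + ((l + l) + i)" if "i < k" for i using that by simp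
        moreover have "reversed k x i = x (k - 1 - i)" if "i < k" for i using that by (simp add: reversed_def)
        ultimately show ?thesis unfolding suffix_def by metis
      qed
      moreover have "(\<forall>i<l. x (k + i) = x ((k + l) + (k + l) - 1 - (k + i))) \<longleftrightarrow>
          (\<forall>i<l. suffix k x i = suffix k x (l + l - 1 - i))"
      proof -
        have "(k + l) + (k + l) - 1 - (k + i) = k + (l + l - 1 - i)" if "i < l" for i using that by simp
        then show ?thesis unfolding suffix_def by metis
      qed
      ultimately show ?thesis unfolding weight_cap weight_id all_less_add
        by (simp only: of_bool_conj mult.commute)
    qed
    finally show ?thesis by simp
  qed
  from stack_eqI[OF N cap_in_matchings cap_in_matchings this]
  show "stack (N k l) (cap_diagram k) = cap_diagram (k + l)" "stack_loops (N k l) (cap_diagram k) = 0" .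
qed

section \<open>The circle and turn-backs at an arc\<close>

lemma colourings_1: "colourings 1 = {\<lambda>_. False, \<lambda>i. i = 0}"
proof (intro equalityI subsetI)
  fix y assume y: "y \<in> colourings 1"
  then have "y i = (i = 0 \<and> y 0)" for i by (cases i) (auto simp: colourings_def)
  then show "y \<in> {\<lambda>_. False, \<lambda>i. i = 0}" by (cases "y 0") (auto simp: fun_eq_iff)
qed (auto simp: colourings_def)

lemma sum_colourings_1: "(\<Sum>y\<in>colourings 1. f y) = f (\<lambda>_. False) + f (\<lambda>i. i = 0)"
proof -
  have "(\<lambda>_::nat. False) \<noteq> (\<lambda>i. i = 0)" by (metis (full_types))
  then show ?thesis unfolding colourings_1 by simp
qed

lemma stack_circle: "stack (cup_diagram 1) (cap_diagram 1) = id_diagram 0" "stack_loops (cup_diagram 1) (cap_diagram 1) = 1"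
proof -
  have "(\<Sum>y\<in>colourings (1 + 1). weight (cup_diagram 1) x y * weight (cap_diagram 1) y z) = 2 ^ 1 * weight (id_diagram 0) x z" for x z
    unfolding sum_weight_cap sum_colourings_1 by (simp add: weight_cup weight_id join_def reversed_def)
  from stack_eqI[OF cup_in_matchings cap_in_matchings id_in_matchings this]
  show "stack (cup_diagram 1) (cap_diagram 1) = id_diagram 0" "stack_loops (cup_diagram 1) (cap_diagram 1) = 1" .
qed

text \<open>
  Inserting a cup and a cap at an arc joining two neighbouring endpoints only creates a loop.
\<close>

lemma stack_turnback:
  defines "C \<equiv> \<lambda>p q. juxtapose (juxtapose (id_diagram p) (cap_diagram 1)) (id_diagram q)"
    and "U \<equiv> \<lambda>p q. juxtapose (juxtapose (id_diagram p) (cup_diagram 1)) (id_diagram q)"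
  assumes D: "D \<in> matchings (p + (1 + 1) + q) n" and arc: "{(0, p), (0, p + 1)} \<in> arcs D"
  shows "stack (C p q) (stack (U p q) D) = D"
    and "stack_loops (C p q) (stack (U p q) D) + stack_loops (U p q) D = 1"
proof -
  let ?m = "p + (1 + 1)"
  note IC = juxtapose_in_matchings[OF id_in_matchings[of p] cap_in_matchings[of 1]]
    and IU = juxtapose_in_matchings[OF id_in_matchings[of p] cup_in_matchings[of 1]]
  have C: "C p q \<in> matchings (?m + q) (p + q)"
    using juxtapose_in_matchings[OF IC id_in_matchings[of q]] unfolding C_def by simp
  have U: "U p q \<in> matchings (p + q) (?m + q)"
    using juxtapose_in_matchings[OF IU id_in_matchings[of q]] unfolding U_def by simp
  have wC: "weight (C p q) x y = weight (id_diagram p) x y * of_bool (x p = x (p + 1)) *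
      weight (id_diagram q) (suffix ?m x) (suffix p y)" for x y
    unfolding C_def weight_juxtapose[OF IC id_in_matchings] weight_juxtapose[OF id_in_matchings cap_in_matchings]
    by (simp add: weight_cap suffix_def)
  \<comment> \<open>\<open>J x b\<close> inserts two equally coloured points at the positions
    \<open>p\<close> and \<open>p + 1\<close>: reversing a single colour changes nothing.\<close>
  define J where "J x b = join ?m (join p x (join 1 b (reversed 1 b))) (suffix p x)" for x b
  have UD: "2 ^ stack_loops (U p q) D * weight (stack (U p q) D) y z = (\<Sum>b\<in>colourings 1. weight D (J y b) z)" for y z
  proof -
    have "2 ^ stack_loops (U p q) D * weight (stack (U p q) D) y z =
        (\<Sum>w\<in>colourings (?m + q). weight (U p q) y w * weight D w z)"
      by (rule stack_weight[OF U D, symmetric])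
    also have "\<dots> = (\<Sum>u\<in>colourings ?m. \<Sum>c\<in>colourings q. weight (id_diagram q) (suffix p y) c *
        (weight (id_diagram p) y u * weight (cup_diagram 1) (suffix p y) (suffix p u) * weight D (join ?m u c) z))"
    proof -
      have "weight (U p q) y (join ?m u c) = weight (id_diagram p) y u * weight (cup_diagram 1) (suffix p y) (suffix p u) *
          weight (id_diagram q) (suffix p y) c" for u c
        using weight_juxtapose[OF IU id_in_matchings[of q], of y "join ?m u c"]
        unfolding U_def suffix_join weight_join_right[OF IU]
        by (simp only: weight_juxtapose[OF id_in_matchings cup_in_matchings] add_0_right)
      then show ?thesis unfolding sum_colourings_add[of _ ?m q] by (simp only: mult_ac)
    qed
    also have "\<dots> = (\<Sum>u\<in>colourings ?m. weight (id_diagram p) y u * weight (cup_diagram 1) (suffix p y) (suffix p u) *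
        weight D (join ?m u (suffix p y)) z)"
    proof (intro sum.cong refl sum_weight_id)
      fix u c
      have "weight D (join ?m u c) z = weight D (join ?m u (\<lambda>i. i < q \<and> c i)) z"
        by (rule weight_cong[OF D]) (auto simp: join_def)
      then show "weight (id_diagram p) y u * weight (cup_diagram 1) (suffix p y) (suffix p u) * weight D (join ?m u c) z =
        weight (id_diagram p) y u * weight (cup_diagram 1) (suffix p y) (suffix p u) *
          weight D (join ?m u (\<lambda>i. i < q \<and> c i)) z" by simp
    qed
    also have "\<dots> = (\<Sum>a\<in>colourings p. weight (id_diagram p) y a *
        (\<Sum>b\<in>colourings (1 + 1). weight (cup_diagram 1) (suffix p y) b * weight D (join ?m (join p a b) (suffix p y)) z))"
      unfolding sum_colourings_add[of _ p "1 + 1"] suffix_join weight_join_right[OF id_in_matchings] sum_distrib_left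
      by (simp only: mult.assoc)
    also have "\<dots> = (\<Sum>b\<in>colourings (1 + 1). weight (cup_diagram 1) (suffix p y) b * weight D (join ?m (join p y b) (suffix p y)) z)"
    proof (rule sum_weight_id)
      fix a
      have "weight D (join ?m (join p a b) (suffix p y)) z = weight D (join ?m (join p (\<lambda>i. i < p \<and> a i) b) (suffix p y)) z" for b
        by (rule weight_cong[OF D]) (auto simp: join_def)
      then show "(\<Sum>b\<in>colourings (1 + 1). weight (cup_diagram 1) (suffix p y) b * weight D (join ?m (join p a b) (suffix p y)) z) =
        (\<Sum>b\<in>colourings (1 + 1). weight (cup_diagram 1) (suffix p y) b *
          weight D (join ?m (join p (\<lambda>i. i < p \<and> a i) b) (suffix p y)) z)" by simp
    qed
    also have "\<dots> = (\<Sum>b\<in>colourings 1. weight D (J y b) z)"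
      unfolding sum_weight_cup J_def ..
    finally show ?thesis .
  qed
  have arcw: "x p = x (p + 1)" if "monochrome D x z" for x z
  proof -
    have "colour x z (0, p) = colour x z (0, p + 1)"
      using that arc unfolding monochrome_def by (metis insertI1 insertI2)
    then show ?thesis by (simp add: colour_def)
  qed
  \<comment> \<open>The arc at \<open>p\<close> and \<open>p + 1\<close> is disjoint from all
    others, so giving its two ends another common colour affects no other arc.\<close>
  have move: "weight D x' z = weight D x z"
    if "x p = x (p + 1)" "x' p = x' (p + 1)" "\<And>i. i < ?m + q \<Longrightarrow> i \<noteq> p \<Longrightarrow> i \<noteq> p + 1 \<Longrightarrow> x' i = x i" for x x' z
  proof -
    have "monochrome D x' z" if mono: "monochrome D x z" and eqs: "x p = x (p + 1)" "x' p = x' (p + 1)"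
      and off: "\<And>i. i < ?m + q \<Longrightarrow> i \<noteq> p \<Longrightarrow> i \<noteq> p + 1 \<Longrightarrow> x' i = x i" for x x'
      unfolding monochrome_def
    proof (intro ballI)
      fix a u v assume a: "a \<in> arcs D" "u \<in> a" "v \<in> a"
      show "colour x' z u = colour x' z v"
      proof (cases "a = {(0, p), (0, p + 1)}")
        case True
        then have "u = (0, p) \<or> u = (0, p + 1)" "v = (0, p) \<or> v = (0, p + 1)" using a by auto
        then show ?thesis using eqs(2) by (auto simp: colour_def)
      next
        case False
        then have disj: "a \<inter> {(0, p), (0, p + 1)} = {}"
          using disjointD[OF partition_onD2[OF matchingsD(3)[OF D]] a(1) arc] by simp
        have "colour x' z w = colour x z w" if w: "w \<in> a" for w
        proof -
          have "w \<in> row 0 (?m + q) \<union> row 1 n" using matchingsD(5)[OF D] a(1) w by blast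
          moreover have "w \<noteq> (0, p)" "w \<noteq> (0, p + 1)" using disj w by auto
          ultimately show ?thesis using off[of "snd w"] by (cases w) (auto simp: colour_def)
        qed
        then show ?thesis using mono a unfolding monochrome_def by metis
      qed
    qed
    then have "monochrome D x' z \<longleftrightarrow> monochrome D x z" using that by (metis (no_types, lifting))
    then show ?thesis by (simp add: weight_def)
  qed
  have "2 ^ (stack_loops (C p q) (stack (U p q) D) + stack_loops (U p q) D) * weight (stack (C p q) (stack (U p q) D)) x z =
      2 ^ 1 * weight D x z" for x z
  proof -
    have "2 ^ (stack_loops (C p q) (stack (U p q) D) + stack_loops (U p q) D) * weight (stack (C p q) (stack (U p q) D)) x z =
      (\<Sum>y\<in>colourings (p + q). weight (C p q) x y * (2 ^ stack_loops (U p q) D * weight (stack (U p q) D) y z))"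
    proof -
      have "2 ^ (stack_loops (C p q) (stack (U p q) D) + stack_loops (U p q) D) * weight (stack (C p q) (stack (U p q) D)) x z =
        2 ^ stack_loops (U p q) D * (\<Sum>y\<in>colourings (p + q). weight (C p q) x y * weight (stack (U p q) D) y z)"
        unfolding stack_weight[OF C stack_in_matchings[OF U D]] by (simp only: power_add mult_ac)
      then show ?thesis by (simp only: sum_distrib_left mult.left_commute)
    qed
    also have "\<dots> = (\<Sum>a\<in>colourings p. weight (id_diagram p) x a * (\<Sum>c\<in>colourings q. weight (id_diagram q) (suffix ?m x) c *
        (of_bool (x p = x (p + 1)) * (\<Sum>b\<in>colourings 1. weight D (J (join p a c) b) z))))"
      unfolding UD sum_colourings_add wC suffix_join weight_join_right[OF id_in_matchings] sum_distrib_left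
      by (simp only: mult_ac)
    also have "\<dots> = (\<Sum>a\<in>colourings p. weight (id_diagram p) x a *
        (of_bool (x p = x (p + 1)) * (\<Sum>b\<in>colourings 1. weight D (J (join p a (suffix ?m x)) b) z)))"
    proof -
      have "weight D (J (join p a c) b) z = weight D (J (join p a (\<lambda>i. i < q \<and> c i)) b) z" for a b c
        by (rule weight_cong[OF D]) (auto simp: join_def J_def suffix_def)
      then show ?thesis by (subst sum_weight_id) simp_all
    qed
    also have "\<dots> = of_bool (x p = x (p + 1)) * (\<Sum>b\<in>colourings 1. weight D (J (join p x (suffix ?m x)) b) z)"
    proof -
      have "weight D (J (join p a c) b) z = weight D (J (join p (\<lambda>i. i < p \<and> a i) c) b) z" for a b c
        by (rule weight_cong[OF D]) (auto simp: join_def J_def suffix_def)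
      then show ?thesis by (intro sum_weight_id) simp
    qed
    \<comment> \<open>The inserted pair is free to take either colour, whence the factor 2, i.e. one
      loop altogether. If the ends at \<open>p\<close> and \<open>p + 1\<close> differ in colour,
      both sides vanish.\<close>
    also have "\<dots> = 2 * weight D x z"
    proof (cases "x p = x (p + 1)")
      case True
      have "weight D (J (join p x (suffix ?m x)) b) z = weight D x z" for b
      proof (rule move[OF True])
        show "J (join p x (suffix ?m x)) b p = J (join p x (suffix ?m x)) b (p + 1)"
          by (simp add: join_def J_def reversed_def)
        fix i assume i: "i < ?m + q" "i \<noteq> p" "i \<noteq> p + 1"
        show "J (join p x (suffix ?m x)) b i = x i"
        proof (cases "i < p")
          case False
          then obtain k where "i = ?m + k" using i le_Suc_ex[of ?m i] by force
          then show ?thesis by (simp add: join_def J_def suffix_def)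
        qed (simp add: join_def J_def)
      qed
      then show ?thesis unfolding sum_colourings_1 using True by simp
    next
      case False
      then show ?thesis using arcw by (auto simp: weight_def)
    qed
    finally show ?thesis by simp
  qed
  from weight_determines[OF stack_in_matchings[OF C stack_in_matchings[OF U D]] D this]
  show "stack (C p q) (stack (U p q) D) = D" "stack_loops (C p q) (stack (U p q) D) + stack_loops (U p q) D = 1" .
qed

section \<open>Planarity\<close>

definition tops :: "point set \<Rightarrow> nat set" where "tops a = {i. (0, i) \<in> a}"
definition bots :: "point set \<Rightarrow> nat set" where "bots a = {i. (1, i) \<in> a}"

definition below :: "nat set \<Rightarrow> nat set \<Rightarrow> nat" where
  "below X Y = (\<Sum>i\<in>X. \<Sum>j\<in>Y. of_bool (i < j))"

definition cross :: "point set \<Rightarrow> point set \<Rightarrow> nat" where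
  "cross a b = (\<Sum>p\<in>a. \<Sum>q\<in>b. of_bool (boundary_pos p < boundary_pos q))"

text \<open>
  For disjoint pairs \<open>a\<close> and \<open>b\<close>, the parity of \<open>cross a b\<close> detects whether they interleave; in
  contrast to interleaving, it is additive in both arguments.
\<close>

definition planar :: "point set set \<Rightarrow> bool" where
  "planar M \<longleftrightarrow> (\<forall>a\<in>M. \<forall>b\<in>M. a \<noteq> b \<longrightarrow> even (cross a b))"

lemma inj_boundary_pos: "inj_on boundary_pos (row 0 m \<union> row 1 n)"
  by (auto simp: inj_on_def boundary_pos_def row_def split: if_splits)

lemma card_2_sorted:
  fixes f :: "'a \<Rightarrow> int"
  assumes "card a = 2" "inj_on f a"
  obtains p q where "a = {p, q}" "f p < f q"
proof -
  obtain p q where a: "a = {p, q}" "p \<noteq> q" using assms(1) by (auto simp: card_2_iff)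
  then have "f p \<noteq> f q" using assms(2) by (auto simp: inj_on_def)
  then consider "f p < f q" | "f q < f p" by linarith
  then show thesis using a that[of p q] that[of q p] by cases (auto simp: insert_commute)
qed

lemma cross_pairs:
  assumes "p \<noteq> q" "r \<noteq> s"
  shows "cross {p, q} {r, s} = of_bool (boundary_pos p < boundary_pos r) + of_bool (boundary_pos p < boundary_pos s)
    + of_bool (boundary_pos q < boundary_pos r) + of_bool (boundary_pos q < boundary_pos s)"
  using assms by (simp add: cross_def)

text \<open>Two pairs that do not interleave lie side by side or nested. The four cases yield 4, 0,
  2 and 2 true comparisons.\<close>

lemma even_comparisons:
  fixes p q r s :: int
  assumes "p < q" "r < s" "p \<noteq> r" "p \<noteq> s" "q \<noteq> r" "q \<noteq> s"
    "\<not> (p < r \<and> r < q \<and> q < s)" "\<not> (r < p \<and> p < s \<and> s < q)"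
  shows "even (of_bool (p < r) + of_bool (p < s) + of_bool (q < r) + of_bool (q < s) :: nat)"
proof -
  consider "q < r" | "s < p" | "p < r" "s < q" | "r < p" "q < s" using assms by linarith
  then show ?thesis
  proof cases
    case 1
    then have "p < r" "p < s" "q < s" using assms by linarith+
    then show ?thesis using 1 by simp
  next
    case 2
    then have "\<not> p < r" "\<not> p < s" "\<not> q < r" "\<not> q < s" using assms by linarith+
    then show ?thesis by simp
  next
    case 3
    then have "p < s" "\<not> q < r" "\<not> q < s" using assms by linarith+
    then show ?thesis using 3 by simp
  next
    case 4
    then have "p < s" "\<not> p < r" "\<not> q < r" using assms by linarith+
    then show ?thesis using 4 by simp
  qed
qed

lemma noncrossing_iff_planar:
  assumes part: "partition_on (row 0 m \<union> row 1 n) M" and two: "\<And>a. a \<in> M \<Longrightarrow> card a = 2"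
  shows "noncrossing M \<longleftrightarrow> planar M"
proof -
  have inj: "inj_on boundary_pos a" if "a \<in> M" for a
    using inj_on_subset[OF inj_boundary_pos] partition_onD1[OF part] that by blast
  have inj2: "boundary_pos p \<noteq> boundary_pos q" if "a \<in> M" "b \<in> M" "a \<noteq> b" "p \<in> a" "q \<in> b" for a b p q
  proof -
    have "p \<noteq> q" using disjointD[OF partition_onD2[OF part] that(1-3)] that(4,5) by blast
    moreover have "p \<in> row 0 m \<union> row 1 n" "q \<in> row 0 m \<union> row 1 n"
      using partition_onD1[OF part] that by blast+
    ultimately show ?thesis using inj_onD[OF inj_boundary_pos] by metis
  qed
  show ?thesis
  proof
    assume nc: "noncrossing M"
    have nc': "\<not> (boundary_pos p < boundary_pos r \<and> boundary_pos r < boundary_pos q \<and> boundary_pos q < boundary_pos s)"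
      if "a \<in> M" "b \<in> M" "p \<in> a" "q \<in> a" "r \<in> b" "s \<in> b" for a b p q r s
      using nc that unfolding noncrossing_def by blast
    show "planar M"
      unfolding planar_def
    proof (intro ballI impI)
      fix a b assume ab: "a \<in> M" "b \<in> M" "a \<noteq> b"
      obtain p q where a: "a = {p, q}" "boundary_pos p < boundary_pos q"
        using card_2_sorted[OF two[OF ab(1)] inj[OF ab(1)]] .
      obtain r s where b: "b = {r, s}" "boundary_pos r < boundary_pos s"
        using card_2_sorted[OF two[OF ab(2)] inj[OF ab(2)]] .
      have neq: "boundary_pos p \<noteq> boundary_pos r" "boundary_pos p \<noteq> boundary_pos s"
        "boundary_pos q \<noteq> boundary_pos r" "boundary_pos q \<noteq> boundary_pos s"
        by (rule inj2[OF ab]; simp add: a b)+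
      have 1: "\<not> (boundary_pos p < boundary_pos r \<and> boundary_pos r < boundary_pos q \<and> boundary_pos q < boundary_pos s)"
        by (rule nc'[OF ab(1,2)]) (simp_all add: a b)
      have 2: "\<not> (boundary_pos r < boundary_pos p \<and> boundary_pos p < boundary_pos s \<and> boundary_pos s < boundary_pos q)"
        by (rule nc'[OF ab(2,1)]) (simp_all add: a b)
      have "p \<noteq> q" "r \<noteq> s" using a(2) b(2) by auto
      then have c: "cross a b = of_bool (boundary_pos p < boundary_pos r) + of_bool (boundary_pos p < boundary_pos s)
          + of_bool (boundary_pos q < boundary_pos r) + of_bool (boundary_pos q < boundary_pos s)"
        unfolding a(1) b(1) by (rule cross_pairs)
      show "even (cross a b)"
        unfolding c using a(2) b(2) neq 1 2 by (rule even_comparisons)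
    qed
  next
    assume pl: "planar M"
    show "noncrossing M"
      unfolding noncrossing_def
    proof (intro notI, elim bexE conjE)
      fix a b p q r s
      assume ab: "a \<in> M" "b \<in> M" "p \<in> a" "q \<in> a" "r \<in> b" "s \<in> b"
        and lt: "boundary_pos p < boundary_pos r" "boundary_pos r < boundary_pos q" "boundary_pos q < boundary_pos s"
      have pq: "p \<noteq> q" and rs: "r \<noteq> s" using lt by auto
      have a: "a = {p, q}" using two[OF ab(1)] ab pq by (auto simp: card_2_iff)
      have b: "b = {r, s}" using two[OF ab(2)] ab rs by (auto simp: card_2_iff)
      have "r \<notin> a" using lt unfolding a by auto
      then have "a \<noteq> b" using b by auto
      then have "even (cross a b)" using pl ab unfolding planar_def by blast
      \<comment> \<open>For interleaved pairs exactly three of the four comparisons hold; the one of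
        \<open>q\<close> with \<open>r\<close> fails.\<close>
      then show False unfolding a b cross_pairs[OF pq rs] using lt by simp
    qed
  qed
qed

lemma diagrams_iff: "D \<in> diagrams m n \<longleftrightarrow> D \<in> matchings m n \<and> planar (arcs D)"
  unfolding diagrams_eq using noncrossing_iff_planar[OF matchingsD(3,4)] by auto

lemma diagrams_in_matchings: "D \<in> diagrams m n \<Longrightarrow> D \<in> matchings m n"
  by (simp add: diagrams_eq)

lemma planarD: "planar M \<Longrightarrow> a \<in> M \<Longrightarrow> b \<in> M \<Longrightarrow> a \<noteq> b \<Longrightarrow> even (cross a b)"
  by (auto simp: planar_def)

text \<open>All bottom points precede all top points in the boundary order, which yields the product
  of cardinalities, and the bottom row is run through from right to left, which exchanges the
  arguments of the last term.\<close>

lemma cross_rows: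
  assumes "finite a" "finite b" "a \<subseteq> row 0 m \<union> row 1 n" "b \<subseteq> row 0 m' \<union> row 1 n'"
  shows "cross a b = below (tops a) (tops b) + card (bots a) * card (tops b) + below (bots b) (bots a)"
proof -
  have split: "(\<Sum>p\<in>c. g p) = (\<Sum>i\<in>tops c. g (0, i)) + (\<Sum>i\<in>bots c. g (1, i))"
    if "finite c" "c \<subseteq> row 0 k \<union> row 1 l" for c k l and g :: "point \<Rightarrow> nat"
  proof -
    have c: "c = Pair 0 ` tops c \<union> Pair 1 ` bots c"
      using that(2) by (auto simp: tops_def bots_def row_def)
    have sub: "Pair 0 ` tops c \<subseteq> c" "Pair 1 ` bots c \<subseteq> c" by (auto simp: tops_def bots_def)
    note fin = finite_subset[OF sub(1) that(1)] finite_subset[OF sub(2) that(1)]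
    have "sum g (Pair 0 ` tops c \<union> Pair 1 ` bots c) = sum g (Pair 0 ` tops c) + sum g (Pair 1 ` bots c)"
      by (rule sum.union_disjoint[OF fin]) auto
    also have "\<dots> = (\<Sum>i\<in>tops c. g (0, i)) + (\<Sum>i\<in>bots c. g (1, i))"
      by (simp add: sum.reindex inj_on_def)
    finally show ?thesis using c by metis
  qed
  have "cross a b = (\<Sum>p\<in>a. (\<Sum>j\<in>tops b. of_bool (boundary_pos p < boundary_pos (0, j)))
      + (\<Sum>j\<in>bots b. of_bool (boundary_pos p < boundary_pos (1, j))))"
    unfolding cross_def by (rule sum.cong[OF refl split[OF assms(2,4)]])
  also have "\<dots> = below (tops a) (tops b) + (\<Sum>i\<in>bots a. (\<Sum>j\<in>tops b. 1) + (\<Sum>j\<in>bots b. of_bool (j < i)))"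
    unfolding split[OF assms(1,3)] below_def by (simp add: boundary_pos_def)
  also have "\<dots> = below (tops a) (tops b) + card (bots a) * card (tops b) + (\<Sum>i\<in>bots a. \<Sum>j\<in>bots b. of_bool (j < i))"
    by (simp add: sum.distrib)
  also have "(\<Sum>i\<in>bots a. \<Sum>j\<in>bots b. of_bool (j < i)) = below (bots b) (bots a)"
    unfolding below_def by (rule sum.swap)
  finally show ?thesis .
qed

lemma card_rows:
  assumes "finite a" "a \<subseteq> row 0 m \<union> row 1 n"
  shows "card a = card (tops a) + card (bots a)"
proof -
  have c: "a = Pair 0 ` tops a \<union> Pair 1 ` bots a"
    using assms(2) by (auto simp: tops_def bots_def row_def)
  have sub: "Pair 0 ` tops a \<subseteq> a" "Pair 1 ` bots a \<subseteq> a" by (auto simp: tops_def bots_def)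
  note fin = finite_subset[OF sub(1) assms(1)] finite_subset[OF sub(2) assms(1)]
  have "card (Pair 0 ` tops a \<union> Pair 1 ` bots a :: point set) = card (Pair (0::nat) ` tops a) + card (Pair (1::nat) ` bots a)"
    by (rule card_Un_disjoint[OF fin]) auto
  also have "\<dots> = card (tops a) + card (bots a)" by (simp add: card_image inj_on_def)
  finally show ?thesis unfolding c[symmetric] .
qed

lemma below_add_below:
  assumes "finite X" "finite Y" "X \<inter> Y = {}"
  shows "below X Y + below Y X = card X * card Y"
proof -
  have "below X Y + below Y X = (\<Sum>i\<in>X. \<Sum>j\<in>Y. of_bool (i < j) + of_bool (j < i))"
    unfolding below_def by (subst (2) sum.swap) (simp add: sum.distrib)
  also have "\<dots> = (\<Sum>i\<in>X. \<Sum>j\<in>Y. 1)"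
    by (intro sum.cong refl) (use assms(3) in \<open>auto simp: neq_iff\<close>)
  finally show ?thesis by simp
qed

text \<open>\<open>cross\<close> is additive in both arguments, and the two sets are disjoint unions
  of arcs. Each pair of arcs contributes an even number, so planarity extends from arcs to unions of
  arcs.\<close>

lemma cross_union:
  assumes part: "partition_on W M" and two: "\<And>a. a \<in> M \<Longrightarrow> card a = 2" and pl: "planar M"
    and A: "\<And>a. a \<in> M \<Longrightarrow> a \<inter> A \<noteq> {} \<Longrightarrow> a \<subseteq> A"
    and B: "\<And>a. a \<in> M \<Longrightarrow> a \<inter> B \<noteq> {} \<Longrightarrow> a \<subseteq> B"
    and AB: "A \<inter> B = {}"
  shows "even (cross (A \<inter> W) (B \<inter> W))"
proof -
  have A': "A \<inter> W = \<Union>{a \<in> M. a \<subseteq> A}" using A partition_onD1[OF part] by blast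
  have B': "B \<inter> W = \<Union>{a \<in> M. a \<subseteq> B}" using B partition_onD1[OF part] by blast
  have sum: "(\<Sum>p\<in>\<Union>{a \<in> M. a \<subseteq> C}. g p) = (\<Sum>a\<in>{a \<in> M. a \<subseteq> C}. \<Sum>p\<in>a. g p)" for C and g :: "point \<Rightarrow> nat"
  proof -
    have "\<forall>a\<in>{a \<in> M. a \<subseteq> C}. finite a" using two by (auto intro: card_ge_0_finite)
    moreover have "\<forall>a\<in>{a \<in> M. a \<subseteq> C}. \<forall>b\<in>{a \<in> M. a \<subseteq> C}. a \<noteq> b \<longrightarrow> a \<inter> b = {}"
      using disjointD[OF partition_onD2[OF part]] by simp
    ultimately show ?thesis using sum.Union_disjoint[of "{a \<in> M. a \<subseteq> C}" g] by simp
  qed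
  have "cross (A \<inter> W) (B \<inter> W) = (\<Sum>a\<in>{a \<in> M. a \<subseteq> A}. \<Sum>p\<in>a. \<Sum>b\<in>{a \<in> M. a \<subseteq> B}. \<Sum>q\<in>b.
      of_bool (boundary_pos p < boundary_pos q))"
    unfolding cross_def A' B' sum ..
  also have "\<dots> = (\<Sum>a\<in>{a \<in> M. a \<subseteq> A}. \<Sum>b\<in>{a \<in> M. a \<subseteq> B}. cross a b)"
    unfolding cross_def by (intro sum.cong refl sum.swap)
  finally have *: "cross (A \<inter> W) (B \<inter> W) = (\<Sum>a\<in>{a \<in> M. a \<subseteq> A}. \<Sum>b\<in>{a \<in> M. a \<subseteq> B}. cross a b)" .
  have "even (cross a b)" if "a \<in> {a \<in> M. a \<subseteq> A}" "b \<in> {a \<in> M. a \<subseteq> B}" for a b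
  proof (rule planarD[OF pl])
    have "a \<noteq> {}" using partition_onD3[OF part] that by auto
    then show "a \<noteq> b" using that AB by blast
  qed (use that in auto)
  then show ?thesis unfolding * by (intro dvd_sum) simp
qed

context stacking
begin

text \<open>Crossing numbers are computed for whole components: on the upper diagram, on the lower
  one and on the composite. The middle row enters the first two in opposite orders, so that its
  contributions combine to a product of cardinalities; evenness of the components in each diagram
  then decides the parity.\<close>

lemma planar_stack:
  assumes plD: "planar (arcs D)" and plE: "planar (arcs E)"
  shows "planar (arcs (stack D E))"
  unfolding planar_def
proof (intro ballI impI)
  fix a b assume ab: "a \<in> arcs (stack D E)" "b \<in> arcs (stack D E)" "a \<noteq> b"
  from ab obtain c d where c: "c \<in> outer" "a = halve ` (c - row 1 n)"
    and d: "d \<in> outer" "b = halve ` (d - row 1 n)" unfolding stack_eq diagram.sel by blast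
  \<comment> \<open>The positions of a component in each of the three rows; all three crossing
    numbers are expressed in them.\<close>
  define T where "T c r = {i. (r, i) \<in> c}" for c :: "point set" and r :: nat
  have cc: "c \<in> comps" and dd: "d \<in> comps" using c d unfolding outer_def by auto
  have "c \<noteq> d" using ab(3) c d by auto
  then have disj: "c \<inter> d = {}" using disjointD[OF partition_onD2[OF part] cc dd] by simp
  have arcD: "x \<subseteq> e" if "e \<in> comps" "x \<in> arcs D" "x \<inter> e \<noteq> {}" for x e
    using component_arc[OF S_sub that(1) _ that(3)] that(2) unfolding S_def by blast
  have arcE: "x \<subseteq> lower -` e" if "e \<in> comps" "x \<in> arcs E" "x \<inter> lower -` e \<noteq> {}" for x e
  proof -
    have "lower ` x \<subseteq> e"
      by (rule component_arc[OF S_sub that(1)]) (use that(2,3) in \<open>auto simp: S_def\<close>)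
    then show ?thesis by blast
  qed
  let ?cD = "c \<inter> (row 0 m \<union> row 1 n)" and ?dD = "d \<inter> (row 0 m \<union> row 1 n)"
    and ?cE = "lower -` c \<inter> (row 0 n \<union> row 1 p)" and ?dE = "lower -` d \<inter> (row 0 n \<union> row 1 p)"
  have evD: "even (cross ?cD ?dD)"
    by (rule cross_union[OF matchingsD(3,4)[OF D] plD]) (use arcD cc dd disj in auto)
  have evE: "even (cross ?cE ?dE)"
    by (rule cross_union[OF matchingsD(3,4)[OF E] plE]) (use arcE cc dd disj in auto)
  have tb: "tops (e \<inter> (row 0 m \<union> row 1 n)) = T e 0" "bots (e \<inter> (row 0 m \<union> row 1 n)) = T e 1"
    "tops (lower -` e \<inter> (row 0 n \<union> row 1 p)) = T e 1" "bots (lower -` e \<inter> (row 0 n \<union> row 1 p)) = T e 2"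
    "tops (halve ` (e - row 1 n)) = T e 0" "bots (halve ` (e - row 1 n)) = T e 2"
    "finite (T e r)" if e: "e \<in> comps" for e r
  proof -
    note sub = subsetD[OF comp_sub[OF e], unfolded V_def]
    show "tops (e \<inter> (row 0 m \<union> row 1 n)) = T e 0" "bots (e \<inter> (row 0 m \<union> row 1 n)) = T e 1"
      "tops (lower -` e \<inter> (row 0 n \<union> row 1 p)) = T e 1" "bots (lower -` e \<inter> (row 0 n \<union> row 1 p)) = T e 2"
      using sub[of "(_, _)"] by (auto simp: tops_def bots_def T_def lower_def numeral_2_eq_2)
    have val: "r = 0 \<or> r = 1 \<or> r = 2" if "(r, i) \<in> e" for r i using sub[OF that] by auto
    have "halve u = (0, i) \<longleftrightarrow> u = (0, i)" if "u \<in> e - row 1 n" for u i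
      using sub[of u] that by (cases u) (auto simp: halve_def)
    moreover have "(0, i) \<in> e \<Longrightarrow> (0, i) \<in> e - row 1 n" for i by simp
    ultimately show "tops (halve ` (e - row 1 n)) = T e 0"
      unfolding tops_def T_def image_iff by (metis (no_types, lifting) DiffD1)
    have "halve u = (1, i) \<longleftrightarrow> u = (2, i)" if "u \<in> e - row 1 n" for u i
      using sub[of u] that by (cases u) (auto simp: halve_def)
    moreover have "(2, i) \<in> e \<Longrightarrow> (2, i) \<in> e - row 1 n" for i by simp
    ultimately show "bots (halve ` (e - row 1 n)) = T e 2"
      unfolding bots_def T_def image_iff by (metis (no_types, lifting) DiffD1)
    have "T e r \<subseteq> {..<m + n + p}"
    proof
      fix i assume "i \<in> T e r"
      then have "(r, i) \<in> e" by (simp add: T_def)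
      from sub[OF this] show "i \<in> {..<m + n + p}" by auto
    qed
    then show "finite (T e r)" by (rule finite_subset) simp
  qed
  have fin: "finite c" "finite d" using comp_sub[OF cc] comp_sub[OF dd] finite_V finite_subset by auto
  have subS: "halve ` (e - row 1 n) \<subseteq> row 0 m \<union> row 1 p" if "e \<in> comps" for e
    using comp_sub[OF that] halve_rows by (metis Diff_mono image_mono order_refl)
  have xD: "cross ?cD ?dD = below (T c 0) (T d 0) + card (T c 1) * card (T d 0) + below (T d 1) (T c 1)"
    by (subst cross_rows) (use fin tb cc dd in auto)
  have xE: "cross ?cE ?dE = below (T c 1) (T d 1) + card (T c 2) * card (T d 1) + below (T d 2) (T c 2)"
    by (subst cross_rows) (use tb cc dd in \<open>auto intro: finite_subset[of _ "row 0 n \<union> row 1 p"]\<close>)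
  have xS: "cross a b = below (T c 0) (T d 0) + card (T c 2) * card (T d 0) + below (T d 2) (T c 2)"
    unfolding c d by (subst cross_rows[OF _ _ subS[OF cc] subS[OF dd]]) (use fin tb cc dd in auto)
  have "T c 1 \<inter> T d 1 = {}" using disj by (auto simp: T_def)
  then have 1: "below (T c 1) (T d 1) + below (T d 1) (T c 1) = card (T c 1) * card (T d 1)"
    by (rule below_add_below[OF tb(7)[OF cc] tb(7)[OF dd]])
  have evc: "even (card (T c 1) + card (T c 2))"
  proof -
    have "card ?cE = 2 * card {x \<in> arcs E. x \<subseteq> lower -` c}"
      by (rule card_union_arcs[OF matchingsD(3,4)[OF E]]) (use arcE cc in auto)
    moreover have "card ?cE = card (T c 1) + card (T c 2)"
      using card_rows[of ?cE n p] tb(3,4)[OF cc] by simp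
    ultimately have "card (T c 1) + card (T c 2) = 2 * card {x \<in> arcs E. x \<subseteq> lower -` c}" by simp
    then show ?thesis by (simp only: dvd_triv_left)
  qed
  have evd: "even (card (T d 0) + card (T d 1))"
  proof -
    have "card ?dD = 2 * card {x \<in> arcs D. x \<subseteq> d}" using comp_even(1)[OF dd] .
    moreover have "card ?dD = card (T d 0) + card (T d 1)"
      using card_rows[of ?dD m n] tb(1,2)[OF dd] by simp
    ultimately have "card (T d 0) + card (T d 1) = 2 * card {x \<in> arcs D. x \<subseteq> d}" by simp
    then show ?thesis by (simp only: dvd_triv_left)
  qed
  \<comment> \<open>The mixed products of the three crossing numbers complete one another to a
    product of two even numbers, up to twice a product.\<close>
  have "cross a b + (card (T c 1) + card (T c 2)) * (card (T d 0) + card (T d 1)) =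
      cross ?cD ?dD + cross ?cE ?dE + 2 * (card (T c 2) * card (T d 0))"
    unfolding xD xE xS using 1 by (simp add: algebra_simps)
  then have "even (cross a b + (card (T c 1) + card (T c 2)) * (card (T d 0) + card (T d 1)))"
    using evD evE by simp
  then show "even (cross a b)" using evc by simp
qed

end

lemma stack_in_diagrams:
  assumes "D \<in> diagrams m n" "E \<in> diagrams n p"
  shows "stack D E \<in> diagrams m p"
  using assms stacking.planar_stack[OF stacking.intro] stack_in_matchings unfolding diagrams_iff by blast

section \<open>Planarity of the elementary diagrams and under reflection, half turn and
  juxtaposition\<close>

lemma below_image_shift: "below ((+) k ` X) ((+) k ` Y) = below X Y"
  unfolding below_def by (simp add: sum.reindex)

lemma inj_reverse:
  fixes X :: "nat set"
  assumes "X \<subseteq> {..<k}"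
  shows "inj_on (\<lambda>i. k - 1 - i) X"
proof (rule inj_onI)
  fix i j assume "i \<in> X" "j \<in> X" "k - 1 - i = k - 1 - j"
  moreover from this assms have "i < k" "j < k" by auto
  ultimately show "i = j" by linarith
qed

lemma below_image_reverse:
  assumes "X \<subseteq> {..<k}" "Y \<subseteq> {..<k}"
  shows "below ((\<lambda>i. k - 1 - i) ` X) ((\<lambda>i. k - 1 - i) ` Y) = below Y X"
proof -
  note inj = inj_reverse[OF assms(1)] inj_reverse[OF assms(2)]
  have "below ((\<lambda>i. k - 1 - i) ` X) ((\<lambda>i. k - 1 - i) ` Y) = (\<Sum>i\<in>X. \<Sum>j\<in>Y. of_bool (j < i))"
    unfolding below_def sum.reindex[OF inj(1)] sum.reindex[OF inj(2)] o_def
    by (intro sum.cong refl arg_cong[where f = of_bool]) (use assms in \<open>auto simp: subset_iff\<close>)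
  then show ?thesis unfolding below_def by (subst sum.swap)
qed

lemma arc_facts:
  assumes "D \<in> matchings m n" "a \<in> arcs D"
  shows "finite a" "a \<subseteq> row 0 m \<union> row 1 n" "card (tops a) + card (bots a) = 2"
    "tops a \<subseteq> {..<m}" "bots a \<subseteq> {..<n}"
proof -
  have c: "card a = 2" by (rule matchingsD(4)[OF assms])
  then show f: "finite a" by (intro card_ge_0_finite) simp
  show s: "a \<subseteq> row 0 m \<union> row 1 n" using matchingsD(5)[OF assms(1)] assms(2) by blast
  show "card (tops a) + card (bots a) = 2" using card_rows[OF f s] c by simp
  show "tops a \<subseteq> {..<m}" "bots a \<subseteq> {..<n}" using s by (auto simp: tops_def bots_def)
qed

lemma arc_cross:
  assumes "D \<in> matchings m n" "a \<in> arcs D" "b \<in> arcs D"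
  shows "cross a b = below (tops a) (tops b) + card (bots a) * card (tops b) + below (bots b) (bots a)"
  using arc_facts[OF assms(1,2)] arc_facts[OF assms(1,3)] cross_rows by blast

text \<open>Reflection reverses the order of the endpoints along the boundary, so it merely
  exchanges the arguments of \<open>cross\<close>.\<close>

lemma flip_in_diagrams:
  assumes "D \<in> diagrams m n"
  shows "flip_diagram D \<in> diagrams n m"
proof -
  have D: "D \<in> matchings m n" and pl: "planar (arcs D)" using assms by (auto simp: diagrams_iff)
  note FD = flip_in_matchings[OF D]
  let ?f = "\<lambda>(r, i). (1 - r, i) :: point"
  have tb: "tops (?f ` a) = bots a" "bots (?f ` a) = tops a" if "a \<in> arcs D" for a
    using arc_facts(2)[OF D that] by (force simp: tops_def bots_def row_def image_iff)+
  have "planar (arcs (flip_diagram D))"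
    unfolding planar_def
  proof (intro ballI impI)
    fix a' b' assume *: "a' \<in> arcs (flip_diagram D)" "b' \<in> arcs (flip_diagram D)" "a' \<noteq> b'"
    then obtain a b where a: "a \<in> arcs D" "a' = ?f ` a" and b: "b \<in> arcs D" "b' = ?f ` b"
      unfolding flip_diagram_def diagram.sel by blast
    then have "even (cross b a)" using planarD[OF pl] *(3) by blast
    moreover have "cross a' b' = cross b a"
      unfolding arc_cross[OF FD *(1,2)] arc_cross[OF D b(1) a(1)] using tb a b by simp
    ultimately show "even (cross a' b')" by simp
  qed
  then show ?thesis using FD by (simp add: diagrams_iff)
qed

lemma rotate_in_diagrams:
  assumes "D \<in> diagrams m n"
  shows "rotate_diagram D \<in> diagrams n m"
proof -
  have D: "D \<in> matchings m n" and pl: "planar (arcs D)" using assms by (auto simp: diagrams_iff)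
  note RD = rotate_in_matchings[OF D]
  let ?f = "\<lambda>(r, i). (1 - r, (if r = 0 then m else n) - 1 - i) :: point"
  have arcs: "arcs (rotate_diagram D) = (`) ?f ` arcs D"
    unfolding rotate_diagram_def diagram.sel matchingsD(1,2)[OF D] ..
  have tb: "tops (?f ` a) = (\<lambda>i. n - 1 - i) ` bots a" "bots (?f ` a) = (\<lambda>i. m - 1 - i) ` tops a"
    if a: "a \<in> arcs D" for a
  proof -
    have r: "fst u = 0 \<or> fst u = 1" if "u \<in> a" for u
      using arc_facts(2)[OF D a] that by (auto simp: row_def)
    show "tops (?f ` a) = (\<lambda>i. n - 1 - i) ` bots a"
    proof (intro equalityI subsetI)
      fix i assume "i \<in> tops (?f ` a)"
      then obtain u where u: "u \<in> a" "?f u = (0, i)" unfolding tops_def by fastforce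
      then have "u = (1, snd u)" "i = n - 1 - snd u" using r[OF u(1)] by (cases u; auto)+
      then show "i \<in> (\<lambda>i. n - 1 - i) ` bots a" using u(1) unfolding bots_def by force
    next
      fix i assume "i \<in> (\<lambda>i. n - 1 - i) ` bots a"
      then obtain j where "(1, j) \<in> a" "i = n - 1 - j" unfolding bots_def by blast
      then show "i \<in> tops (?f ` a)" unfolding tops_def by (force intro: image_eqI[of _ _ "(1, j)"])
    qed
    show "bots (?f ` a) = (\<lambda>i. m - 1 - i) ` tops a"
    proof (intro equalityI subsetI)
      fix i assume "i \<in> bots (?f ` a)"
      then obtain u where u: "u \<in> a" "?f u = (1, i)" unfolding bots_def by fastforce
      then have "u = (0, snd u)" "i = m - 1 - snd u" using r[OF u(1)] by (cases u; auto)+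
      then show "i \<in> (\<lambda>i. m - 1 - i) ` tops a" using u(1) unfolding tops_def by force
    next
      fix i assume "i \<in> (\<lambda>i. m - 1 - i) ` tops a"
      then obtain j where "(0, j) \<in> a" "i = m - 1 - j" unfolding tops_def by blast
      then show "i \<in> bots (?f ` a)" unfolding bots_def by (force intro: image_eqI[of _ _ "(0, j)"])
    qed
  qed
  have "planar (arcs (rotate_diagram D))"
    unfolding planar_def
  proof (intro ballI impI)
    fix a' b' assume *: "a' \<in> arcs (rotate_diagram D)" "b' \<in> arcs (rotate_diagram D)" "a' \<noteq> b'"
    then obtain a b where a: "a \<in> arcs D" "a' = ?f ` a" and b: "b \<in> arcs D" "b' = ?f ` b"
      unfolding arcs by blast
    note fa = arc_facts[OF D a(1)] and fb = arc_facts[OF D b(1)]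
    have "even (cross a b)" using planarD[OF pl a(1) b(1)] a b *(3) by blast
    moreover have "cross a' b' = below (bots b) (bots a) + card (tops a) * card (bots b) + below (tops a) (tops b)"
    proof -
      have "card ((\<lambda>i. m - 1 - i) ` tops a) = card (tops a)" "card ((\<lambda>i. n - 1 - i) ` bots b) = card (bots b)"
        using card_image[OF inj_reverse[OF fa(4)]] card_image[OF inj_reverse[OF fb(5)]] .
      then show ?thesis
        unfolding arc_cross[OF RD *(1,2)] unfolding a(2) b(2) tb[OF a(1)] tb[OF b(1)]
        using below_image_reverse[OF fa(5) fb(5)] below_image_reverse[OF fb(4) fa(4)] by simp
    qed
    \<comment> \<open>The half turn replaces one mixed product by the other. They have the same
      parity, since each arc has as many top ends as bottom ends modulo 2.\<close>
    moreover have "even (card (tops a) * card (bots b) + card (bots a) * card (tops b))"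
    proof -
      have "even x \<longleftrightarrow> even y" if "x + y = 2" for x y :: nat using that by presburger
      from this[OF fa(3)] this[OF fb(3)] show ?thesis by auto
    qed
    ultimately show "even (cross a' b')"
      unfolding arc_cross[OF D a(1) b(1)] by presburger
  qed
  then show ?thesis using RD by (simp add: diagrams_iff)
qed

lemma id_in_diagrams: "id_diagram n \<in> diagrams n n"
proof -
  have "planar (arcs (id_diagram n))"
    unfolding planar_def
  proof (intro ballI impI)
    fix a b assume "a \<in> arcs (id_diagram n)" "b \<in> arcs (id_diagram n)" "a \<noteq> b"
    then obtain i j where ij: "a = {(0, i), (1, i)}" "b = {(0, j), (1, j)}" "i \<noteq> j"
      unfolding id_diagram_def diagram.sel by blast
    show "even (cross a b)" unfolding ij(1,2)
      by (subst cross_pairs) (use ij(3) in \<open>auto simp: boundary_pos_def\<close>)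
  qed
  then show ?thesis using id_in_matchings by (simp add: diagrams_iff)
qed

lemma cap_in_diagrams: "cap_diagram n \<in> diagrams (n + n) 0"
proof -
  have "planar (arcs (cap_diagram n))"
    unfolding planar_def
  proof (intro ballI impI)
    fix a b assume ab: "a \<in> arcs (cap_diagram n)" "b \<in> arcs (cap_diagram n)" "a \<noteq> b"
    then obtain i j where ij: "a = {(0, i), (0, n + n - 1 - i)}" "b = {(0, j), (0, n + n - 1 - j)}"
      "i \<noteq> j" "i < n" "j < n"
      unfolding cap_diagram_def diagram.sel by blast
    have "(0::nat, i) \<noteq> (0, n + n - 1 - i)" "(0::nat, j) \<noteq> (0, n + n - 1 - j)" using ij by auto
    note c = cross_pairs[OF this]
    have "i < n + n - 1 - j" "\<not> n + n - 1 - i < j" using ij by linarith+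
    moreover have "n + n - 1 - i < n + n - 1 - j \<longleftrightarrow> j < i" using ij by linarith
    moreover have "boundary_pos (0, x) < boundary_pos (0, y) \<longleftrightarrow> x < y" for x y
      by (simp add: boundary_pos_def)
    ultimately show "even (cross a b)" unfolding ij(1,2) c using ij(3)
      by (cases "i < j") (simp_all del: diff_diff_left)
  qed
  then show ?thesis using cap_in_matchings by (simp add: diagrams_iff)
qed

lemma cup_in_diagrams: "cup_diagram n \<in> diagrams 0 (n + n)"
  using flip_in_diagrams[OF cap_in_diagrams] by (simp add: flip_cap)

text \<open>For arcs from different factors, every end of the left arc lies to the left of every end
  of the right arc in the same row. The crossing number then contains the number of ends of the left
  arc, which is 2, as a factor.\<close>

lemma juxtapose_in_diagrams:
  assumes "D \<in> diagrams m n" "E \<in> diagrams m' n'"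
  shows "juxtapose D E \<in> diagrams (m + m') (n + n')"
proof -
  have D: "D \<in> matchings m n" and plD: "planar (arcs D)"
    and E: "E \<in> matchings m' n'" and plE: "planar (arcs E)" using assms by (auto simp: diagrams_iff)
  note J = juxtapose_in_matchings[OF D E]
  let ?f = "\<lambda>(r, i). (r, (if r = 0 then m else n) + i) :: point"
  have arcs: "arcs (juxtapose D E) = arcs D \<union> (`) ?f ` arcs E"
    unfolding juxtapose_def diagram.sel matchingsD(1,2)[OF D] ..
  have tb: "tops (?f ` a) = (+) m ` tops a" "bots (?f ` a) = (+) n ` bots a" for a
    by (force simp: tops_def bots_def image_iff)+
  have zero: "below X Y = 0" if "\<And>i j. i \<in> X \<Longrightarrow> j \<in> Y \<Longrightarrow> j \<le> i" for X Y
    unfolding below_def using that by (intro sum.neutral ballI) (auto simp: not_less)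
  have all: "below X Y = card X * card Y" if "\<And>i j. i \<in> X \<Longrightarrow> j \<in> Y \<Longrightarrow> i < j" for X Y
  proof -
    have "below X Y = (\<Sum>i\<in>X. \<Sum>j\<in>Y. 1)" unfolding below_def using that by (intro sum.cong refl) simp
    then show ?thesis by simp
  qed
  have "planar (arcs (juxtapose D E))"
    unfolding planar_def
  proof (intro ballI impI)
    fix a b assume ab: "a \<in> arcs (juxtapose D E)" "b \<in> arcs (juxtapose D E)" "a \<noteq> b"
    note x = arc_cross[OF J ab(1,2)]
    consider (DD) "a \<in> arcs D" "b \<in> arcs D"
      | (EE) a' b' where "a' \<in> arcs E" "b' \<in> arcs E" "a = ?f ` a'" "b = ?f ` b'"
      | (DE) b' where "a \<in> arcs D" "b' \<in> arcs E" "b = ?f ` b'"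
      | (ED) a' where "a' \<in> arcs E" "b \<in> arcs D" "a = ?f ` a'"
      using ab(1,2) unfolding arcs by blast
    then show "even (cross a b)"
    proof cases
      case DD
      then show ?thesis using planarD[OF plD] ab(3) by blast
    next
      case EE
      have "a' \<noteq> b'" using ab(3) EE by blast
      then have "even (cross a' b')" using planarD[OF plE] EE by blast
      then show ?thesis
        unfolding x unfolding EE(3,4) tb arc_cross[OF E EE(1,2)] by (simp add: below_image_shift card_image)
    next
      case DE
      note fa = arc_facts[OF D DE(1)]
      have "below (tops a) (tops b) = card (tops a) * card (tops b)"
        by (rule all) (use fa(4) in \<open>auto simp: DE(3) tb\<close>)
      moreover have "below (bots b) (bots a) = 0"
        by (rule zero) (use fa(5) in \<open>force simp: DE(3) tb\<close>)
      ultimately have "cross a b = (card (tops a) + card (bots a)) * card (tops b)"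
        unfolding x by (simp add: algebra_simps)
      then show ?thesis using fa(3) by simp
    next
      case ED
      note fb = arc_facts[OF D ED(2)]
      have "below (tops a) (tops b) = 0"
        by (rule zero) (use fb(4) in \<open>force simp: ED(3) tb\<close>)
      moreover have "below (bots b) (bots a) = card (bots b) * card (bots a)"
        by (rule all) (use fb(5) in \<open>auto simp: ED(3) tb\<close>)
      ultimately have "cross a b = card (bots a) * (card (tops b) + card (bots b))"
        unfolding x by (simp add: algebra_simps)
      then show ?thesis using fb(3) by simp
    qed
  qed
  then show ?thesis using J by (simp add: diagrams_iff)
qed

section \<open>Laws of the Temperley--Lieb category\<close>

text \<open>The span of the planar diagrams of all sizes at once. Laws such as associativity hold
  here without any bookkeeping of sources and targets; where the shape matters,
  \<open>tl_hom\<close> is used instead.\<close>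

definition tl :: "tl_mor set" where
  "tl = {x. Poly_Mapping.keys x \<subseteq> {D. D \<in> diagrams (src D) (tgt D)}}"

abbreviation basis :: "diagram \<Rightarrow> tl_mor" where
  "basis D \<equiv> Poly_Mapping.single D 1"

lemma diagramsD: "D \<in> diagrams m n \<Longrightarrow> src D = m \<and> tgt D = n"
  by (auto simp: diagrams_def)

lemma tlD: "x \<in> tl \<Longrightarrow> Poly_Mapping.keys x \<subseteq> {D. D \<in> diagrams (src D) (tgt D)}"
  by (simp add: tl_def)

lemma homD: "x \<in> tl_hom m n \<Longrightarrow> Poly_Mapping.keys x \<subseteq> diagrams m n"
  by (simp add: tl_hom_def)

lemma hom_tl: "x \<in> tl_hom m n \<Longrightarrow> x \<in> tl"
  unfolding tl_def tl_hom_def using diagramsD by fastforce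

lemma basis_hom: "D \<in> diagrams m n \<Longrightarrow> basis D \<in> tl_hom m n"
  by (simp add: tl_hom_def)

lemma lin_comp_left: "lin F \<Longrightarrow> lin (\<lambda>x. F x \<circ>\<^bsub>A\<^esub> g)"
  and lin_comp_right: "lin F \<Longrightarrow> lin (\<lambda>x. g \<circ>\<^bsub>A\<^esub> F x)"
  unfolding tl_comp_def by (rule lin_bilin_left, assumption) (rule lin_bilin_right)

lemma lin_tensor_left: "lin F \<Longrightarrow> lin (\<lambda>x. F x \<otimes> g)"
  and lin_tensor_right: "lin F \<Longrightarrow> lin (\<lambda>x. g \<otimes> F x)"
  unfolding tl_tensor_def by (rule lin_bilin_left, assumption) (rule lin_bilin_right)

lemmas lin_intros = lin_id lin_comp_left lin_comp_right lin_tensor_left lin_tensor_right lin_extend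

lemma comp_basis:
  "basis E \<circ>\<^bsub>A\<^esub> basis D = (if tgt D = src E then scale (loop_value A ^ stack_loops D E) (basis (stack D E)) else 0)"
  unfolding tl_comp_def bilin_single diagram_comp_def by (auto simp: scale_single[of _ "loop_value A ^ _"])

lemma tensor_basis: "basis D \<otimes> basis E = basis (juxtapose D E)"
  by (simp add: tl_tensor_def)

lemma comp_add_left: "(f + f') \<circ>\<^bsub>A\<^esub> g = f \<circ>\<^bsub>A\<^esub> g + f' \<circ>\<^bsub>A\<^esub> g"
  and comp_scale_left: "scale c f \<circ>\<^bsub>A\<^esub> g = scale c (f \<circ>\<^bsub>A\<^esub> g)"
  and comp_zero_left: "0 \<circ>\<^bsub>A\<^esub> g = 0"
  using lin_comp_left[OF lin_id, of A g] lin_zero[OF lin_comp_left[OF lin_id, of A g]] by (simp_all add: lin_def)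

lemma comp_add_right: "g \<circ>\<^bsub>A\<^esub> (f + f') = g \<circ>\<^bsub>A\<^esub> f + g \<circ>\<^bsub>A\<^esub> f'"
  and comp_scale_right: "g \<circ>\<^bsub>A\<^esub> scale c f = scale c (g \<circ>\<^bsub>A\<^esub> f)"
  and comp_zero_right: "g \<circ>\<^bsub>A\<^esub> 0 = 0"
  using lin_comp_right[OF lin_id, of g A] lin_zero[OF lin_comp_right[OF lin_id, of g A]] by (simp_all add: lin_def)

lemma tensor_add_left: "(f + f') \<otimes> g = f \<otimes> g + f' \<otimes> g"
  and tensor_scale_left: "scale c f \<otimes> g = scale c (f \<otimes> g)"
  and tensor_zero_left: "0 \<otimes> g = 0"
  using lin_tensor_left[OF lin_id, of g] lin_zero[OF lin_tensor_left[OF lin_id, of g]] by (simp_all add: lin_def)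

lemma tensor_add_right: "g \<otimes> (f + f') = g \<otimes> f + g \<otimes> f'"
  and tensor_scale_right: "g \<otimes> scale c f = scale c (g \<otimes> f)"
  and tensor_zero_right: "g \<otimes> 0 = 0"
  using lin_tensor_right[OF lin_id, of g] lin_zero[OF lin_tensor_right[OF lin_id, of g]] by (simp_all add: lin_def)

lemmas tl_linear = comp_add_left comp_scale_left comp_zero_left comp_add_right comp_scale_right comp_zero_right
  tensor_add_left tensor_scale_left tensor_zero_left tensor_add_right tensor_scale_right tensor_zero_right

subsection \<open>Typing\<close>

lemma hom_zero: "0 \<in> tl_hom m n"
  by (simp add: tl_hom_def)

lemma hom_add: "f \<in> tl_hom m n \<Longrightarrow> g \<in> tl_hom m n \<Longrightarrow> f + g \<in> tl_hom m n"
  by (simp add: tl_hom_def keys_add_subset)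

lemma hom_scale: "f \<in> tl_hom m n \<Longrightarrow> scale c f \<in> tl_hom m n"
  unfolding tl_hom_def using keys_scale by fastforce

lemma hom_comp: "f \<in> tl_hom m n \<Longrightarrow> g \<in> tl_hom n p \<Longrightarrow> g \<circ>\<^bsub>A\<^esub> f \<in> tl_hom m p"
  unfolding tl_hom_def tl_comp_def mem_Collect_eq
  by (rule keys_bilin) (auto simp: diagram_comp_def dest!: subsetD intro!: stack_in_diagrams split: if_splits)

lemma hom_tensor': "f \<in> tl_hom m n \<Longrightarrow> g \<in> tl_hom m' n' \<Longrightarrow> f \<otimes> g \<in> tl_hom (m + m') (n + n')"
  unfolding tl_hom_def tl_tensor_def mem_Collect_eq
  by (rule keys_bilin) (auto dest!: subsetD intro!: juxtapose_in_diagrams split: if_splits)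

lemma hom_tensor:
  assumes "f \<in> tl_hom m n" "g \<in> tl_hom m' n'" "m + m' = k" "n + n' = l"
  shows "f \<otimes> g \<in> tl_hom k l"
  using hom_tensor'[OF assms(1,2)] assms(3,4) by simp

lemma hom_id: "tl_id n \<in> tl_hom n n"
  unfolding tl_id_def by (rule basis_hom[OF id_in_diagrams])

lemma hom_cap: "n + n = k \<Longrightarrow> tl_cap n \<in> tl_hom k 0"
  unfolding tl_cap_def using basis_hom[OF cap_in_diagrams[of n]] by simp

lemma hom_cup: "n + n = k \<Longrightarrow> tl_cup n \<in> tl_hom 0 k"
  unfolding tl_cup_def using basis_hom[OF cup_in_diagrams[of n]] by simp

lemma tl_comp_closed [simp]: "f \<in> tl \<Longrightarrow> g \<in> tl \<Longrightarrow> g \<circ>\<^bsub>A\<^esub> f \<in> tl"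
  unfolding tl_def tl_comp_def mem_Collect_eq
proof (rule keys_bilin)
  fix D E assume *: "Poly_Mapping.keys f \<subseteq> {D. D \<in> diagrams (src D) (tgt D)}"
    "Poly_Mapping.keys g \<subseteq> {D. D \<in> diagrams (src D) (tgt D)}" "E \<in> Poly_Mapping.keys g" "D \<in> Poly_Mapping.keys f"
  then have DE: "D \<in> diagrams (src D) (tgt D)" "E \<in> diagrams (src E) (tgt E)" by auto
  have "stack D E \<in> diagrams (src (stack D E)) (tgt (stack D E))" if "tgt D = src E"
    using stack_in_diagrams[of D "src D" "tgt D" E "tgt E"] DE that by (simp add: stack_def)
  then show "Poly_Mapping.keys (diagram_comp A E D) \<subseteq> {D. D \<in> diagrams (src D) (tgt D)}"
    by (auto simp: diagram_comp_def split: if_splits)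
qed

lemma tl_tensor_closed [simp]: "f \<in> tl \<Longrightarrow> g \<in> tl \<Longrightarrow> f \<otimes> g \<in> tl"
  unfolding tl_def tl_tensor_def mem_Collect_eq
proof (rule keys_bilin)
  fix D E assume *: "Poly_Mapping.keys f \<subseteq> {D. D \<in> diagrams (src D) (tgt D)}"
    "Poly_Mapping.keys g \<subseteq> {D. D \<in> diagrams (src D) (tgt D)}" "D \<in> Poly_Mapping.keys f" "E \<in> Poly_Mapping.keys g"
  then have "juxtapose D E \<in> diagrams (src D + src E) (tgt D + tgt E)"
    by (intro juxtapose_in_diagrams) auto
  then show "Poly_Mapping.keys (basis (juxtapose D E)) \<subseteq> {D. D \<in> diagrams (src D) (tgt D)}"
    by (simp add: juxtapose_def)
qed

lemma tl_id_tl [simp]: "tl_id n \<in> tl" and tl_cap_tl [simp]: "tl_cap n \<in> tl" and tl_cup_tl [simp]: "tl_cup n \<in> tl"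
  using hom_tl hom_id hom_cap hom_cup by blast+

subsection \<open>Composition and tensor product\<close>

text \<open>For composable diagrams the loop exponents agree by \<open>stack_assoc\<close>.
  Otherwise both sides vanish, because a composite keeps its outer source and target.\<close>

lemma comp_assoc_basis:
  assumes "D \<in> diagrams (src D) (tgt D)" "E \<in> diagrams (src E) (tgt E)" "F \<in> diagrams (src F) (tgt F)"
  shows "basis F \<circ>\<^bsub>A\<^esub> (basis E \<circ>\<^bsub>A\<^esub> basis D) = (basis F \<circ>\<^bsub>A\<^esub> basis E) \<circ>\<^bsub>A\<^esub> basis D"
proof (cases "tgt D = src E \<and> tgt E = src F")
  case True
  have m: "D \<in> matchings (src D) (src E)" "E \<in> matchings (src E) (src F)" "F \<in> matchings (src F) (tgt F)"
    using assms True by (auto simp: diagrams_iff)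
  have st: "tgt (stack D E) = src F" "src (stack E F) = src E" using True by (simp_all add: stack_def)
  have "loop_value A ^ stack_loops D E * loop_value A ^ stack_loops (stack D E) F =
      loop_value A ^ stack_loops E F * loop_value A ^ stack_loops D (stack E F)"
    using stack_assoc(2)[OF m] by (metis power_add)
  then show ?thesis
    using True st by (simp add: comp_basis tl_linear stack_assoc(1)[OF m])
next
  case False
  then show ?thesis by (auto simp: comp_basis tl_linear stack_def)
qed

lemma tl_comp_assoc:
  assumes "f \<in> tl" "g \<in> tl" "h \<in> tl"
  shows "h \<circ>\<^bsub>A\<^esub> (g \<circ>\<^bsub>A\<^esub> f) = (h \<circ>\<^bsub>A\<^esub> g) \<circ>\<^bsub>A\<^esub> f"
proof (rule lin_eqI[where F = "\<lambda>f. h \<circ>\<^bsub>A\<^esub> (g \<circ>\<^bsub>A\<^esub> f)", OF _ _ tlD[OF assms(1)]])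
  fix D assume D: "D \<in> {D. D \<in> diagrams (src D) (tgt D)}"
  show "h \<circ>\<^bsub>A\<^esub> (g \<circ>\<^bsub>A\<^esub> basis D) = (h \<circ>\<^bsub>A\<^esub> g) \<circ>\<^bsub>A\<^esub> basis D"
  proof (rule lin_eqI[where F = "\<lambda>g. h \<circ>\<^bsub>A\<^esub> (g \<circ>\<^bsub>A\<^esub> basis D)", OF _ _ tlD[OF assms(2)]])
    fix E assume E: "E \<in> {D. D \<in> diagrams (src D) (tgt D)}"
    show "h \<circ>\<^bsub>A\<^esub> (basis E \<circ>\<^bsub>A\<^esub> basis D) = (h \<circ>\<^bsub>A\<^esub> basis E) \<circ>\<^bsub>A\<^esub> basis D"
      by (rule lin_eqI[where F = "\<lambda>h. h \<circ>\<^bsub>A\<^esub> (basis E \<circ>\<^bsub>A\<^esub> basis D)", OF _ _ tlD[OF assms(3)]])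
        (use D E in \<open>auto intro!: lin_intros comp_assoc_basis\<close>)
  qed (intro lin_intros)+
qed (intro lin_intros)+

lemma tensor_assoc:
  assumes "f \<in> tl" "g \<in> tl" "h \<in> tl"
  shows "(f \<otimes> g) \<otimes> h = f \<otimes> (g \<otimes> h)"
proof (rule lin_eqI[where F = "\<lambda>f. (f \<otimes> g) \<otimes> h", OF _ _ tlD[OF assms(1)]])
  fix D assume D: "D \<in> {D. D \<in> diagrams (src D) (tgt D)}"
  show "(basis D \<otimes> g) \<otimes> h = basis D \<otimes> (g \<otimes> h)"
  proof (rule lin_eqI[where F = "\<lambda>g. (basis D \<otimes> g) \<otimes> h", OF _ _ tlD[OF assms(2)]])
    fix E assume E: "E \<in> {D. D \<in> diagrams (src D) (tgt D)}"
    show "(basis D \<otimes> basis E) \<otimes> h = basis D \<otimes> (basis E \<otimes> h)"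
    proof (rule lin_eqI[where F = "\<lambda>h. (basis D \<otimes> basis E) \<otimes> h", OF _ _ tlD[OF assms(3)]])
      fix F assume F: "F \<in> {D. D \<in> diagrams (src D) (tgt D)}"
      show "(basis D \<otimes> basis E) \<otimes> basis F = basis D \<otimes> (basis E \<otimes> basis F)"
        using D E F by (simp add: tensor_basis juxtapose_assoc[OF diagrams_in_matchings diagrams_in_matchings diagrams_in_matchings])
    qed (intro lin_intros)+
  qed (intro lin_intros)+
qed (intro lin_intros)+

text \<open>The typing is essential: if only the total numbers of strands matched, the left side
  could be a genuine composite while the right side is 0.\<close>

lemma interchange:
  assumes f: "f \<in> tl_hom m n" and h: "h \<in> tl_hom n p" and g: "g \<in> tl_hom m' n'" and k: "k \<in> tl_hom n' p'"
  shows "(h \<otimes> k) \<circ>\<^bsub>A\<^esub> (f \<otimes> g) = (h \<circ>\<^bsub>A\<^esub> f) \<otimes> (k \<circ>\<^bsub>A\<^esub> g)"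
proof (rule lin_eqI[where F = "\<lambda>f. (h \<otimes> k) \<circ>\<^bsub>A\<^esub> (f \<otimes> g)", OF _ _ homD[OF f]])
  fix D assume D: "D \<in> diagrams m n"
  show "(h \<otimes> k) \<circ>\<^bsub>A\<^esub> (basis D \<otimes> g) = (h \<circ>\<^bsub>A\<^esub> basis D) \<otimes> (k \<circ>\<^bsub>A\<^esub> g)"
  proof (rule lin_eqI[where F = "\<lambda>h. (h \<otimes> k) \<circ>\<^bsub>A\<^esub> (basis D \<otimes> g)", OF _ _ homD[OF h]])
    fix D' assume D': "D' \<in> diagrams n p"
    show "(basis D' \<otimes> k) \<circ>\<^bsub>A\<^esub> (basis D \<otimes> g) = (basis D' \<circ>\<^bsub>A\<^esub> basis D) \<otimes> (k \<circ>\<^bsub>A\<^esub> g)"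
    proof (rule lin_eqI[where F = "\<lambda>g. (basis D' \<otimes> k) \<circ>\<^bsub>A\<^esub> (basis D \<otimes> g)", OF _ _ homD[OF g]])
      fix E assume E: "E \<in> diagrams m' n'"
      show "(basis D' \<otimes> k) \<circ>\<^bsub>A\<^esub> (basis D \<otimes> basis E) = (basis D' \<circ>\<^bsub>A\<^esub> basis D) \<otimes> (k \<circ>\<^bsub>A\<^esub> basis E)"
      proof (rule lin_eqI[where F = "\<lambda>k. (basis D' \<otimes> k) \<circ>\<^bsub>A\<^esub> (basis D \<otimes> basis E)", OF _ _ homD[OF k]])
        fix E' assume E': "E' \<in> diagrams n' p'"
        note M = D[THEN diagrams_in_matchings] E[THEN diagrams_in_matchings]
          D'[THEN diagrams_in_matchings] E'[THEN diagrams_in_matchings]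
        have st: "src D = m" "tgt D = n" "src E = m'" "tgt E = n'" "src D' = n" "tgt D' = p" "src E' = n'" "tgt E' = p'"
          using D E D' E' diagramsD by auto
        show "(basis D' \<otimes> basis E') \<circ>\<^bsub>A\<^esub> (basis D \<otimes> basis E) = (basis D' \<circ>\<^bsub>A\<^esub> basis D) \<otimes> (basis E' \<circ>\<^bsub>A\<^esub> basis E)"
          using st by (simp add: tensor_basis comp_basis tl_linear stack_juxtapose[OF M] power_add mult.commute)
            (simp add: juxtapose_def)
      qed (intro lin_intros)+
    qed (intro lin_intros)+
  qed (intro lin_intros)+
qed (intro lin_intros)+

lemma id_comp: "f \<in> tl_hom m n \<Longrightarrow> tl_id n \<circ>\<^bsub>A\<^esub> f = f"
proof -
  assume f: "f \<in> tl_hom m n"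
  show ?thesis
  proof (rule lin_eqI[where F = "\<lambda>f. tl_id n \<circ>\<^bsub>A\<^esub> f", OF _ _ homD[OF f]])
    fix D assume D: "D \<in> diagrams m n"
    show "tl_id n \<circ>\<^bsub>A\<^esub> basis D = basis D"
      using diagramsD[OF D] stack_id_right[OF diagrams_in_matchings[OF D]]
      by (simp add: tl_id_def comp_basis) (simp add: id_diagram_def)
  qed (intro lin_intros)+
qed

lemma comp_id: "f \<in> tl_hom m n \<Longrightarrow> f \<circ>\<^bsub>A\<^esub> tl_id m = f"
proof -
  assume f: "f \<in> tl_hom m n"
  show ?thesis
  proof (rule lin_eqI[where F = "\<lambda>f. f \<circ>\<^bsub>A\<^esub> tl_id m", OF _ _ homD[OF f]])
    fix D assume D: "D \<in> diagrams m n"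
    show "basis D \<circ>\<^bsub>A\<^esub> tl_id m = basis D"
      using diagramsD[OF D] stack_id_left[OF diagrams_in_matchings[OF D]]
      by (simp add: tl_id_def comp_basis) (simp add: id_diagram_def)
  qed (intro lin_intros)+
qed

lemma id_0_tensor: "f \<in> tl \<Longrightarrow> tl_id 0 \<otimes> f = f"
proof -
  assume f: "f \<in> tl"
  show ?thesis
    by (rule lin_eqI[where F = "\<lambda>f. tl_id 0 \<otimes> f", OF _ _ tlD[OF f]])
      (auto intro!: lin_intros simp: tl_id_def tensor_basis juxtapose_id_0[OF diagrams_in_matchings])
qed

lemma tensor_id_0: "f \<in> tl \<Longrightarrow> f \<otimes> tl_id 0 = f"
proof -
  assume f: "f \<in> tl"
  show ?thesis
    by (rule lin_eqI[where F = "\<lambda>f. f \<otimes> tl_id 0", OF _ _ tlD[OF f]])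
      (auto intro!: lin_intros simp: tl_id_def tensor_basis juxtapose_id_0[OF diagrams_in_matchings])
qed

lemma id_tensor_id: "tl_id m \<otimes> tl_id n = tl_id (m + n)"
  by (simp add: tl_id_def tensor_basis juxtapose_id_id)

subsection \<open>Reflection and rotation\<close>

definition flip :: "tl_mor \<Rightarrow> tl_mor" where "flip = extend flip_diagram"
definition rotation :: "tl_mor \<Rightarrow> tl_mor" where "rotation = extend rotate_diagram"

lemma lin_flip: "lin F \<Longrightarrow> lin (\<lambda>x. flip (F x))" and lin_rotate: "lin F \<Longrightarrow> lin (\<lambda>x. rotation (F x))"
  unfolding flip_def rotation_def by (rule lin_extend, assumption)+

lemma flip_basis: "flip (basis D) = basis (flip_diagram D)"
  and rotate_basis: "rotation (basis D) = basis (rotate_diagram D)"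
  by (simp_all add: flip_def rotation_def)

lemma flip_add: "flip (f + g) = flip f + flip g" and flip_scale: "flip (scale c f) = scale c (flip f)"
  and flip_zero: "flip 0 = 0"
  using lin_flip[OF lin_id] lin_zero[OF lin_flip[OF lin_id]] by (simp_all add: lin_def)

lemma rotate_add: "rotation (f + g) = rotation f + rotation g" and rotate_scale: "rotation (scale c f) = scale c (rotation f)"
  and rotate_zero: "rotation 0 = 0"
  using lin_rotate[OF lin_id] lin_zero[OF lin_rotate[OF lin_id]] by (simp_all add: lin_def)

lemma hom_flip: "f \<in> tl_hom m n \<Longrightarrow> flip f \<in> tl_hom n m"
  unfolding tl_hom_def flip_def mem_Collect_eq by (rule keys_extend) (use flip_in_diagrams in blast)

lemma hom_rotate: "f \<in> tl_hom m n \<Longrightarrow> rotation f \<in> tl_hom n m"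
  unfolding tl_hom_def rotation_def mem_Collect_eq by (rule keys_extend) (use rotate_in_diagrams in blast)

lemma flip_comp:
  assumes "f \<in> tl" "g \<in> tl"
  shows "flip (g \<circ>\<^bsub>A\<^esub> f) = flip f \<circ>\<^bsub>A\<^esub> flip g"
proof (rule lin_eqI[where F = "\<lambda>f. flip (g \<circ>\<^bsub>A\<^esub> f)", OF _ _ tlD[OF assms(1)]])
  fix D assume D: "D \<in> {D. D \<in> diagrams (src D) (tgt D)}"
  show "flip (g \<circ>\<^bsub>A\<^esub> basis D) = flip (basis D) \<circ>\<^bsub>A\<^esub> flip g"
  proof (rule lin_eqI[where F = "\<lambda>g. flip (g \<circ>\<^bsub>A\<^esub> basis D)", OF _ _ tlD[OF assms(2)]])
    fix E assume E: "E \<in> {D. D \<in> diagrams (src D) (tgt D)}"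
    show "flip (basis E \<circ>\<^bsub>A\<^esub> basis D) = flip (basis D) \<circ>\<^bsub>A\<^esub> flip (basis E)"
    proof (cases "tgt D = src E")
      case True
      then have "D \<in> matchings (src D) (src E)" "E \<in> matchings (src E) (tgt E)"
        using D E by (auto simp: diagrams_iff)
      from stack_flip[OF this] show ?thesis
        using True by (simp add: comp_basis flip_basis flip_scale) (simp add: flip_diagram_def)
    qed (auto simp: comp_basis flip_basis flip_zero flip_diagram_def)
  qed (intro lin_intros lin_flip)+
qed (intro lin_intros lin_flip)+

lemma rotate_comp:
  assumes "f \<in> tl" "g \<in> tl"
  shows "rotation (g \<circ>\<^bsub>A\<^esub> f) = rotation f \<circ>\<^bsub>A\<^esub> rotation g"
proof (rule lin_eqI[where F = "\<lambda>f. rotation (g \<circ>\<^bsub>A\<^esub> f)", OF _ _ tlD[OF assms(1)]])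
  fix D assume D: "D \<in> {D. D \<in> diagrams (src D) (tgt D)}"
  show "rotation (g \<circ>\<^bsub>A\<^esub> basis D) = rotation (basis D) \<circ>\<^bsub>A\<^esub> rotation g"
  proof (rule lin_eqI[where F = "\<lambda>g. rotation (g \<circ>\<^bsub>A\<^esub> basis D)", OF _ _ tlD[OF assms(2)]])
    fix E assume E: "E \<in> {D. D \<in> diagrams (src D) (tgt D)}"
    show "rotation (basis E \<circ>\<^bsub>A\<^esub> basis D) = rotation (basis D) \<circ>\<^bsub>A\<^esub> rotation (basis E)"
    proof (cases "tgt D = src E")
      case True
      then have "D \<in> matchings (src D) (src E)" "E \<in> matchings (src E) (tgt E)"
        using D E by (auto simp: diagrams_iff)
      from stack_rotate[OF this] show ?thesis
        using True by (simp add: comp_basis rotate_basis rotate_scale) (simp add: rotate_diagram_def)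
    qed (auto simp: comp_basis rotate_basis rotate_zero rotate_diagram_def)
  qed (intro lin_intros lin_rotate)+
qed (intro lin_intros lin_rotate)+

lemma flip_tensor:
  assumes "f \<in> tl" "g \<in> tl"
  shows "flip (f \<otimes> g) = flip f \<otimes> flip g"
proof (rule lin_eqI[where F = "\<lambda>f. flip (f \<otimes> g)", OF _ _ tlD[OF assms(1)]])
  fix D assume D: "D \<in> {D. D \<in> diagrams (src D) (tgt D)}"
  show "flip (basis D \<otimes> g) = flip (basis D) \<otimes> flip g"
    by (rule lin_eqI[where F = "\<lambda>g. flip (basis D \<otimes> g)", OF _ _ tlD[OF assms(2)]])
      (use D in \<open>auto intro!: lin_intros lin_flip simp: tensor_basis flip_basis
        flip_juxtapose[OF diagrams_in_matchings diagrams_in_matchings]\<close>)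
qed (intro lin_intros lin_flip)+

lemma rotate_tensor:
  assumes "f \<in> tl" "g \<in> tl"
  shows "rotation (f \<otimes> g) = rotation g \<otimes> rotation f"
proof (rule lin_eqI[where F = "\<lambda>f. rotation (f \<otimes> g)", OF _ _ tlD[OF assms(1)]])
  fix D assume D: "D \<in> {D. D \<in> diagrams (src D) (tgt D)}"
  show "rotation (basis D \<otimes> g) = rotation g \<otimes> rotation (basis D)"
    by (rule lin_eqI[where F = "\<lambda>g. rotation (basis D \<otimes> g)", OF _ _ tlD[OF assms(2)]])
      (use D in \<open>auto intro!: lin_intros lin_rotate simp: tensor_basis rotate_basis
        rotate_juxtapose[OF diagrams_in_matchings diagrams_in_matchings]\<close>)
qed (intro lin_intros lin_rotate)+

lemma flip_id_cap_cup [simp]: "flip (tl_id n) = tl_id n" "flip (tl_cap n) = tl_cup n" "flip (tl_cup n) = tl_cap n"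
  by (simp_all add: tl_id_def tl_cap_def tl_cup_def flip_basis flip_id flip_cap flip_cup)

lemma rotate_id_cap_cup [simp]: "rotation (tl_id n) = tl_id n" "rotation (tl_cap n) = tl_cup n" "rotation (tl_cup n) = tl_cap n"
  by (simp_all add: tl_id_def tl_cap_def tl_cup_def rotate_basis rotate_id rotate_cap rotate_cup)

lemma flip_closed: "f \<in> tl \<Longrightarrow> flip f \<in> tl" and rotate_closed: "f \<in> tl \<Longrightarrow> rotation f \<in> tl"
proof -
  have *: "Poly_Mapping.keys (extend g f) \<subseteq> {D. D \<in> diagrams (src D) (tgt D)}"
    if "f \<in> tl" "\<And>D. D \<in> diagrams (src D) (tgt D) \<Longrightarrow> g D \<in> diagrams (tgt D) (src D)" for g
  proof (rule keys_extend)
    fix D assume "D \<in> Poly_Mapping.keys f"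
    then have "g D \<in> diagrams (tgt D) (src D)" using tlD[OF that(1)] that(2) by blast
    then show "g D \<in> {D. D \<in> diagrams (src D) (tgt D)}" using diagramsD by fastforce
  qed
  show "f \<in> tl \<Longrightarrow> flip f \<in> tl" "f \<in> tl \<Longrightarrow> rotation f \<in> tl"
    using *[of flip_diagram] *[of rotate_diagram] flip_in_diagrams rotate_in_diagrams
    by (auto simp: tl_def flip_def rotation_def)
qed

lemma flip_flip_tl: "f \<in> tl \<Longrightarrow> flip (flip f) = f"
proof -
  assume f: "f \<in> tl"
  show ?thesis
    by (rule lin_eqI[where F = "\<lambda>f. flip (flip f)", OF _ _ tlD[OF f]])
      (auto intro!: lin_intros lin_flip simp: flip_basis flip_flip[OF diagrams_in_matchings])
qed

lemma rotate_rotate_tl: "f \<in> tl \<Longrightarrow> rotation (rotation f) = f"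
proof -
  assume f: "f \<in> tl"
  show ?thesis
    by (rule lin_eqI[where F = "\<lambda>f. rotation (rotation f)", OF _ _ tlD[OF f]])
      (auto intro!: lin_intros lin_rotate simp: rotate_basis rotate_rotate[OF diagrams_in_matchings])
qed

subsection \<open>Duality\<close>

lemma cap_slide_tl:
  assumes f: "f \<in> tl_hom m n"
  shows "tl_cap n \<circ>\<^bsub>A\<^esub> (f \<otimes> tl_id n) = tl_cap m \<circ>\<^bsub>A\<^esub> (tl_id m \<otimes> rotation f)"
proof (rule lin_eqI[where F = "\<lambda>f. tl_cap n \<circ>\<^bsub>A\<^esub> (f \<otimes> tl_id n)", OF _ _ homD[OF f]])
  fix D assume D: "D \<in> diagrams m n"
  have "src D = m" "tgt D = n" using diagramsD[OF D] by auto
  then show "tl_cap n \<circ>\<^bsub>A\<^esub> (basis D \<otimes> tl_id n) = tl_cap m \<circ>\<^bsub>A\<^esub> (tl_id m \<otimes> rotation (basis D))"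
    unfolding tl_cap_def tl_id_def rotate_basis tensor_basis comp_basis
      cap_slide[OF diagrams_in_matchings[OF D]]
    by (simp add: juxtapose_def cap_diagram_def id_diagram_def rotate_diagram_def)
qed (intro lin_intros lin_rotate)+

lemma zigzag: "(tl_id m \<otimes> tl_cap m) \<circ>\<^bsub>A\<^esub> (tl_cup m \<otimes> tl_id m) = tl_id m"
  unfolding tl_id_def tl_cap_def tl_cup_def tensor_basis comp_basis stack_zigzag
  by (simp add: juxtapose_def cap_diagram_def cup_diagram_def id_diagram_def)

lemma zigzag': "(tl_cap m \<otimes> tl_id m) \<circ>\<^bsub>A\<^esub> (tl_id m \<otimes> tl_cup m) = tl_id m"
proof -
  have "flip ((tl_id m \<otimes> tl_cap m) \<circ>\<^bsub>A\<^esub> (tl_cup m \<otimes> tl_id m)) = tl_id m"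
    unfolding zigzag by simp
  then show ?thesis by (simp add: flip_comp flip_tensor)
qed

lemma nested_caps_tl: "tl_cap k \<circ>\<^bsub>A\<^esub> (tl_id k \<otimes> tl_cap l \<otimes> tl_id k) = tl_cap (k + l)"
proof -
  have "tl_cap k \<circ>\<^bsub>A\<^esub> (tl_id k \<otimes> (tl_cap l \<otimes> tl_id k)) = tl_cap (k + l)"
    unfolding tl_id_def tl_cap_def tensor_basis comp_basis stack_nested_caps
    by (simp add: juxtapose_def cap_diagram_def id_diagram_def)
  then show ?thesis by (simp add: tensor_assoc)
qed

lemma circle: "tl_cap 1 \<circ>\<^bsub>A\<^esub> tl_cup 1 = scale (loop_value A) (tl_id 0)"
  unfolding tl_id_def tl_cap_def tl_cup_def comp_basis stack_circle
  by (simp add: cap_diagram_def cup_diagram_def)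

text \<open>At the cap, \<open>f\<close> slides over to the other leg and becomes its half turn.
  There it passes beside the cup, and the remaining cup and cap form a snake.\<close>

lemma rotate_bend_right:
  assumes f: "f \<in> tl_hom m n"
  shows "(tl_id m \<otimes> tl_cap n) \<circ>\<^bsub>A\<^esub> (tl_id m \<otimes> f \<otimes> tl_id n) \<circ>\<^bsub>A\<^esub> (tl_cup m \<otimes> tl_id n) = rotation f"
proof -
  note t [simp] = hom_tl[OF f] rotate_closed[OF hom_tl[OF f]] and r = hom_rotate[OF f]
  have "(tl_id m \<otimes> tl_cap n) \<circ>\<^bsub>A\<^esub> (tl_id m \<otimes> f \<otimes> tl_id n) = tl_id m \<otimes> (tl_cap n \<circ>\<^bsub>A\<^esub> (f \<otimes> tl_id n))"
    unfolding tensor_assoc[OF tl_id_tl t(1) tl_id_tl]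
    by (subst interchange[OF hom_id hom_id hom_tensor'[OF f hom_id] hom_cap[OF refl]])
      (simp add: id_comp[OF hom_id])
  also have "\<dots> = tl_id m \<otimes> (tl_cap m \<circ>\<^bsub>A\<^esub> (tl_id m \<otimes> rotation f))"
    by (simp add: cap_slide_tl[OF f])
  also have "\<dots> = (tl_id m \<otimes> tl_cap m) \<circ>\<^bsub>A\<^esub> (tl_id m \<otimes> (tl_id m \<otimes> rotation f))"
    by (subst interchange[OF hom_id hom_id hom_tensor'[OF hom_id r] hom_cap[OF refl]])
      (simp add: id_comp[OF hom_id])
  also have "tl_id m \<otimes> (tl_id m \<otimes> rotation f) = tl_id (m + m) \<otimes> rotation f"
    by (simp add: tensor_assoc[symmetric] id_tensor_id)
  finally have "(tl_id m \<otimes> tl_cap n) \<circ>\<^bsub>A\<^esub> (tl_id m \<otimes> f \<otimes> tl_id n) \<circ>\<^bsub>A\<^esub> (tl_cup m \<otimes> tl_id n) =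
      (tl_id m \<otimes> tl_cap m) \<circ>\<^bsub>A\<^esub> ((tl_id (m + m) \<otimes> rotation f) \<circ>\<^bsub>A\<^esub> (tl_cup m \<otimes> tl_id n))"
    by (simp add: tl_comp_assoc)
  also have "(tl_id (m + m) \<otimes> rotation f) \<circ>\<^bsub>A\<^esub> (tl_cup m \<otimes> tl_id n) = tl_cup m \<otimes> rotation f"
    by (subst interchange[OF hom_cup[OF refl] hom_id hom_id r]) (simp add: id_comp[OF hom_cup[OF refl]] comp_id[OF r])
  also have "\<dots> = (tl_cup m \<otimes> tl_id m) \<circ>\<^bsub>A\<^esub> rotation f"
    by (subst (2) id_0_tensor[OF t(2), symmetric], subst interchange[OF hom_id hom_cup[OF refl] r hom_id])
      (simp add: comp_id[OF hom_cup[OF refl]] id_comp[OF r])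
  finally show ?thesis by (simp add: tl_comp_assoc zigzag id_comp[OF r])
qed

section \<open>Turn-backs\<close>

definition partner :: "diagram \<Rightarrow> point \<Rightarrow> point" where
  "partner D u = (THE v. {u, v} \<in> arcs D)"

lemma partner_eq:
  assumes D: "D \<in> matchings m n" and uv: "{u, v} \<in> arcs D"
  shows "partner D u = v" "u \<noteq> v" "partner D v = u" "v \<in> row 0 m \<union> row 1 n"
proof -
  have neq: "u \<noteq> v" if "{u, v} \<in> arcs D" for u v using matchingsD(4)[OF D that] by auto
  have eq: "partner D u = v" if uv: "{u, v} \<in> arcs D" for u v
    unfolding partner_def
  proof (rule the_equality[of "\<lambda>v. {u, v} \<in> arcs D", OF uv])
    fix w assume w: "{u, w} \<in> arcs D"
    have "{u, w} = {u, v}"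
      using disjointD[OF partition_onD2[OF matchingsD(3)[OF D]] w uv] by auto
    then show "w = v" using neq[OF w] neq[OF uv] by (auto simp: doubleton_eq_iff)
  qed
  show "partner D u = v" "partner D v = u" using eq uv by (simp_all add: insert_commute)
  show "u \<noteq> v" using neq uv by simp
  show "v \<in> row 0 m \<union> row 1 n" using matchingsD(5)[OF D] uv by blast
qed

lemma partner_arc:
  assumes D: "D \<in> matchings m n" and u: "u \<in> row 0 m \<union> row 1 n"
  shows "{u, partner D u} \<in> arcs D"
proof -
  obtain a where a: "a \<in> arcs D" "u \<in> a" using matchingsD(5)[OF D] u by blast
  then obtain v where "a = {u, v}" using matchingsD(4)[OF D a(1)] by (auto simp: card_2_iff)
  then show ?thesis using partner_eq(1)[OF D] a(1) by auto
qed

lemma partner_partner: "D \<in> matchings m n \<Longrightarrow> u \<in> row 0 m \<union> row 1 n \<Longrightarrow> partner D (partner D u) = u"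
  using partner_eq(3) partner_arc by blast

lemma partner_in: "D \<in> matchings m n \<Longrightarrow> u \<in> row 0 m \<union> row 1 n \<Longrightarrow> partner D u \<in> row 0 m \<union> row 1 n"
  using partner_eq(4) partner_arc by blast

text \<open>An arc cuts the boundary into two intervals that no other arc connects; injectivity of
  \<open>boundary_pos\<close> excludes that an end of one arc coincides with an end of
  another.\<close>

lemma partner_between:
  assumes D: "D \<in> diagrams m n" and u: "u \<in> row 0 m \<union> row 1 n" and w: "w \<in> row 0 m \<union> row 1 n"
    and lt: "boundary_pos u < boundary_pos w" "boundary_pos w < boundary_pos (partner D u)"
  shows "boundary_pos u < boundary_pos (partner D w)" "boundary_pos (partner D w) < boundary_pos (partner D u)"
proof -
  have M: "D \<in> matchings m n" and nc: "noncrossing (arcs D)" using D by (auto simp: diagrams_eq)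
  note au = partner_arc[OF M u] and aw = partner_arc[OF M w]
  have nc': "\<not> (boundary_pos p < boundary_pos r \<and> boundary_pos r < boundary_pos q \<and> boundary_pos q < boundary_pos s)"
    if "{p, q} \<in> arcs D" "{r, s} \<in> arcs D" for p q r s
  proof -
    have "\<not> (boundary_pos p < boundary_pos r \<and> boundary_pos r < boundary_pos q \<and> boundary_pos q < boundary_pos s)"
      if "a \<in> arcs D" "b \<in> arcs D" "p \<in> a" "q \<in> a" "r \<in> b" "s \<in> b" for a b
      using nc that unfolding noncrossing_def by blast
    from this[OF that] show ?thesis by simp
  qed
  have "w \<noteq> u" "w \<noteq> partner D u" using lt by auto
  then have "partner D w \<noteq> u" "partner D w \<noteq> partner D u"
    using partner_partner[OF M w] partner_partner[OF M u] by metis+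
  then have neq: "boundary_pos (partner D w) \<noteq> boundary_pos u" "boundary_pos (partner D w) \<noteq> boundary_pos (partner D u)"
    using inj_onD[OF inj_boundary_pos] partner_in[OF M w] partner_in[OF M u] u by metis+
  show "boundary_pos u < boundary_pos (partner D w)"
    using nc'[of "partner D w" w u "partner D u"] au aw lt neq by (fastforce simp: insert_commute)
  show "boundary_pos (partner D w) < boundary_pos (partner D u)"
    using nc'[OF au aw] lt neq by linarith
qed

lemma partner_outside:
  assumes D: "D \<in> diagrams m n" and u: "u \<in> row 0 m \<union> row 1 n" and w: "w \<in> row 0 m \<union> row 1 n"
    and lt: "boundary_pos w < boundary_pos u \<or> boundary_pos (partner D u) < boundary_pos w"
    and up: "boundary_pos u < boundary_pos (partner D u)"
  shows "boundary_pos (partner D w) < boundary_pos u \<or> boundary_pos (partner D u) < boundary_pos (partner D w)"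
proof (rule ccontr)
  note M = diagrams_in_matchings[OF D]
  note pw = partner_in[OF M w]
  assume *: "\<not> ?thesis"
  have "w \<noteq> u" "w \<noteq> partner D u" using lt up by auto
  then have "partner D w \<noteq> u" "partner D w \<noteq> partner D u"
    using partner_partner[OF M w] partner_partner[OF M u] by metis+
  then have "boundary_pos (partner D w) \<noteq> boundary_pos u" "boundary_pos (partner D w) \<noteq> boundary_pos (partner D u)"
    using inj_onD[OF inj_boundary_pos] pw partner_in[OF M u] u by metis+
  then have "boundary_pos u < boundary_pos (partner D w)" "boundary_pos (partner D w) < boundary_pos (partner D u)"
    using * by linarith+
  from partner_between[OF D u pw this] show False
    using lt partner_partner[OF M w] by auto
qed

lemma boundary_pos_rows [simp]: "boundary_pos (0, i) = int i" "boundary_pos (Suc 0, i) = - int i - 1"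
  by (simp_all add: boundary_pos_def)

lemma row_cases:
  assumes "u \<in> row 0 m \<union> row 1 n"
  obtains j where "u = (0, j)" "j < m" | i where "u = (1, i)" "i < n"
  using assms by (auto simp: row_def)

text \<open>An innermost arc inside an interval joins neighbours.\<close>

lemma adjacent_arc:
  assumes D: "D \<in> diagrams m n"
  shows "{(0, i), (0, j)} \<in> arcs D \<Longrightarrow> i < j \<Longrightarrow> \<exists>p. i \<le> p \<and> p + 1 \<le> j \<and> {(0, p), (0, p + 1)} \<in> arcs D"
proof (induction "j - i" arbitrary: i j rule: less_induct)
  case less
  note M = diagrams_in_matchings[OF D]
  show ?case
  proof (cases "j = i + 1")
    case True
    then show ?thesis using less.prems by auto
  next
    case False
    have j: "(0, j) \<in> row 0 m \<union> row 1 n" by (rule partner_eq(4)[OF M less.prems(1)])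
    then have i: "(0, i) \<in> row 0 m \<union> row 1 n" and i1: "(0, i + 1) \<in> row 0 m \<union> row 1 n"
      using less.prems(2) by auto
    have p: "partner D (0, i) = (0, j)" by (rule partner_eq(1)[OF M less.prems(1)])
    have b: "int i < boundary_pos (partner D (0, i + 1))" "boundary_pos (partner D (0, i + 1)) < int j"
      using partner_between[OF D i i1] less.prems(2) False unfolding p by auto
    obtain k where k: "partner D (0, i + 1) = (0, k)" "i < k" "k < j"
      using partner_in[OF M i1] by (rule row_cases) (use b in auto)
    have arc: "{(0, i + 1), (0, k)} \<in> arcs D" using partner_arc[OF M i1] k by simp
    then have "k \<noteq> i + 1" using partner_eq(2)[OF M arc] by auto
    then have "i + 1 < k" using k by simp
    moreover have "k - (i + 1) < j - i" using k by simp
    ultimately obtain p where "i + 1 \<le> p" "p + 1 \<le> k" "{(0, p), (0, p + 1)} \<in> arcs D"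
      using less.hyps[OF _ arc] by blast
    then show ?thesis using k by (intro exI[of _ p]) simp
  qed
qed

text \<open>\<open>partner\<close> is an involution, so exchanging \<open>P\<close> and
  \<open>Q\<close> makes it a bijection. Positions of arcs will be found by counting what lies on
  one side of them.\<close>

lemma card_partner_eq:
  assumes M: "D \<in> matchings m n" and fin: "finite P" "finite Q"
    and P: "P \<subseteq> row 0 m \<union> row 1 n" and Q: "Q \<subseteq> row 0 m \<union> row 1 n"
    and PQ: "\<And>u. u \<in> P \<Longrightarrow> partner D u \<in> Q" and QP: "\<And>u. u \<in> Q \<Longrightarrow> partner D u \<in> P"
  shows "card P = card Q"
proof -
  have "inj_on (partner D) (row 0 m \<union> row 1 n)"
    by (rule inj_on_inverseI[where g = "partner D"]) (use partner_partner[OF M] in blast)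
  then have "inj_on (partner D) P" "inj_on (partner D) Q" using P Q by (auto intro: inj_on_subset)
  then have "card P \<le> card Q" "card Q \<le> card P"
    using card_inj_on_le[of "partner D" P Q] card_inj_on_le[of "partner D" Q P] fin PQ QP by blast+
  then show ?thesis by simp
qed

lemma downward_closed_nat:
  fixes X :: "nat set"
  assumes "finite X" "\<And>i j. j \<in> X \<Longrightarrow> i < j \<Longrightarrow> i \<in> X"
  shows "X = {..<card X}"
proof (cases "X = {}")
  case False
  then have "Max X \<in> X" "\<And>i. i \<in> X \<Longrightarrow> i \<le> Max X" using assms(1) by auto
  then have "X = {..Max X}"
    using assms(2) by (auto simp: le_less)
  moreover have "card {..Max X} = Suc (Max X)" by simp
  ultimately show ?thesis by (metis lessThan_Suc_atMost)
qed simp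

text \<open>The arcs of \<open>E\<close> already use up all endpoints and leave no room for further
  arcs of \<open>D\<close>.\<close>

lemma matchings_eqI:
  assumes D: "D \<in> matchings m n" and E: "E \<in> matchings m n" and sub: "arcs E \<subseteq> arcs D"
  shows "D = E"
proof -
  have "a \<in> arcs E" if a: "a \<in> arcs D" for a
  proof -
    obtain u where u: "u \<in> a" using matchingsD(4)[OF D a] by (auto simp: card_2_iff)
    then obtain b where b: "b \<in> arcs E" "u \<in> b"
      using matchingsD(5)[OF D] matchingsD(5)[OF E] a by blast
    then have "a = b" using disjointD[OF partition_onD2[OF matchingsD(3)[OF D]] a] u sub by blast
    then show ?thesis using b by simp
  qed
  then have "arcs D = arcs E" using sub by blast
  then show ?thesis using matchingsD(1,2)[OF D] matchingsD(1,2)[OF E] by (simp add: diagram.expand)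
qed

section \<open>The diagram underlying a 3-vertex\<close>

definition vertex_diagram :: "nat \<Rightarrow> nat \<Rightarrow> nat \<Rightarrow> diagram" where
  "vertex_diagram x y z = juxtapose (juxtapose (id_diagram x) (cap_diagram y)) (id_diagram z)"

lemma vertex_in_diagrams: "vertex_diagram x y z \<in> diagrams ((x + y) + (y + z)) (x + z)"
  using juxtapose_in_diagrams[OF juxtapose_in_diagrams[OF id_in_diagrams[of x] cap_in_diagrams[of y]] id_in_diagrams[of z]]
  by (simp add: vertex_diagram_def add_ac)

lemma vertex_diagram_arcs:
  assumes "\<And>i. i < x \<Longrightarrow> {(0, i), (1, i)} \<in> M"
    and "\<And>i. i < y \<Longrightarrow> {(0, x + i), (0, x + (y + y - 1 - i))} \<in> M"
    and "\<And>i. i < z \<Longrightarrow> {(0, x + y + y + i), (1, x + i)} \<in> M"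
  shows "arcs (vertex_diagram x y z) \<subseteq> M"
proof
  fix a assume a: "a \<in> arcs (vertex_diagram x y z)"
  define f where "f = (\<lambda>(r, i). (r, (if r = 0 then x else x) + i) :: point)"
  define g where "g = (\<lambda>(r, i). (r, (if r = 0 then x + (y + y) else x + 0) + i) :: point)"
  have "arcs (vertex_diagram x y z) = arcs (id_diagram x) \<union> (`) f ` arcs (cap_diagram y) \<union> (`) g ` arcs (id_diagram z)"
  proof -
    have st: "src (id_diagram k) = k" "tgt (id_diagram k) = k" "src (cap_diagram k) = k + k" "tgt (cap_diagram k) = 0" for k
      by (simp_all add: id_diagram_def cap_diagram_def)
    show ?thesis unfolding vertex_diagram_def juxtapose_def diagram.sel st f_def g_def ..
  qed
  with a consider (1) "a \<in> arcs (id_diagram x)"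
    | (2) b where "b \<in> arcs (cap_diagram y)" "a = f ` b" | (3) b where "b \<in> arcs (id_diagram z)" "a = g ` b"
    by (metis UnE imageE)
  then show "a \<in> M"
  proof cases
    case 1
    then show ?thesis using assms(1) by (auto simp: id_diagram_def)
  next
    case 2
    then obtain i where "i < y" "b = {(0, i), (0, y + y - 1 - i)}" by (auto simp: cap_diagram_def)
    then have "a = {(0, x + i), (0, x + (y + y - 1 - i))}" using 2(2) by (simp add: f_def)
    then show ?thesis using assms(2)[OF \<open>i < y\<close>] by simp
  next
    case 3
    then obtain i where "i < z" "b = {(0, i), (1, i)}" by (auto simp: id_diagram_def)
    then have "a = {(0, x + y + y + i), (1, x + i)}" using 3(2) by (simp add: g_def add.assoc)
    then show ?thesis using assms(3)[OF \<open>i < z\<close>] by simp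
  qed
qed

text \<open>The hypotheses leave three kinds of arcs: left block to bottom, right block to bottom,
  and left block to right block. For each kind, planarity forces the points on one side of the arc
  to be matched among themselves across different blocks, so their numbers agree and the position of
  the arc is determined.\<close>

lemma three_block_diagram:
  assumes D: "D \<in> diagrams (a + b) n" and abn: "a = x + y" "b = y + z" "n = x + z"
    and H1: "\<And>i j. i < a \<Longrightarrow> j < a \<Longrightarrow> {(0, i), (0, j)} \<notin> arcs D"
    and H2: "\<And>i j. a \<le> i \<Longrightarrow> a \<le> j \<Longrightarrow> {(0, i), (0, j)} \<notin> arcs D"
    and H3: "\<And>i j. {(1, i), (1, j)} \<notin> arcs D"
  shows "D = vertex_diagram x y z"
proof -
  note M = diagrams_in_matchings[OF D]
  let ?W = "row 0 (a + b) \<union> row 1 n" and ?p = "partner D"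
  have top: "(0, j) \<in> ?W" if "j < a + b" for j using that by simp
  have bot: "(1, i) \<in> ?W" if "i < n" for i using that by simp
  have left: "(\<exists>i<n. ?p (0, j) = (1, i)) \<or> (\<exists>k. a \<le> k \<and> k < a + b \<and> ?p (0, j) = (0, k))" if j: "j < a" for j
    using partner_in[OF M top[of j]]
  proof (rule row_cases)
    fix k assume "?p (0, j) = (0, k)" "k < a + b"
    then show ?thesis using H1[OF j, of k] partner_arc[OF M top[of j]] j by (cases "k < a") auto
  qed (use j in auto)
  have right: "(\<exists>i<n. ?p (0, k) = (1, i)) \<or> (\<exists>j<a. ?p (0, k) = (0, j))" if k: "a \<le> k" "k < a + b" for k
    using partner_in[OF M top[OF k(2)]]
  proof (rule row_cases)
    fix j assume "?p (0, k) = (0, j)" "j < a + b"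
    then show ?thesis using H2[OF k(1), of j] partner_arc[OF M top[OF k(2)]] by (cases "j < a") auto
  qed auto
  have down: "\<exists>j<a + b. ?p (1, i) = (0, j)" if i: "i < n" for i
    using partner_in[OF M bot[OF i]]
  proof (rule row_cases)
    fix j assume "?p (1, i) = (1, j)"
    then show ?thesis using H3[of i j] partner_arc[OF M bot[OF i]] by auto
  qed auto
  \<comment> \<open>In the boundary order, the points to the left of a strand from the left block
    lie between its ends. They are matched among themselves, top with bottom, so there are equally
    many in both rows.\<close>
  have F1: "i = j" "\<And>j'. j' < j \<Longrightarrow> \<exists>i'<n. ?p (0, j') = (1, i')"
    if j: "j < a" and p: "?p (0, j) = (1, i)" and i: "i < n" for i j
  proof -
    have pi: "?p (1, i) = (0, j)" using partner_partner[OF M top[of j]] j p by simp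
    have A: "\<exists>i'<i. ?p (0, j') = (1, i')" if j': "j' < j" for j'
    proof -
      have "boundary_pos (1, i) < boundary_pos (?p (0, j'))" "boundary_pos (?p (0, j')) < boundary_pos (0, j)"
        using partner_between[OF D bot[OF i] top[of j']] j j' unfolding pi by auto
      then show ?thesis using left[of j'] j j' by auto
    qed
    have B: "\<exists>j'<j. ?p (1, i') = (0, j')" if i': "i' < i" for i'
    proof -
      have "boundary_pos (1, i) < boundary_pos (?p (1, i'))" "boundary_pos (?p (1, i')) < boundary_pos (0, j)"
        using partner_between[OF D bot[OF i] bot[of i']] i i' unfolding pi by auto
      then show ?thesis using down[of i'] i i' by auto
    qed
    have "card (row 1 i) = card (row 0 j)"
    proof (rule card_partner_eq[OF M])
      fix u assume "u \<in> row 1 i"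
      then obtain i' where "u = (1, i')" "i' < i" by (auto simp: row_def)
      then show "?p u \<in> row 0 j" using B[of i'] by auto
    next
      fix u assume "u \<in> row 0 j"
      then obtain j' where "u = (0, j')" "j' < j" by (auto simp: row_def)
      then show "?p u \<in> row 1 i" using A[of j'] by auto
    qed (use i j in \<open>auto simp: row_def\<close>)
    then show "i = j" by simp
    show "\<exists>i'<n. ?p (0, j') = (1, i')" if "j' < j" for j'
      using A[OF that] i by auto
  qed
  \<comment> \<open>Inside an arc that joins the two blocks, the points of one block are matched
    with those of the other.\<close>
  have F2: "a - 1 - j = k - a" if j: "j < a" and k: "a \<le> k" "k < a + b" and p: "?p (0, j) = (0, k)" for j k
  proof -
    have btw: "int j < boundary_pos (?p (0, i))" "boundary_pos (?p (0, i)) < int k" if "j < i" "i < k" for i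
      using partner_between[OF D top[of j] top[of i]] that j k unfolding p by auto
    have A: "\<exists>k'. a \<le> k' \<and> k' < k \<and> ?p (0, i) = (0, k')" if i: "j < i" "i < a" for i
      using left[OF i(2)] btw[of i] i k by auto
    have B: "\<exists>i. j < i \<and> i < a \<and> ?p (0, k') = (0, i)" if k': "a \<le> k'" "k' < k" for k'
      using right[of k'] btw[of k'] k' j k by auto
    have "card (Pair (0::nat) ` {j<..<a}) = card (Pair (0::nat) ` {a..<k})"
    proof (rule card_partner_eq[OF M])
      fix u assume "u \<in> Pair (0::nat) ` {j<..<a}"
      then obtain i where "u = (0, i)" "j < i" "i < a" by auto
      then show "?p u \<in> Pair 0 ` {a..<k}" using A[of i] by auto
    next
      fix u assume "u \<in> Pair (0::nat) ` {a..<k}"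
      then obtain i where "u = (0, i)" "a \<le> i" "i < k" by auto
      then show "?p u \<in> Pair 0 ` {j<..<a}" using B[of i] by auto
    qed (use k j in auto)
    then show ?thesis by (simp add: card_image inj_on_def)
  qed
  \<comment> \<open>Here the points outside the strand are used, which are those to its
    right.\<close>
  have F3: "a + b - 1 - k = n - 1 - i" if k: "a \<le> k" "k < a + b" and p: "?p (0, k) = (1, i)" and i: "i < n" for i k
  proof -
    have pi: "?p (1, i) = (0, k)" using partner_partner[OF M top[OF k(2)]] p by simp
    have out: "boundary_pos (?p w) < - int i - 1 \<or> int k < boundary_pos (?p w)"
      if "w \<in> ?W" "boundary_pos w < - int i - 1 \<or> int k < boundary_pos w" for w
      using partner_outside[OF D bot[OF i] that(1)] that(2) unfolding pi by simp
    have A: "\<exists>i'. i < i' \<and> i' < n \<and> ?p (0, k') = (1, i')" if k': "k < k'" "k' < a + b" for k'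
      using right[of k'] out[of "(0, k')"] k' k by auto
    have B: "\<exists>k'. k < k' \<and> k' < a + b \<and> ?p (1, i') = (0, k')" if i': "i < i'" "i' < n" for i'
      using down[of i'] out[of "(1, i')"] i' by auto
    have "card (Pair (0::nat) ` {k<..<a + b}) = card (Pair (1::nat) ` {i<..<n})"
    proof (rule card_partner_eq[OF M])
      fix u assume "u \<in> Pair (0::nat) ` {k<..<a + b}"
      then obtain k' where "u = (0, k')" "k < k'" "k' < a + b" by auto
      then show "?p u \<in> Pair 1 ` {i<..<n}" using A[of k'] by auto
    next
      fix u assume "u \<in> Pair (1::nat) ` {i<..<n}"
      then obtain i' where "u = (1, i')" "i < i'" "i' < n" by auto
      then show "?p u \<in> Pair 0 ` {k<..<a + b}" using B[of i'] by auto
    qed auto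
    then show ?thesis by (simp add: card_image inj_on_def)
  qed
  \<comment> \<open>\<open>X\<close> and \<open>Z\<close> collect the top ends of the through
    strands in the left and in the right block.\<close>
  define X where "X = {j. j < a \<and> (\<exists>i<n. ?p (0, j) = (1, i))}"
  define Z where "Z = {k. a \<le> k \<and> k < a + b \<and> (\<exists>i<n. ?p (0, k) = (1, i))}"
  have finX: "finite X" and finZ: "finite Z" and XZ: "X \<inter> Z = {}" and subX: "X \<subseteq> {..<a}" and subZ: "Z \<subseteq> {a..<a + b}"
    by (auto simp: X_def Z_def)
  have "card (row 1 n) = card (Pair (0::nat) ` (X \<union> Z))"
  proof (rule card_partner_eq[OF M])
    fix u assume "u \<in> row 1 n"
    then obtain i where i: "u = (1, i)" "i < n" by (auto simp: row_def)
    obtain j where j: "j < a + b" "?p u = (0, j)" using down[OF i(2)] i by auto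
    then have "?p (0, j) = (1, i)" using partner_partner[OF M bot[OF i(2)]] i by simp
    then show "?p u \<in> Pair 0 ` (X \<union> Z)" using i j by (auto simp: X_def Z_def)
  qed (use finX finZ in \<open>auto simp: X_def Z_def\<close>)
  then have n: "n = card X + card Z" by (simp add: card_image inj_on_def card_Un_disjoint[OF finX finZ XZ])
  have "card (Pair (0::nat) ` ({..<a} - X)) = card (Pair (0::nat) ` ({a..<a + b} - Z))"
  proof (rule card_partner_eq[OF M])
    fix u assume "u \<in> Pair (0::nat) ` ({..<a} - X)"
    then obtain j where j: "u = (0, j)" "j < a" "j \<notin> X" by auto
    then obtain k where k: "a \<le> k" "k < a + b" "?p u = (0, k)" using left[OF j(2)] by (auto simp: X_def)
    then have "?p (0, k) = (0, j)" using partner_partner[OF M top[of j]] j by simp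
    then show "?p u \<in> Pair 0 ` ({a..<a + b} - Z)" using k by (auto simp: Z_def)
  next
    fix u assume "u \<in> Pair (0::nat) ` ({a..<a + b} - Z)"
    then obtain k where k: "u = (0, k)" "a \<le> k" "k < a + b" "k \<notin> Z" by auto
    then obtain j where j: "j < a" "?p u = (0, j)" using right[of k] by (auto simp: Z_def)
    then have "?p (0, j) = (0, k)" using partner_partner[OF M top[of k]] k by simp
    then show "?p u \<in> Pair 0 ` ({..<a} - X)" using j by (auto simp: X_def)
  qed auto
  \<comment> \<open>The remaining points of the two blocks are matched with one another. Together
    with \<open>n = card X + card Z\<close> this determines \<open>card X = x\<close>.\<close>
  then have "a - card X = b - card Z"
    using card_Diff_subset[OF finX subX] card_Diff_subset[OF finZ subZ] by (simp add: card_image inj_on_def)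
  moreover have "card X \<le> a" "card Z \<le> b"
    using card_mono[OF _ subX] card_mono[OF _ subZ] by auto
  ultimately have "card X = x" using n abn by linarith
  moreover have "i \<in> X" if ij: "j \<in> X" "i < j" for i j
  proof -
    obtain i' where "j < a" "i' < n" "?p (0, j) = (1, i')" using ij(1) by (auto simp: X_def)
    then show ?thesis using F1(2)[of j i' i] ij(2) by (simp add: X_def)
  qed
  ultimately have X: "X = {..<x}" using downward_closed_nat[OF finX] by metis
  have "arcs (vertex_diagram x y z) \<subseteq> arcs D"
  proof (rule vertex_diagram_arcs)
    fix i assume i: "i < x"
    then obtain i' where "i' < n" "?p (0, i) = (1, i')" "i < a" using X unfolding X_def by blast
    then show "{(0, i), (1, i)} \<in> arcs D" using F1(1)[of i i'] partner_arc[OF M top[of i]] by simp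
  next
    fix i assume i: "i < y"
    then have "x + i \<notin> X" "x + i < a" using X abn by auto
    then obtain k where k: "a \<le> k" "k < a + b" "?p (0, x + i) = (0, k)" using left[of "x + i"] by (auto simp: X_def)
    then have "a - 1 - (x + i) = k - a" using F2[of "x + i" k] \<open>x + i < a\<close> by simp
    then have "k = x + (y + y - 1 - i)" using k(1) i abn by linarith
    then show "{(0, x + i), (0, x + (y + y - 1 - i))} \<in> arcs D"
      using partner_arc[OF M top[of "x + i"]] k \<open>x + i < a\<close> by simp
  next
    fix i assume i: "i < z"
    then have xi: "x + i < n" using abn by simp
    obtain k where k: "k < a + b" "?p (1, x + i) = (0, k)" using down[OF xi] by auto
    then have pk: "?p (0, k) = (1, x + i)" using partner_partner[OF M bot[OF xi]] by simp
    have "a \<le> k"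
    proof (rule ccontr)
      assume "\<not> a \<le> k"
      then have "k < a" by simp
      then have "k \<in> X" "x + i = k" using F1(1)[OF _ pk xi] pk xi unfolding X_def by auto
      then show False unfolding X by simp
    qed
    then have "a + b - 1 - k = n - 1 - (x + i)" using F3[OF _ k(1) pk xi] by simp
    then have "k = x + y + y + i" using k(1) abn i \<open>a \<le> k\<close> by linarith
    then show "{(0, x + y + y + i), (1, x + i)} \<in> arcs D"
      using partner_arc[OF M bot[OF xi]] k by (simp add: insert_commute)
  qed
  then show ?thesis
    using matchings_eqI[OF M] diagrams_in_matchings[OF vertex_in_diagrams[of x y z]] abn by simp
qed

lemma vertex_diagram_id: "vertex_diagram n 0 0 = id_diagram n"
proof -
  have "cap_diagram 0 = id_diagram 0" by (simp add: cap_diagram_def id_diagram_def)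
  then show ?thesis by (simp add: vertex_diagram_def juxtapose_id_0[OF id_in_matchings])
qed

text \<open>Without an arc between top points, \<open>partner\<close> injects the top row into the
  bottom row, hence onto it, and no bottom arc is left. Then the diagram is the vertex diagram with
  \<open>n\<close> strands in the left block and empty other blocks, that is, the identity.\<close>

lemma nonidentity_adjacent_arc:
  assumes D: "D \<in> diagrams n n" and ne: "D \<noteq> id_diagram n"
  shows "\<exists>p. p + 2 \<le> n \<and> {(0, p), (0, p + 1)} \<in> arcs D"
proof (rule ccontr)
  note M = diagrams_in_matchings[OF D]
  assume *: "\<not> ?thesis"
  have H: "{(0, i), (0, j)} \<notin> arcs D" for i j
  proof
    assume arc: "{(0, i), (0, j)} \<in> arcs D"
    have False if ij: "{(0, i), (0, j)} \<in> arcs D" "i < j" for i j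
    proof -
      have "j < n" using partner_eq(4)[OF M ij(1)] by auto
      moreover obtain p where "i \<le> p" "p + 1 \<le> j" "{(0, p), (0, p + 1)} \<in> arcs D"
        using adjacent_arc[OF D ij] by blast
      ultimately show False using * by auto
    qed
    moreover have "i \<noteq> j" using partner_eq(2)[OF M arc] by auto
    ultimately show False using arc by (metis insert_commute linorder_neqE_nat)
  qed
  have img: "partner D ` row 0 n = row 1 n"
  proof (rule card_seteq)
    show "partner D ` row 0 n \<subseteq> row 1 n"
    proof
      fix v assume "v \<in> partner D ` row 0 n"
      then obtain i where i: "i < n" "v = partner D (0, i)" by (auto simp: row_def)
      then have "(0, i) \<in> row 0 n \<union> row 1 n" by simp
      note arc = partner_arc[OF M this] and p = partner_in[OF M this]
      from p show "v \<in> row 1 n"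
      proof (rule row_cases)
        fix j assume "partner D (0, i) = (0, j)"
        then show ?thesis using arc H[of i j] by simp
      qed (simp add: i(2))
    qed
    have "inj_on (partner D) (row 0 n)"
      by (rule inj_on_inverseI[where g = "partner D"]) (use partner_partner[OF M] in blast)
    then show "card (row 1 n) \<le> card (partner D ` row 0 n)" by (simp add: card_image)
  qed simp
  have "D = vertex_diagram n 0 0"
  proof (rule three_block_diagram[of D n 0])
    fix i j
    show "{(1, i), (1, j)} \<notin> arcs D"
    proof
      assume arc: "{(1, i), (1, j)} \<in> arcs D"
      have "(1, j) \<in> row 1 n" using partner_eq(4)[OF M arc] by auto
      then obtain u where u: "u \<in> row 0 n" "(1, j) = partner D u" using img by blast
      then have "partner D (1, j) = u" using partner_partner[OF M, of u] by simp
      moreover have "partner D (1, j) = (1, i)" by (rule partner_eq(3)[OF M arc])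
      ultimately show False using u(1) by auto
    qed
  qed (use D H in auto)
  then show False using ne vertex_diagram_id by simp
qed

section \<open>Absorption\<close>

definition cap_at :: "nat \<Rightarrow> nat \<Rightarrow> tl_mor" where
  "cap_at p q = tl_id p \<otimes> tl_cap 1 \<otimes> tl_id q"

definition cup_at :: "nat \<Rightarrow> nat \<Rightarrow> tl_mor" where
  "cup_at p q = tl_id p \<otimes> tl_cup 1 \<otimes> tl_id q"

lemma hom_cap_at: "p + 2 + q = m \<Longrightarrow> p + q = n \<Longrightarrow> cap_at p q \<in> tl_hom m n"
  unfolding cap_at_def by (intro hom_tensor[OF hom_tensor'[OF hom_id hom_cap[OF refl]] hom_id]) simp_all

lemma hom_cup_at: "p + 2 + q = m \<Longrightarrow> p + q = n \<Longrightarrow> cup_at p q \<in> tl_hom n m"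
  unfolding cup_at_def by (intro hom_tensor[OF hom_tensor'[OF hom_id hom_cup[OF refl]] hom_id]) simp_all

lemma tl_cap_at [simp]: "cap_at p q \<in> tl" and tl_cup_at [simp]: "cup_at p q \<in> tl"
  using hom_tl hom_cap_at hom_cup_at by blast+

lemma flip_cap_at [simp]: "flip (cap_at p q) = cup_at p q" "flip (cup_at p q) = cap_at p q"
  by (simp_all add: cap_at_def cup_at_def flip_tensor)

lemma rotate_cap_at [simp]: "rotation (cap_at p q) = cup_at q p" "rotation (cup_at p q) = cap_at q p"
  by (simp_all add: cap_at_def cup_at_def rotate_tensor tensor_assoc)

text \<open>Makes "acts by its coefficient" a linear expression in \<open>x\<close>, so that such
  claims can be checked on single diagrams.\<close>

lemma lin_lookup: "lin (\<lambda>x. scale (Poly_Mapping.lookup x d) v)"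
  by (simp add: lin_def lookup_add scale_add_left)

locale generic =
  fixes A :: complex
  assumes A_nonzero: "A \<noteq> 0" and Delta_nonzero: "\<And>n. Delta A n \<noteq> 0"
begin

abbreviation comp :: "tl_mor \<Rightarrow> tl_mor \<Rightarrow> tl_mor" (infixl "\<bullet>" 70) where
  "g \<bullet> f \<equiv> g \<circ>\<^bsub>A\<^esub> f"

abbreviation "\<delta> \<equiv> loop_value A"

lemma assoc: "f \<in> tl \<Longrightarrow> g \<in> tl \<Longrightarrow> h \<in> tl \<Longrightarrow> h \<bullet> g \<bullet> f = h \<bullet> (g \<bullet> f)"
  by (simp add: tl_comp_assoc)

lemma Delta_0: "Delta A 0 = 1" and Delta_1: "Delta A 1 = \<delta>"
  using A_nonzero by (simp_all add: Delta_def loop_value_def power_int_minus power_inverse field_simps)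

lemma loop_nonzero: "\<delta> \<noteq> 0"
  using Delta_nonzero[of 1] Delta_1 by simp

text \<open>The Chebyshev recursion. Multiplying the sum for \<open>n + 1\<close> by
  \<open>A ^ 2\<close> and by \<open>inverse A ^ 2\<close> shifts the exponents up and down by 2:
  the first shift gives the sum for \<open>n + 2\<close> without its last power, the second gives
  that power and the sum for \<open>n\<close>.\<close>

lemma Delta_Suc_Suc: "Delta A (n + 2) = \<delta> * Delta A (n + 1) - Delta A n"
proof -
  define S where "S n = (\<Sum>s=0..n. A powi (2 * int n - 4 * int s))" for n
  have "A ^ 2 * S (n + 1) = (\<Sum>s=0..n + 1. A powi (2 * int (n + 2) - 4 * int s))"
    unfolding S_def sum_distrib_left
  proof (rule sum.cong[OF refl])
    fix s
    have "A ^ 2 * A powi (2 * int (n + 1) - 4 * int s) = A powi (2 + (2 * int (n + 1) - 4 * int s))"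
      using A_nonzero by (subst power_int_add) simp_all
    then show "A ^ 2 * A powi (2 * int (n + 1) - 4 * int s) = A powi (2 * int (n + 2) - 4 * int s)"
      by (simp add: algebra_simps)
  qed
  moreover have "S (n + 2) = (\<Sum>s=0..n + 1. A powi (2 * int (n + 2) - 4 * int s)) + A powi (- 2 * int n - 4)"
  proof -
    have "- 4 - 2 * int n = - 2 * int n - 4" by simp
    moreover have "S (n + 2) = (\<Sum>s=0..n + 1. A powi (2 * int (n + 2) - 4 * int s)) + A powi (- 4 - 2 * int n)"
      unfolding S_def by (simp add: algebra_simps)
    ultimately show ?thesis by metis
  qed
  moreover have "inverse A ^ 2 * S (n + 1) = (\<Sum>s=0..n + 1. A powi (2 * int n - 4 * int s))"
    unfolding S_def sum_distrib_left
  proof (rule sum.cong[OF refl])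
    fix s
    have "inverse A ^ 2 * A powi (2 * int (n + 1) - 4 * int s) = A powi (- 2 + (2 * int (n + 1) - 4 * int s))"
      using A_nonzero by (subst power_int_add) (simp_all add: power_int_minus power_inverse)
    then show "inverse A ^ 2 * A powi (2 * int (n + 1) - 4 * int s) = A powi (2 * int n - 4 * int s)"
      by (simp add: algebra_simps)
  qed
  moreover have "(\<Sum>s=0..n + 1. A powi (2 * int n - 4 * int s)) = S n + A powi (- 2 * int n - 4)"
  proof -
    have "- 4 - 2 * int n = - 2 * int n - 4" by simp
    moreover have "(\<Sum>s=0..n + 1. A powi (2 * int n - 4 * int s)) = S n + A powi (- 4 - 2 * int n)"
      unfolding S_def by (simp add: algebra_simps)
    ultimately show ?thesis by metis
  qed
  ultimately have rec: "S (n + 2) = A ^ 2 * S (n + 1) + inverse A ^ 2 * S (n + 1) - S n" by simp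
  then show ?thesis
    unfolding Delta_def S_def[symmetric] rec loop_value_def by (simp add: algebra_simps)
qed

definition whisker :: "nat \<Rightarrow> nat \<Rightarrow> tl_mor \<Rightarrow> tl_mor" where
  "whisker l r x = tl_id l \<otimes> x \<otimes> tl_id r"

lemma whisker_tl [simp]: "x \<in> tl \<Longrightarrow> whisker l r x \<in> tl"
  by (simp add: whisker_def)

lemma whisker_comp:
  assumes "f \<in> tl_hom m n" "g \<in> tl_hom n p"
  shows "whisker l r (g \<bullet> f) = whisker l r g \<bullet> whisker l r f"
  unfolding whisker_def interchange[OF hom_tensor'[OF hom_id assms(1)] hom_tensor'[OF hom_id assms(2)] hom_id hom_id]
    interchange[OF hom_id hom_id assms] id_comp[OF hom_id] ..

lemma whisker_scale: "whisker l r (scale c x) = scale c (whisker l r x)"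
  by (simp add: whisker_def tl_linear)

lemma whisker_id: "whisker l r (tl_id n) = tl_id (l + n + r)"
  by (simp add: whisker_def id_tensor_id)

text \<open>Linear form of \<open>stack_turnback\<close>: whichever of the two stackings closes the
  loop, the exponents of \<delta> add up to 1.\<close>

lemma turnback:
  assumes D: "D \<in> diagrams (p + 2 + q) n" and arc: "{(0, p), (0, p + 1)} \<in> arcs D"
  shows "basis D \<bullet> cup_at p q \<bullet> cap_at p q = scale \<delta> (basis D)"
proof -
  define C where "C = juxtapose (juxtapose (id_diagram p) (cap_diagram 1)) (id_diagram q)"
  define U where "U = juxtapose (juxtapose (id_diagram p) (cup_diagram 1)) (id_diagram q)"
  have D': "D \<in> matchings (p + (1 + 1) + q) n" using diagrams_in_matchings[OF D] by simp
  note st = stack_turnback[OF D' arc, folded C_def U_def]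
  have "cap_at p q = basis C" "cup_at p q = basis U"
    by (simp_all add: C_def U_def cap_at_def cup_at_def tl_id_def tl_cap_def tl_cup_def tensor_basis)
  moreover have "tgt C = p + q" "src U = p + q" "tgt U = p + 2 + q"
    by (simp_all add: C_def U_def juxtapose_def cap_diagram_def cup_diagram_def id_diagram_def)
  moreover have "src (stack U D) = src U" by (simp add: stack_def)
  moreover have "\<delta> ^ stack_loops U D * \<delta> ^ stack_loops C (stack U D) = \<delta>"
    using st(2) by (metis add.commute power_add power_one_right)
  ultimately show ?thesis
    using diagramsD[OF D] by (simp add: comp_basis tl_linear st(1))
qed

lemma turnback_bottom:
  assumes D: "D \<in> diagrams n (p + 2 + q)" and arc: "{(1, p), (1, p + 1)} \<in> arcs D"
  shows "cup_at p q \<bullet> (cap_at p q \<bullet> basis D) = scale \<delta> (basis D)"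
proof -
  have "{(0, p), (0, p + 1)} = (\<lambda>(r, i). (1 - r, i) :: point) ` {(1, p), (1, p + 1)}" by simp
  then have "{(0, p), (0, p + 1)} \<in> arcs (flip_diagram D)"
    unfolding flip_diagram_def diagram.sel using arc by (metis imageI)
  note flipped = arg_cong[where f = flip, OF turnback[OF flip_in_diagrams[OF D] this]]
  have "basis D \<in> tl" "basis (flip_diagram D) \<in> tl"
    using hom_tl[OF basis_hom] D flip_in_diagrams[OF D] by blast+
  then show ?thesis
    using flipped by (simp add: flip_comp flip_scale flip_basis flip_flip[OF diagrams_in_matchings[OF D]])
qed

lemma nonidentity_factor:
  assumes D: "D \<in> diagrams n n" "D \<noteq> id_diagram n"
  obtains p q where "p + 2 + q = n" "scale \<delta> (basis D) = basis D \<bullet> cup_at p q \<bullet> cap_at p q"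
proof -
  obtain p where p: "p + 2 \<le> n" "{(0, p), (0, p + 1)} \<in> arcs D"
    using nonidentity_adjacent_arc[OF D] by blast
  then obtain q where q: "p + 2 + q = n" using le_Suc_ex[of "p + 2" n] by metis
  have "D \<in> diagrams (p + 2 + q) n" using D(1) unfolding q .
  from that[OF q turnback[OF this p(2), symmetric]] show thesis .
qed

text \<open>As \<delta> is invertible, every diagram other than the identity factors through a
  turn-back, which \<open>u\<close> annihilates; only the coefficient of the identity survives.
  Since \<open>u\<close> is an arbitrary element of \<open>tl\<close>, an identity factor stays in
  front of it.\<close>

lemma absorb_left:
  assumes u: "u \<in> tl" and x: "x \<in> tl_hom n n"
    and kill: "\<And>p q. p + 2 + q = n \<Longrightarrow> whisker l r (cap_at p q) \<bullet> u = 0"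
  shows "whisker l r x \<bullet> u = scale (Poly_Mapping.lookup x (id_diagram n)) (tl_id (l + n + r) \<bullet> u)"
proof (rule lin_eqI[where F = "\<lambda>x. whisker l r x \<bullet> u", OF _ lin_lookup homD[OF x]])
  fix D assume D: "D \<in> diagrams n n"
  show "whisker l r (basis D) \<bullet> u = scale (Poly_Mapping.lookup (basis D) (id_diagram n)) (tl_id (l + n + r) \<bullet> u)"
  proof (cases "D = id_diagram n")
    case True
    then show ?thesis using whisker_id[of l r n] by (simp add: tl_id_def)
  next
    case False
    then obtain p q where pq: "p + 2 + q = n" "scale \<delta> (basis D) = basis D \<bullet> cup_at p q \<bullet> cap_at p q"
      using nonidentity_factor[OF D] by metis
    note b = basis_hom[OF D]
    have "scale \<delta> (whisker l r (basis D) \<bullet> u) = whisker l r (basis D \<bullet> cup_at p q) \<bullet> whisker l r (cap_at p q) \<bullet> u"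
      unfolding whisker_comp[OF hom_cap_at[OF pq(1) refl] hom_comp[OF hom_cup_at[OF pq(1) refl] b], symmetric]
        pq(2)[symmetric] by (simp add: whisker_scale tl_linear)
    also have "\<dots> = 0"
      using u hom_tl[OF b] by (simp add: assoc kill[OF pq(1)] tl_linear)
    finally have "scale (inverse \<delta>) (scale \<delta> (whisker l r (basis D) \<bullet> u)) = 0" by simp
    then show ?thesis using False loop_nonzero by (simp add: lookup_single when_def)
  qed
qed (unfold whisker_def, intro lin_intros)

text \<open>Mirror image of \<open>absorb_left\<close>: the factorisation is applied to the
  reflected diagram and reflected back.\<close>

lemma absorb_right:
  assumes u: "u \<in> tl" and x: "x \<in> tl_hom n n"
    and kill: "\<And>p q. p + 2 + q = n \<Longrightarrow> u \<bullet> whisker l r (cup_at p q) = 0"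
  shows "u \<bullet> whisker l r x = scale (Poly_Mapping.lookup x (id_diagram n)) (u \<bullet> tl_id (l + n + r))"
proof (rule lin_eqI[where F = "\<lambda>x. u \<bullet> whisker l r x", OF _ lin_lookup homD[OF x]])
  fix D assume D: "D \<in> diagrams n n"
  show "u \<bullet> whisker l r (basis D) = scale (Poly_Mapping.lookup (basis D) (id_diagram n)) (u \<bullet> tl_id (l + n + r))"
  proof (cases "D = id_diagram n")
    case True
    then show ?thesis using whisker_id[of l r n] by (simp add: tl_id_def)
  next
    case False
    note b = basis_hom[OF D] and FD = flip_in_diagrams[OF D] and fb = basis_hom[OF flip_in_diagrams[OF D]]
    have "flip_diagram D \<noteq> id_diagram n"
      using False flip_flip[OF diagrams_in_matchings[OF D]] flip_id by metis
    then obtain p q where pq: "p + 2 + q = n"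
        "scale \<delta> (basis (flip_diagram D)) = basis (flip_diagram D) \<bullet> cup_at p q \<bullet> cap_at p q"
      using nonidentity_factor[OF FD] by metis
    have eq: "scale \<delta> (basis D) = cup_at p q \<bullet> (cap_at p q \<bullet> basis D)"
      using arg_cong[where f = flip, OF pq(2)] hom_tl[OF b] hom_tl[OF fb]
      by (simp add: flip_comp flip_scale flip_basis flip_flip[OF diagrams_in_matchings[OF D]])
    have "scale \<delta> (u \<bullet> whisker l r (basis D)) = u \<bullet> (whisker l r (cup_at p q) \<bullet> whisker l r (cap_at p q \<bullet> basis D))"
      unfolding whisker_comp[OF hom_comp[OF b hom_cap_at[OF pq(1) refl]] hom_cup_at[OF pq(1) refl], symmetric]
        eq[symmetric] by (simp add: whisker_scale tl_linear)
    also have "\<dots> = 0"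
      using u hom_tl[OF b] by (simp add: assoc[symmetric] kill[OF pq(1)] tl_linear)
    finally have "scale (inverse \<delta>) (scale \<delta> (u \<bullet> whisker l r (basis D))) = 0" by simp
    then show ?thesis using False loop_nonzero by (simp add: lookup_single when_def)
  qed
qed (unfold whisker_def, intro lin_intros)

text \<open>
  Killing the turn-backs at the bottom and the ones inside two blocks at the top leaves at most one
  diagram, the one underlying the 3-vertex.
\<close>

lemma schur:
  assumes u: "u \<in> tl" and v: "v \<in> tl" and Y: "Y \<in> tl_hom (a + b) n"
    and abn: "a = x + y" "b = y + z" "n = x + z"
    and killu: "\<And>p q. p + 2 + q = n \<Longrightarrow> u \<bullet> cup_at p q = 0"
    and killv: "\<And>p q. p + 2 + q = a + b \<Longrightarrow> p + 2 \<le> a \<or> a \<le> p \<Longrightarrow> cap_at p q \<bullet> v = 0"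
  shows "u \<bullet> (Y \<bullet> v) = scale (Poly_Mapping.lookup Y (vertex_diagram x y z)) (u \<bullet> (basis (vertex_diagram x y z) \<bullet> v))"
proof (rule lin_eqI[where F = "\<lambda>Y. u \<bullet> (Y \<bullet> v)", OF _ lin_lookup homD[OF Y]])
  fix D assume D: "D \<in> diagrams (a + b) n"
  let ?B = "vertex_diagram x y z"
  note b = basis_hom[OF D] and M = diagrams_in_matchings[OF D]
  show "u \<bullet> (basis D \<bullet> v) = scale (Poly_Mapping.lookup (basis D) ?B) (u \<bullet> (basis ?B \<bullet> v))"
  proof (cases "D = ?B")
    case False
    have top: ?thesis if arc: "{(0, p), (0, p + 1)} \<in> arcs D" and p: "p + 2 \<le> a \<or> a \<le> p" for p
    proof -
      have "p + 1 < a + b" using partner_eq(4)[OF M arc] by auto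
      then obtain q where q: "p + 2 + q = a + b" using le_Suc_ex[of "p + 2" "a + b"] by force
      have "scale \<delta> (u \<bullet> (basis D \<bullet> v)) = u \<bullet> (scale \<delta> (basis D) \<bullet> v)" by (simp add: tl_linear)
      also have "scale \<delta> (basis D) = basis D \<bullet> cup_at p q \<bullet> cap_at p q"
        by (rule turnback[OF D[folded q] arc, symmetric])
      also have "u \<bullet> (basis D \<bullet> cup_at p q \<bullet> cap_at p q \<bullet> v) = 0"
        using hom_tl[OF b] v by (simp add: assoc killv[OF q p] tl_linear)
      finally have "scale (inverse \<delta>) (scale \<delta> (u \<bullet> (basis D \<bullet> v))) = 0" by simp
      then show ?thesis using False loop_nonzero by (simp add: lookup_single when_def)
    qed
    have bottom: ?thesis if arc: "{(1, p), (1, p + 1)} \<in> arcs D" for p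
    proof -
      have "p + 1 < n" using partner_eq(4)[OF M arc] by auto
      then obtain q where q: "p + 2 + q = n" using le_Suc_ex[of "p + 2" n] by force
      have "scale \<delta> (u \<bullet> (basis D \<bullet> v)) = u \<bullet> (scale \<delta> (basis D) \<bullet> v)" by (simp add: tl_linear)
      also have "scale \<delta> (basis D) = cup_at p q \<bullet> (cap_at p q \<bullet> basis D)"
        by (rule turnback_bottom[OF D[folded q] arc, symmetric])
      also have "u \<bullet> (cup_at p q \<bullet> (cap_at p q \<bullet> basis D) \<bullet> v) =
          (u \<bullet> cup_at p q) \<bullet> (cap_at p q \<bullet> (basis D \<bullet> v))"
        using hom_tl[OF b] u v by (simp add: assoc)
      also have "\<dots> = 0" by (simp add: killu[OF q] tl_linear)
      finally have "scale (inverse \<delta>) (scale \<delta> (u \<bullet> (basis D \<bullet> v))) = 0" by simp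
      then show ?thesis using False loop_nonzero by (simp add: lookup_single when_def)
    qed
    have FD: "flip_diagram D \<in> diagrams n (a + b)" by (rule flip_in_diagrams[OF D])
    have sorted: "\<exists>p. min i j \<le> p \<and> p + 1 \<le> max i j \<and> {(0, p), (0, p + 1)} \<in> arcs E"
      if E: "E \<in> diagrams k l" and arc: "{(0, i), (0, j)} \<in> arcs E" for E k l i j
    proof -
      have "i \<noteq> j" using partner_eq(2)[OF diagrams_in_matchings[OF E] arc] by auto
      then consider "i < j" | "j < i" by linarith
      then show ?thesis
      proof cases
        case 1
        then show ?thesis using adjacent_arc[OF E arc] by simp
      next
        case 2
        then show ?thesis using adjacent_arc[OF E, of j i] arc by (simp add: insert_commute)
      qed
    qed
    have flip_arc: "{(1 - r, i), (1 - r', j)} \<in> arcs (flip_diagram E)"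
      if "{(r, i), (r', j)} \<in> arcs E" for E r r' i j
    proof -
      have "(\<lambda>(r, i). (1 - r, i)) ` {(r, i), (r', j)} \<in> arcs (flip_diagram E)"
        unfolding flip_diagram_def diagram.sel using that by (rule imageI)
      then show ?thesis by simp
    qed
    show ?thesis
    proof (rule ccontr)
      assume no: "\<not> ?thesis"
      \<comment> \<open>If the claim fails, \<open>top\<close> and \<open>bottom\<close> exclude
        every arc between neighbours inside a block or at the bottom. By \<open>sorted\<close>, any
        arc inside a block would contain one, and the three blocks then determine the
        diagram.\<close>
      have "D = ?B"
      proof (rule three_block_diagram[OF D abn])
        show "{(0, i), (0, j)} \<notin> arcs D" if ij: "i < a" "j < a" for i j
        proof
          assume "{(0, i), (0, j)} \<in> arcs D"
          from sorted[OF D this] obtain p where "p + 1 \<le> max i j" "{(0, p), (0, p + 1)} \<in> arcs D" by blast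
          moreover from this ij have "p + 2 \<le> a" by (simp add: max_def split: if_splits)
          ultimately show False using top[of p] no by blast
        qed
        show "{(0, i), (0, j)} \<notin> arcs D" if ij: "a \<le> i" "a \<le> j" for i j
        proof
          assume "{(0, i), (0, j)} \<in> arcs D"
          from sorted[OF D this] obtain p where "min i j \<le> p" "{(0, p), (0, p + 1)} \<in> arcs D" by blast
          moreover from this ij have "a \<le> p" by (simp add: min_def split: if_splits)
          ultimately show False using top[of p] no by blast
        qed
        show "{(1, i), (1, j)} \<notin> arcs D" for i j
        proof
          assume "{(1, i), (1, j)} \<in> arcs D"
          then have "{(0, i), (0, j)} \<in> arcs (flip_diagram D)" using flip_arc[of 1 i 1 j D] by simp
          from sorted[OF FD this] obtain p where "{(0, p), (0, p + 1)} \<in> arcs (flip_diagram D)" by blast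
          then have "{(1, p), (1, p + 1)} \<in> arcs D"
            using flip_arc[of 0 p 0 "p + 1" "flip_diagram D"] flip_flip[OF M] by simp
          then show False using bottom no by blast
        qed
      qed
      then show False using False by simp
    qed
  qed simp
qed (intro lin_intros)

end

section \<open>Jones--Wenzl idempotents\<close>

text \<open>The coefficient is the one for which a turn-back on the last two strands annihilates the
  result; its denominator is non-zero in \<open>generic\<close>.\<close>

fun wenzl :: "complex \<Rightarrow> nat \<Rightarrow> tl_mor" where
  "wenzl A 0 = tl_id 0"
| "wenzl A (Suc 0) = tl_id 1"
| "wenzl A (Suc (Suc n)) = wenzl A (Suc n) \<otimes> tl_id 1 + scale (- (Delta A n / Delta A (n + 1)))
    ((wenzl A (Suc n) \<otimes> tl_id 1) \<circ>\<^bsub>A\<^esub> ((tl_id n \<otimes> (tl_cup 1 \<circ>\<^bsub>A\<^esub> tl_cap 1)) \<circ>\<^bsub>A\<^esub> (wenzl A (Suc n) \<otimes> tl_id 1)))"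

declare One_nat_def [simp del] wenzl.simps(2,3) [simp del]

context generic
begin

text \<open>The Temperley-Lieb generator on two strands.\<close>

definition turn :: tl_mor where "turn = tl_cup 1 \<bullet> tl_cap 1"

lemma hom_turn: "turn \<in> tl_hom 2 2"
  unfolding turn_def by (rule hom_comp[OF hom_cap hom_cup]) simp_all

lemma tl_turn [simp]: "turn \<in> tl"
  by (rule hom_tl[OF hom_turn])

lemma flip_turn [simp]: "flip turn = turn"
  by (simp add: turn_def flip_comp)

lemma rotate_turn [simp]: "rotation turn = turn"
  by (simp add: turn_def rotate_comp)

lemma cap_turn: "tl_cap 1 \<bullet> turn = scale \<delta> (tl_cap 1)"
  unfolding turn_def by (simp add: tl_comp_assoc circle tl_linear id_comp[OF hom_cap[OF refl]])

lemma turn_turn: "turn \<bullet> turn = scale \<delta> turn"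
  by (subst (1) turn_def) (simp add: assoc cap_turn tl_linear, simp add: turn_def)

text \<open>The Temperley-Lieb relation between neighbouring generators: after splitting each
  generator into cup and cap, neighbouring caps and cups form snakes.\<close>

lemma braid_turn:
  "(tl_id 1 \<otimes> turn) \<bullet> ((turn \<otimes> tl_id 1) \<bullet> (tl_id 1 \<otimes> turn)) = tl_id 1 \<otimes> turn"
  "(turn \<otimes> tl_id 1) \<bullet> ((tl_id 1 \<otimes> turn) \<bullet> (turn \<otimes> tl_id 1)) = turn \<otimes> tl_id 1"
proof -
  have eq: "tl_id 1 \<otimes> turn = (tl_id 1 \<otimes> tl_cup 1) \<bullet> (tl_id 1 \<otimes> tl_cap 1)"
    unfolding turn_def interchange[OF hom_id hom_id hom_cap[OF refl] hom_cup[OF refl]] id_comp[OF hom_id] ..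
  have eq': "turn \<otimes> tl_id 1 = (tl_cup 1 \<otimes> tl_id 1) \<bullet> (tl_cap 1 \<otimes> tl_id 1)"
    unfolding turn_def interchange[OF hom_cap[OF refl] hom_cup[OF refl] hom_id hom_id] id_comp[OF hom_id] ..
  have z: "(tl_id 1 \<otimes> tl_cap 1) \<bullet> ((tl_cup 1 \<otimes> tl_id 1) \<bullet> x) = x" "(tl_cap 1 \<otimes> tl_id 1) \<bullet> ((tl_id 1 \<otimes> tl_cup 1) \<bullet> x) = x"
    if "x \<in> tl_hom m 1" for x m
    using hom_tl[OF that] zigzag[of 1 A] zigzag'[of 1 A] id_comp[OF that, of A]
    by (simp_all add: assoc[symmetric])
  have h: "tl_id 1 \<otimes> tl_cap 1 \<in> tl_hom 3 1" "tl_cap 1 \<otimes> tl_id 1 \<in> tl_hom 3 1"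
    by (rule hom_tensor[OF hom_id hom_cap[OF refl]] hom_tensor[OF hom_cap[OF refl] hom_id]; simp)+
  show "(tl_id 1 \<otimes> turn) \<bullet> ((turn \<otimes> tl_id 1) \<bullet> (tl_id 1 \<otimes> turn)) = tl_id 1 \<otimes> turn"
    unfolding eq eq' using z(1)[of "(tl_cap 1 \<otimes> tl_id 1) \<bullet> ((tl_id 1 \<otimes> tl_cup 1) \<bullet> (tl_id 1 \<otimes> tl_cap 1))"]
      z(1,2)[OF h(1)] h hom_tl[OF h(1)]
    by (simp add: assoc)
  show "(turn \<otimes> tl_id 1) \<bullet> ((tl_id 1 \<otimes> turn) \<bullet> (turn \<otimes> tl_id 1)) = turn \<otimes> tl_id 1"
    unfolding eq eq' using z(1,2)[OF h(2)] h hom_tl[OF h(1)]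
    by (simp add: assoc)
qed

abbreviation "W \<equiv> wenzl A"

lemma hom_wenzl: "W n \<in> tl_hom n n"
proof (induction n rule: induct_nat_012)
  case (ge2 n)
  have "W (Suc n) \<otimes> tl_id 1 \<in> tl_hom (Suc (Suc n)) (Suc (Suc n))"
    by (rule hom_tensor[OF ge2(2) hom_id]) simp_all
  moreover have "tl_id n \<otimes> turn \<in> tl_hom (Suc (Suc n)) (Suc (Suc n))"
    by (rule hom_tensor[OF hom_id hom_turn]) simp_all
  ultimately show ?case
    unfolding wenzl.simps turn_def[symmetric] by (intro hom_add hom_scale hom_comp)
qed (use hom_id[of 0] hom_id[of 1] in \<open>simp_all add: wenzl.simps(2)\<close>, simp add: One_nat_def)

lemma tl_wenzl [simp]: "W n \<in> tl"
  by (rule hom_tl[OF hom_wenzl])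

lemma flip_wenzl: "flip (W n) = W n"
proof (induction n rule: induct_nat_012)
  case (ge2 n)
  then show ?case
    unfolding wenzl.simps turn_def[symmetric]
    by (simp add: flip_add flip_scale flip_comp flip_tensor assoc)
qed (simp_all add: wenzl.simps(2))

lemma cap_at_Suc: "cap_at p (Suc q) = cap_at p q \<otimes> tl_id 1"
  using id_tensor_id[of q 1] by (simp add: cap_at_def tensor_assoc Suc_eq_plus1)

lemma cap_at_turn: "cap_at n 0 \<bullet> (tl_id n \<otimes> turn) = scale \<delta> (cap_at n 0)"
  unfolding cap_at_def tensor_id_0[OF tl_tensor_closed[OF tl_id_tl tl_cap_tl]]
    interchange[OF hom_id hom_id hom_turn hom_cap[of 1 2, simplified]] id_comp[OF hom_id]
  using cap_turn by (simp add: tl_linear)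

text \<open>The induction has to carry two consecutive stages, the absorption of one by the next,
  and the partial trace over the last strand. The ratio in the partial trace is the reciprocal, up
  to sign, of the next coefficient in the recursion and makes the cancellation work.\<close>

lemma wenzl_invariants:
  "W n \<bullet> W n = W n \<and> (\<forall>p q. p + 2 + q = n \<longrightarrow> cap_at p q \<bullet> W n = 0) \<and>
   W (Suc n) \<bullet> W (Suc n) = W (Suc n) \<and> (\<forall>p q. p + 2 + q = Suc n \<longrightarrow> cap_at p q \<bullet> W (Suc n) = 0) \<and>
   W (Suc n) \<bullet> (W n \<otimes> tl_id 1) = W (Suc n) \<and>
   (tl_id n \<otimes> turn) \<bullet> ((W (Suc n) \<otimes> tl_id 1) \<bullet> (tl_id n \<otimes> turn)) = scale (Delta A (n + 1) / Delta A n) (W n \<otimes> turn)"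
proof (induction n)
  case 0
  have "tl_id 1 \<otimes> tl_id 1 = tl_id 2" using id_tensor_id[of 1 1] by simp
  moreover have "W (Suc 0) = tl_id 1" by (simp add: wenzl.simps(2))
  ultimately show ?case
    using id_comp[OF hom_id] id_comp[OF hom_turn] turn_turn Delta_0 Delta_1
    by (simp add: id_0_tensor)
next
  case (Suc n)
  define c where "c = Delta A n / Delta A (n + 1)"
  define G where "G = W (Suc n) \<otimes> tl_id 1"
  define b where "b = tl_id n \<otimes> turn"
  define X where "X = W (Suc (Suc n))"
  have IH: "W (Suc n) \<bullet> W (Suc n) = W (Suc n)" "\<And>p q. p + 2 + q = Suc n \<Longrightarrow> cap_at p q \<bullet> W (Suc n) = 0"
    "W (Suc n) \<bullet> (W n \<otimes> tl_id 1) = W (Suc n)"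
    "b \<bullet> (G \<bullet> b) = scale (Delta A (n + 1) / Delta A n) (W n \<otimes> turn)"
    using Suc by (auto simp: b_def G_def)
  have X: "X = G + scale (- c) (G \<bullet> (b \<bullet> G))"
    unfolding X_def c_def G_def b_def turn_def by (simp add: wenzl.simps(3))
  have hG: "G \<in> tl_hom (n + 2) (n + 2)" unfolding G_def by (rule hom_tensor[OF hom_wenzl hom_id]) simp_all
  have hb: "b \<in> tl_hom (n + 2) (n + 2)" unfolding b_def by (rule hom_tensor[OF hom_id hom_turn]) simp_all
  have hX: "X \<in> tl_hom (n + 2) (n + 2)" using hom_wenzl[of "n + 2"] by (simp add: X_def)
  note [simp] = hom_tl[OF hG] hom_tl[OF hb] hom_tl[OF hX]
  have fG: "flip G = G" and fb: "flip b = b" and fX: "flip X = X"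
    by (simp_all add: G_def b_def X_def flip_tensor flip_wenzl)
  have GG: "G \<bullet> G = G"
    unfolding G_def interchange[OF hom_wenzl hom_wenzl hom_id hom_id] IH(1) id_comp[OF hom_id] ..
  have GG': "G \<bullet> (G \<bullet> x) = G \<bullet> x" if "x \<in> tl" for x
    using that GG by (simp add: assoc[symmetric])
  have XG: "X \<bullet> G = X"
    unfolding X by (simp add: tl_linear assoc GG)
  \<comment> \<open>By the partial trace the correction term is a multiple of
    \<open>b \<bullet> G\<close> too, since \<open>G\<close> absorbs the smaller idempotent. Its
    coefficient is -1, the product of the partial-trace ratio with \<open>c\<close> being 1.\<close>
  have bX: "b \<bullet> X = 0"
  proof -
    have WG: "(W n \<otimes> tl_id 2) \<bullet> G = G"
    proof -
      have "flip (W (Suc n) \<bullet> (W n \<otimes> tl_id 1)) = W (Suc n)"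
        unfolding IH(3) by (rule flip_wenzl)
      then have "(W n \<otimes> tl_id 1) \<bullet> W (Suc n) = W (Suc n)"
        by (simp add: flip_comp flip_tensor flip_wenzl)
      moreover have "W n \<otimes> tl_id 2 = (W n \<otimes> tl_id 1) \<otimes> tl_id 1"
        using id_tensor_id[of 1 1] by (simp add: tensor_assoc)
      moreover have "W n \<otimes> tl_id 1 \<in> tl_hom (Suc n) (Suc n)" by (rule hom_tensor[OF hom_wenzl hom_id]) simp_all
      ultimately show ?thesis
        unfolding G_def using interchange[OF hom_wenzl _ hom_id hom_id] id_comp[OF hom_id] by metis
    qed
    have "W n \<otimes> turn = b \<bullet> (W n \<otimes> tl_id 2)"
      unfolding b_def using interchange[OF hom_wenzl hom_id hom_id hom_turn] id_comp[OF hom_wenzl] comp_id[OF hom_turn] by metis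
    then have "b \<bullet> X = b \<bullet> G + scale (- (c * (Delta A (n + 1) / Delta A n))) (b \<bullet> G)"
      unfolding X using IH(4) WG by (simp add: tl_linear assoc[symmetric]) (simp add: assoc tl_linear)
    also have "c * (Delta A (n + 1) / Delta A n) = 1"
      using Delta_nonzero[of n] Delta_nonzero[of "n + 1"] by (simp add: c_def)
    finally show ?thesis using scale_add_left[of 1 "- 1" "b \<bullet> G"] by simp
  qed
  have Xb: "X \<bullet> b = 0"
    using arg_cong[where f = flip, OF bX] by (simp add: flip_comp fb fX flip_zero)
  have XX: "X \<bullet> X = X"
  proof -
    have "X \<bullet> X = X \<bullet> G + scale (- c) (X \<bullet> G \<bullet> b \<bullet> G)"
      by (subst (2) X) (simp add: tl_linear assoc)
    then show ?thesis by (simp add: XG Xb tl_linear)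
  qed
  \<comment> \<open>A cap on the last two strands is \<open>inverse \<delta>\<close> times a
    multiple of \<open>b\<close>; any other cap acts on the strands of \<open>G\<close> and is
    annihilated there.\<close>
  have capX: "cap_at p q \<bullet> X = 0" if pq: "p + 2 + q = Suc (Suc n)" for p q
  proof (cases q)
    case 0
    then have p: "p = n" using pq by simp
    have "scale \<delta> (cap_at n 0 \<bullet> X) = cap_at n 0 \<bullet> b \<bullet> X"
      unfolding b_def cap_at_turn by (simp add: tl_linear)
    also have "\<dots> = 0" by (simp add: assoc bX tl_linear)
    finally have "scale (inverse \<delta>) (scale \<delta> (cap_at n 0 \<bullet> X)) = 0" by simp
    then show ?thesis using loop_nonzero 0 p by simp
  next
    case (Suc q')
    then have pq': "p + 2 + q' = Suc n" using pq by simp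
    have cG: "cap_at p q \<bullet> G = 0"
      unfolding G_def Suc cap_at_Suc interchange[OF hom_wenzl hom_cap_at[OF pq' refl] hom_id hom_id] IH(2)[OF pq']
      by (simp add: tl_linear)
    show ?thesis unfolding X by (simp add: tl_linear assoc[symmetric] cG)
  qed
  \<comment> \<open>The partial trace of the new stage lives on \<open>n + 3\<close> strands:
    \<open>F\<close> is the previous idempotent with two extra strands, \<open>a\<close> and
    \<open>d\<close> are the last two generators.\<close>
  define F where "F = W (Suc n) \<otimes> tl_id 2"
  define a where "a = tl_id n \<otimes> (turn \<otimes> tl_id 1)"
  define d where "d = tl_id n \<otimes> (tl_id 1 \<otimes> turn)"
  have FG: "F = G \<otimes> tl_id 1" and ab: "a = b \<otimes> tl_id 1" and d: "d = tl_id (Suc n) \<otimes> turn"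
    using id_tensor_id[of 1 1] id_tensor_id[of n 1]
    by (simp_all add: F_def G_def a_def b_def d_def tensor_assoc[symmetric] Suc_eq_plus1)
      (simp add: tensor_assoc)
  have [simp]: "F \<in> tl" "a \<in> tl" "d \<in> tl" by (simp_all add: F_def a_def d_def)
  have X1: "X \<otimes> tl_id 1 = F + scale (- c) (F \<bullet> (a \<bullet> F))"
    unfolding X FG ab tl_linear interchange[OF hom_comp[OF hG hb] hG hom_id hom_id, symmetric, of A, unfolded id_comp[OF hom_id]]
      interchange[OF hG hb hom_id hom_id, symmetric, of A, unfolded id_comp[OF hom_id]]
    ..
  have FF: "F \<bullet> F = F"
    unfolding F_def interchange[OF hom_wenzl hom_wenzl hom_id hom_id] IH(1) id_comp[OF hom_id] ..
  define K where "K = W (Suc n) \<otimes> turn"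
  have Fd: "F \<bullet> d = K" and dF: "d \<bullet> F = K"
    unfolding F_def d K_def interchange[OF hom_wenzl hom_id hom_id hom_turn] interchange[OF hom_id hom_wenzl hom_turn hom_id]
      id_comp[OF hom_wenzl] comp_id[OF hom_wenzl] id_comp[OF hom_turn] comp_id[OF hom_turn] by (rule refl)+
  have dd: "d \<bullet> d = scale \<delta> d"
    unfolding d interchange[OF hom_id hom_id hom_turn hom_turn] id_comp[OF hom_id] turn_turn by (simp add: tl_linear)
  have dad: "d \<bullet> (a \<bullet> d) = d"
  proof -
    have h: "turn \<otimes> tl_id 1 \<in> tl_hom 3 3" "tl_id 1 \<otimes> turn \<in> tl_hom 3 3"
      by (rule hom_tensor[OF hom_turn hom_id] hom_tensor[OF hom_id hom_turn]; simp)+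
    show ?thesis
      unfolding a_def d_def interchange[OF hom_id hom_id h(2) h(1)] interchange[OF hom_id _ hom_comp[OF h(2) h(1)] h(2)]
        id_comp[OF hom_id] interchange[OF hom_id hom_id hom_comp[OF h(2) h(1)] h(2)] braid_turn ..
  qed
  \<comment> \<open>The term \<open>F\<close> contributes a closed loop. In the correction term
    \<open>d\<close> commutes with \<open>F\<close>, and the relation between the neighbouring
    generators \<open>d\<close> and \<open>a\<close> removes \<open>a\<close>.\<close>
  have main: "d \<bullet> ((X \<otimes> tl_id 1) \<bullet> d) = scale (\<delta> - c) K"
  proof -
    have "d \<bullet> (F \<bullet> d) = scale \<delta> K"
    proof -
      have "d \<bullet> (F \<bullet> d) = (d \<bullet> F) \<bullet> d" by (simp add: assoc)
      also have "\<dots> = F \<bullet> (d \<bullet> d)" unfolding dF Fd[symmetric] by (simp add: assoc)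
      finally show ?thesis by (simp add: dd tl_linear Fd)
    qed
    moreover have "d \<bullet> (F \<bullet> (a \<bullet> (F \<bullet> d))) = K"
    proof -
      have comm: "d \<bullet> F = F \<bullet> d" by (simp only: Fd dF)
      have "d \<bullet> (F \<bullet> (a \<bullet> (F \<bullet> d))) = (d \<bullet> F) \<bullet> (a \<bullet> (F \<bullet> d))" by (simp add: assoc)
      also have "\<dots> = (F \<bullet> d) \<bullet> (a \<bullet> (d \<bullet> F))" by (simp only: comm)
      also have "\<dots> = F \<bullet> ((d \<bullet> (a \<bullet> d)) \<bullet> F)" by (simp add: assoc)
      also have "\<dots> = F \<bullet> (F \<bullet> d)" unfolding dad comm ..
      also have "\<dots> = (F \<bullet> F) \<bullet> d" by (simp add: tl_comp_assoc)
      also have "\<dots> = K" unfolding FF Fd ..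
      finally show ?thesis .
    qed
    ultimately have "d \<bullet> ((X \<otimes> tl_id 1) \<bullet> d) = scale \<delta> K + scale (- c) K"
      unfolding X1 by (simp add: tl_linear assoc)
    then show ?thesis by (simp add: scale_add_left[symmetric])
  qed
  \<comment> \<open>The Chebyshev recursion turns the new partial-trace coefficient into the next
    ratio of \<open>Delta\<close> values.\<close>
  have "\<delta> - c = Delta A (Suc n + 1) / Delta A (Suc n)"
  proof -
    have e: "n + 1 = Suc n" and e2: "Suc n + 1 = n + 2" by simp_all
    have "\<delta> - c = (\<delta> * Delta A (Suc n) - Delta A n) / Delta A (Suc n)"
      unfolding c_def e using Delta_nonzero[of "Suc n"] by (simp add: diff_divide_distrib)
    then show ?thesis unfolding e2 Delta_Suc_Suc unfolding e .
  qed
  then show ?case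
    using Suc XX capX XG main unfolding X_def[symmetric] G_def[symmetric] K_def d by simp
qed

lemma wenzl_idem: "W n \<bullet> W n = W n"
  and cap_at_wenzl: "p + 2 + q = n \<Longrightarrow> cap_at p q \<bullet> W n = 0"
  using wenzl_invariants[of n] by auto

lemma cup_at_wenzl: "p + 2 + q = n \<Longrightarrow> W n \<bullet> cup_at p q = 0"
  using arg_cong[where f = flip, OF cap_at_wenzl[of p q n]] by (simp add: flip_comp flip_wenzl flip_zero)

text \<open>If stage \<open>n + 1\<close> vanished, the partial trace would give
  \<open>W n \<otimes> turn = 0\<close>. Closing \<open>turn\<close> by a cap and a cup produces
  \<delta> twice and leaves a non-zero multiple of \<open>W n\<close>.\<close>

lemma wenzl_nonzero: "W n \<noteq> 0"
proof (induction n)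
  case 0
  have "Poly_Mapping.lookup (W 0) (id_diagram 0) = 1" by (simp add: tl_id_def)
  then show ?case by auto
next
  case (Suc n)
  show ?case
  proof
    assume 0: "W (Suc n) = 0"
    have "scale (Delta A (n + 1) / Delta A n) (W n \<otimes> turn) = 0"
      using wenzl_invariants[of n] unfolding 0 by (simp add: tl_linear)
    then have "scale (Delta A n / Delta A (n + 1)) (scale (Delta A (n + 1) / Delta A n) (W n \<otimes> turn)) = 0" by simp
    then have Wt: "W n \<otimes> turn = 0"
      using Delta_nonzero[of n] Delta_nonzero[of "n + 1"] by simp
    have hc: "tl_cap 1 \<in> tl_hom 2 0" "tl_cup 1 \<in> tl_hom 0 2" by (rule hom_cap hom_cup; simp)+
    have "(tl_id n \<otimes> tl_cap 1) \<bullet> ((W n \<otimes> turn) \<bullet> (tl_id n \<otimes> tl_cup 1)) = W n \<otimes> (tl_cap 1 \<bullet> (turn \<bullet> tl_cup 1))"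
      unfolding interchange[OF hom_id hom_wenzl hc(2) hom_turn] comp_id[OF hom_wenzl]
        interchange[OF hom_wenzl hom_id hom_comp[OF hc(2) hom_turn] hc(1)] id_comp[OF hom_wenzl] ..
    also have "tl_cap 1 \<bullet> (turn \<bullet> tl_cup 1) = scale (\<delta> * \<delta>) (tl_id 0)"
      using cap_turn circle[of A] by (simp add: assoc[symmetric] tl_linear)
    finally have "scale (\<delta> * \<delta>) (W n) = 0"
      unfolding Wt by (simp add: tl_linear tensor_id_0)
    moreover have "W n = scale (inverse (\<delta> * \<delta>)) (scale (\<delta> * \<delta>) (W n))"
      using loop_nonzero by (simp add: field_simps)
    ultimately have "W n = 0" by simp
    then show False using Suc by simp
  qed
qed

lemma is_jones_wenzl_iff:
  "is_jones_wenzl A n f \<longleftrightarrow> f \<in> tl_hom n n \<and> f \<noteq> 0 \<and> f \<bullet> f = f \<and>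
    (\<forall>p q. p + 2 + q = n \<longrightarrow> cap_at p q \<bullet> f = 0 \<and> f \<bullet> cup_at p q = 0)"
proof -
  have "(\<forall>i. i + 2 \<le> n \<longrightarrow> P i (n - 2 - i)) \<longleftrightarrow> (\<forall>p q. p + 2 + q = n \<longrightarrow> P p q)" for P
    by (auto simp: le_iff_add)
  from this[of "\<lambda>p q. cap_at p q \<bullet> f = 0 \<and> f \<bullet> cup_at p q = 0"] show ?thesis
    unfolding is_jones_wenzl_def cap_at_def[symmetric] cup_at_def[symmetric] by (simp only:)
qed

lemma is_jones_wenzl_wenzl: "is_jones_wenzl A n (W n)"
  unfolding is_jones_wenzl_iff by (simp add: hom_wenzl wenzl_nonzero wenzl_idem cap_at_wenzl cup_at_wenzl)

lemma whisker_0: "x \<in> tl \<Longrightarrow> whisker 0 0 x = x"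
  by (simp add: whisker_def id_0_tensor tensor_id_0)

text \<open>By absorption, \<open>f\<close> and \<open>g\<close> act on endomorphisms by the
  coefficient of the identity. Idempotency makes their own coefficients 1, and evaluating
  \<open>f \<bullet> g\<close> from both sides gives equality.\<close>

lemma jones_wenzl_unique:
  assumes "is_jones_wenzl A n f" "is_jones_wenzl A n g"
  shows "f = g" "Poly_Mapping.lookup f (id_diagram n) = 1"
proof -
  note f = assms(1)[unfolded is_jones_wenzl_iff] and g = assms(2)[unfolded is_jones_wenzl_iff]
  have ft: "f \<in> tl" and gt: "g \<in> tl" using f g hom_tl by auto
  have left: "f \<bullet> x = scale (Poly_Mapping.lookup x (id_diagram n)) f" if x: "x \<in> tl_hom n n" for x
    using absorb_right[OF ft x, of 0 0] f hom_tl[OF x] comp_id[of f n n A] by (simp add: whisker_0)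
  have right: "x \<bullet> g = scale (Poly_Mapping.lookup x (id_diagram n)) g" if x: "x \<in> tl_hom n n" for x
    using absorb_left[OF gt x, of 0 0] g hom_tl[OF x] id_comp[of g n n A] by (simp add: whisker_0)
  have one: "c = 1" if eq: "scale c x = x" and ne: "x \<noteq> 0" for c and x :: tl_mor
  proof -
    obtain d where "Poly_Mapping.lookup x d \<noteq> 0" using ne by (metis lookup_zero poly_mapping_eqI)
    moreover have "c * Poly_Mapping.lookup x d = Poly_Mapping.lookup x d" using eq by (metis lookup_scale)
    ultimately show ?thesis by simp
  qed
  show 1: "Poly_Mapping.lookup f (id_diagram n) = 1" using left[of f] f one by metis
  have "Poly_Mapping.lookup g (id_diagram n) = 1" using right[of g] g one by metis
  then show "f = g" using left[of g] right[of f] 1 f g by simp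
qed

abbreviation "J n \<equiv> jones_wenzl A n"

lemma jones_wenzl_is: "is_jones_wenzl A n (J n)"
  unfolding jones_wenzl_def by (rule theI[where P = "is_jones_wenzl A n" and a = "W n", OF is_jones_wenzl_wenzl]) (rule jones_wenzl_unique(1)[OF _ is_jones_wenzl_wenzl])

lemma hom_J: "J n \<in> tl_hom n n" and J_idem: "J n \<bullet> J n = J n"
  and cap_at_J: "p + 2 + q = n \<Longrightarrow> cap_at p q \<bullet> J n = 0"
  and J_cup_at: "p + 2 + q = n \<Longrightarrow> J n \<bullet> cup_at p q = 0"
  using jones_wenzl_is[of n] unfolding is_jones_wenzl_iff by auto

lemma J_lookup: "Poly_Mapping.lookup (J n) (id_diagram n) = 1"
  by (rule jones_wenzl_unique(2)[OF jones_wenzl_is jones_wenzl_is])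

lemma tl_J [simp]: "J n \<in> tl"
  by (rule hom_tl[OF hom_J])

lemma flip_J [simp]: "flip (J n) = J n"
  using jones_wenzl_unique(1)[OF jones_wenzl_is is_jones_wenzl_wenzl] flip_wenzl by metis

lemma rotate_J [simp]: "rotation (J n) = J n"
proof -
  have "is_jones_wenzl A n (rotation (J n))"
    unfolding is_jones_wenzl_iff
  proof (intro conjI allI impI)
    show "rotation (J n) \<in> tl_hom n n" by (rule hom_rotate[OF hom_J])
    show "rotation (J n) \<noteq> 0"
      using rotate_rotate_tl[OF tl_J] rotate_zero jones_wenzl_is[of n] unfolding is_jones_wenzl_def by metis
    show "rotation (J n) \<bullet> rotation (J n) = rotation (J n)"
      using rotate_comp[of "J n" "J n" A] by (simp add: J_idem)
    fix p q assume "p + 2 + q = n"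
    then have pq: "q + 2 + p = n" by simp
    show "cap_at p q \<bullet> rotation (J n) = 0"
      using arg_cong[where f = rotation, OF J_cup_at[OF pq]] by (simp add: rotate_comp rotate_zero)
    show "rotation (J n) \<bullet> cup_at p q = 0"
      using arg_cong[where f = rotation, OF cap_at_J[OF pq]] by (simp add: rotate_comp rotate_zero)
  qed
  then show ?thesis by (rule jones_wenzl_unique(1)[OF _ jones_wenzl_is])
qed

end

section \<open>Crossings\<close>

fun opposite :: "over_strand \<Rightarrow> over_strand" where
  "opposite TopLeft = TopRight" | "opposite TopRight = TopLeft"

declare Suc_eq_plus1 [symmetric, simp] Suc_eq_plus1_left [symmetric, simp]

context generic
begin

text \<open>Treats both signs uniformly, the opposite crossing having the coefficients exchanged.
  The last equation is the definition of the loop value and is responsible for the Reidemeister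
  moves.\<close>

lemma crossing_form:
  obtains a b where "crossing A s = scale a (tl_id 2) + scale b turn"
    "crossing A (opposite s) = scale b (tl_id 2) + scale a turn" "a * b = 1" "a * a + b * b + \<delta> = 0"
proof (cases s)
  case TopLeft
  show thesis
    by (rule that[of "inverse A" A])
      (use A_nonzero in \<open>simp_all add: TopLeft turn_def add.commute loop_value_def power2_eq_square\<close>)
next
  case TopRight
  show thesis
    by (rule that[of A "inverse A"])
      (use A_nonzero in \<open>simp_all add: TopRight turn_def add.commute loop_value_def power2_eq_square\<close>)
qed

lemma hom_crossing: "crossing A s \<in> tl_hom 2 2"
  using crossing_form[of s] hom_add[OF hom_scale[OF hom_id] hom_scale[OF hom_turn]] by metis

lemma tl_crossing [simp]: "crossing A s \<in> tl"
  by (rule hom_tl[OF hom_crossing])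

text \<open>\<open>flip\<close> leaves coefficients alone. For pictures with crossings it is thus
  the half turn in space about a horizontal axis, which exchanges over and under, and not a plane
  reflection; this is why the sign is kept.\<close>

lemma flip_crossing [simp]: "flip (crossing A s) = crossing A s"
proof -
  obtain a b where "crossing A s = scale a (tl_id 2) + scale b turn" using crossing_form by metis
  then show ?thesis by (simp add: flip_add flip_scale del: crossing.simps)
qed

lemma rotate_crossing [simp]: "rotation (crossing A s) = crossing A s"
proof -
  obtain a b where "crossing A s = scale a (tl_id 2) + scale b turn" using crossing_form by metis
  then show ?thesis by (simp add: rotate_add rotate_scale del: crossing.simps)
qed

text \<open>The second Reidemeister move: in the product, \<open>turn\<close> has the coefficient a
  * a + b * b + \<delta>, which is 0.\<close>

lemma crossing_opposite: "crossing A s \<bullet> crossing A (opposite s) = tl_id 2"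
proof -
  obtain a b where ab: "crossing A s = scale a (tl_id 2) + scale b turn"
    "crossing A (opposite s) = scale b (tl_id 2) + scale a turn" "a * b = 1" "a * a + b * b + \<delta> = 0"
    by (rule crossing_form)
  have "crossing A s \<bullet> crossing A (opposite s) = scale (a * b) (tl_id 2) + scale (a * a + b * b + a * b * \<delta>) turn"
    unfolding ab(1,2) by (simp add: tl_linear id_comp[OF hom_id] id_comp[OF hom_turn] comp_id[OF hom_turn] turn_turn
        scale_add_right scale_add_left algebra_simps)
  then show ?thesis using ab(3,4) by simp
qed

text \<open>The Reidemeister move that pulls a turn-back through two crossings.\<close>

lemma crossing_turn:
  "((tl_id 1 \<otimes> crossing A s) \<bullet> (crossing A s \<otimes> tl_id 1)) \<bullet> (tl_id 1 \<otimes> turn) =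
   (turn \<otimes> tl_id 1) \<bullet> ((tl_id 1 \<otimes> crossing A s) \<bullet> (crossing A s \<otimes> tl_id 1))"
proof -
  obtain a b where ab: "crossing A s = scale a (tl_id 2) + scale b turn" "a * b = 1" "a * a + b * b + \<delta> = 0"
    by (rule crossing_form)
  define e where "e = turn \<otimes> tl_id 1"
  define f where "f = tl_id 1 \<otimes> turn"
  have he: "e \<in> tl_hom 3 3" unfolding e_def by (rule hom_tensor[OF hom_turn hom_id]) simp_all
  have hf: "f \<in> tl_hom 3 3" unfolding f_def by (rule hom_tensor[OF hom_id hom_turn]) simp_all
  note [simp] = hom_tl[OF he] hom_tl[OF hf]
  have ee: "e \<bullet> e = scale \<delta> e" "f \<bullet> f = scale \<delta> f"
    unfolding e_def f_def interchange[OF hom_turn hom_turn hom_id hom_id] interchange[OF hom_id hom_id hom_turn hom_turn]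
      turn_turn id_comp[OF hom_id] by (simp_all add: tl_linear)
  have efe: "e \<bullet> (f \<bullet> e) = e" "f \<bullet> (e \<bullet> f) = f"
    unfolding e_def f_def by (rule braid_turn)+
  have ids: "tl_id 1 \<otimes> tl_id 2 = tl_id 3" "tl_id 2 \<otimes> tl_id 1 = tl_id 3"
    using id_tensor_id[of 1 2] id_tensor_id[of 2 1] by simp_all
  have x: "tl_id 1 \<otimes> crossing A s = scale a (tl_id 3) + scale b f" "crossing A s \<otimes> tl_id 1 = scale a (tl_id 3) + scale b e"
    unfolding ab(1) by (simp_all add: tl_linear ids e_def f_def)
  have "((tl_id 1 \<otimes> crossing A s) \<bullet> (crossing A s \<otimes> tl_id 1)) \<bullet> f = scale (a * a + b * b + a * b * \<delta>) f + scale (a * b) (e \<bullet> f)"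
    unfolding x by (simp add: tl_linear assoc id_comp[OF hf] id_comp[OF hom_comp[OF hf he]] ee efe
        scale_add_right scale_add_left algebra_simps)
  moreover have "e \<bullet> ((tl_id 1 \<otimes> crossing A s) \<bullet> (crossing A s \<otimes> tl_id 1)) = scale (a * a + b * b + a * b * \<delta>) e + scale (a * b) (e \<bullet> f)"
    unfolding x by (simp add: tl_linear assoc id_comp[OF he] id_comp[OF hom_id] comp_id[OF he] comp_id[OF hf] ee efe
        scale_add_right scale_add_left algebra_simps)
  ultimately show ?thesis using ab(2,3) unfolding e_def[symmetric] f_def[symmetric] by simp
qed

section \<open>Crossings of cables: symmetries and inverses\<close>

abbreviation "S s b \<equiv> strand_crossing A s b"
abbreviation "X s a b \<equiv> cable_crossing A s a b"

lemma hom_S: "S s b \<in> tl_hom (b + 1) (b + 1)"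
proof (induction b)
  case 0
  then show ?case using hom_id[of 1] by (simp add: One_nat_def[symmetric])
next
  case (Suc b)
  have "S s b \<otimes> tl_id 1 \<in> tl_hom (Suc b + 1) (Suc b + 1)" by (rule hom_tensor[OF Suc hom_id]) simp_all
  moreover have "tl_id b \<otimes> crossing A s \<in> tl_hom (Suc b + 1) (Suc b + 1)" by (rule hom_tensor[OF hom_id hom_crossing]) simp_all
  ultimately show ?case unfolding strand_crossing.simps by (rule hom_comp)
qed

lemma hom_X: "X s a b \<in> tl_hom (a + b) (a + b)"
proof (induction a)
  case 0
  then show ?case using hom_id[of b] by simp
next
  case (Suc a)
  have "X s a b \<otimes> tl_id 1 \<in> tl_hom (Suc a + b) (Suc a + b)" by (rule hom_tensor[OF Suc hom_id]) simp_all
  moreover have "tl_id a \<otimes> S s b \<in> tl_hom (Suc a + b) (Suc a + b)" by (rule hom_tensor[OF hom_id hom_S]) simp_all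
  ultimately show ?case unfolding cable_crossing.simps by (rule hom_comp[rotated])
qed

lemma tl_S [simp]: "S s b \<in> tl" and tl_X [simp]: "X s a b \<in> tl"
  by (rule hom_tl[OF hom_S], rule hom_tl[OF hom_X])

lemma id_Suc: "tl_id (Suc n) = tl_id n \<otimes> tl_id 1" "tl_id (Suc n) = tl_id 1 \<otimes> tl_id n"
  by (simp_all add: id_tensor_id)

lemma tensor_id_comp:
  assumes "f \<in> tl_hom m n" "g \<in> tl_hom n p"
  shows "(g \<bullet> f) \<otimes> tl_id k = (g \<otimes> tl_id k) \<bullet> (f \<otimes> tl_id k)"
    and "tl_id k \<otimes> (g \<bullet> f) = (tl_id k \<otimes> g) \<bullet> (tl_id k \<otimes> f)"
  unfolding interchange[OF assms hom_id hom_id] interchange[OF hom_id hom_id assms] id_comp[OF hom_id] by (rule refl)+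

lemma tensor_commute:
  assumes "f \<in> tl_hom m n" "g \<in> tl_hom m' n'"
  shows "(f \<otimes> tl_id n') \<bullet> (tl_id m \<otimes> g) = f \<otimes> g" "(tl_id n \<otimes> g) \<bullet> (f \<otimes> tl_id m') = f \<otimes> g"
  unfolding interchange[OF hom_id assms(1) assms(2) hom_id] interchange[OF assms(1) hom_id hom_id assms(2)]
    id_comp[OF assms(1)] id_comp[OF assms(2)] comp_id[OF assms(1)] comp_id[OF assms(2)] by (rule refl)+

lemma S_1: "S s 1 = crossing A s"
proof -
  have "tl_id 1 \<otimes> tl_id 1 = tl_id 2" using id_tensor_id[of 1 1] by simp
  moreover have "S s 1 = (tl_id 0 \<otimes> crossing A s) \<bullet> (tl_id 1 \<otimes> tl_id 1)"
    using strand_crossing.simps(2)[of A s 0] by (simp only: One_nat_def[symmetric] strand_crossing.simps(1))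
  ultimately show ?thesis
    using comp_id[OF hom_crossing] by (simp add: id_0_tensor del: crossing.simps)
qed

text \<open>The recursion read from the other end, with the first crossing split off instead of the
  last. A half turn carries one recursion into the other.\<close>

lemma S_Suc': "S s (Suc b) = (tl_id 1 \<otimes> S s b) \<bullet> (crossing A s \<otimes> tl_id b)"
proof (induction b)
  case 0
  have "tl_id 1 \<otimes> tl_id 1 = tl_id 2" using id_tensor_id[of 1 1] by simp
  then show ?case using S_1[of s] id_comp[OF hom_crossing]
    by (simp add: One_nat_def[symmetric] tensor_id_0 del: crossing.simps strand_crossing.simps(2))
next
  case (Suc b)
  have hxb: "tl_id b \<otimes> crossing A s \<in> tl_hom (b + 2) (b + 2)" by (rule hom_tensor[OF hom_id hom_crossing]) simp_all
  have hSb: "S s b \<otimes> tl_id 1 \<in> tl_hom (b + 2) (b + 2)" by (rule hom_tensor[OF hom_S hom_id]) simp_all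
  have hcb: "crossing A s \<otimes> tl_id b \<in> tl_hom (b + 2) (b + 2)" by (rule hom_tensor[OF hom_crossing hom_id]) simp_all
  have hSb': "tl_id 1 \<otimes> S s b \<in> tl_hom (b + 2) (b + 2)" by (rule hom_tensor[OF hom_id hom_S]) simp_all
  have "S s (Suc (Suc b)) = (tl_id (Suc b) \<otimes> crossing A s) \<bullet> (((tl_id 1 \<otimes> S s b) \<bullet> (crossing A s \<otimes> tl_id b)) \<otimes> tl_id 1)"
    using Suc by simp
  also have "\<dots> = ((tl_id 1 \<otimes> (tl_id b \<otimes> crossing A s)) \<bullet> (tl_id 1 \<otimes> (S s b \<otimes> tl_id 1))) \<bullet> (crossing A s \<otimes> tl_id (Suc b))"
  proof -
    have "tl_id b \<otimes> tl_id 1 = tl_id 1 \<otimes> tl_id b" by (simp add: id_tensor_id)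
    then show ?thesis
      unfolding tensor_id_comp(1)[OF hcb hSb'] id_Suc(2)[of b]
      by (simp add: assoc tensor_assoc del: crossing.simps)
  qed
  also have "\<dots> = (tl_id 1 \<otimes> S s (Suc b)) \<bullet> (crossing A s \<otimes> tl_id (Suc b))"
    unfolding tensor_id_comp(2)[OF hSb hxb, symmetric] by simp
  finally show ?case .
qed

lemma rotate_S: "rotation (S s b) = S s b"
proof (induction b)
  case (Suc b)
  have "rotation (S s (Suc b)) = (tl_id 1 \<otimes> S s b) \<bullet> (crossing A s \<otimes> tl_id b)"
    using Suc by (simp add: rotate_comp rotate_tensor del: crossing.simps)
  then show ?case by (simp only: S_Suc')
qed simp

text \<open>Splits off the leftmost strand of the left cable, whereas the definition splits off the
  rightmost one. The half turn exchanges the two recursions.\<close>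

lemma X_Suc': "X s (Suc a) b = (S s b \<otimes> tl_id a) \<bullet> (tl_id 1 \<otimes> X s a b)"
proof (induction a)
  case 0
  have "X s (Suc 0) b = (tl_id b \<otimes> tl_id 1) \<bullet> (tl_id 0 \<otimes> S s b)" by simp
  also have "\<dots> = S s b" using id_comp[OF hom_S] by (simp add: id_0_tensor id_tensor_id)
  finally show ?case using comp_id[OF hom_S] by (simp add: tensor_id_0 id_tensor_id add.commute)
next
  case (Suc a)
  have h1: "tl_id 1 \<otimes> X s a b \<in> tl_hom (a + b + 1) (a + b + 1)" by (rule hom_tensor[OF hom_id hom_X]) simp_all
  have h2: "S s b \<otimes> tl_id a \<in> tl_hom (a + b + 1) (a + b + 1)" by (rule hom_tensor[OF hom_S hom_id]) simp_all
  have h3: "X s a b \<otimes> tl_id 1 \<in> tl_hom (a + b + 1) (a + b + 1)" by (rule hom_tensor[OF hom_X hom_id]) simp_all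
  have h4: "tl_id a \<otimes> S s b \<in> tl_hom (a + b + 1) (a + b + 1)" by (rule hom_tensor[OF hom_id hom_S]) simp_all
  have "X s (Suc (Suc a)) b = (((S s b \<otimes> tl_id a) \<bullet> (tl_id 1 \<otimes> X s a b)) \<otimes> tl_id 1) \<bullet> (tl_id (Suc a) \<otimes> S s b)"
    unfolding Suc[symmetric] by simp
  also have "\<dots> = (S s b \<otimes> tl_id (Suc a)) \<bullet> ((tl_id 1 \<otimes> (X s a b \<otimes> tl_id 1)) \<bullet> (tl_id 1 \<otimes> (tl_id a \<otimes> S s b)))"
  proof -
    have "tl_id a \<otimes> tl_id 1 = tl_id 1 \<otimes> tl_id a" by (simp add: id_tensor_id)
    then show ?thesis
      unfolding tensor_id_comp(1)[OF h1 h2] id_Suc(2)[of a]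
      by (simp add: assoc tensor_assoc)
  qed
  also have "\<dots> = (S s b \<otimes> tl_id (Suc a)) \<bullet> (tl_id 1 \<otimes> X s (Suc a) b)"
    unfolding tensor_id_comp(2)[OF h4 h3, symmetric] by simp
  finally show ?case .
qed

lemma rotate_X: "rotation (X s a b) = X s a b"
proof (induction a)
  case (Suc a)
  have "rotation (X s (Suc a) b) = (S s b \<otimes> tl_id a) \<bullet> (tl_id 1 \<otimes> X s a b)"
    using Suc by (simp add: rotate_comp rotate_tensor rotate_S)
  then show ?case by (simp only: X_Suc')
qed simp

lemma X_0_right: "X s a 0 = tl_id a"
proof (induction a)
  case (Suc a)
  then show ?case using id_comp[OF hom_id] by (simp add: id_tensor_id)
qed simp

lemma X_Suc_1: "X s (Suc a) 1 = (X s a 1 \<otimes> tl_id 1) \<bullet> (tl_id a \<otimes> crossing A s)"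
  using S_1[of s] by simp

text \<open>Splits off a strand of the other cable. Reflection exchanges the roles of the two
  cables, so \<open>flip_X\<close> and \<open>X_opposite\<close> compare this recursion with the
  defining one.\<close>

lemma X_Suc_right: "X s a (Suc b) = (tl_id b \<otimes> X s a 1) \<bullet> (X s a b \<otimes> tl_id 1)"
proof (induction a)
  case 0
  then show ?case using id_comp[OF hom_id] by (simp add: id_tensor_id)
next
  case (Suc a)
  have hA: "tl_id b \<otimes> X s a 1 \<in> tl_hom (a + b + 1) (a + b + 1)" by (rule hom_tensor[OF hom_id hom_X]) simp_all
  have hB: "X s a b \<otimes> tl_id 1 \<in> tl_hom (a + b + 1) (a + b + 1)" by (rule hom_tensor[OF hom_X hom_id]) simp_all
  have hC: "tl_id b \<otimes> crossing A s \<in> tl_hom (b + 2) (b + 2)" by (rule hom_tensor[OF hom_id hom_crossing]) simp_all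
  have hD: "S s b \<otimes> tl_id 1 \<in> tl_hom (b + 2) (b + 2)" by (rule hom_tensor[OF hom_S hom_id]) simp_all
  have hE: "tl_id a \<otimes> S s b \<in> tl_hom (a + b + 1) (a + b + 1)" by (rule hom_tensor[OF hom_id hom_S]) simp_all
  have hF: "X s a 1 \<otimes> tl_id 1 \<in> tl_hom (a + 2) (a + 2)" by (rule hom_tensor[OF hom_X hom_id]) simp_all
  have hG: "tl_id a \<otimes> crossing A s \<in> tl_hom (a + 2) (a + 2)" by (rule hom_tensor[OF hom_id hom_crossing]) simp_all
  have t2: "x \<otimes> tl_id 1 \<otimes> tl_id 1 = x \<otimes> tl_id 2" if "x \<in> tl" for x
    using that id_tensor_id[of 1 1] by (simp add: tensor_assoc)
  have ab: "tl_id (a + b) = tl_id a \<otimes> tl_id b" "tl_id (a + b) = tl_id b \<otimes> tl_id a"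
    by (simp_all add: id_tensor_id add.commute)
  have "X s (Suc a) (Suc b) = (((tl_id b \<otimes> X s a 1) \<bullet> (X s a b \<otimes> tl_id 1)) \<otimes> tl_id 1) \<bullet>
      (tl_id a \<otimes> ((tl_id b \<otimes> crossing A s) \<bullet> (S s b \<otimes> tl_id 1)))"
    unfolding Suc[symmetric] by simp
  also have "\<dots> = (tl_id b \<otimes> (X s a 1 \<otimes> tl_id 1)) \<bullet> (((X s a b \<otimes> tl_id 2) \<bullet> (tl_id (a + b) \<otimes> crossing A s)) \<bullet>
      ((tl_id a \<otimes> S s b) \<otimes> tl_id 1))"
    unfolding tensor_id_comp(1)[OF hB hA] tensor_id_comp(2)[OF hD hC] t2[OF tl_X] ab(1)
    by (simp add: assoc tensor_assoc del: crossing.simps)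
  \<comment> \<open>Far commutativity: the cable crossing and the new crossing act on disjoint
    strands.\<close>
  also have "(X s a b \<otimes> tl_id 2) \<bullet> (tl_id (a + b) \<otimes> crossing A s) = (tl_id (a + b) \<otimes> crossing A s) \<bullet> (X s a b \<otimes> tl_id 2)"
    unfolding tensor_commute[OF hom_X hom_crossing] ..
  also have "(tl_id b \<otimes> (X s a 1 \<otimes> tl_id 1)) \<bullet> (((tl_id (a + b) \<otimes> crossing A s) \<bullet> (X s a b \<otimes> tl_id 2)) \<bullet> ((tl_id a \<otimes> S s b) \<otimes> tl_id 1)) =
      ((tl_id b \<otimes> (X s a 1 \<otimes> tl_id 1)) \<bullet> (tl_id b \<otimes> (tl_id a \<otimes> crossing A s))) \<bullet> (((X s a b \<otimes> tl_id 1) \<otimes> tl_id 1) \<bullet> ((tl_id a \<otimes> S s b) \<otimes> tl_id 1))"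
    unfolding t2[OF tl_X] ab(2) by (simp add: assoc tensor_assoc del: crossing.simps)
  also have "\<dots> = (tl_id b \<otimes> X s (Suc a) 1) \<bullet> (X s (Suc a) b \<otimes> tl_id 1)"
    unfolding tensor_id_comp(1)[OF hE hB, symmetric] tensor_id_comp(2)[OF hG hF, symmetric] X_Suc_1 by simp
  finally show ?case .
qed

lemma flip_S: "flip (S s b) = X s b 1"
proof (induction b)
  case (Suc b)
  then show ?case unfolding X_Suc_1 by (simp add: flip_comp flip_tensor del: crossing.simps)
qed simp

lemma flip_X: "flip (X s a b) = X s b a"
proof (induction a)
  case 0
  then show ?case by (simp add: X_0_right)
next
  case (Suc a)
  then show ?case unfolding X_Suc_right[of s b a] by (simp add: flip_comp flip_tensor flip_S)
qed

lemma S_opposite: "S s b \<bullet> X (opposite s) b 1 = tl_id (b + 1)"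
proof (induction b)
  case 0
  then show ?case using id_comp[OF hom_id] by (simp add: One_nat_def[symmetric])
next
  case (Suc b)
  have h: "S s b \<bullet> X (opposite s) b 1 \<in> tl_hom (b + 1) (b + 1)" by (rule hom_comp[OF hom_X hom_S])
  have hx: "tl_id b \<otimes> crossing A s' \<in> tl_hom (b + 2) (b + 2)" for s' by (rule hom_tensor[OF hom_id hom_crossing]) simp_all
  have "S s (Suc b) \<bullet> X (opposite s) (Suc b) 1 =
    (tl_id b \<otimes> crossing A s) \<bullet> (((S s b \<otimes> tl_id 1) \<bullet> (X (opposite s) b 1 \<otimes> tl_id 1)) \<bullet> (tl_id b \<otimes> crossing A (opposite s)))"
    unfolding X_Suc_1 by (simp add: assoc del: crossing.simps cable_crossing.simps)
  also have "(S s b \<otimes> tl_id 1) \<bullet> (X (opposite s) b 1 \<otimes> tl_id 1) = tl_id (b + 2)"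
    unfolding tensor_id_comp(1)[OF hom_X hom_S, symmetric] Suc by (simp add: id_tensor_id)
  also have "(tl_id b \<otimes> crossing A s) \<bullet> (tl_id (b + 2) \<bullet> (tl_id b \<otimes> crossing A (opposite s))) = tl_id b \<otimes> tl_id 2"
    unfolding id_comp[OF hx] tensor_id_comp(2)[OF hom_crossing hom_crossing, symmetric] crossing_opposite ..
  finally show ?case by (simp add: id_tensor_id)
qed

text \<open>The second Reidemeister move for cables. Expanding one crossing along its left and the
  other along its right cable puts two opposite strand crossings next to each other, and they cancel
  from the inside.\<close>

lemma X_opposite: "X s a b \<bullet> X (opposite s) b a = tl_id (a + b)"
proof (induction a)
  case 0
  then show ?case using id_comp[OF hom_id] by (simp add: X_0_right)
next
  case (Suc a)
  have h: "X (opposite s) b a \<in> tl_hom (a + b) (a + b)" using hom_X[of "opposite s" b a] by (simp add: add.commute)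
  have h': "X (opposite s) b a \<otimes> tl_id 1 \<in> tl_hom (a + (b + 1)) (a + (b + 1))" by (rule hom_tensor[OF h hom_id]) simp_all
  have "X s (Suc a) b \<bullet> X (opposite s) b (Suc a) =
    (X s a b \<otimes> tl_id 1) \<bullet> (((tl_id a \<otimes> S s b) \<bullet> (tl_id a \<otimes> X (opposite s) b 1)) \<bullet> (X (opposite s) b a \<otimes> tl_id 1))"
    unfolding X_Suc_right[of "opposite s" b a] by (simp add: assoc)
  also have "(tl_id a \<otimes> S s b) \<bullet> (tl_id a \<otimes> X (opposite s) b 1) = tl_id (a + (b + 1))"
    unfolding tensor_id_comp(2)[OF hom_X hom_S, symmetric] S_opposite by (simp add: id_tensor_id)
  also have "(X s a b \<otimes> tl_id 1) \<bullet> (tl_id (a + (b + 1)) \<bullet> (X (opposite s) b a \<otimes> tl_id 1)) = tl_id (Suc a + b)"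
    unfolding id_comp[OF h'] tensor_id_comp(1)[OF h hom_X, symmetric] Suc by (simp add: id_tensor_id)
  finally show ?case .
qed

text \<open>Unlike a cap or a cup, this form of a turn-back keeps the number of strands, so that it
  can be moved through a cable crossing without changing the width of the cable.\<close>

definition turn_at :: "nat \<Rightarrow> nat \<Rightarrow> tl_mor" where
  "turn_at p q = tl_id p \<otimes> turn \<otimes> tl_id q"

lemma hom_turn_at: "p + 2 + q = n \<Longrightarrow> turn_at p q \<in> tl_hom n n"
  unfolding turn_at_def by (rule hom_tensor[OF hom_tensor'[OF hom_id hom_turn] hom_id]) simp_all

lemma tl_turn_at [simp]: "turn_at p q \<in> tl"
  by (simp add: turn_at_def)

lemma flip_turn_at [simp]: "flip (turn_at p q) = turn_at p q"
  by (simp add: turn_at_def flip_tensor)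

lemma turn_at_eq: "turn_at p q = cup_at p q \<bullet> cap_at p q"
  unfolding turn_at_def cap_at_def cup_at_def turn_def
  by (simp only: tensor_id_comp[OF hom_tensor'[OF hom_id hom_cap[OF refl]] hom_tensor'[OF hom_id hom_cup[OF refl]]]
      tensor_id_comp(2)[OF hom_cap[OF refl] hom_cup[OF refl]])

lemma cap_at_turn_at: "cap_at p q \<bullet> turn_at p q = scale \<delta> (cap_at p q)"
proof -
  have hc: "tl_cap 1 \<in> tl_hom 2 0" by (rule hom_cap) simp
  show ?thesis
    unfolding turn_at_def cap_at_def tensor_id_comp(1)[OF hom_tensor'[OF hom_id hom_turn] hom_tensor'[OF hom_id hc], symmetric]
      tensor_id_comp(2)[OF hom_turn hc, symmetric] cap_turn by (simp add: tl_linear)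
qed

lemma turn_at_cup_at: "turn_at p q \<bullet> cup_at p q = scale \<delta> (cup_at p q)"
  using arg_cong[where f = flip, OF cap_at_turn_at[of p q]] by (simp add: flip_comp flip_scale)

text \<open>If the turn-back sits on the last two strands, this is the move
  \<open>crossing_turn\<close>. Otherwise the last crossing is far from it and commutes, so the
  induction runs over the strands to its right.\<close>

lemma S_turn_at: "p + 2 + q = b \<Longrightarrow> S s b \<bullet> (tl_id 1 \<otimes> turn_at p q) = (turn_at p q \<otimes> tl_id 1) \<bullet> S s b"
proof (induction q arbitrary: b)
  case 0
  then have b: "b = Suc (Suc p)" by simp
  let ?x = "crossing A s"
  have t2: "x \<otimes> tl_id 1 \<otimes> tl_id 1 = x \<otimes> tl_id 2" if "x \<in> tl" for x
    using that id_tensor_id[of 1 1] by (simp add: tensor_assoc)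
  have h1: "tl_id p \<otimes> ?x \<in> tl_hom (p + 2) (p + 2)" by (rule hom_tensor[OF hom_id hom_crossing]) simp_all
  have h2: "S s p \<otimes> tl_id 1 \<in> tl_hom (p + 2) (p + 2)" by (rule hom_tensor[OF hom_S hom_id]) simp_all
  have h3: "tl_id 1 \<otimes> ?x \<in> tl_hom 3 3" "?x \<otimes> tl_id 1 \<in> tl_hom 3 3" "turn \<otimes> tl_id 1 \<in> tl_hom 3 3" "tl_id 1 \<otimes> turn \<in> tl_hom 3 3"
    by (rule hom_tensor[OF hom_id hom_crossing] hom_tensor[OF hom_crossing hom_id] hom_tensor[OF hom_turn hom_id] hom_tensor[OF hom_id hom_turn]; simp)+
  define Y where "Y = (tl_id 1 \<otimes> ?x) \<bullet> (?x \<otimes> tl_id 1)"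
  have hY: "Y \<in> tl_hom 3 3" unfolding Y_def by (rule hom_comp[OF h3(2,1)])
  have Sb: "S s b = (tl_id p \<otimes> Y) \<bullet> (S s p \<otimes> tl_id 2)"
  proof -
    have "S s b = (tl_id (Suc p) \<otimes> ?x) \<bullet> (((tl_id p \<otimes> ?x) \<otimes> tl_id 1) \<bullet> (S s p \<otimes> tl_id 1 \<otimes> tl_id 1))"
      unfolding b by (simp add: tensor_id_comp(1)[OF h2 h1] del: crossing.simps)
    then show ?thesis
      unfolding t2[OF tl_S] id_Suc(1)[of p] Y_def tensor_id_comp(2)[OF h3(2,1)]
      by (simp add: assoc tensor_assoc del: crossing.simps)
  qed
  have T: "turn_at p 0 = tl_id p \<otimes> turn" by (simp add: turn_at_def tensor_id_0)
  have T1: "tl_id 1 \<otimes> turn_at p 0 = tl_id (p + 1) \<otimes> turn" "tl_id (p + 1) \<otimes> turn = tl_id p \<otimes> (tl_id 1 \<otimes> turn)"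
    unfolding T by (simp_all add: tensor_assoc[symmetric] id_tensor_id add.commute)
  have T2: "turn_at p 0 \<otimes> tl_id 1 = tl_id p \<otimes> (turn \<otimes> tl_id 1)"
    unfolding T by (simp add: tensor_assoc)
  have [simp]: "Y \<in> tl" by (rule hom_tl[OF hY])
  have "S s b \<bullet> (tl_id 1 \<otimes> turn_at p 0) = (tl_id p \<otimes> Y) \<bullet> ((S s p \<otimes> tl_id 2) \<bullet> (tl_id (p + 1) \<otimes> turn))"
    unfolding Sb T1(1) by (simp add: assoc)
  also have "\<dots> = (tl_id p \<otimes> Y) \<bullet> ((tl_id (p + 1) \<otimes> turn) \<bullet> (S s p \<otimes> tl_id 2))"
    unfolding tensor_commute[OF hom_S hom_turn] ..
  also have "\<dots> = (tl_id p \<otimes> (Y \<bullet> (tl_id 1 \<otimes> turn))) \<bullet> (S s p \<otimes> tl_id 2)"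
    unfolding T1(2) tensor_id_comp(2)[OF h3(4) hY] by (simp add: assoc)
  also have "Y \<bullet> (tl_id 1 \<otimes> turn) = (turn \<otimes> tl_id 1) \<bullet> Y"
    unfolding Y_def by (rule crossing_turn)
  also have "(tl_id p \<otimes> ((turn \<otimes> tl_id 1) \<bullet> Y)) \<bullet> (S s p \<otimes> tl_id 2) = (turn_at p 0 \<otimes> tl_id 1) \<bullet> S s b"
    unfolding Sb T2 tensor_id_comp(2)[OF hY h3(3)] by (simp add: assoc)
  finally show ?case .
next
  case (Suc q)
  obtain b' where b: "b = Suc b'" and b': "p + 2 + q = b'" using Suc.prems by (cases b) auto
  note hT = hom_turn_at[OF b']
  have T: "turn_at p (Suc q) = turn_at p q \<otimes> tl_id 1"
    unfolding turn_at_def id_Suc(1)[of q] by (simp add: tensor_assoc)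
  have h1: "tl_id 1 \<otimes> turn_at p q \<in> tl_hom (b' + 1) (b' + 1)" by (rule hom_tensor[OF hom_id hT]) simp_all
  have h2: "turn_at p q \<otimes> tl_id 1 \<in> tl_hom (b' + 1) (b' + 1)" by (rule hom_tensor[OF hT hom_id]) simp_all
  have t2: "x \<otimes> tl_id 1 \<otimes> tl_id 1 = x \<otimes> tl_id 2" if "x \<in> tl" for x
    using that id_tensor_id[of 1 1] by (simp add: tensor_assoc)
  have "S s b \<bullet> (tl_id 1 \<otimes> turn_at p (Suc q)) =
      (tl_id b' \<otimes> crossing A s) \<bullet> ((S s b' \<otimes> tl_id 1) \<bullet> ((tl_id 1 \<otimes> turn_at p q) \<otimes> tl_id 1))"
    unfolding b T by (simp add: assoc tensor_assoc del: crossing.simps)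
  also have "(S s b' \<otimes> tl_id 1) \<bullet> ((tl_id 1 \<otimes> turn_at p q) \<otimes> tl_id 1) =
      (turn_at p q \<otimes> tl_id 2) \<bullet> (S s b' \<otimes> tl_id 1)"
    unfolding tensor_id_comp(1)[OF h1 hom_S, symmetric] Suc.IH[OF b'] tensor_id_comp(1)[OF hom_S h2] t2[OF tl_turn_at] ..
  also have "(tl_id b' \<otimes> crossing A s) \<bullet> ((turn_at p q \<otimes> tl_id 2) \<bullet> (S s b' \<otimes> tl_id 1)) =
      ((tl_id b' \<otimes> crossing A s) \<bullet> (turn_at p q \<otimes> tl_id 2)) \<bullet> (S s b' \<otimes> tl_id 1)"
    by (simp add: assoc del: crossing.simps)
  also have "(tl_id b' \<otimes> crossing A s) \<bullet> (turn_at p q \<otimes> tl_id 2) = (turn_at p q \<otimes> tl_id 2) \<bullet> (tl_id b' \<otimes> crossing A s)"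
    unfolding tensor_commute[OF hT hom_crossing] ..
  also have "\<dots> \<bullet> (S s b' \<otimes> tl_id 1) = (turn_at p (Suc q) \<otimes> tl_id 1) \<bullet> S s b"
    unfolding b T t2[OF tl_turn_at] by (simp add: assoc del: crossing.simps)
  finally show ?case .
qed

lemma X_turn_at_right:
  assumes "p + 2 + q = b"
  shows "X s a b \<bullet> (tl_id a \<otimes> turn_at p q) = (turn_at p q \<otimes> tl_id a) \<bullet> X s a b"
proof (induction a)
  case 0
  show ?case using id_comp[OF hom_turn_at[OF assms]] comp_id[OF hom_turn_at[OF assms]]
    by (simp add: id_0_tensor tensor_id_0)
next
  case (Suc a)
  note hT = hom_turn_at[OF assms]
  have h1: "tl_id 1 \<otimes> turn_at p q \<in> tl_hom (b + 1) (b + 1)" by (rule hom_tensor[OF hom_id hT]) simp_all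
  have h2: "turn_at p q \<otimes> tl_id 1 \<in> tl_hom (b + 1) (b + 1)" by (rule hom_tensor[OF hT hom_id]) simp_all
  have h3: "tl_id a \<otimes> turn_at p q \<in> tl_hom (a + b) (a + b)" by (rule hom_tensor[OF hom_id hT]) simp_all
  have h4: "turn_at p q \<otimes> tl_id a \<in> tl_hom (a + b) (a + b)" by (rule hom_tensor[OF hT hom_id]) simp_all
  have "X s (Suc a) b \<bullet> (tl_id (Suc a) \<otimes> turn_at p q) =
      (X s a b \<otimes> tl_id 1) \<bullet> ((tl_id a \<otimes> S s b) \<bullet> (tl_id a \<otimes> (tl_id 1 \<otimes> turn_at p q)))"
    unfolding id_Suc(1)[of a] by (simp add: assoc tensor_assoc)
  also have "(tl_id a \<otimes> S s b) \<bullet> (tl_id a \<otimes> (tl_id 1 \<otimes> turn_at p q)) =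
      ((tl_id a \<otimes> turn_at p q) \<otimes> tl_id 1) \<bullet> (tl_id a \<otimes> S s b)"
    unfolding tensor_id_comp(2)[OF h1 hom_S, symmetric] S_turn_at[OF assms] tensor_id_comp(2)[OF hom_S h2]
    by (simp add: tensor_assoc)
  also have "(X s a b \<otimes> tl_id 1) \<bullet> (((tl_id a \<otimes> turn_at p q) \<otimes> tl_id 1) \<bullet> (tl_id a \<otimes> S s b)) =
      ((X s a b \<otimes> tl_id 1) \<bullet> ((tl_id a \<otimes> turn_at p q) \<otimes> tl_id 1)) \<bullet> (tl_id a \<otimes> S s b)"
    by (simp add: assoc)
  also have "(X s a b \<otimes> tl_id 1) \<bullet> ((tl_id a \<otimes> turn_at p q) \<otimes> tl_id 1) = (turn_at p q \<otimes> tl_id (Suc a)) \<bullet> (X s a b \<otimes> tl_id 1)"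
    unfolding tensor_id_comp(1)[OF h3 hom_X, symmetric] Suc tensor_id_comp(1)[OF hom_X h4] id_Suc(1)[of a]
    by (simp add: tensor_assoc)
  finally show ?case by (simp add: assoc)
qed

text \<open>Reflecting \<open>X_turn_at_right\<close> exchanges the two cables.\<close>

lemma X_turn_at_left:
  assumes "p + 2 + q = a"
  shows "X s a b \<bullet> (turn_at p q \<otimes> tl_id b) = (tl_id b \<otimes> turn_at p q) \<bullet> X s a b"
  using arg_cong[where f = flip, OF X_turn_at_right[OF assms, of s b]]
  by (simp add: flip_comp flip_tensor flip_X)

end

lemma flip_rotation:
  assumes "f \<in> tl"
  shows "flip (rotation f) = rotation (flip f)"
proof (rule lin_eqI[where F = "\<lambda>f. flip (rotation f)", OF _ _ tlD[OF assms]])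
  fix D assume "D \<in> {D. D \<in> diagrams (src D) (tgt D)}"
  then have D: "D \<in> matchings (src D) (tgt D)" by (simp add: diagrams_iff)
  have "flip_diagram (rotate_diagram D) = rotate_diagram (flip_diagram D)"
    by (rule diagram_eqI[OF flip_in_matchings[OF rotate_in_matchings[OF D]] rotate_in_matchings[OF flip_in_matchings[OF D]]])
      (simp add: weight_flip[OF rotate_in_matchings[OF D]] weight_rotate[OF flip_in_matchings[OF D]]
        weight_rotate[OF D] weight_flip[OF D])
  then show "flip (rotation (basis D)) = rotation (flip (basis D))"
    by (simp add: flip_basis rotate_basis)
qed (intro lin_intros lin_flip lin_rotate)+

section \<open>Vertices\<close>

context generic
begin

abbreviation "J2 a b \<equiv> J a \<otimes> J b"

lemma hom_J2: "J2 a b \<in> tl_hom (a + b) (a + b)"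
  by (rule hom_tensor'[OF hom_J hom_J])

lemma J2_idem: "J2 a b \<bullet> J2 a b = J2 a b"
  unfolding interchange[OF hom_J hom_J hom_J hom_J] J_idem ..

lemma rotate_J2: "rotation (J2 a b) = J2 b a" and flip_J2: "flip (J2 a b) = J2 a b"
  by (simp_all add: rotate_tensor flip_tensor)

definition base :: "nat \<Rightarrow> nat \<Rightarrow> nat \<Rightarrow> tl_mor" where
  "base x y z = tl_id x \<otimes> tl_cap y \<otimes> tl_id z"

lemma base_basis: "base x y z = basis (vertex_diagram x y z)"
  by (simp add: base_def vertex_diagram_def tl_id_def tl_cap_def tensor_basis)

lemma hom_base: "base x y z \<in> tl_hom ((x + y) + (y + z)) (x + z)"
  unfolding base_basis by (rule basis_hom[OF vertex_in_diagrams])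

lemma tl_base [simp]: "base x y z \<in> tl"
  by (rule hom_tl[OF hom_base])

lemma rotate_flip_base: "rotation (base x y z) = flip (base z y x)"
  by (simp add: base_def rotate_tensor flip_tensor tensor_assoc)

text \<open>The numbers of strands joining the legs pairwise. With half the label sum
  \<open>k\<close> they are \<open>x = k - b\<close>, \<open>y = k - c\<close> and
  \<open>z = k - a\<close>.\<close>

lemma admissible_cases:
  assumes "admissible a b c"
  obtains x y z where "a = x + y" "b = y + z" "c = x + z"
proof -
  have "even (a + b + c)" using assms unfolding admissible_def by (elim conjE)
  then obtain k where k: "a + b + c = 2 * k" by (rule evenE)
  have "a \<le> k" "b \<le> k" "c \<le> k" using assms k by (auto simp: admissible_def)
  then show thesis using k by (intro that[of "k - b" "k - c" "k - a"]) linarith+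
qed

lemma admissible_sums: "admissible (x + y) (y + z) (x + z)"
proof -
  have "(x + y) + (y + z) + (x + z) = 2 * (x + y + z)" by simp
  then have "even ((x + y) + (y + z) + (x + z))" by (metis dvd_triv_left)
  then show ?thesis by (simp add: admissible_def)
qed

lemma sums_div: "((x + y) + (x + z) - (y + z)) div 2 = x" "((x + y) + (y + z) - (x + z)) div 2 = y"
  "((y + z) + (x + z) - (x + y)) div 2 = z" for x y z :: nat
proof -
  have "(x + y) + (x + z) - (y + z) = 2 * x" "(x + y) + (y + z) - (x + z) = 2 * y" "(y + z) + (x + z) - (x + y) = 2 * z"
    by simp_all
  then show "((x + y) + (x + z) - (y + z)) div 2 = x" "((x + y) + (y + z) - (x + z)) div 2 = y"
    "((y + z) + (x + z) - (x + y)) div 2 = z" by simp_all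
qed

lemma vertex_merge_eq: "vertex_merge A (x + y) (y + z) (x + z) = J (x + z) \<bullet> (base x y z \<bullet> J2 (x + y) (y + z))"
  unfolding vertex_merge_def sums_div base_def[symmetric] using admissible_sums by (simp add: assoc)

lemma vertex_split_eq: "vertex_split A (x + z) (x + y) (y + z) = J2 (x + y) (y + z) \<bullet> (flip (base x y z) \<bullet> J (x + z))"
  unfolding vertex_split_def sums_div using admissible_sums by (simp add: assoc base_def flip_tensor)

lemma hom_merge: "vertex_merge A a b c \<in> tl_hom (a + b) c"
proof (cases "admissible a b c")
  case True
  then obtain x y z where "a = x + y" "b = y + z" "c = x + z" by (rule admissible_cases)
  then show ?thesis using hom_comp[OF hom_comp[OF hom_J2 hom_base] hom_J] by (simp add: vertex_merge_eq)
qed (simp add: vertex_merge_def hom_zero)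

lemma tl_merge [simp]: "vertex_merge A a b c \<in> tl"
  by (rule hom_tl[OF hom_merge])

lemma flip_merge: "flip (vertex_merge A a b c) = vertex_split A c a b"
proof (cases "admissible a b c")
  case True
  then obtain x y z where "a = x + y" "b = y + z" "c = x + z" by (rule admissible_cases)
  then show ?thesis by (simp add: vertex_merge_eq vertex_split_eq flip_comp flip_J2 flip_closed tl_comp_assoc)
qed (simp add: vertex_merge_def vertex_split_def flip_zero)

text \<open>In contrast to the reflection \<open>flip_merge\<close>, the half turn also exchanges
  the two legs. The interplay of the two symmetries is used twice below: for \<open>theta\<close>
  and for the scalar of a crossing.\<close>

lemma rotate_merge: "rotation (vertex_merge A a b c) = vertex_split A c b a"
proof (cases "admissible a b c")
  case True
  then obtain x y z where abc: "a = x + y" "b = y + z" "c = x + z" by (rule admissible_cases)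
  have "vertex_split A c b a = J2 b a \<bullet> (flip (base z y x) \<bullet> J c)"
    using vertex_split_eq[of z x y] by (simp add: abc add.commute)
  then show ?thesis using abc
    by (simp add: vertex_merge_eq rotate_comp rotate_J2 rotate_flip_base flip_closed tl_comp_assoc)
next
  case False
  then have "\<not> admissible b a c" by (simp add: admissible_def add_ac)
  then show ?thesis using False by (simp add: vertex_merge_def vertex_split_def rotate_zero)
qed

lemma hom_split: "vertex_split A c a b \<in> tl_hom c (a + b)"
  using hom_flip[OF hom_merge] by (simp add: flip_merge)

lemma tl_split [simp]: "vertex_split A c a b \<in> tl"
  by (rule hom_tl[OF hom_split])

lemma flip_split: "flip (vertex_split A c a b) = vertex_merge A a b c"
  using flip_flip_tl[OF tl_merge] by (simp add: flip_merge)

lemma rotate_split: "rotation (vertex_split A c a b) = vertex_merge A b a c"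
  using rotate_rotate_tl[OF tl_merge] by (simp add: rotate_merge)

lemma merge_J2: "vertex_merge A a b c \<bullet> J2 a b = vertex_merge A a b c"
proof (cases "admissible a b c")
  case True
  then obtain x y z where "a = x + y" "b = y + z" "c = x + z" by (rule admissible_cases)
  then show ?thesis by (simp add: vertex_merge_eq assoc J2_idem)
qed (simp add: vertex_merge_def tl_linear)

lemma J2_split: "J2 a b \<bullet> vertex_split A c a b = vertex_split A c a b"
  using arg_cong[where f = flip, OF merge_J2[of a b c]] by (simp add: flip_comp flip_merge flip_J2)

text \<open>By Schur's lemma the bubble is a multiple of the idempotent, which is invariant under rotation.\<close>

lemma theta_commute: "theta A a b c = theta A b a c"
proof -
  let ?Y = "\<lambda>a b. vertex_merge A a b c \<bullet> vertex_split A c a b"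
  have "rotation (?Y a b) = ?Y a b"
  proof (cases "admissible a b c")
    case True
    then obtain x y z where abc: "a = x + y" "b = y + z" "c = x + z" by (rule admissible_cases)
    have hY: "?Y a b \<in> tl_hom c c" by (rule hom_comp[OF hom_split hom_merge])
    have kill: "J c \<bullet> whisker 0 0 (cup_at p q) = 0" if "p + 2 + q = c" for p q
      using J_cup_at[OF that] by (simp add: whisker_0)
    have "?Y a b = J c \<bullet> ?Y a b"
      unfolding abc vertex_merge_eq using J_idem by (simp add: assoc[symmetric])
    also have "\<dots> = J c \<bullet> whisker 0 0 (?Y a b)" by (simp add: whisker_0)
    also have "\<dots> = scale (Poly_Mapping.lookup (?Y a b) (id_diagram c)) (J c)"
      using absorb_right[OF tl_J hY kill] comp_id[OF hom_J] by simp
    finally show ?thesis by (metis rotate_scale rotate_J)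
  qed (simp add: vertex_merge_def tl_linear rotate_zero)
  \<comment> \<open>The half turn of a bubble is a bubble with its two edges exchanged.\<close>
  moreover have "rotation (?Y a b) = ?Y b a"
    by (simp add: rotate_comp rotate_merge rotate_split)
  ultimately show ?thesis by (simp add: theta_def)
qed

section \<open>Crossings at a vertex\<close>

lemma J_turn_at: "p + 2 + q = n \<Longrightarrow> J n \<bullet> turn_at p q = 0"
  unfolding turn_at_eq using J_cup_at[of p q n] by (simp add: assoc[symmetric] tl_linear)

text \<open>The hypothesis is phrased with \<open>turn_at\<close>, because that is what passes
  through crossings. A cup is, up to \<delta>, its own composite with \<open>turn_at\<close>, so
  cups are annihilated as well, and the identity has coefficient 1 in \<open>J n\<close>.\<close>

lemma absorb_J:
  assumes u: "u \<in> tl" and kill: "\<And>p q. p + 2 + q = n \<Longrightarrow> u \<bullet> whisker l r (turn_at p q) = 0"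
  shows "u \<bullet> whisker l r (J n) = u \<bullet> tl_id (l + n + r)"
proof -
  have "u \<bullet> whisker l r (cup_at p q) = 0" if pq: "p + 2 + q = n" for p q
  proof -
    note h = hom_cup_at[OF pq refl] hom_turn_at[OF pq]
    have "scale \<delta> (u \<bullet> whisker l r (cup_at p q)) = u \<bullet> whisker l r (turn_at p q \<bullet> cup_at p q)"
      unfolding turn_at_cup_at by (simp add: whisker_scale tl_linear)
    also have "\<dots> = 0"
      unfolding whisker_comp[OF h] using u by (simp add: assoc[symmetric] kill[OF pq] tl_linear)
    finally have "scale (inverse \<delta>) (scale \<delta> (u \<bullet> whisker l r (cup_at p q))) = 0" by simp
    then show ?thesis using loop_nonzero by simp
  qed
  from absorb_right[OF u hom_J this] show ?thesis by (simp add: J_lookup)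
qed

text \<open>A turn-back placed above the crossing slides through it and dies at the idempotents
  below. Hence the composite absorbs idempotents on both cables at the top.\<close>

lemma J2_X: "J2 i j \<bullet> X s j i = J2 i j \<bullet> (X s j i \<bullet> J2 j i)"
proof -
  define u where "u = J2 i j \<bullet> X s j i"
  have hu: "u \<in> tl_hom (j + i) (j + i)"
    unfolding u_def using hom_comp[OF hom_X[of s j i], of "J2 i j" "j + i"] hom_J2[of i j] by (simp add: add.commute)
  have u [simp]: "u \<in> tl" by (rule hom_tl[OF hu])
  have "u \<bullet> whisker 0 i (turn_at p q) = 0" if pq: "p + 2 + q = j" for p q
  proof -
    have "u \<bullet> whisker 0 i (turn_at p q) = J2 i j \<bullet> (X s j i \<bullet> (turn_at p q \<otimes> tl_id i))"
      unfolding u_def whisker_def by (simp add: assoc id_0_tensor)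
    also have "\<dots> = (J2 i j \<bullet> (tl_id i \<otimes> turn_at p q)) \<bullet> X s j i"
      unfolding X_turn_at_left[OF pq] by (simp add: assoc)
    also have "J2 i j \<bullet> (tl_id i \<otimes> turn_at p q) = 0"
      unfolding interchange[OF hom_id hom_J hom_turn_at[OF pq] hom_J] J_turn_at[OF pq] by (simp add: tl_linear)
    finally show ?thesis by (simp add: tl_linear)
  qed
  then have 1: "u \<bullet> (J j \<otimes> tl_id i) = u"
    using absorb_J[OF u, of j 0 i] comp_id[OF hu] by (simp add: whisker_def id_0_tensor)
  have "u \<bullet> whisker j 0 (turn_at p q) = 0" if pq: "p + 2 + q = i" for p q
  proof -
    have "u \<bullet> whisker j 0 (turn_at p q) = J2 i j \<bullet> (X s j i \<bullet> (tl_id j \<otimes> turn_at p q))"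
      unfolding u_def whisker_def by (simp add: assoc tensor_id_0)
    also have "\<dots> = (J2 i j \<bullet> (turn_at p q \<otimes> tl_id j)) \<bullet> X s j i"
      unfolding X_turn_at_right[OF pq] by (simp add: assoc)
    also have "J2 i j \<bullet> (turn_at p q \<otimes> tl_id j) = 0"
      unfolding interchange[OF hom_turn_at[OF pq] hom_J hom_id hom_J] J_turn_at[OF pq] by (simp add: tl_linear)
    finally show ?thesis by (simp add: tl_linear)
  qed
  then have 2: "u \<bullet> (tl_id j \<otimes> J i) = u"
    using absorb_J[OF u, of i j 0] comp_id[OF hu] by (simp add: whisker_def tensor_id_0)
  have "u \<bullet> J2 j i = u \<bullet> (J j \<otimes> tl_id i) \<bullet> (tl_id j \<otimes> J i)"
    using tensor_commute(1)[OF hom_J hom_J, of j i] by (simp add: assoc)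
  then have "u \<bullet> J2 j i = u" unfolding 1 2 .
  then show ?thesis unfolding u_def by (simp add: assoc)
qed

text \<open>The excluded position \<open>p = a - 1\<close> is the cap joining the two blocks; such
  arcs are the ones a vertex may contain.\<close>

lemma cap_at_J2:
  assumes pq: "p + 2 + q = a + b" and p: "p + 2 \<le> a \<or> a \<le> p"
  shows "cap_at p q \<bullet> J2 a b = 0"
  using p
proof
  assume "p + 2 \<le> a"
  then obtain q' where q': "p + 2 + q' = a" using le_Suc_ex by metis
  then have "q = q' + b" using pq by simp
  then have "cap_at p q = cap_at p q' \<otimes> tl_id b"
    by (simp add: cap_at_def tensor_assoc id_tensor_id)
  then show ?thesis
    using interchange[OF hom_J hom_cap_at[OF q' refl] hom_J[of b] hom_id[of b], of A] cap_at_J[OF q'] by (simp add: tl_linear)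
next
  assume "a \<le> p"
  then obtain p' where p': "p = a + p'" using le_Suc_ex by metis
  then have q: "p' + 2 + q = b" using pq by simp
  have "cap_at p q = tl_id a \<otimes> cap_at p' q"
    unfolding p' cap_at_def id_tensor_id[symmetric] by (simp add: tensor_assoc)
  then show ?thesis
    using interchange[OF hom_J[of a] hom_id[of a] hom_J hom_cap_at[OF q refl], of A] id_comp[OF hom_J[of a]] cap_at_J[OF q] by (simp add: tl_linear)
qed

text \<open>With idempotents on all three legs, \<open>schur\<close> leaves a multiple of the vertex
  with exchanged legs. If the labels are not admissible, both vertices are 0 and any scalar will
  do.\<close>

lemma merge_crossing_exists:
  "\<exists>\<kappa>. vertex_merge A i j n \<bullet> X s j i = scale \<kappa> (vertex_merge A j i n)"
proof (cases "admissible i j n")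
  case True
  \<comment> \<open>The letters are chosen in reverse, so that the vertex with exchanged legs
    appears as \<open>vertex_diagram x y z\<close>.\<close>
  then obtain z y x where ijn: "i = z + y" "j = y + x" "n = z + x" by (rule admissible_cases)
  define Y where "Y = base z y x \<bullet> (J2 i j \<bullet> X s j i)"
  have hY: "Y \<in> tl_hom (j + i) n"
  proof -
    have "J2 i j \<bullet> X s j i \<in> tl_hom (j + i) (i + j)"
      using hom_comp[OF hom_X[of s j i], of "J2 i j" "j + i"] hom_J2[of i j] by (simp add: add.commute)
    moreover have "base z y x \<in> tl_hom (i + j) n" using hom_base[of z y x] ijn by simp
    ultimately show ?thesis unfolding Y_def by (rule hom_comp)
  qed
  have "vertex_merge A i j n \<bullet> X s j i = J n \<bullet> Y"
    unfolding Y_def ijn vertex_merge_eq by (simp add: assoc)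
  also have "\<dots> = J n \<bullet> (Y \<bullet> J2 j i)"
    unfolding Y_def by (subst J2_X) (simp add: assoc)
  also have "\<dots> = scale (Poly_Mapping.lookup Y (vertex_diagram x y z)) (J n \<bullet> (basis (vertex_diagram x y z) \<bullet> J2 j i))"
  proof (rule schur[OF _ _ hY])
    show "j = x + y" "i = y + z" "n = x + z" using ijn by simp_all
  qed (simp_all add: J_cup_at cap_at_J2)
  also have "J n \<bullet> (basis (vertex_diagram x y z) \<bullet> J2 j i) = vertex_merge A j i n"
    using vertex_merge_eq[of x y z] ijn by (simp add: base_basis add.commute)
  finally show ?thesis by blast
next
  case False
  then show ?thesis by (simp add: vertex_merge_def tl_linear admissible_def add_ac) (metis scale_zero_right)
qed

text \<open>
  The eigenvalue \<open>\<kappa>\<close> of a crossing at a vertex need not be computed: reflecting and rotating the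
  vertex shows that it is symmetric in the two legs, and the opposite crossing undoes the crossing.
\<close>

lemma merge_crossing:
  "\<exists>\<kappa> \<kappa>'. \<kappa> * \<kappa>' = 1 \<and> vertex_merge A i j n \<bullet> X s j i = scale \<kappa> (vertex_merge A j i n) \<and>
    vertex_merge A i j n \<bullet> X (opposite s) j i = scale \<kappa>' (vertex_merge A j i n)"
proof -
  have split: "X s j i \<bullet> vertex_split A n j i = scale \<kappa> (vertex_split A n i j)"
    "X s i j \<bullet> vertex_split A n i j = scale \<kappa> (vertex_split A n j i)"
    if "vertex_merge A i j n \<bullet> X s j i = scale \<kappa> (vertex_merge A j i n)" for \<kappa> i j s
  proof -
    show "X s j i \<bullet> vertex_split A n j i = scale \<kappa> (vertex_split A n i j)"
      using arg_cong[where f = rotation, OF that] by (simp add: rotate_comp rotate_scale rotate_X rotate_merge)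
    show "X s i j \<bullet> vertex_split A n i j = scale \<kappa> (vertex_split A n j i)"
      using arg_cong[where f = flip, OF that] by (simp add: flip_comp flip_scale flip_X flip_merge)
  qed
  obtain \<kappa> where k: "vertex_merge A i j n \<bullet> X s j i = scale \<kappa> (vertex_merge A j i n)"
    using merge_crossing_exists by metis
  obtain \<mu> where m: "vertex_merge A i j n \<bullet> X (opposite s) j i = scale \<mu> (vertex_merge A j i n)"
    using merge_crossing_exists by metis
  obtain \<nu> where n: "vertex_merge A j i n \<bullet> X (opposite s) i j = scale \<nu> (vertex_merge A i j n)"
    using merge_crossing_exists by metis
  show ?thesis
  proof (cases "vertex_merge A i j n = 0")
    \<comment> \<open>A vanishing vertex has no well-defined scalar; both scalars are taken to be
      1.\<close>
    case True
    then have "vertex_split A n j i = 0" using rotate_merge[of i j n] by (simp add: rotate_zero)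
    then have "vertex_merge A j i n = 0" using flip_split[of n j i] by (simp add: flip_zero)
    then show ?thesis using True by (intro exI[of _ 1]) (simp add: tl_linear)
  next
    case False
    have cancel: "c = d" if eq: "scale c x = scale d x" and ne: "x \<noteq> 0" for c d and x :: tl_mor
    proof -
      obtain D where "Poly_Mapping.lookup x D \<noteq> 0" using ne by (metis lookup_zero poly_mapping_eqI)
      moreover have "c * Poly_Mapping.lookup x D = d * Poly_Mapping.lookup x D" using eq by (metis lookup_scale)
      ultimately show ?thesis by simp
    qed
    have "vertex_split A n j i \<noteq> 0"
      using False rotate_split[of n j i] by (auto simp: rotate_zero)
    \<comment> \<open>Both scalars describe the opposite crossing below the same splitting vertex:
      \<mu> is obtained by reflection, \<nu> by a half turn.\<close>
    moreover have "scale \<mu> (vertex_split A n j i) = scale \<nu> (vertex_split A n j i)"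
      using split(2)[OF m] split(1)[OF n] by simp
    ultimately have "\<mu> = \<nu>" using cancel by blast
    have "scale (\<kappa> * \<nu>) (vertex_merge A i j n) = (vertex_merge A i j n \<bullet> X s j i) \<bullet> X (opposite s) i j"
      unfolding k by (simp add: tl_linear n)
    also have "\<dots> = vertex_merge A i j n \<bullet> tl_id (j + i)"
      by (simp add: assoc X_opposite)
    also have "\<dots> = scale 1 (vertex_merge A i j n)"
      using comp_id[OF hom_merge[of i j n]] by (simp add: add.commute)
    finally have "\<kappa> * \<nu> = 1" using cancel False by blast
    then show ?thesis using k m \<open>\<mu> = \<nu>\<close> by blast
  qed
qed

lemma hom_labelled_crossing: "labelled_crossing A s a b \<in> tl_hom (a + b) (a + b)"
proof -
  have "J2 b a \<in> tl_hom (a + b) (a + b)" using hom_J2[of b a] by (simp add: add.commute)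
  then show ?thesis unfolding labelled_crossing_def by (intro hom_comp[OF hom_J2] hom_comp[OF hom_X])
qed

lemma tl_labelled_crossing [simp]: "labelled_crossing A s a b \<in> tl"
  by (rule hom_tl[OF hom_labelled_crossing])

lemma flip_labelled_crossing: "flip (labelled_crossing A s a b) = labelled_crossing A s b a"
  by (simp add: labelled_crossing_def flip_comp flip_J2 flip_X assoc)

text \<open>The idempotents above the crossing slide down through it by \<open>J2_X\<close>, and the
  vertex absorbs them.\<close>

lemma merge_labelled_crossing:
  "vertex_merge A i j n \<bullet> labelled_crossing A s j i = vertex_merge A i j n \<bullet> X s j i"
proof -
  have "vertex_merge A i j n \<bullet> labelled_crossing A s j i = vertex_merge A i j n \<bullet> (J2 i j \<bullet> (X s j i \<bullet> J2 j i))"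
    by (simp add: labelled_crossing_def assoc)
  also have "\<dots> = vertex_merge A i j n \<bullet> J2 i j \<bullet> X s j i"
    unfolding J2_X[symmetric] by (simp add: assoc)
  finally show ?thesis unfolding merge_J2 .
qed

lemma merge_braiding:
  obtains \<kappa> \<kappa>' where "\<kappa> * \<kappa>' = 1"
    "vertex_merge A i j n \<bullet> labelled_crossing A s j i = scale \<kappa> (vertex_merge A j i n)"
    "vertex_merge A i j n \<bullet> labelled_crossing A (opposite s) j i = scale \<kappa>' (vertex_merge A j i n)"
  using merge_crossing[of i j n s] unfolding merge_labelled_crossing by metis

lemma braiding_split:
  obtains \<kappa> \<kappa>' where "\<kappa> * \<kappa>' = 1"
    "labelled_crossing A s i j \<bullet> vertex_split A n i j = scale \<kappa> (vertex_split A n j i)"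
    "labelled_crossing A (opposite s) i j \<bullet> vertex_split A n i j = scale \<kappa>' (vertex_split A n j i)"
proof -
  obtain \<kappa> \<kappa>' where k: "\<kappa> * \<kappa>' = 1"
    "vertex_merge A i j n \<bullet> labelled_crossing A s j i = scale \<kappa> (vertex_merge A j i n)"
    "vertex_merge A i j n \<bullet> labelled_crossing A (opposite s) j i = scale \<kappa>' (vertex_merge A j i n)"
    by (rule merge_braiding)
  show thesis
    using that[OF k(1)] arg_cong[where f = flip, OF k(2)] arg_cong[where f = flip, OF k(3)]
    by (simp add: flip_comp flip_scale flip_labelled_crossing flip_merge)
qed

section \<open>Half turns of 4-vertices\<close>

text \<open>The doubled idempotents on the outer arc collapse, and the two bare bundles of arcs form
  one cap, so that a pair of labels can be handled like a single strand bundle.\<close>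

lemma nested_caps_eq: "nested_caps A a b = tl_cap (a + b) \<bullet> (J2 a b \<otimes> J2 b a)"
proof -
  define C where "C = tl_cap b \<bullet> J2 b b"
  have hC: "C \<in> tl_hom (b + b) 0" unfolding C_def by (rule hom_comp[OF hom_J2 hom_cap[OF refl]])
  note [simp] = hom_tl[OF hC]
  have JC: "J a \<otimes> C \<in> tl_hom (a + (b + b)) a" by (rule hom_tensor[OF hom_J hC]) simp_all
  have "J a \<bullet> (J a \<otimes> C) = (J a \<otimes> tl_id 0) \<bullet> (J a \<otimes> C)" by (simp add: tensor_id_0)
  also have "\<dots> = J a \<otimes> C" unfolding interchange[OF hom_J hom_J hC hom_id] J_idem id_comp[OF hC] ..
  finally have "J2 a a \<bullet> (J a \<otimes> C \<otimes> J a) = J a \<otimes> C \<otimes> J a"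
    unfolding interchange[OF JC hom_J hom_J hom_J] J_idem by simp
  moreover have "J a \<otimes> C \<otimes> J a = (tl_id a \<otimes> tl_cap b \<otimes> tl_id a) \<bullet> (J a \<otimes> J2 b b \<otimes> J a)"
    unfolding C_def interchange[OF hom_tensor'[OF hom_J hom_J2] hom_tensor'[OF hom_id hom_cap[OF refl]] hom_J hom_id]
      interchange[OF hom_J hom_id hom_J2 hom_cap[OF refl]] id_comp[OF hom_J] ..
  ultimately have "nested_caps A a b = tl_cap a \<bullet> ((tl_id a \<otimes> tl_cap b \<otimes> tl_id a) \<bullet> (J a \<otimes> J2 b b \<otimes> J a))"
    unfolding nested_caps_def labelled_cap_def C_def[symmetric] by (simp add: assoc)
  also have "\<dots> = tl_cap (a + b) \<bullet> (J a \<otimes> J2 b b \<otimes> J a)"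
    using nested_caps_tl[of a A b] by (simp add: assoc[symmetric])
  finally show ?thesis by (simp add: tensor_assoc)
qed

lemma flip_labelled_cap: "flip (labelled_cap A a) = labelled_cup A a"
  by (simp add: labelled_cap_def labelled_cup_def flip_comp flip_J2)

lemma tl_labelled_cap [simp]: "labelled_cap A a \<in> tl"
  by (simp add: labelled_cap_def)

lemma flip_nested_caps: "flip (nested_caps A a b) = nested_cups A a b"
  by (simp add: nested_caps_def nested_cups_def flip_comp flip_tensor flip_labelled_cap)

lemma nested_cups_eq: "nested_cups A a b = (J2 a b \<otimes> J2 b a) \<bullet> tl_cup (a + b)"
  unfolding flip_nested_caps[symmetric] nested_caps_eq by (simp add: flip_comp flip_tensor)

lemma tl_nested [simp]: "nested_caps A a b \<in> tl" "nested_cups A a b \<in> tl"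
  by (simp_all add: nested_caps_eq nested_cups_eq)

lemma rotate_nested: "rotation (nested_caps A a b) = nested_cups A a b" "rotation (nested_cups A a b) = nested_caps A a b"
  by (simp_all add: nested_caps_eq nested_cups_eq rotate_comp rotate_tensor tensor_assoc)

text \<open>The idempotents next to \<open>Y\<close> are absorbed by \<open>Y\<close>, those on the
  cup slide round to the leg entering \<open>Y\<close>, and those on the outgoing strands are
  absorbed by the rotated morphism. What remains is the bare bend of
  \<open>rotate_bend_right\<close>.\<close>

lemma half_turn_right:
  assumes Y: "Y \<in> tl_hom (i + j) (k + l)" and JY: "J2 k l \<bullet> Y = Y" and YJ: "Y \<bullet> J2 i j = Y"
  shows "(J j \<otimes> J i \<otimes> nested_caps A k l) \<bullet> (J j \<otimes> J i \<otimes> Y \<otimes> J l \<otimes> J k) \<bullet> (nested_cups A j i \<otimes> J l \<otimes> J k) = rotation Y"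
proof -
  define m n P P' Q Q' where "m = i + j" and "n = k + l" and "P = J2 j i" and "P' = J2 i j" and "Q = J2 l k" and "Q' = J2 k l"
  have hP: "P \<in> tl_hom m m" and hP': "P' \<in> tl_hom m m" and hQ: "Q \<in> tl_hom n n" and hQ': "Q' \<in> tl_hom n n" and hY: "Y \<in> tl_hom m n"
    using hom_J2[of j i] hom_J2[of i j] hom_J2[of l k] hom_J2[of k l] Y
    by (simp_all add: m_def n_def P_def P'_def Q_def Q'_def add.commute)
  note [simp] = hom_tl[OF hP] hom_tl[OF hP'] hom_tl[OF hQ] hom_tl[OF hQ'] hom_tl[OF hY]
  have PP: "P \<bullet> P = P" "Q \<bullet> Q = Q" by (simp_all add: P_def Q_def J2_idem)
  have Y': "Q' \<bullet> Y = Y" "Y \<bullet> P' = Y" using JY YJ by (simp_all add: Q'_def P'_def)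
  have rP: "rotation P = P'" and fP: "flip P = P" "flip P' = P'"
    by (simp_all add: P_def P'_def rotate_J2 flip_J2)
  \<comment> \<open>Reflection of \<open>cap_slide_tl\<close>: rounding the cup turns
    \<open>P\<close> by a half turn, which exchanges its two labels.\<close>
  have slide: "(P \<otimes> tl_id m) \<bullet> tl_cup m = (tl_id m \<otimes> P') \<bullet> tl_cup m"
    using arg_cong[where f = flip, OF cap_slide_tl[OF hP, of A]] by (simp add: flip_comp flip_tensor fP rP)
  have hcap: "tl_cap n \<in> tl_hom (n + n) 0" and hcup: "tl_cup m \<in> tl_hom 0 (m + m)" by (rule hom_cap[OF refl] hom_cup[OF refl])+
  have hQQ: "Q' \<otimes> Q \<in> tl_hom (n + n) (n + n)" by (rule hom_tensor'[OF hQ' hQ])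
  have hYQ: "Y \<otimes> Q \<in> tl_hom (m + n) (n + n)" by (rule hom_tensor'[OF hY hQ])
  have caps: "J j \<otimes> J i \<otimes> nested_caps A k l = P \<otimes> (tl_cap n \<bullet> (Q' \<otimes> Q))"
    by (simp add: nested_caps_eq P_def Q_def Q'_def n_def)
  have mid: "J j \<otimes> J i \<otimes> Y \<otimes> J l \<otimes> J k = P \<otimes> (Y \<otimes> Q)"
    by (simp add: P_def Q_def tensor_assoc)
  have cups: "nested_cups A j i \<otimes> J l \<otimes> J k = ((P \<otimes> P') \<bullet> tl_cup m) \<otimes> Q"
    by (simp add: nested_cups_eq P_def P'_def Q_def m_def tensor_assoc add.commute)
  have 1: "(P \<otimes> (tl_cap n \<bullet> (Q' \<otimes> Q))) \<bullet> (P \<otimes> (Y \<otimes> Q)) = P \<otimes> (tl_cap n \<bullet> (Y \<otimes> Q))"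
    unfolding interchange[OF hP hP hYQ hom_comp[OF hQQ hcap]] PP
    using interchange[OF hY hQ' hQ hQ, of A] Y' PP by (simp add: assoc)
  have hPI: "P \<otimes> tl_id m \<in> tl_hom (m + m) (m + m)" and hIP: "tl_id m \<otimes> P' \<in> tl_hom (m + m) (m + m)"
    by (rule hom_tensor'[OF hP hom_id] hom_tensor'[OF hom_id hP'])+
  have YI: "tl_id m \<otimes> Y \<otimes> tl_id n \<in> tl_hom (m + m + n) (m + n + n)" by (intro hom_tensor' hom_id hY)
  have 2: "P \<otimes> (tl_cap n \<bullet> (Y \<otimes> Q)) = (tl_id m \<otimes> tl_cap n) \<bullet> ((tl_id m \<otimes> Y \<otimes> tl_id n) \<bullet> (P \<otimes> tl_id m \<otimes> Q))"
  proof -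
    have "(tl_id m \<otimes> Y \<otimes> tl_id n) \<bullet> (P \<otimes> tl_id m \<otimes> Q) = P \<otimes> (Y \<otimes> Q)"
      unfolding interchange[OF hPI hom_tensor'[OF hom_id hY] hQ hom_id] interchange[OF hP hom_id hom_id hY]
        id_comp[OF hP] id_comp[OF hQ] comp_id[OF hY] by (simp add: tensor_assoc)
    then show ?thesis
      using interchange[OF hP hom_id hYQ hcap, of A] id_comp[OF hP, of A] by simp
  qed
  have 3: "(P \<otimes> tl_id m \<otimes> Q) \<bullet> (((P \<otimes> P') \<bullet> tl_cup m) \<otimes> Q) = (tl_id m \<otimes> P' \<otimes> tl_id n) \<bullet> ((tl_id m \<otimes> P' \<otimes> tl_id n) \<bullet> (tl_cup m \<otimes> Q))"
  proof -
    have hPP: "P \<otimes> P' \<in> tl_hom (m + m) (m + m)" by (rule hom_tensor'[OF hP hP'])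
    have "(P \<otimes> tl_id m) \<bullet> ((P \<otimes> P') \<bullet> tl_cup m) = (P \<otimes> P') \<bullet> tl_cup m"
      using interchange[OF hP hP hP' hom_id, of A] PP id_comp[OF hP'] by (simp add: assoc[symmetric])
    also have "\<dots> = (tl_id m \<otimes> P') \<bullet> ((P \<otimes> tl_id m) \<bullet> tl_cup m)"
      using tensor_commute(2)[OF hP hP'] by (simp add: assoc[symmetric])
    also have "\<dots> = (tl_id m \<otimes> P') \<bullet> ((tl_id m \<otimes> P') \<bullet> tl_cup m)" unfolding slide ..
    finally show ?thesis
      unfolding interchange[OF hom_comp[OF hcup hPP] hPI hQ hQ] PP interchange[OF hcup hIP hQ hom_id]
        interchange[OF hom_comp[OF hcup hIP] hIP hQ hom_id] id_comp[OF hQ] by simp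
  qed
  have 4: "(tl_id m \<otimes> Y \<otimes> tl_id n) \<bullet> ((tl_id m \<otimes> P' \<otimes> tl_id n) \<bullet> x) = (tl_id m \<otimes> Y \<otimes> tl_id n) \<bullet> x" if "x \<in> tl" for x
    using that whisker_comp[OF hP' hY, of m n] Y' by (simp add: whisker_def assoc[symmetric])
  have 5: "tl_cup m \<otimes> Q = (tl_cup m \<otimes> tl_id n) \<bullet> Q"
    using interchange[OF hom_id hcup hQ hom_id, of A] comp_id[OF hcup] id_comp[OF hQ] by (simp add: id_0_tensor)
  have "(J j \<otimes> J i \<otimes> nested_caps A k l) \<bullet> (J j \<otimes> J i \<otimes> Y \<otimes> J l \<otimes> J k) \<bullet> (nested_cups A j i \<otimes> J l \<otimes> J k) =
      (tl_id m \<otimes> tl_cap n) \<bullet> ((tl_id m \<otimes> Y \<otimes> tl_id n) \<bullet> ((P \<otimes> tl_id m \<otimes> Q) \<bullet> (((P \<otimes> P') \<bullet> tl_cup m) \<otimes> Q)))"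
    unfolding caps mid cups 1 2 by (simp add: assoc)
  also have "\<dots> = (tl_id m \<otimes> tl_cap n) \<bullet> (tl_id m \<otimes> Y \<otimes> tl_id n) \<bullet> (tl_cup m \<otimes> tl_id n) \<bullet> Q"
    unfolding 3 5 by (simp add: 4 assoc)
  also have "\<dots> = rotation Y \<bullet> Q"
    unfolding rotate_bend_right[OF hY] ..
  also have "\<dots> = rotation (Q' \<bullet> Y)"
    by (simp add: rotate_comp) (simp add: Q'_def Q_def rotate_J2)
  finally show ?thesis unfolding Y' .
qed

text \<open>Reflection followed by a half turn is the left-right mirror. The mirrored
  \<open>Y\<close> satisfies \<open>half_turn_right\<close>, and mirroring that equation gives the
  claim.\<close>

lemma half_turn_left:
  assumes Y: "Y \<in> tl_hom (i + j) (k + l)" and JY: "J2 k l \<bullet> Y = Y" and YJ: "Y \<bullet> J2 i j = Y"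
  shows "(nested_caps A l k \<otimes> J j \<otimes> J i) \<bullet> (J l \<otimes> J k \<otimes> Y \<otimes> J j \<otimes> J i) \<bullet> (J l \<otimes> J k \<otimes> nested_cups A i j) = rotation Y"
proof -
  define Z where "Z = flip (rotation Y)"
  note [simp] = hom_tl[OF Y] rotate_closed[OF hom_tl[OF Y]]
  have hZ: "Z \<in> tl_hom (j + i) (l + k)"
    unfolding Z_def using hom_flip[OF hom_rotate[OF Y]] by (simp add: add.commute)
  have "J2 l k \<bullet> Z = Z"
    using arg_cong[where f = "\<lambda>x. flip (rotation x)", OF JY]
    by (simp add: Z_def rotate_comp rotate_J2 flip_comp flip_J2)
  moreover have "Z \<bullet> J2 j i = Z"
    using arg_cong[where f = "\<lambda>x. flip (rotation x)", OF YJ]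
    by (simp add: Z_def rotate_comp rotate_J2 flip_comp flip_J2)
  ultimately have "(J i \<otimes> J j \<otimes> nested_caps A l k) \<bullet> (J i \<otimes> J j \<otimes> Z \<otimes> J k \<otimes> J l) \<bullet> (nested_cups A i j \<otimes> J k \<otimes> J l) = rotation Z"
    by (rule half_turn_right[OF hZ])
  note mirrored = arg_cong[where f = "\<lambda>x. rotation (flip x)", OF this]
  note [simp] = hom_tl[OF hZ] flip_closed[OF hom_tl[OF hZ]]
  have "flip Z = rotation Y" "rotation (flip Z) = Y"
    by (simp_all add: Z_def flip_flip_tl rotate_rotate_tl)
  moreover have "flip (nested_cups A a b) = nested_caps A a b" for a b
    using flip_flip_tl[of "nested_caps A a b"] by (simp add: flip_nested_caps)
  moreover have "rotation (flip (rotation Z)) = rotation Y"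
    unfolding flip_rotation[OF hom_tl[OF hZ]] calculation(1) by (simp add: rotate_rotate_tl)
  ultimately show ?thesis
    using mirrored
    by (simp add: flip_comp flip_tensor rotate_comp rotate_tensor flip_nested_caps rotate_nested tensor_assoc)
qed

end

section \<open>The balanced theory\<close>

lemma lin_ext_left: "lin F \<Longrightarrow> lin (\<lambda>x. F x \<boxtimes> y)" and lin_ext_right: "lin F \<Longrightarrow> lin (\<lambda>x. y \<boxtimes> F x)"
  unfolding ext_tensor_def by (rule lin_bilin_left, assumption) (rule lin_bilin_right)

lemma lin_bal_comp_left: "lin F \<Longrightarrow> lin (\<lambda>x. F x \<odot>\<^bsub>A\<^esub> y)" and lin_bal_comp_right: "lin F \<Longrightarrow> lin (\<lambda>x. y \<odot>\<^bsub>A\<^esub> F x)"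
  unfolding bal_comp_def by (rule lin_bilin_left, assumption) (rule lin_bilin_right)

lemma lin_bal_tensor_left: "lin F \<Longrightarrow> lin (\<lambda>x. F x \<otimes>\<^sub>b y)" and lin_bal_tensor_right: "lin F \<Longrightarrow> lin (\<lambda>x. y \<otimes>\<^sub>b F x)"
  unfolding bal_tensor_def by (rule lin_bilin_left, assumption) (rule lin_bilin_right)

lemmas bal_lin_intros = lin_intros lin_ext_left lin_ext_right lin_bal_comp_left lin_bal_comp_right
  lin_bal_tensor_left lin_bal_tensor_right

lemma ext_scale: "scale c x \<boxtimes> scale d y = scale (c * d) (x \<boxtimes> y)"
  by (simp add: lin_scale[OF lin_ext_left[OF lin_id]] lin_scale[OF lin_ext_right[OF lin_id]] mult.commute)

lemma ext_basis: "basis D \<boxtimes> basis E = Poly_Mapping.single (D, E) 1"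
  by (simp add: ext_tensor_def)

text \<open>Linearity in each of the four arguments reduces this to single diagrams, where both
  sides are the same external product.\<close>

lemma bal_comp_ext: "(g \<boxtimes> g') \<odot>\<^bsub>A\<^esub> (f \<boxtimes> f') = (g \<circ>\<^bsub>A\<^esub> f) \<boxtimes> (g' \<circ>\<^bsub>inverse A\<^esub> f')"
proof (rule lin_eqI[where F = "\<lambda>g. (g \<boxtimes> g') \<odot>\<^bsub>A\<^esub> (f \<boxtimes> f')", OF _ _ subset_UNIV])
  fix E show "(basis E \<boxtimes> g') \<odot>\<^bsub>A\<^esub> (f \<boxtimes> f') = (basis E \<circ>\<^bsub>A\<^esub> f) \<boxtimes> (g' \<circ>\<^bsub>inverse A\<^esub> f')"
  proof (rule lin_eqI[where F = "\<lambda>g'. (basis E \<boxtimes> g') \<odot>\<^bsub>A\<^esub> (f \<boxtimes> f')", OF _ _ subset_UNIV])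
    fix E' show "(basis E \<boxtimes> basis E') \<odot>\<^bsub>A\<^esub> (f \<boxtimes> f') = (basis E \<circ>\<^bsub>A\<^esub> f) \<boxtimes> (basis E' \<circ>\<^bsub>inverse A\<^esub> f')"
    proof (rule lin_eqI[where F = "\<lambda>f. (basis E \<boxtimes> basis E') \<odot>\<^bsub>A\<^esub> (f \<boxtimes> f')", OF _ _ subset_UNIV])
      fix D show "(basis E \<boxtimes> basis E') \<odot>\<^bsub>A\<^esub> (basis D \<boxtimes> f') = (basis E \<circ>\<^bsub>A\<^esub> basis D) \<boxtimes> (basis E' \<circ>\<^bsub>inverse A\<^esub> f')"
      proof (rule lin_eqI[where F = "\<lambda>f'. (basis E \<boxtimes> basis E') \<odot>\<^bsub>A\<^esub> (basis D \<boxtimes> f')", OF _ _ subset_UNIV])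
        fix D' show "(basis E \<boxtimes> basis E') \<odot>\<^bsub>A\<^esub> (basis D \<boxtimes> basis D') =
            (basis E \<circ>\<^bsub>A\<^esub> basis D) \<boxtimes> (basis E' \<circ>\<^bsub>inverse A\<^esub> basis D')"
          by (simp add: ext_basis bal_comp_def tl_comp_def)
      qed (intro bal_lin_intros)+
    qed (intro bal_lin_intros)+
  qed (intro bal_lin_intros)+
qed (intro bal_lin_intros)+

lemma bal_tensor_ext: "(f \<boxtimes> f') \<otimes>\<^sub>b (g \<boxtimes> g') = (f \<otimes> g) \<boxtimes> (f' \<otimes> g')"
proof (rule lin_eqI[where F = "\<lambda>f. (f \<boxtimes> f') \<otimes>\<^sub>b (g \<boxtimes> g')", OF _ _ subset_UNIV])
  fix D show "(basis D \<boxtimes> f') \<otimes>\<^sub>b (g \<boxtimes> g') = (basis D \<otimes> g) \<boxtimes> (f' \<otimes> g')"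
  proof (rule lin_eqI[where F = "\<lambda>f'. (basis D \<boxtimes> f') \<otimes>\<^sub>b (g \<boxtimes> g')", OF _ _ subset_UNIV])
    fix D' show "(basis D \<boxtimes> basis D') \<otimes>\<^sub>b (g \<boxtimes> g') = (basis D \<otimes> g) \<boxtimes> (basis D' \<otimes> g')"
    proof (rule lin_eqI[where F = "\<lambda>g. (basis D \<boxtimes> basis D') \<otimes>\<^sub>b (g \<boxtimes> g')", OF _ _ subset_UNIV])
      fix E show "(basis D \<boxtimes> basis D') \<otimes>\<^sub>b (basis E \<boxtimes> g') = (basis D \<otimes> basis E) \<boxtimes> (basis D' \<otimes> g')"
      proof (rule lin_eqI[where F = "\<lambda>g'. (basis D \<boxtimes> basis D') \<otimes>\<^sub>b (basis E \<boxtimes> g')", OF _ _ subset_UNIV])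
        fix E' show "(basis D \<boxtimes> basis D') \<otimes>\<^sub>b (basis E \<boxtimes> basis E') = (basis D \<otimes> basis E) \<boxtimes> (basis D' \<otimes> basis E')"
          by (simp add: ext_basis bal_tensor_def tl_tensor_def)
      qed (intro bal_lin_intros)+
    qed (intro bal_lin_intros)+
  qed (intro bal_lin_intros)+
qed (intro bal_lin_intros)+

text \<open>
  The loop value is invariant under inverting the parameter, so only the crossings distinguish
  the two factors.
\<close>

lemma comp_inverse: "g \<circ>\<^bsub>inverse A\<^esub> f = g \<circ>\<^bsub>A\<^esub> f"
proof -
  have "loop_value (inverse A) = loop_value A" by (simp add: loop_value_def)
  then have "diagram_comp (inverse A) = diagram_comp A" by (simp add: diagram_comp_def fun_eq_iff)
  then show ?thesis by (simp add: tl_comp_def)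
qed

text \<open>The characterisation of the idempotent involves the parameter through composition
  alone.\<close>

lemma jones_wenzl_inverse: "jones_wenzl (inverse A) n = jones_wenzl A n"
  by (simp add: jones_wenzl_def is_jones_wenzl_def comp_inverse)

lemma vertex_inverse: "vertex_merge (inverse A) a b c = vertex_merge A a b c"
    "vertex_split (inverse A) c a b = vertex_split A c a b"
  by (simp_all add: vertex_merge_def vertex_split_def comp_inverse jones_wenzl_inverse)

lemma nested_inverse: "nested_caps (inverse A) a b = nested_caps A a b" "nested_cups (inverse A) a b = nested_cups A a b"
  by (simp_all add: nested_caps_def nested_cups_def labelled_cap_def labelled_cup_def comp_inverse jones_wenzl_inverse)

lemma crossing_inverse: "crossing (inverse A) s = crossing A (opposite s)"
  by (cases s) (simp_all add: comp_inverse add.commute)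

lemma cable_crossing_inverse: "cable_crossing (inverse A) s a b = cable_crossing A (opposite s) a b"
proof -
  have "strand_crossing (inverse A) s b = strand_crossing A (opposite s) b" for b
    by (induction b) (simp_all add: comp_inverse crossing_inverse del: crossing.simps)
  then show ?thesis by (induction a) (simp_all add: comp_inverse)
qed

lemma labelled_crossing_inverse: "labelled_crossing (inverse A) s a b = labelled_crossing A (opposite s) a b"
  by (simp add: labelled_crossing_def comp_inverse jones_wenzl_inverse cable_crossing_inverse)

lemma admissible_commute: "admissible a b n = admissible b a n"
  by (auto simp: admissible_def add_ac)

context generic
begin

text \<open>The planar 4-vertex through the intermediate edge \<open>n\<close>. Being free of
  crossings, it serves both tensor factors of a summand.\<close>

definition channel :: "nat \<Rightarrow> nat \<Rightarrow> nat \<Rightarrow> nat \<Rightarrow> nat \<Rightarrow> tl_mor" where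
  "channel i j k l n = vertex_split A n k l \<bullet> vertex_merge A i j n"

lemma barrett_crane_eq:
  "barrett_crane A i j k l = (\<Sum>n\<in>{n. admissible i j n \<and> admissible k l n}.
     scale (Delta A n / (theta A i j n * theta A k l n)) (channel i j k l n \<boxtimes> channel i j k l n))"
  by (simp add: barrett_crane_def balanced_def channel_def comp_inverse vertex_inverse)

lemma hom_channel: "channel i j k l n \<in> tl_hom (i + j) (k + l)"
  unfolding channel_def by (rule hom_comp[OF hom_merge hom_split])

lemma channel_J2: "J2 k l \<bullet> channel i j k l n = channel i j k l n" "channel i j k l n \<bullet> J2 i j = channel i j k l n"
  unfolding channel_def by (simp_all add: tl_comp_assoc J2_split) (simp add: assoc merge_J2)

lemma rotate_channel: "rotation (channel i j k l n) = channel l k j i n"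
  unfolding channel_def by (simp add: rotate_comp rotate_merge rotate_split)

lemma barrett_crane_braiding: "barrett_crane A i j k l \<odot>\<^bsub>A\<^esub> bal_braiding A s j i = barrett_crane A j i k l"
proof -
  have "(channel i j k l n \<boxtimes> channel i j k l n) \<odot>\<^bsub>A\<^esub> bal_braiding A s j i = channel j i k l n \<boxtimes> channel j i k l n" for n
  proof -
    obtain \<kappa> \<kappa>' where k: "\<kappa> * \<kappa>' = 1"
      "vertex_merge A i j n \<bullet> labelled_crossing A s j i = scale \<kappa> (vertex_merge A j i n)"
      "vertex_merge A i j n \<bullet> labelled_crossing A (opposite s) j i = scale \<kappa>' (vertex_merge A j i n)"
      by (rule merge_braiding)
    have "channel i j k l n \<bullet> labelled_crossing A s j i = scale \<kappa> (channel j i k l n)"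
      "channel i j k l n \<bullet> labelled_crossing A (opposite s) j i = scale \<kappa>' (channel j i k l n)"
      unfolding channel_def by (simp_all add: assoc k(2,3) tl_linear)
    then show ?thesis
      by (simp add: bal_braiding_def balanced_def labelled_crossing_inverse bal_comp_ext comp_inverse ext_scale k(1))
  qed
  then show ?thesis
    unfolding barrett_crane_eq lin_sum[OF lin_bal_comp_left[OF lin_id]] lin_scale[OF lin_bal_comp_left[OF lin_id]]
    by (simp add: theta_commute[of i j] admissible_commute[of i j])
qed

lemma braiding_barrett_crane: "bal_braiding A s k l \<odot>\<^bsub>A\<^esub> barrett_crane A i j k l = barrett_crane A i j l k"
proof -
  have "bal_braiding A s k l \<odot>\<^bsub>A\<^esub> (channel i j k l n \<boxtimes> channel i j k l n) = channel i j l k n \<boxtimes> channel i j l k n" for n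
  proof -
    obtain \<kappa> \<kappa>' where k: "\<kappa> * \<kappa>' = 1"
      "labelled_crossing A s k l \<bullet> vertex_split A n k l = scale \<kappa> (vertex_split A n l k)"
      "labelled_crossing A (opposite s) k l \<bullet> vertex_split A n k l = scale \<kappa>' (vertex_split A n l k)"
      by (rule braiding_split)
    have "labelled_crossing A s k l \<bullet> channel i j k l n = scale \<kappa> (channel i j l k n)"
      "labelled_crossing A (opposite s) k l \<bullet> channel i j k l n = scale \<kappa>' (channel i j l k n)"
      unfolding channel_def by (simp_all add: tl_comp_assoc k(2,3) tl_linear)
    then show ?thesis
      by (simp add: bal_braiding_def balanced_def labelled_crossing_inverse bal_comp_ext comp_inverse ext_scale k(1))
  qed
  then show ?thesis
    unfolding barrett_crane_eq lin_sum[OF lin_bal_comp_right[OF lin_id]] lin_scale[OF lin_bal_comp_right[OF lin_id]]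
    by (simp add: theta_commute[of k l] admissible_commute[of k l])
qed

text \<open>A half turn changes the order of labels inside each admissibility condition and each
  \<open>theta\<close>, and exchanges the two conditions and the two \<open>theta\<close> factors.
  Index set and coefficients are therefore unchanged.\<close>

lemma rotated_sum:
  assumes F: "lin F" and turn: "\<And>n. F (channel i j k l n \<boxtimes> channel i j k l n) = channel l k j i n \<boxtimes> channel l k j i n"
  shows "F (barrett_crane A i j k l) = barrett_crane A l k j i"
proof -
  have "{n. admissible i j n \<and> admissible k l n} = {n. admissible l k n \<and> admissible j i n}"
    using admissible_commute by blast
  then show ?thesis
    unfolding barrett_crane_eq lin_sum[OF F] lin_scale[OF F] turn
    by (simp add: theta_commute[of i j] theta_commute[of k l] mult.commute)
qed

lemma barrett_crane_half_turn_right: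
  "((bal_obj A j \<otimes>\<^sub>b bal_obj A i \<otimes>\<^sub>b bal_eta A k l) \<odot>\<^bsub>A\<^esub>
     (bal_obj A j \<otimes>\<^sub>b bal_obj A i \<otimes>\<^sub>b barrett_crane A i j k l \<otimes>\<^sub>b bal_obj A l \<otimes>\<^sub>b bal_obj A k) \<odot>\<^bsub>A\<^esub>
     (bal_eps A j i \<otimes>\<^sub>b bal_obj A l \<otimes>\<^sub>b bal_obj A k)) = barrett_crane A l k j i"
proof (rule rotated_sum)
  show "lin (\<lambda>x. (bal_obj A j \<otimes>\<^sub>b bal_obj A i \<otimes>\<^sub>b bal_eta A k l) \<odot>\<^bsub>A\<^esub>
     (bal_obj A j \<otimes>\<^sub>b bal_obj A i \<otimes>\<^sub>b x \<otimes>\<^sub>b bal_obj A l \<otimes>\<^sub>b bal_obj A k) \<odot>\<^bsub>A\<^esub>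
     (bal_eps A j i \<otimes>\<^sub>b bal_obj A l \<otimes>\<^sub>b bal_obj A k))"
    by (intro bal_lin_intros)
  fix n
  note turn = half_turn_right[OF hom_channel[of i j k l n] channel_J2(1)[of k l i j n] channel_J2(2)[of i j k l n], unfolded rotate_channel]
  show "(bal_obj A j \<otimes>\<^sub>b bal_obj A i \<otimes>\<^sub>b bal_eta A k l) \<odot>\<^bsub>A\<^esub>
     (bal_obj A j \<otimes>\<^sub>b bal_obj A i \<otimes>\<^sub>b (channel i j k l n \<boxtimes> channel i j k l n) \<otimes>\<^sub>b bal_obj A l \<otimes>\<^sub>b bal_obj A k) \<odot>\<^bsub>A\<^esub>
     (bal_eps A j i \<otimes>\<^sub>b bal_obj A l \<otimes>\<^sub>b bal_obj A k) = channel l k j i n \<boxtimes> channel l k j i n"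
    by (simp only: bal_obj_def bal_eta_def bal_eps_def balanced_def jones_wenzl_inverse nested_inverse
        bal_tensor_ext bal_comp_ext comp_inverse turn)
qed

lemma barrett_crane_half_turn_left:
  "((bal_eta A l k \<otimes>\<^sub>b bal_obj A j \<otimes>\<^sub>b bal_obj A i) \<odot>\<^bsub>A\<^esub>
     (bal_obj A l \<otimes>\<^sub>b bal_obj A k \<otimes>\<^sub>b barrett_crane A i j k l \<otimes>\<^sub>b bal_obj A j \<otimes>\<^sub>b bal_obj A i) \<odot>\<^bsub>A\<^esub>
     (bal_obj A l \<otimes>\<^sub>b bal_obj A k \<otimes>\<^sub>b bal_eps A i j)) = barrett_crane A l k j i"
proof (rule rotated_sum)
  show "lin (\<lambda>x. (bal_eta A l k \<otimes>\<^sub>b bal_obj A j \<otimes>\<^sub>b bal_obj A i) \<odot>\<^bsub>A\<^esub>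
     (bal_obj A l \<otimes>\<^sub>b bal_obj A k \<otimes>\<^sub>b x \<otimes>\<^sub>b bal_obj A j \<otimes>\<^sub>b bal_obj A i) \<odot>\<^bsub>A\<^esub>
     (bal_obj A l \<otimes>\<^sub>b bal_obj A k \<otimes>\<^sub>b bal_eps A i j))"
    by (intro bal_lin_intros)
  fix n
  note turn = half_turn_left[OF hom_channel[of i j k l n] channel_J2(1)[of k l i j n] channel_J2(2)[of i j k l n], unfolded rotate_channel]
  show "(bal_eta A l k \<otimes>\<^sub>b bal_obj A j \<otimes>\<^sub>b bal_obj A i) \<odot>\<^bsub>A\<^esub>
     (bal_obj A l \<otimes>\<^sub>b bal_obj A k \<otimes>\<^sub>b (channel i j k l n \<boxtimes> channel i j k l n) \<otimes>\<^sub>b bal_obj A j \<otimes>\<^sub>b bal_obj A i) \<odot>\<^bsub>A\<^esub>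
     (bal_obj A l \<otimes>\<^sub>b bal_obj A k \<otimes>\<^sub>b bal_eps A i j) = channel l k j i n \<boxtimes> channel l k j i n"
    by (simp only: bal_obj_def bal_eta_def bal_eps_def balanced_def jones_wenzl_inverse nested_inverse
        bal_tensor_ext bal_comp_ext comp_inverse turn)
qed

end

theorem mainTheorem2:
  fixes A :: complex and s :: over_strand and i j k l :: nat
  assumes "A \<noteq> 0" and "\<And>n. Delta A n \<noteq> 0"
  shows "(barrett_crane A i j k l \<odot>\<^bsub>A\<^esub> bal_braiding A s j i = barrett_crane A j i k l) \<and>
    (bal_braiding A s k l \<odot>\<^bsub>A\<^esub> barrett_crane A i j k l = barrett_crane A i j l k) \<and>
    ((bal_obj A j \<otimes>\<^sub>b bal_obj A i \<otimes>\<^sub>b bal_eta A k l) \<odot>\<^bsub>A\<^esub>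
     (bal_obj A j \<otimes>\<^sub>b bal_obj A i \<otimes>\<^sub>b barrett_crane A i j k l \<otimes>\<^sub>b bal_obj A l \<otimes>\<^sub>b bal_obj A k) \<odot>\<^bsub>A\<^esub>
     (bal_eps A j i \<otimes>\<^sub>b bal_obj A l \<otimes>\<^sub>b bal_obj A k)
       = barrett_crane A l k j i) \<and>
    ((bal_eta A l k \<otimes>\<^sub>b bal_obj A j \<otimes>\<^sub>b bal_obj A i) \<odot>\<^bsub>A\<^esub>
     (bal_obj A l \<otimes>\<^sub>b bal_obj A k \<otimes>\<^sub>b barrett_crane A i j k l \<otimes>\<^sub>b bal_obj A j \<otimes>\<^sub>b bal_obj A i) \<odot>\<^bsub>A\<^esub>
     (bal_obj A l \<otimes>\<^sub>b bal_obj A k \<otimes>\<^sub>b bal_eps A i j)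
       = barrett_crane A l k j i)"
proof -
  interpret generic A by (rule generic.intro) (use assms in auto)
  show ?thesis
    by (intro conjI barrett_crane_braiding braiding_barrett_crane barrett_crane_half_turn_right barrett_crane_half_turn_left)
qed

end
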